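(* Let $M$ be a closed oriented $2n$-manifold, let $K$ be a triangulation of $M$, and let $K^*$ be the dual cell complex (also a CW complex embedded in $M$). Then $$P_{K,M}(X,Y,A,B)=P_{K^*,M}(Y,X,B,A).$$
   Context: Homology has real coefficients and $|H_i(L)|=\dim_{\mathbb R}H_i(L;\mathbb R)$. For a finite CW (or simplicial) complex $K$ of dimension $\ge n$, a spanning $n$-subcomplex is an $n$-dimensional subcomplex $L$ with $L^{(n-1)}=K^{(n-1)}$. Let $M$ be a closed oriented $2n$-manifold with intersection pairing $\cdot: H_n(M)\times H_n(M)\to\mathbb R$. For a subcomplex $L\subset M$ with inclusion $i:L\to M$, define $k(L)=\dim\ker(i_*:H_n(L)\to H_n(M))$, $V=V(L)=\mathrm{im}(i_*:H_n(L)\to H_n(M))$, $V^\perp=V^\perp(L)=\{u\in H_n(M): u\cdot v=0\ \forall v\in V\}$, $s(L)=\dim V/(V\cap V^\perp)$ and $s^\perp(L)=\dim V^\perp/(V\cap V^\perp)$. For a complex $K$ embedded in $M$ define $$P_{K,M}(X,Y,A,B)=\sum_L X^{|H_{n-1}(L)|-|H_{n-1}(K)|}Y^{k(L)}A^{s(L)}B^{s^\perp(L)},$$ the sum over all spanning $n$-subcomplexes $L$ of $K$. Dual complex: for each $k$-simplex $\sigma$ of $K$, the dual cell $D\sigma$ is the $(2n-k)$-cell formed by the union of all simplices of the barycentric subdivision of $K$ containing the barycenter of $\sigma$ as a vertex and transverse to $\sigma$; these form the CW complex $K^*$, whose $k$-cells correspond bijectively to the $(2n-k)$-simplices of $K$.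 *)

theory Defs
  imports
    "HOL-Analysis.Analysis"
    "HOL-Homology.Homology"
    "Jordan_Normal_Form.VS_Connect"
begin

section \<open>Real vector spaces with explicit carriers\<close>

definition quot_space :: "('k, 'v, 'm) module_scheme \<Rightarrow> 'v set \<Rightarrow> ('k, 'v set) module"
  where "quot_space V W =
    \<lparr>carrier = a_rcosets\<^bsub>V\<^esub> W, mult = undefined, one = undefined,
     zero = W, add = set_add V,
     smult = (\<lambda>r C. \<Union>x\<in>C. W +>\<^bsub>V\<^esub> (r \<odot>\<^bsub>V\<^esub> x))\<rparr>"

abbreviation rdim :: "(real, 'v) module \<Rightarrow> nat"
  where "rdim V \<equiv> vectorspace.dim (class_ring :: real ring) V"


section \<open>Singular homology with real coefficients\<close>

text \<open>The singular simplices are those of \<open>HOL-Homology\<close>; only the coefficients change from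
  \<open>int\<close> to \<open>real\<close>. The chain groups vanish in negative degrees.\<close>

type_synonym 'a rchain = "((nat \<Rightarrow> real) \<Rightarrow> 'a) \<Rightarrow>\<^sub>0 real"

definition rscale :: "real \<Rightarrow> ('s \<Rightarrow>\<^sub>0 real) \<Rightarrow> ('s \<Rightarrow>\<^sub>0 real)"
  where "rscale r c = Poly_Mapping.map ((*) r) c"

definition rextend :: "('s \<Rightarrow> 't \<Rightarrow>\<^sub>0 real) \<Rightarrow> ('s \<Rightarrow>\<^sub>0 real) \<Rightarrow> ('t \<Rightarrow>\<^sub>0 real)"
  where "rextend g c = (\<Sum>s\<in>Poly_Mapping.keys c. rscale (Poly_Mapping.lookup c s) (g s))"

definition rchains :: "int \<Rightarrow> 'a topology \<Rightarrow> 'a rchain set"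
  where "rchains p X =
    {c. \<forall>s\<in>Poly_Mapping.keys c. 0 \<le> p \<and> singular_simplex (nat p) X s}"

definition rboundary :: "int \<Rightarrow> 'a rchain \<Rightarrow> 'a rchain"
  where "rboundary p c =
    (if p \<le> 0 then 0
     else rextend (\<lambda>s. \<Sum>k\<le>nat p. Poly_Mapping.single (singular_face (nat p) k s) ((-1) ^ k)) c)"

definition rcycles :: "int \<Rightarrow> 'a topology \<Rightarrow> 'a rchain set"
  where "rcycles p X = {c \<in> rchains p X. rboundary p c = 0}"

definition rboundaries :: "int \<Rightarrow> 'a topology \<Rightarrow> 'a rchain set"
  where "rboundaries p X = rboundary (p + 1) ` rchains (p + 1) X"

definition rcycle_space :: "int \<Rightarrow> 'a topology \<Rightarrow> (real, 'a rchain) module"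
  where "rcycle_space p X =
    \<lparr>carrier = rcycles p X, mult = undefined, one = undefined,
     zero = 0, add = (+), smult = rscale\<rparr>"

definition rhomology :: "int \<Rightarrow> 'a topology \<Rightarrow> (real, 'a rchain set) module"
  where "rhomology p X = quot_space (rcycle_space p X) (rboundaries p X)"

definition rhomology_class :: "int \<Rightarrow> 'a topology \<Rightarrow> 'a rchain \<Rightarrow> 'a rchain set"
  where "rhomology_class p X c = rboundaries p X +>\<^bsub>rcycle_space p X\<^esub> c"

definition betti :: "int \<Rightarrow> 'a topology \<Rightarrow> nat"
  where "betti p X = rdim (rhomology p X)"

definition rchain_map :: "int \<Rightarrow> ('a \<Rightarrow> 'b) \<Rightarrow> 'a rchain \<Rightarrow> 'b rchain"
  where "rchain_map p f = rextend (\<lambda>s. Poly_Mapping.single (simplex_map (nat p) f s) 1)"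

definition rhom_induced ::
    "int \<Rightarrow> 'b topology \<Rightarrow> ('a \<Rightarrow> 'b) \<Rightarrow> 'a rchain set \<Rightarrow> 'b rchain set"
  where "rhom_induced p Y f C = (\<Union>c\<in>C. rhomology_class p Y (rchain_map p f c))"


section \<open>Cochains, cup and cap products\<close>

type_synonym 'a rcochain = "((nat \<Rightarrow> real) \<Rightarrow> 'a) \<Rightarrow> real"

definition cochain_eval :: "'a rcochain \<Rightarrow> 'a rchain \<Rightarrow> real"
  where "cochain_eval \<phi> c = (\<Sum>s\<in>Poly_Mapping.keys c. Poly_Mapping.lookup c s * \<phi> s)"

definition rcocycle :: "int \<Rightarrow> 'a topology \<Rightarrow> 'a rcochain \<Rightarrow> bool"
  where "rcocycle p X \<phi> \<longleftrightarrow>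
    (\<forall>c\<in>rchains (p + 1) X. cochain_eval \<phi> (rboundary (p + 1) c) = 0)"

definition front_face :: "nat \<Rightarrow> ((nat \<Rightarrow> real) \<Rightarrow> 'a) \<Rightarrow> (nat \<Rightarrow> real) \<Rightarrow> 'a"
  where "front_face p s = restrict s (standard_simplex p)"

definition back_face :: "nat \<Rightarrow> nat \<Rightarrow> ((nat \<Rightarrow> real) \<Rightarrow> 'a) \<Rightarrow> (nat \<Rightarrow> real) \<Rightarrow> 'a"
  where "back_face p q s =
    restrict (s \<circ> (\<lambda>x i. if i < p then 0 else x (i - p))) (standard_simplex q)"

definition cup :: "nat \<Rightarrow> nat \<Rightarrow> 'a rcochain \<Rightarrow> 'a rcochain \<Rightarrow> 'a rcochain"
  where "cup p q \<phi> \<psi> = (\<lambda>s. \<phi> (front_face p s) * \<psi> (back_face p q s))"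

definition cap :: "nat \<Rightarrow> nat \<Rightarrow> 'a rchain \<Rightarrow> 'a rcochain \<Rightarrow> 'a rchain"
  where "cap p q c \<phi> =
    rextend (\<lambda>s. Poly_Mapping.single (back_face p q s) (\<phi> (front_face p s))) c"


section \<open>Closed oriented manifolds and the intersection pairing\<close>

definition closed_manifold :: "nat \<Rightarrow> 'a topology \<Rightarrow> bool"
  where "closed_manifold m M \<longleftrightarrow>
    compact_space M \<and> Hausdorff_space M \<and>
    (\<forall>x\<in>topspace M. \<exists>U. openin M U \<and> x \<in> U \<and>
       subtopology M U homeomorphic_space Euclidean_space m)"

text \<open>An orientation is a locally consistent choice of generators of the integral local
  homology groups \<open>H\<^sub>m(M, M - {x}; \<int>)\<close>.\<close>

definition manifold_orientation :: "nat \<Rightarrow> 'a topology \<Rightarrow> ('a \<Rightarrow> 'a chain set) \<Rightarrow> bool"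
  where "manifold_orientation m M ori \<longleftrightarrow>
    (\<forall>x\<in>topspace M.
       ori x \<in> carrier (relative_homology_group (int m) M (topspace M - {x})) \<and>
       generate (relative_homology_group (int m) M (topspace M - {x})) {ori x} =
         carrier (relative_homology_group (int m) M (topspace M - {x}))) \<and>
    (\<forall>x\<in>topspace M. \<exists>U c. openin M U \<and> x \<in> U \<and>
       singular_relcycle m M (topspace M - U) c \<and>
       (\<forall>y\<in>U. homologous_rel_set m M (topspace M - {y}) c = ori y))"

definition fundamental_cycle ::
    "nat \<Rightarrow> 'a topology \<Rightarrow> ('a \<Rightarrow> 'a chain set) \<Rightarrow> 'a chain \<Rightarrow> bool"
  where "fundamental_cycle m M ori z \<longleftrightarrow>
    singular_relcycle m M {} z \<and>
    (\<forall>x\<in>topspace M. homologous_rel_set m M (topspace M - {x}) z = ori x)"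

text \<open>For classes \<open>u\<close>, \<open>v\<close> of degree \<open>n\<close> in an oriented \<open>2 * n\<close>-manifold, the intersection
  number is \<open>\<langle>\<phi> \<union> \<psi>, [M]\<rangle>\<close>, where \<open>\<phi>\<close> and \<open>\<psi>\<close> are the Poincare duals of \<open>u\<close> and \<open>v\<close>, that is,
  \<open>[M] \<inter> \<phi> = u\<close> and \<open>[M] \<inter> \<psi> = v\<close>.\<close>

definition intersection_number ::
    "nat \<Rightarrow> 'a topology \<Rightarrow> ('a \<Rightarrow> 'a chain set) \<Rightarrow> 'a rchain set \<Rightarrow> 'a rchain set \<Rightarrow> real"
  where "intersection_number n M ori u v =
    (THE r. \<exists>z \<mu> \<phi> \<psi>.
       fundamental_cycle (2 * n) M ori z \<and> \<mu> = Poly_Mapping.map real_of_int z \<and>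
       rcocycle (int n) M \<phi> \<and> rcocycle (int n) M \<psi> \<and>
       rhomology_class (int n) M (cap n n \<mu> \<phi>) = u \<and>
       rhomology_class (int n) M (cap n n \<mu> \<psi>) = v \<and>
       r = cochain_eval (cup n n \<phi> \<psi>) \<mu>)"


section \<open>Complexes embedded in a manifold\<close>

text \<open>A finite complex embedded in a space is represented by the family of its closed cells,
  indexed by dimension. All complexes considered here are regular, so the faces of a cell are
  the cells contained in it.\<close>

type_synonym 'a cells = "nat \<Rightarrow> 'a set set"

definition subcomplex :: "'a cells \<Rightarrow> 'a cells \<Rightarrow> bool"
  where "subcomplex L K \<longleftrightarrow>
    (\<forall>k. L k \<subseteq> K k) \<and>
    (\<forall>k j. \<forall>e\<in>L k. \<forall>f\<in>K j. f \<subseteq> e \<longrightarrow> f \<in> L j)"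

text \<open>The case \<open>L n = {}\<close>, in which \<open>L\<close> is just the \<open>(n - 1)\<close>-skeleton, is included.\<close>

definition spanning_subcomplex :: "nat \<Rightarrow> 'a cells \<Rightarrow> 'a cells \<Rightarrow> bool"
  where "spanning_subcomplex n L K \<longleftrightarrow>
    subcomplex L K \<and> (\<forall>k<n. L k = K k) \<and> (\<forall>k>n. L k = {})"

lemma finite_spanning_subcomplexes:
  assumes "finite (K n)"
  shows "finite {L. spanning_subcomplex n L K}"
proof (rule finite_subset)
  show "{L. spanning_subcomplex n L K} \<subseteq>
        (\<lambda>S k. if k < n then K k else if k = n then S else {}) ` Pow (K n)"
  proof
    fix L assume "L \<in> {L. spanning_subcomplex n L K}"
    then have L: "L n \<subseteq> K n" "\<And>k. k < n \<Longrightarrow> L k = K k" "\<And>k. k > n \<Longrightarrow> L k = {}"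
      by (auto simp: spanning_subcomplex_def subcomplex_def)
    then have "L = (\<lambda>k. if k < n then K k else if k = n then L n else {})"
      by (auto simp: fun_eq_iff)
    then show "L \<in> (\<lambda>S k. if k < n then K k else if k = n then S else {}) ` Pow (K n)"
      using L(1) by blast
  qed
qed (use assms in simp)

definition cells_space :: "'a topology \<Rightarrow> 'a cells \<Rightarrow> 'a topology"
  where "cells_space M L = subtopology M (\<Union>k. \<Union>(L k))"

definition k_inv :: "nat \<Rightarrow> 'a topology \<Rightarrow> 'a cells \<Rightarrow> nat"
  where "k_inv n M L =
    rdim ((rhomology (int n) (cells_space M L))
            \<lparr>carrier := {u \<in> carrier (rhomology (int n) (cells_space M L)).
                          rhom_induced (int n) M id u = \<zero>\<^bsub>rhomology (int n) M\<^esub>}\<rparr>)"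

definition V_img :: "nat \<Rightarrow> 'a topology \<Rightarrow> 'a cells \<Rightarrow> 'a rchain set set"
  where "V_img n M L =
    rhom_induced (int n) M id ` carrier (rhomology (int n) (cells_space M L))"

definition V_perp ::
    "nat \<Rightarrow> 'a topology \<Rightarrow> ('a \<Rightarrow> 'a chain set) \<Rightarrow> 'a cells \<Rightarrow> 'a rchain set set"
  where "V_perp n M ori L =
    {u \<in> carrier (rhomology (int n) M). \<forall>v\<in>V_img n M L. intersection_number n M ori u v = 0}"

definition s_inv :: "nat \<Rightarrow> 'a topology \<Rightarrow> ('a \<Rightarrow> 'a chain set) \<Rightarrow> 'a cells \<Rightarrow> nat"
  where "s_inv n M ori L =
    rdim (quot_space ((rhomology (int n) M)\<lparr>carrier := V_img n M L\<rparr>)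
                     (V_img n M L \<inter> V_perp n M ori L))"

definition s_perp_inv :: "nat \<Rightarrow> 'a topology \<Rightarrow> ('a \<Rightarrow> 'a chain set) \<Rightarrow> 'a cells \<Rightarrow> nat"
  where "s_perp_inv n M ori L =
    rdim (quot_space ((rhomology (int n) M)\<lparr>carrier := V_perp n M ori L\<rparr>)
                     (V_img n M L \<inter> V_perp n M ori L))"

text \<open>The polynomial, evaluated in an arbitrary commutative ring. The natural number subtraction
  in the exponent does not truncate: \<open>L\<close> contains the \<open>(n - 1)\<close>-skeleton of \<open>K\<close>, so
  \<open>H\<^bsub>n-1\<^esub>(L) \<rightarrow> H\<^bsub>n-1\<^esub>(K)\<close> is surjective.\<close>

definition P_poly ::
    "nat \<Rightarrow> 'a topology \<Rightarrow> ('a \<Rightarrow> 'a chain set) \<Rightarrow> 'a cells \<Rightarrow>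
     'r::comm_ring_1 \<Rightarrow> 'r \<Rightarrow> 'r \<Rightarrow> 'r \<Rightarrow> 'r"
  where "P_poly n M ori K X Y A B =
    (\<Sum>L | spanning_subcomplex n L K.
       X ^ (betti (int n - 1) (cells_space M L) - betti (int n - 1) (cells_space M K)) *
       Y ^ k_inv n M L * A ^ s_inv n M ori L * B ^ s_perp_inv n M ori L)"


section \<open>Triangulations and dual complexes\<close>

definition triangulates :: "'e::euclidean_space set set \<Rightarrow> ('e \<Rightarrow> 'a) \<Rightarrow> 'a topology \<Rightarrow> bool"
  where "triangulates K h M \<longleftrightarrow>
    simplicial_complex K \<and> homeomorphic_map (top_of_set (\<Union>K)) M h"

definition simplicial_cells :: "'e::euclidean_space set set \<Rightarrow> ('e \<Rightarrow> 'a) \<Rightarrow> 'a cells"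
  where "simplicial_cells K h k = {h ` \<sigma> |\<sigma>. \<sigma> \<in> K \<and> int k simplex \<sigma>}"

definition barycenter :: "'e::euclidean_space set \<Rightarrow> 'e"
  where "barycenter \<sigma> =
    (\<Sum>v | v extreme_point_of \<sigma>. v) /\<^sub>R real (card {v. v extreme_point_of \<sigma>})"

text \<open>The library's simplicial complexes contain the empty face, which is discarded here.\<close>

definition barycentric_subdivision :: "'e::euclidean_space set set \<Rightarrow> 'e set set"
  where "barycentric_subdivision K =
    {convex hull (barycenter ` C) |C.
       C \<subseteq> K - {{}} \<and> C \<noteq> {} \<and> (\<forall>\<sigma>\<in>C. \<forall>\<tau>\<in>C. \<sigma> \<subseteq> \<tau> \<or> \<tau> \<subseteq> \<sigma>)}"

text \<open>A simplex of the subdivision with vertex \<open>barycenter \<sigma>\<close> is transverse to \<open>\<sigma>\<close> if it meets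
  \<open>\<sigma>\<close> in that point only, i.e. if \<open>\<sigma>\<close> is the smallest member of the flag spanning it.\<close>

definition dual_cell :: "'e::euclidean_space set set \<Rightarrow> 'e set \<Rightarrow> 'e set"
  where "dual_cell K \<sigma> =
    \<Union>{\<tau> \<in> barycentric_subdivision K.
        barycenter \<sigma> extreme_point_of \<tau> \<and> \<tau> \<inter> \<sigma> = {barycenter \<sigma>}}"

definition dual_cells :: "nat \<Rightarrow> 'e::euclidean_space set set \<Rightarrow> ('e \<Rightarrow> 'a) \<Rightarrow> 'a cells"
  where "dual_cells m K h k =
    {h ` dual_cell K \<sigma> |\<sigma>. \<sigma> \<in> K \<and> \<sigma> \<noteq> {} \<and> (int m - int k) simplex \<sigma>}"

end

theory Submission
  imports Defs
begin

text \<open>Flags of simplices of \<open>K\<close> are the simplices of the barycentric subdivision. Excision along the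
  subdivision shows that singular homology of a subcomplex is computed by flag chains, and the local
  homology of the manifold shows that the fundamental cycle restricted to the flags through a
  simplex \<open>s\<close> is a product of a chain \<open>E s\<close> of flags ending in \<open>s\<close> and a chain \<open>D s\<close> of flags
  starting in \<open>s\<close>. The \<open>E s\<close> and the \<open>D s\<close> are the cells of \<open>K\<close> and of \<open>K\<^sup>*\<close>, their incidence
  matrices are transposes of each other up to sign, and the cap product with the fundamental cycle
  sends the cochain dual to \<open>E s\<close> to \<open>D s\<close>, so that the intersection pairing of \<open>E s\<close> and \<open>D t\<close> is
  the Kronecker symbol. If \<open>S\<close> is the set of \<open>n\<close>-simplices of a spanning subcomplex \<open>L\<close>, let
  \<open>L\<^sup>*\<close> consist of the dual cells of the \<open>n\<close>-simplices not in \<open>S\<close> and of all dual cells of smaller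
  dimension. Linear algebra with the transposed matrices then gives \<open>V(L\<^sup>*) = V(L)\<^sup>\<bottom>\<close>, and vice
  versa, and \<open>k(L\<^sup>*)\<close> is the excess of the Betti number of \<open>L\<close> in degree \<open>n - 1\<close>.\<close>

section \<open>Finitely supported real functions as a vector space\<close>

text \<open>A triangulated topological manifold need not have spherical links, so dual cells cannot
  be treated as balls. What is available is local homology, and it suffices: a cycle of the lower
  link of \<open>s\<close> times a fixed full slice of the fundamental cycle above \<open>s\<close>
  is a relative cycle at \<open>s\<close>, hence a boundary or a multiple of the fundamental cycle.
  This makes both halves of the link homology spheres and yields the product form. The axioms of
  flag complexes are symmetric under reversal of ranks, so results on \<open>E\<close> transfer to
  \<open>D\<close>. Scaling \<open>D s\<close> by a value of the fundamental cycle makes the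
  incidence matrices exact transposes up to a sign depending only on the degree. Excision, homotopy
  invariance and orientations concern integral chains. A real chain is cut into integral ones along
  finitely many reals independent over the integers; such parts cannot cancel, so each inherits the
  support conditions on the boundary. The comparisons of singular, flag and cellular chains are all
  stated for chains whose boundary already has the smaller type, which contains surjectivity and
  injectivity on homology at once.\<close>

abbreviation "lookup \<equiv> Poly_Mapping.lookup"
abbreviation "keys \<equiv> Poly_Mapping.keys"
abbreviation "single \<equiv> Poly_Mapping.single"

lemma lookup_rscale [simp]: "lookup (rscale r c) s = r * lookup c s"
	unfolding rscale_def by (simp add: Poly_Mapping.map.rep_eq when_def)

global_interpretation rv: vector_space "rscale :: real => ('s \<Rightarrow>\<^sub>0 real) => ('s \<Rightarrow>\<^sub>0 real)"
	by unfold_locales (auto intro!: poly_mapping_eqI simp: lookup_add algebra_simps)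

global_interpretation rr: vector_space "(*) :: real => real => real"
	by unfold_locales (auto simp: algebra_simps)

global_interpretation rvp: vector_space_pair "rscale :: real => ('s \<Rightarrow>\<^sub>0 real) => ('s \<Rightarrow>\<^sub>0 real)"
	"rscale :: real => ('t \<Rightarrow>\<^sub>0 real) => ('t \<Rightarrow>\<^sub>0 real)"
	by unfold_locales

global_interpretation rvr: vector_space_pair "rscale :: real => ('s \<Rightarrow>\<^sub>0 real) => ('s \<Rightarrow>\<^sub>0 real)"
	"(*) :: real => real => real"
	by unfold_locales

abbreviation rlinear :: "(('s \<Rightarrow>\<^sub>0 real) => ('t \<Rightarrow>\<^sub>0 real)) => bool"
	where "rlinear \<equiv> Vector_Spaces.linear rscale rscale"

abbreviation rfunctional :: "(('s \<Rightarrow>\<^sub>0 real) => real) => bool"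
	where "rfunctional \<equiv> Vector_Spaces.linear rscale (*)"

lemma rlinearI:
	assumes "!!a b. f (a + b) = f a + f b" "!!r a. f (rscale r a) = rscale r (f a)"
	shows "rlinear f"
	using assms by unfold_locales auto

lemma rfunctionalI:
	assumes "!!a b. f (a + b) = f a + f b" "!!r a. f (rscale r a) = r * f a"
	shows "rfunctional f"
	using assms by unfold_locales auto

lemma keys_rscale: "keys (rscale r c) \<subseteq> keys c"
	by (auto simp: in_keys_iff)

lemma rextend_alt:
	assumes "finite A" "keys c \<subseteq> A"
	shows "rextend g c = (\<Sum>s\<in>A. rscale (lookup c s) (g s))"
	unfolding rextend_def
	by (rule sum.mono_neutral_left) (use assms in \<open>auto simp: in_keys_iff\<close>)

lemma rlinear_rextend: "rlinear (rextend g)"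
proof (rule rlinearI)
	fix a b :: "'a \<Rightarrow>\<^sub>0 real"
	let ?A = "keys a Un keys b"
	have "keys (a + b) \<subseteq> ?A" by (rule Poly_Mapping.keys_add)
	then have "rextend g (a + b) = (\<Sum>s\<in>?A. rscale (lookup (a + b) s) (g s))"
		by (intro rextend_alt) simp_all
	also have "\<dots> = (\<Sum>s\<in>?A. rscale (lookup a s) (g s)) + (\<Sum>s\<in>?A. rscale (lookup b s) (g s))"
		by (simp add: lookup_add rv.scale_left_distrib sum.distrib)
	finally show "rextend g (a + b) = rextend g a + rextend g b"
		by (simp add: rextend_alt[of ?A a] rextend_alt[of ?A b])
next
	fix r and a :: "'a \<Rightarrow>\<^sub>0 real"
	have "rextend g (rscale r a) = (\<Sum>s\<in>keys a. rscale (lookup (rscale r a) s) (g s))"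
		by (rule rextend_alt) (simp_all add: keys_rscale)
	also have "\<dots> = rscale r (rextend g a)"
		by (simp add: rextend_def rv.scale_sum_right)
	finally show "rextend g (rscale r a) = rscale r (rextend g a)" .
qed

lemmas rextend_add = Vector_Spaces.linear.axioms(3)[OF rlinear_rextend, THEN module_hom.add]
lemmas rextend_scale = rvp.linear_scale[OF rlinear_rextend]
lemmas rextend_sum = rvp.linear_sum[OF rlinear_rextend]
lemmas rextend_0 [simp] = rvp.linear_0[OF rlinear_rextend]

lemma rextend_single [simp]: "rextend g (single s r) = rscale r (g s)"
	by (subst rextend_alt[of "{s}"]) auto

lemma lookup_rextend:
	"lookup (rextend g c) t =
		 (\<Sum>s\<in>keys c. lookup c s * lookup (g s) t)"
	by (simp add: rextend_def lookup_sum)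

lemma keys_rextend: "keys (rextend g c) \<subseteq> (\<Union>s\<in>keys c. keys (g s))"
proof
	fix t assume "t : keys (rextend g c)"
	then have "(\<Sum>s\<in>keys c. lookup c s * lookup (g s) t) ~= 0"
		by (simp add: in_keys_iff lookup_rextend)
	then obtain s where "s : keys c" "lookup c s * lookup (g s) t ~= 0"
		by (rule sum.not_neutral_contains_not_neutral)
	then show "t : (\<Union>s\<in>keys c. keys (g s))"
		by (auto simp: in_keys_iff)
qed

lemma rextend_cong:
	"(!!s. s : keys c ==> g s = h s) ==> rextend g c = rextend h c"
	by (simp add: rextend_def)

lemma rexpansion: "(\<Sum>s\<in>keys c. rscale (lookup c s) (single s 1)) = c"
proof (rule poly_mapping_eqI)
	fix t
	have "lookup (\<Sum>s\<in>keys c. rscale (lookup c s) (single s 1)) t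
			= (\<Sum>s\<in>keys c. if s = t then lookup c s else 0)"
		unfolding lookup_sum lookup_rscale by (rule sum.cong) (auto simp: lookup_single when_def)
	also have "\<dots> = lookup c t"
		by (simp add: in_keys_iff)
	finally show "lookup (\<Sum>s\<in>keys c. rscale (lookup c s) (single s 1)) t
			= lookup c t" .
qed

lemma rlinear_expansion:
	assumes "rlinear f"
	shows "f c = (\<Sum>s\<in>keys c. rscale (lookup c s) (f (single s 1)))"
proof -
	have "f c = f (\<Sum>s\<in>keys c. rscale (lookup c s) (single s 1))"
		by (simp only: rexpansion)
	then show ?thesis
		by (simp only: rvp.linear_sum[OF assms] rvp.linear_scale[OF assms])
qed

lemma rlinear_eq_on_singles:
	assumes "rlinear f" "rlinear g" "!!s. s : keys c ==> f (single s 1) = g (single s 1)"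
	shows "f c = g c"
	unfolding rlinear_expansion[OF assms(1), of c] rlinear_expansion[OF assms(2), of c]
	by (rule sum.cong) (simp_all add: assms(3))

lemma rfunctional_cochain_eval: "rfunctional (cochain_eval \<psi>)"
proof (rule rfunctionalI)
	have alt: "cochain_eval \<psi> c = (\<Sum>s\<in>A. lookup c s * \<psi> s)"
		if "finite A" "keys c \<subseteq> A" for A c
		unfolding cochain_eval_def
		by (rule sum.mono_neutral_left) (use that in \<open>auto simp: in_keys_iff\<close>)
	fix a b :: "((nat => real) => 'a) \<Rightarrow>\<^sub>0 real"
	let ?A = "keys a Un keys b"
	have "keys (a + b) \<subseteq> ?A" by (rule Poly_Mapping.keys_add)
	then have "cochain_eval \<psi> (a + b) = (\<Sum>s\<in>?A. lookup (a + b) s * \<psi> s)"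
		by (intro alt) simp_all
	also have "\<dots> = (\<Sum>s\<in>?A. lookup a s * \<psi> s) + (\<Sum>s\<in>?A. lookup b s * \<psi> s)"
		by (simp add: lookup_add distrib_right sum.distrib)
	finally show "cochain_eval \<psi> (a + b) = cochain_eval \<psi> a + cochain_eval \<psi> b"
		by (simp add: alt[of ?A a] alt[of ?A b])
	fix r
	have "cochain_eval \<psi> (rscale r a) = (\<Sum>s\<in>keys a. lookup (rscale r a) s * \<psi> s)"
		by (rule alt) (simp_all add: keys_rscale)
	also have "\<dots> = r * cochain_eval \<psi> a"
		by (simp add: cochain_eval_def sum_distrib_left mult.assoc)
	finally show "cochain_eval \<psi> (rscale r a) = r * cochain_eval \<psi> a" .
qed

lemmas cochain_eval_diff = rvr.linear_diff[OF rfunctional_cochain_eval]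
lemmas cochain_eval_scale = rvr.linear_scale[OF rfunctional_cochain_eval]
lemmas cochain_eval_sum = rvr.linear_sum[OF rfunctional_cochain_eval]
lemmas cochain_eval_0 [simp] = rvr.linear_0[OF rfunctional_cochain_eval]

lemma cochain_eval_single [simp]: "cochain_eval \<psi> (single s r) = r * \<psi> s"
	by (cases "r = 0") (auto simp: cochain_eval_def)

lemma rfunctional_is_cochain_eval:
	assumes "rfunctional f"
	shows "cochain_eval (%s. f (single s 1)) c = f c"
proof -
	have "f c = f (\<Sum>s\<in>keys c. rscale (lookup c s) (single s 1))"
		by (simp only: rexpansion)
	then show ?thesis
		by (simp only: rvr.linear_sum[OF assms] rvr.linear_scale[OF assms] cochain_eval_def)
qed

section \<open>Linear algebra in finite-dimensional subspaces\<close>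

text \<open>Chain spaces are infinite-dimensional, so dimension counts are confined to finitely
  spanned subspaces. The spanning set may lie outside \<open>W\<close>, which makes the notion
  hereditary to smaller subspaces.\<close>

definition fin_sub :: "('s \<Rightarrow>\<^sub>0 real) set => bool"
	where "fin_sub W \<longleftrightarrow> rv.subspace W & (EX B. finite B & W \<subseteq> rv.span B)"

lemma fin_sub_basis:
	assumes "fin_sub W" "rv.subspace U" "U \<subseteq> W"
	obtains B A where "finite B" "rv.independent B" "rv.span B = U" "card B = rv.dim U"
		"finite A" "A \<inter> B = {}" "rv.independent (B Un A)" "rv.span (B Un A) = W" "card (B Un A) = rv.dim W"
proof -
	obtain S where S: "finite S" "W \<subseteq> rv.span S" and W: "rv.subspace W"
		using assms(1) by (auto simp: fin_sub_def)
	obtain B where B: "B \<subseteq> U" "rv.independent B" "U \<subseteq> rv.span B"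
		using rv.maximal_independent_subset by blast
	have BW: "B \<subseteq> W" using B assms by auto
	obtain C where C: "B \<subseteq> C" "C \<subseteq> W" "rv.independent C" "W \<subseteq> rv.span C"
		using rv.maximal_independent_subset_extend[OF BW B(2)] by blast
	have fC: "finite C"
		using rv.independent_span_bound[OF S(1) C(3)] C(2) S(2) by auto
	have sB: "rv.span B = U"
		using B rv.span_minimal[OF B(1) assms(2)] by auto
	have sC: "rv.span C = W"
		using C rv.span_minimal[OF C(2) W] by auto
	have eq: "B Un (C - B) = C" using C(1) by blast
	show thesis
	proof (rule that[of B "C - B"])
		show "finite B" using fC C(1) finite_subset by blast
		show "card B = rv.dim U" by (rule rv.basis_card_eq_dim[OF B(1) B(3) B(2)])
		show "card (B Un (C - B)) = rv.dim W" unfolding eq by (rule rv.basis_card_eq_dim[OF C(2) C(4) C(3)])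
	qed (use B sB sC C fC eq in auto)
qed

lemma fin_sub_subspace: "fin_sub W ==> rv.subspace W"
	by (simp add: fin_sub_def)

lemma fin_sub_subset: "fin_sub W ==> rv.subspace U ==> U \<subseteq> W ==> fin_sub U"
	unfolding fin_sub_def by blast

lemma fin_sub_finite_basis:
	assumes "fin_sub W"
	obtains B where "finite B" "rv.span B = W" "card B = rv.dim W"
	by (rule fin_sub_basis[OF assms fin_sub_subspace[OF assms] subset_refl]) (rule that)

lemma dim_complement_exists:
	assumes "fin_sub W" "rv.subspace U" "U \<subseteq> W"
	obtains A where "finite A" "A \<subseteq> W" "rv.span (A Un U) = W" "card A + rv.dim U = rv.dim W"
proof -
	obtain B A where *: "finite B" "rv.independent B" "rv.span B = U" "card B = rv.dim U"
		"finite A" "A \<inter> B = {}" "rv.independent (B Un A)" "rv.span (B Un A) = W" "card (B Un A) = rv.dim W"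
		using fin_sub_basis[OF assms] .
	have A: "A \<subseteq> W" using *(8) rv.span_superset by blast
	have "rv.span (A Un U) \<subseteq> W"
		by (rule rv.span_minimal) (use A assms fin_sub_subspace in auto)
	moreover have "W \<subseteq> rv.span (A Un U)"
		unfolding *(8)[symmetric] by (rule rv.span_mono) (use *(3) rv.span_superset in blast)
	ultimately have "rv.span (A Un U) = W" by blast
	moreover have "card A + rv.dim U = rv.dim W"
		using card_Un_disjoint[OF *(1) *(5)] *(4,6,9) by (simp add: Int_commute)
	ultimately show thesis using that[OF *(5) A] by blast
qed

lemma dim_le_complement:
	assumes "fin_sub W" "rv.subspace U" "U \<subseteq> W" "finite A" "W \<subseteq> rv.span (A Un U)"
	shows "rv.dim W <= card A + rv.dim U"
proof -
	obtain B where *: "finite B" "rv.span B = U" "card B = rv.dim U"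
		by (rule fin_sub_finite_basis[OF fin_sub_subset[OF assms(1-3)]])
	have "rv.span (A Un U) \<subseteq> rv.span (A Un B)"
		by (rule rv.span_minimal) (use * rv.span_superset[of "A Un B"] rv.span_mono[of B "A Un B"] in auto)
	with assms(5) have "rv.dim W <= card (A Un B)"
		by (intro rv.dim_le_card) (use * assms(4) in auto)
	also have "\<dots> <= card A + card B" by (rule card_Un_le)
	finally show ?thesis using * by simp
qed

lemma fin_sub_dim_mono:
	assumes "fin_sub W" "rv.subspace U" "U \<subseteq> W"
	shows "rv.dim U <= rv.dim W"
	using dim_complement_exists[OF assms] by (metis le_add2)

lemma subspace_image: "rlinear f ==> rv.subspace W ==> rv.subspace (f ` W)"
	by (rule rvp.linear_subspace_image)

lemma subspace_ker: "rlinear f ==> rv.subspace W ==> rv.subspace {w\<in>W. f w = 0}"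
	unfolding rv.subspace_def
	by (auto simp: rvp.linear_add rvp.linear_scale rvp.linear_0)

lemma fin_sub_image: "rlinear f ==> fin_sub W ==> fin_sub (f ` W)"
proof -
	assume f: "rlinear f" and "fin_sub W"
	then obtain B where B: "finite B" "W \<subseteq> rv.span B" "rv.subspace W" by (auto simp: fin_sub_def)
	have "f ` W \<subseteq> rv.span (f ` B)"
		using B(2) rvp.linear_span_image[OF f, of B] by blast
	then show ?thesis using B f subspace_image unfolding fin_sub_def by blast
qed

text \<open>One inequality maps a complement of the kernel onto generators of the image; the other
  lifts a basis of the image and adds the kernel to span \<open>W\<close>.\<close>

lemma rank_nullity:
	assumes f: "rlinear f" and W: "fin_sub W"
	shows "rv.dim W = rv.dim (f ` W) + rv.dim {w\<in>W. f w = 0}"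
proof (rule antisym)
	let ?U = "{w\<in>W. f w = 0}"
	have U: "rv.subspace ?U" "?U \<subseteq> W" using subspace_ker[OF f fin_sub_subspace[OF W]] by auto
	obtain A where A: "finite A" "A \<subseteq> W" "rv.span (A Un ?U) = W" "card A + rv.dim ?U = rv.dim W"
		using dim_complement_exists[OF W U] by blast
	have "f ` W = rv.span (f ` A Un f ` ?U)"
		using rvp.linear_span_image[OF f, of "A Un ?U"] A(3) by (simp add: image_Un)
	also have "\<dots> \<subseteq> rv.span (f ` A)"
		by (rule rv.span_minimal) (auto simp: rv.span_base rv.span_zero)
	finally have "rv.dim (f ` W) <= card (f ` A)"
		using A(1) by (intro rv.dim_le_card) auto
	also have "\<dots> <= card A" using A(1) by (rule card_image_le)
	finally show "rv.dim (f ` W) + rv.dim ?U <= rv.dim W" using A(4) by simp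
	obtain C where C: "finite C" "rv.span C = f ` W" "card C = rv.dim (f ` W)"
		by (rule fin_sub_finite_basis[OF fin_sub_image[OF f W]])
	have "C \<subseteq> f ` W" using C(2) rv.span_superset by blast
	then obtain A' where A': "A' \<subseteq> W" "inj_on f A'" "f ` A' = C"
		using subset_image_inj by metis
	have "W \<subseteq> rv.span (A' Un ?U)"
	proof
		fix w assume w: "w : W"
		then have "f w : f ` rv.span A'"
			using C(2) A'(3) rvp.linear_span_image[OF f, of A'] by auto
		then obtain a where a: "a : rv.span A'" "f w = f a" by auto
		have "a : W" using a(1) rv.span_minimal[OF A'(1) fin_sub_subspace[OF W]] by blast
		then have "w - a : ?U"
			using w a(2) rv.subspace_diff[OF fin_sub_subspace[OF W]] by (auto simp: rvp.linear_diff[OF f])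
		then have "w - a : rv.span (A' Un ?U)" by (intro rv.span_base) blast
		moreover have "a : rv.span (A' Un ?U)" using a rv.span_mono[of A' "A' Un ?U"] by blast
		ultimately have "(w - a) + a : rv.span (A' Un ?U)" by (rule rv.span_add)
		then show "w : rv.span (A' Un ?U)" by simp
	qed
	moreover have fA': "finite A'" using finite_image_iff[OF A'(2)] A'(3) C(1) by simp
	ultimately have "rv.dim W <= card A' + rv.dim ?U"
		using dim_le_complement[OF W U fA'] by blast
	then show "rv.dim W <= rv.dim (f ` W) + rv.dim ?U"
		using card_image[OF A'(2)] A'(3) C(3) by simp
qed

lemma dim_zero_space: "rv.dim {0} = 0"
	using rv.dim_le_card[of "{0}" "{}"] by simp

text \<open>A basis of \<open>W\<close> is enlarged by vectors of \<open>T\<close>, and the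
  functional is prescribed as zero on the old and as \<open>g\<close> on the new basis vectors. It
  later extends a functional on cellular chains to a cocycle and separates a vector from a
  subspace.\<close>

lemma extend_functional:
	assumes W: "rv.subspace W" and T: "rv.subspace T" and g: "rfunctional g"
		and z: "!!x. x : T ==> x : W ==> g x = 0"
	obtains f where "rfunctional f" "!!x. x : W ==> f x = 0" "!!x. x : T ==> f x = g x"
proof -
	obtain B where B: "B \<subseteq> W" "rv.independent B" "W \<subseteq> rv.span B"
		using rv.maximal_independent_subset by blast
	obtain C where C: "B \<subseteq> C" "C \<subseteq> B Un T" "rv.independent C" "B Un T \<subseteq> rv.span C"
		using rv.maximal_independent_subset_extend[of B "B Un T"] B(2) by blast
	obtain f where f: "rfunctional f" "ALL x:C. f x = (if x : B then 0 else g x)"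
		using rvr.linear_independent_extend[OF C(3), of "%x. if x : B then 0 else g x"] by blast
	have fW: "f x = 0" if "x : W" for x
	proof -
		have "x : rv.span B" using that B by blast
		then show ?thesis
			by (rule rvr.linear_eq_on[OF f(1) rvr.linear_zero]) (use f(2) C(1) in auto)
	qed
	have "f x = g x" if x: "x : T" for x
	proof -
		have "x : rv.span (B Un (C - B))" using x C by (auto simp: Un_absorb1)
		then obtain a b where ab: "x = a + b" "a : rv.span B" "b : rv.span (C - B)"
			unfolding rv.span_Un by blast
		have bT: "b : T" using ab(3) rv.span_minimal[of "C - B" T] C(2) T by blast
		have aW: "a : W" using ab(2) rv.span_minimal[OF B(1) W] by blast
		have "a : T" using rv.subspace_diff[OF T x bT] ab(1) by simp
		then have "g a = 0" using aW z by blast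
		moreover have "f b = g b"
			using ab(3) by (rule rvr.linear_eq_on[OF f(1) g]) (use f(2) in auto)
		ultimately show ?thesis
			using ab(1) fW[OF aW] by (simp add: rvr.linear_add[OF f(1)] rvr.linear_add[OF g])
	qed
	with fW show thesis by (rule that[OF f(1)])
qed

text \<open>Composes \<open>g\<close> with a linear right inverse of \<open>f\<close> taking values
  in \<open>T\<close>; two preimages in \<open>T\<close> differ by an element killed by
  \<open>f\<close>, hence by \<open>g\<close>.\<close>

lemma factor_functional:
	assumes f: "rlinear f" and T: "rv.subspace T" and g: "rfunctional g"
		and z: "!!x. x : T ==> f x = 0 ==> g x = 0"
	obtains h where "rfunctional h" "!!x. x : T ==> h (f x) = g x"
proof -
	from rvp.linear_exists_right_inverse_on[OF f T]
	obtain r where "range r \<subseteq> T & rlinear r & (ALL v:f ` T. f (r v) = v)"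
		by (rule exE)
	then have r: "r ` UNIV \<subseteq> T" "rlinear r" "ALL v:f ` T. f (r v) = v" by auto
	have gr: "(g \<circ> r) (f x) = g x" if "x : T" for x
	proof -
		have "r (f x) - x : T" using rv.subspace_diff[OF T] r(1) that by blast
		moreover have "f (r (f x) - x) = 0" using r(3) that by (simp add: rvp.linear_diff[OF f])
		ultimately have "g (r (f x) - x) = 0" using z by blast
		then show ?thesis by (simp add: rvr.linear_diff[OF g])
	qed
	have "rfunctional (g \<circ> r)"
		by (rule Vector_Spaces.linear_compose[OF r(2) g])
	then show thesis by (rule that) (rule gr)
qed

section \<open>Coordinate subspaces and annihilators\<close>

definition csub :: "'s set => ('s \<Rightarrow>\<^sub>0 real) set"
	where "csub I = {x. keys x \<subseteq> I}"

lemma subspace_csub: "rv.subspace (csub I)"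
	unfolding rv.subspace_def csub_def
	by (auto dest!: subsetD[OF Poly_Mapping.keys_add] subsetD[OF keys_rscale])

lemma fin_sub_csub: "finite I ==> fin_sub (csub I)"
	unfolding fin_sub_def
proof
	show "rv.subspace (csub I)" by (rule subspace_csub)
	assume "finite I"
	moreover have "csub I \<subseteq> rv.span ((%s. single s 1) ` I)"
	proof
		fix x :: "'a \<Rightarrow>\<^sub>0 real" assume "x : csub I"
		then have "(\<Sum>s\<in>keys x. rscale (lookup x s) (single s 1))
				\<in> rv.span ((%s. single s 1) ` I)"
			by (intro rv.span_sum[OF rv.span_scale[OF rv.span_base]]) (auto simp: csub_def)
		then show "x : rv.span ((%s. single s 1) ` I)"
			by (simp only: rexpansion)
	qed
	ultimately show "EX B. finite B & csub I \<subseteq> rv.span B" by blast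
qed

definition ip :: "('s \<Rightarrow>\<^sub>0 real) => ('s \<Rightarrow>\<^sub>0 real) => real"
	where "ip x y = (\<Sum>i\<in>keys x. lookup x i * lookup y i)"

lemma ip_alt: "finite A ==> keys x \<subseteq> A ==> ip x y = (\<Sum>i\<in>A. lookup x i * lookup y i)"
	unfolding ip_def by (rule sum.mono_neutral_left) (auto simp: in_keys_iff)

lemma rfunctional_ip_right: "rfunctional (ip x)"
	by (rule rfunctionalI) (auto simp: ip_def lookup_add algebra_simps sum.distrib sum_distrib_left)

lemma ip_commute: "ip x y = ip y x"
	by (simp add: ip_alt[of "keys x Un keys y" x]
			ip_alt[of "keys x Un keys y" y] mult.commute)

lemma rfunctional_ip_left: "rfunctional (%x. ip x y)"
	using rfunctional_ip_right[of y] by (simp add: ip_commute[of _ y])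

lemma ip_self: "ip x x = 0 \<longleftrightarrow> x = 0"
proof
	assume "ip x x = 0"
	then have "ALL i:keys x. lookup x i * lookup x i = 0"
		unfolding ip_def by (subst (asm) sum_nonneg_eq_0_iff) auto
	then show "x = 0" by (auto simp: in_keys_iff intro!: poly_mapping_eqI)
qed (simp add: ip_def)

text \<open>Pairing with a spanning set of \<open>B\<close> has the annihilator as kernel. Its rank
  is at least \<open>rv.dim B\<close> because the pairing is positive definite on \<open>B\<close>,
  and at most that because the spanning set has \<open>rv.dim B\<close> elements.\<close>

lemma dim_annihilator:
	assumes I: "finite I" and B: "rv.subspace B" "B \<subseteq> csub I"
	shows "rv.dim {x\<in>csub I. ALL b:B. ip x b = 0} + rv.dim B = rv.dim (csub I)"
proof -
	note C = fin_sub_csub[OF I]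
	have finB: "fin_sub B" by (rule fin_sub_subset[OF C B])
	obtain b where b: "finite b" "rv.span b = B" "card b = rv.dim B"
		by (rule fin_sub_finite_basis[OF finB])
	define f where "f x = (\<Sum>v\<in>b. single v (ip x v))" for x
	have f: "rlinear f"
	proof (rule rlinearI)
		fix x y :: "'a \<Rightarrow>\<^sub>0 real" and r
		show "f (x + y) = f x + f y"
			by (simp add: f_def rvr.linear_add[OF rfunctional_ip_left] single_add sum.distrib)
		have "single v (r * ip x v) = rscale r (single v (ip x v))" for v
			by (rule poly_mapping_eqI) (simp add: lookup_single when_def)
		then show "f (rscale r x) = rscale r (f x)"
			by (simp add: f_def rvr.linear_scale[OF rfunctional_ip_left] rv.scale_sum_right)
	qed
	have lf: "lookup (f x) v = ip x v" if "v : b" for x v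
		using that b(1) by (simp add: f_def lookup_sum lookup_single when_def)
	have ker: "f x = 0 \<longleftrightarrow> (ALL v:B. ip x v = 0)" for x
	proof
		assume "f x = 0"
		then have "ALL v:b. ip x v = 0" using lf[of _ x] by simp
		moreover have "rv.subspace {v. ip x v = 0}"
			by (auto simp: rv.subspace_def rvr.linear_add[OF rfunctional_ip_right]
					rvr.linear_scale[OF rfunctional_ip_right] rvr.linear_0[OF rfunctional_ip_right])
		ultimately have "rv.span b \<subseteq> {v. ip x v = 0}" by (intro rv.span_minimal) auto
		then show "ALL v:B. ip x v = 0" using b(2) by auto
	next
		assume "ALL v:B. ip x v = 0"
		then have "ALL v:b. ip x v = 0" using b(2) rv.span_superset by blast
		then show "f x = 0" by (simp add: f_def)
	qed
	have "{x\<in>B. f x = 0} = {0}"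
		using ker ip_self rv.subspace_0[OF B(1)] rvp.linear_0[OF f] by auto
	then have "rv.dim B = rv.dim (f ` B)" using rank_nullity[OF f finB] dim_zero_space by simp
	also have "\<dots> <= rv.dim (f ` csub I)"
		by (rule fin_sub_dim_mono[OF fin_sub_image[OF f C] subspace_image[OF f B(1)]]) (use B(2) in auto)
	finally have 1: "rv.dim B <= rv.dim (f ` csub I)" .
	have "f ` csub I \<subseteq> rv.span ((%v. single v 1) ` b)"
	proof (clarify)
		fix x
		have "f x = (\<Sum>v\<in>b. rscale (ip x v) (single v 1))"
			unfolding f_def by (rule sum.cong[OF refl], rule poly_mapping_eqI) (auto simp: lookup_single when_def)
		then show "f x : rv.span ((%v. single v 1) ` b)"
			by (auto intro!: rv.span_sum[OF rv.span_scale[OF rv.span_base]])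
	qed
	then have "rv.dim (f ` csub I) <= card ((%v. single v (1::real)) ` b)"
		using b(1) by (intro rv.dim_le_card) auto
	also have "\<dots> <= card b" using b(1) by (rule card_image_le)
	finally have "rv.dim (f ` csub I) = rv.dim B" using 1 b(3) by simp
	then show ?thesis using rank_nullity[OF f C] by (simp add: ker)
qed

text \<open>Let \<open>X J'\<close> be the vectors orthogonal to the columns in \<open>J'\<close>.
  The row map on \<open>X L\<close> has kernel \<open>X J\<close>, and its image is the part of the
  row space supported off \<open>L\<close>; rank-nullity and the annihilator formula for
  \<open>L\<close> and \<open>J\<close> give the identity. For an incidence matrix it equates a
  change of Betti number with a kernel on the dual side.\<close>

lemma rank_complement_transpose:
	fixes a :: "'s => 't => real"
	assumes I: "finite I" "finite J" "L \<subseteq> J"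
	defines "colv \<equiv> %t. \<Sum>s\<in>I. single s (a s t)"
	defines "rowv \<equiv> %s. \<Sum>t\<in>J. single t (a s t)"
	shows "rv.dim (rextend colv ` csub J) =
		 rv.dim (rextend colv ` csub L) + rv.dim {w : rextend rowv ` csub I. keys w \<subseteq> J - L}"
proof -
	have lcol: "lookup (colv t) s = (if s : I then a s t else 0)" for s t
		using I by (simp add: colv_def lookup_sum lookup_single when_def)
	have lrow: "lookup (rowv s) t = (if t : J then a s t else 0)" for s t
		using I by (simp add: rowv_def lookup_sum lookup_single when_def)
	have rowv: "lookup (rextend rowv x) t = (if t : J then ip x (colv t) else 0)"
		if "x : csub I" for x t
		using that by (auto simp: lookup_rextend lrow ip_def lcol csub_def intro!: sum.cong)
	have ann: "(ALL b:rextend colv ` csub J'. ip x b = 0) \<longleftrightarrow> (ALL t:J'. ip x (colv t) = 0)"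
		if "J' \<subseteq> J" for J' x
	proof
		assume h: "ALL b:rextend colv ` csub J'. ip x b = 0"
		have "single t 1 : csub J'" if "t : J'" for t using that by (auto simp: csub_def)
		then have "ip x (rextend colv (single t 1)) = 0" if "t : J'" for t
			using h that by blast
		then show "ALL t:J'. ip x (colv t) = 0" by simp
	next
		assume h: "ALL t:J'. ip x (colv t) = 0"
		then show "ALL b:rextend colv ` csub J'. ip x b = 0"
			by (auto simp: rextend_def csub_def rvr.linear_sum[OF rfunctional_ip_right]
					rvr.linear_scale[OF rfunctional_ip_right] intro!: sum.neutral)
	qed
	have sub: "rv.subspace (rextend colv ` csub J')" for J'
		by (rule subspace_image[OF rlinear_rextend subspace_csub])
	have keyscol: "keys (colv t) \<subseteq> I" for t
		by (auto simp: in_keys_iff lcol split: if_splits)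
	have inI: "rextend colv ` csub J' \<subseteq> csub I" for J'
	proof (clarify)
		fix x
		have "keys (rextend colv x) \<subseteq> I" using keys_rextend[of colv x] keyscol by blast
		then show "rextend colv x : csub I" by (simp add: csub_def)
	qed
	define X where "X J' = {x\<in>csub I. ALL b:rextend colv ` csub J'. ip x b = 0}" for J'
	have dX: "rv.dim (X J') + rv.dim (rextend colv ` csub J') = rv.dim (csub I)" for J'
		unfolding X_def by (rule dim_annihilator[OF I(1) sub inI])
	have subX: "rv.subspace (X J')" for J'
		using fin_sub_subspace[OF fin_sub_csub[OF I(1)]]
		by (auto simp: X_def rv.subspace_def rvr.linear_add[OF rfunctional_ip_left]
				rvr.linear_scale[OF rfunctional_ip_left] rvr.linear_0[OF rfunctional_ip_left])
	have finX: "fin_sub (X L)"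
		by (rule fin_sub_subset[OF fin_sub_csub[OF I(1)] subX]) (auto simp: X_def)
	have ker: "{x\<in>X L. rextend rowv x = 0} = X J"
	proof -
		have "rextend rowv x = 0 \<longleftrightarrow> (ALL t:J. ip x (colv t) = 0)" if "x : csub I" for x
			using rowv[OF that] by (auto simp: poly_mapping_eq_iff fun_eq_iff)
		then show ?thesis unfolding X_def using ann[OF I(3)] ann[of J] I(3) by auto
	qed
	have im: "rextend rowv ` X L = {w : rextend rowv ` csub I. keys w \<subseteq> J - L}"
	proof -
		have "(ALL t:L. ip x (colv t) = 0) \<longleftrightarrow> keys (rextend rowv x) \<subseteq> J - L" if "x : csub I" for x
			using rowv[OF that] I(3) by (auto simp: subset_iff in_keys_iff split: if_splits)
		then show ?thesis unfolding X_def using ann[OF I(3)] by auto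
	qed
	show ?thesis
		using rank_nullity[OF rlinear_rextend[of rowv] finX] dX[of L] dX[of J] ker im by simp
qed

text \<open>Homology groups are carriers of cosets, known only through a surjection \<open>g\<close>
  from a subspace of chains; all axioms are pulled back along \<open>g\<close>.\<close>

lemma vectorspace_of_surj:
	fixes V :: "(real, 'v) module" and g :: "('s \<Rightarrow>\<^sub>0 real) => 'v"
	assumes W: "rv.subspace W" and c: "carrier V = g ` W"
		and add: "!!a b. a : W ==> b : W ==> g (a + b) = g a \<oplus>\<^bsub>V\<^esub> g b"
		and smult: "!!r a. a : W ==> g (rscale r a) = r \<odot>\<^bsub>V\<^esub> g a"
		and zero: "g 0 = \<zero>\<^bsub>V\<^esub>"
	shows "vectorspace (class_ring :: real ring) V"
proof -
	note cl = rv.subspace_add[OF W] rv.subspace_scale[OF W] rv.subspace_0[OF W]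
	have "abelian_group V"
	proof (rule abelian_groupI)
		fix x assume "x : carrier V"
		then obtain a where a: "a : W" "x = g a" using c by auto
		have m: "rscale (-1) a : W" by (rule cl(2)[OF a(1)])
		moreover have z: "rscale (-1) a + a = 0" by (rule poly_mapping_eqI) (simp add: lookup_add)
		have "g (rscale (-1) a) \<oplus>\<^bsub>V\<^esub> x = \<zero>\<^bsub>V\<^esub>"
			unfolding a(2) add[OF m a(1), symmetric] z by (rule zero)
		moreover have "g (rscale (-1) a) : carrier V" unfolding c using m by (rule imageI)
		ultimately show "EX y:carrier V. y \<oplus>\<^bsub>V\<^esub> x = \<zero>\<^bsub>V\<^esub>" by blast
		show "\<zero>\<^bsub>V\<^esub> \<oplus>\<^bsub>V\<^esub> x = x"
			using a zero add[of 0 a] cl by simp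
	next
		show "\<zero>\<^bsub>V\<^esub> : carrier V" using c zero cl by (metis imageI)
	qed (auto simp: c add[symmetric] cl ac_simps)
	then have "module class_ring V"
	proof (intro moduleI)
		show "cring (class_ring :: real ring)" using class_field[where 'a=real] by (simp add: field_def domain_def)
	qed (auto simp: c add[symmetric] smult[symmetric] cl rv.scale_left_distrib rv.scale_right_distrib)
	then show ?thesis
		unfolding vectorspace_def using class_field[where 'a=real] by blast
qed

text \<open>The dimension of \<open>V\<close> is the least size of a generating set. Images of a
  complement of the kernel generate, and lifts of any generators together with the kernel span
  \<open>W\<close>, so the count is settled without constructing a basis of
  \<open>V\<close>.\<close>

lemma rdim_of_surj:
	fixes V :: "(real, 'v) module" and g :: "('s \<Rightarrow>\<^sub>0 real) => 'v"
	assumes W: "fin_sub W" and c: "carrier V = g ` W"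
		and add: "!!a b. a : W ==> b : W ==> g (a + b) = g a \<oplus>\<^bsub>V\<^esub> g b"
		and smult: "!!r a. a : W ==> g (rscale r a) = r \<odot>\<^bsub>V\<^esub> g a"
		and zero: "g 0 = \<zero>\<^bsub>V\<^esub>"
	shows "rdim V + rv.dim {w\<in>W. g w = \<zero>\<^bsub>V\<^esub>} = rv.dim W"
proof -
	note sW = fin_sub_subspace[OF W]
	note cl = rv.subspace_add[OF sW] rv.subspace_scale[OF sW] rv.subspace_0[OF sW]
	interpret V: vectorspace "class_ring :: real ring" V
		by (rule vectorspace_of_surj[OF sW c add smult zero])
	let ?U = "{w\<in>W. g w = \<zero>\<^bsub>V\<^esub>}"
	have U: "rv.subspace ?U" "?U \<subseteq> W"
	proof -
		have "r \<odot>\<^bsub>V\<^esub> \<zero>\<^bsub>V\<^esub> = \<zero>\<^bsub>V\<^esub>" for r :: real using V.smult_r_null[of r] by simp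
		then show "rv.subspace ?U"
			unfolding rv.subspace_def using cl zero by (auto simp: add smult)
	qed auto
	\<comment> \<open>\<open>Q n\<close> is the predicate minimised in the definition of the
	  dimension.\<close>
	define Q where "Q n = (EX A. finite A & card A = n & A \<subseteq> carrier V & V.gen_set A)" for n
	obtain A where A: "finite A" "A \<subseteq> W" "rv.span (A Un ?U) = W" "card A + rv.dim ?U = rv.dim W"
		using dim_complement_exists[OF W U] by blast
	have low: "rv.dim W <= n + rv.dim ?U" if Qn: "Q n" for n
	proof -
		obtain D where D: "finite D" "card D = n" "D \<subseteq> g ` W" "V.gen_set D"
			using Qn unfolding Q_def c by blast
		obtain D' where D': "D' \<subseteq> W" "inj_on g D'" "g ` D' = D"
			using D(3) by (auto simp: subset_image_inj)
		have spD: "rv.span D' \<subseteq> W" using rv.span_minimal[OF D'(1) sW] .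
		have "LinearCombinations.submodule class_ring (g ` rv.span D') V"
		proof (unfold_locales)
			show "g ` rv.span D' \<subseteq> carrier V" using spD c by auto
			show "\<zero>\<^bsub>V\<^esub> : g ` rv.span D'" using zero rv.span_zero by (metis imageI)
		qed (use spD in \<open>auto simp: add[symmetric] smult[symmetric] subset_iff intro!: imageI rv.span_add rv.span_scale\<close>)
		then have "V.span D \<subseteq> g ` rv.span D'"
			by (intro V.span_is_subset) (use D'(3) rv.span_superset in auto)
		then have sur: "g ` W \<subseteq> g ` rv.span D'" using D(4) c by simp
		have "W \<subseteq> rv.span (D' Un ?U)"
		proof
			fix w assume w: "w : W"
			then obtain a where a: "a : rv.span D'" "g w = g a" using sur by auto
			have aW: "a : W" using a spD by auto
			have "w - a : W" using rv.subspace_diff[OF sW w aW] .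
			moreover have "g (w - a) = \<zero>\<^bsub>V\<^esub>"
			proof -
				have "g (w - a) \<oplus>\<^bsub>V\<^esub> g a = g w" using add[OF \<open>w - a : W\<close> aW] by simp
				then show ?thesis
					using a(2) V.M.add.r_cancel_one'[of "g a" "g (w - a)"] c aW \<open>w - a : W\<close> by force
			qed
			ultimately have "w - a : rv.span (D' Un ?U)" by (intro rv.span_base) blast
			moreover have "a : rv.span (D' Un ?U)" using a rv.span_mono[of D' "D' Un ?U"] by blast
			ultimately have "(w - a) + a : rv.span (D' Un ?U)" by (rule rv.span_add)
			then show "w : rv.span (D' Un ?U)" by simp
		qed
		moreover have "finite D'" "card D' = n"
			using finite_image_iff[OF D'(2)] card_image[OF D'(2)] D'(3) D(1,2) by simp_all
		ultimately show ?thesis using dim_le_complement[OF W U \<open>finite D'\<close>] by simp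
	qed
	have gen: "V.gen_set (g ` A)"
	proof
		have gA: "g ` A \<subseteq> carrier V" using A c by auto
		show "V.span (g ` A) \<subseteq> carrier V" by (rule V.span_is_subset2[OF gA])
		have sm: "LinearCombinations.submodule class_ring (V.span (g ` A)) V" by (rule V.span_is_submodule[OF gA])
		let ?N = "{w\<in>W. g w : V.span (g ` A)}"
		have sN: "rv.subspace ?N"
			using LinearCombinations.submodule.m_closed[OF sm] LinearCombinations.submodule.zero_closed[OF sm]
				LinearCombinations.submodule.smult_closed[OF sm]
			unfolding rv.subspace_def by (auto simp: cl zero add smult)
		moreover have AU: "A Un ?U \<subseteq> ?N"
			using A V.in_own_span[OF gA] LinearCombinations.submodule.zero_closed[OF sm] by auto
		ultimately have "W \<subseteq> ?N" using rv.span_minimal[OF AU sN] unfolding A(3) by simp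
		then show "carrier V \<subseteq> V.span (g ` A)" using c by auto
	qed
	have "Q (card (g ` A))" unfolding Q_def using gen A c by blast
	then have le: "(LEAST n. Q n) <= card (g ` A)" and Q: "Q (LEAST n. Q n)"
		by (auto intro: Least_le LeastI)
	have dim: "rdim V = (LEAST n. Q n)" unfolding V.dim_def Q_def by simp
	show ?thesis
		using le low[OF Q] A(4) card_image_le[OF A(1), of g] unfolding dim by simp
qed

section \<open>Real chains as combinations of integer chains\<close>

text \<open>A real identity among integral multiples of such a set splits into integral identities,
  one for each member.\<close>

definition zindep :: "real set => bool"
	where "zindep I \<longleftrightarrow> finite I & (\<forall>k::real => int. (\<Sum>i\<in>I. of_int (k i) * i) = 0 --> (ALL i:I. k i = 0))"

lemma zindepD:
	assumes "zindep I" "(\<Sum>i\<in>I. of_int (k i) * i) = 0" "i : I"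
	shows "(k i :: int) = 0"
	using assms unfolding zindep_def by blast

text \<open>The subgroup of the reals generated by \<open>V\<close> is free of finite rank. A new
  \<open>x\<close> with a nonzero multiple \<open>N * x\<close> in the span is accommodated by
  dividing the whole basis by \<open>N\<close>; otherwise \<open>x\<close> joins the basis.\<close>

lemma zindep_spanning:
	assumes "finite V"
	shows "EX I. zindep I & (ALL v:V. \<exists>k::real => int. v = (\<Sum>i\<in>I. of_int (k i) * i))"
	using assms
proof induction
	case empty
	show ?case by (rule exI[of _ "{}"]) (auto simp: zindep_def)
next
	case (insert x V)
	then obtain I where I: "zindep I" "!!v. v : V ==> \<exists>k::real => int. v = (\<Sum>i\<in>I. of_int (k i) * i)"
		by blast
	have fI: "finite I" using I(1) by (simp add: zindep_def)
	show ?case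
	proof (cases "\<exists>N::int. N ~= 0 & (\<exists>k::real => int. of_int N * x = (\<Sum>i\<in>I. of_int (k i) * i))")
		case True
		then obtain N :: int and k :: "real => int" where N: "N ~= 0" "of_int N * x = (\<Sum>i\<in>I. of_int (k i) * i)"
			by blast
		let ?d = "%i::real. i / of_int N" and ?J = "(%i::real. i / of_int N) ` I"
		have inj: "inj_on ?d I" using N(1) by (auto simp: inj_on_def)
		have sum: "(\<Sum>j\<in>?J. of_int (l j) * j) = (\<Sum>i\<in>I. of_int (l (?d i)) * i) / of_int N" for l :: "real => int"
			by (subst sum.reindex[OF inj]) (simp add: sum_divide_distrib)
		have "zindep ?J"
			unfolding zindep_def
		proof (intro conjI allI impI)
			show "finite ?J" using fI by simp
			fix l :: "real => int" assume "(\<Sum>j\<in>?J. of_int (l j) * j) = 0"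
			then have 0: "(\<Sum>i\<in>I. of_int (l (?d i)) * i) = 0" using N(1) by (simp add: sum)
			have "ALL i:I. l (?d i) = 0" by (intro ballI zindepD[OF I(1) 0])
			then show "ALL j:?J. l j = 0" by auto
		qed
		moreover have "\<exists>l::real => int. v = (\<Sum>j\<in>?J. of_int (l j) * j)" if v: "v : insert x V" for v
		proof -
			have "\<exists>l::real => int. of_int N * v = (\<Sum>i\<in>I. of_int (l i) * i)"
			proof (cases "v = x")
				case False
				then obtain l where "v = (\<Sum>i\<in>I. of_int (l i) * i)" using v I(2) by blast
				then have "of_int N * v = (\<Sum>i\<in>I. of_int (N * l i) * i)" by (simp add: sum_distrib_left mult.assoc)
				then show ?thesis by (intro exI[of _ "%i. N * l i"])
			qed (use N in blast)
			then obtain l :: "real => int" where l: "of_int N * v = (\<Sum>i\<in>I. of_int (l i) * i)" by blast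
			have ev: "(\<Sum>j\<in>?J. of_int (l (j * of_int N)) * j) = v"
				using l N(1) by (subst sum) (simp add: field_simps)
			show ?thesis by (rule exI[where x = "%j. l (j * of_int N)"]) (rule ev[symmetric])
		qed
		ultimately show ?thesis by (intro exI[of _ ?J] conjI ballI)
	next
		case False
		have xI: "x \<notin> I"
		proof
			assume "x : I"
			then have "of_int 1 * x = (\<Sum>i\<in>I. of_int (if i = x then 1 else 0) * i)"
				using fI by (simp add: if_distrib[of of_int] if_distrib[of "%z. z * _"] cong: if_cong)
			then have "\<exists>N::int. N ~= 0 & (\<exists>k::real => int. of_int N * x = (\<Sum>i\<in>I. of_int (k i) * i))"
				by (intro exI[of _ 1] conjI exI[of _ "%i. if i = x then 1 else 0"]) simp_all
			then show False using False by contradiction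
		qed
		have "zindep (insert x I)"
			unfolding zindep_def
		proof (intro conjI allI impI)
			show "finite (insert x I)" using fI by simp
			fix l :: "real => int" assume l: "(\<Sum>i\<in>insert x I. of_int (l i) * i) = 0"
			then have eq: "of_int (l x) * x = (\<Sum>i\<in>I. of_int (- l i) * i)"
				using xI fI by (simp add: sum_negf)
			have "l x = 0"
			proof (rule ccontr)
				assume "l x ~= 0"
				then have "\<exists>N::int. N ~= 0 & (\<exists>k::real => int. of_int N * x = (\<Sum>i\<in>I. of_int (k i) * i))"
					by (intro exI[of _ "l x"] conjI exI[of _ "%i. - l i"] eq)
				then show False using False by contradiction
			qed
			then have "(\<Sum>i\<in>I. of_int (l i) * i) = 0" using l xI fI by simp
			then have "ALL i:I. l i = 0" using I(1) by (simp add: zindep_def)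
			with \<open>l x = 0\<close> show "ALL i:insert x I. l i = 0" by auto
		qed
		moreover have "\<exists>l::real => int. v = (\<Sum>j\<in>insert x I. of_int (l j) * j)" if v: "v : insert x V" for v
		proof (cases "v = x")
			case True
			have ev: "x = (\<Sum>j\<in>insert x I. of_int (if j = x then 1 else 0) * j)"
				using fI by (simp add: if_distrib[of of_int] if_distrib[of "%z. z * _"] cong: if_cong)
			show ?thesis unfolding True by (rule exI[where x = "%j. if j = x then 1 else 0"]) (rule ev)
		next
			case False
			then obtain l :: "real => int" where l: "v = (\<Sum>i\<in>I. of_int (l i) * i)" using v I(2) by blast
			have "(\<Sum>j\<in>insert x I. of_int (if j = x then 0 else l j) * j) = (\<Sum>j\<in>I. of_int (if j = x then 0 else l j) * j)"
				using xI fI by simp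
			also have "\<dots> = v" unfolding l by (rule sum.cong) (use xI in auto)
			finally have ev: "(\<Sum>j\<in>insert x I. of_int (if j = x then 0 else l j) * j) = v" .
			show ?thesis by (rule exI[where x = "%j. if j = x then 0 else l j"]) (rule ev[symmetric])
		qed
		ultimately show ?thesis by (intro exI[of _ "insert x I"] conjI ballI)
	qed
qed

lemma zindep_decompose:
	fixes c :: "'s => real"
	assumes "finite {s. c s ~= 0}"
	obtains I and k :: "real => 's => int" where "zindep I" "!!i s. c s = 0 ==> k i s = 0"
		"!!s. c s = (\<Sum>i\<in>I. of_int (k i s) * i)"
proof -
	have "finite (c ` {s. c s ~= 0})" using assms by simp
	from zindep_spanning[OF this] obtain I where I: "zindep I"
		"!!s. c s ~= 0 ==> \<exists>k::real => int. c s = (\<Sum>i\<in>I. of_int (k i) * i)" by blast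
	have "\<exists>k::real => int. c s = (\<Sum>i\<in>I. of_int (k i) * i) & (c s = 0 --> k = (%_. 0))" for s
	proof (cases "c s = 0")
		case True
		then show ?thesis by (intro exI[where x = "%_. 0"]) simp
	qed (use I(2)[of s] in simp)
	then obtain k :: "'s => real => int" where
		k: "!!s. c s = (\<Sum>i\<in>I. of_int (k s i) * i) & (c s = 0 --> k s = (%_. 0))" by metis
	show thesis
	proof (rule that[OF I(1)])
		show "k s i = 0" if "c s = 0" for i s using conjunct2[OF k[of s]] that by simp
		show "c s = (\<Sum>i\<in>I. of_int (k s i) * i)" for s by (rule conjunct1[OF k])
	qed
qed

text \<open>Extension of scalars from the integers to the reals, the operation that produces the
  chain \<open>\<mu>\<close> in \<open>intersection_number\<close>.\<close>

definition ri :: "('s \<Rightarrow>\<^sub>0 int) => ('s \<Rightarrow>\<^sub>0 real)"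
	where "ri z = Poly_Mapping.map real_of_int z"

lemma lookup_ri [simp]: "lookup (ri z) s = real_of_int (lookup z s)"
	unfolding ri_def by (simp add: Poly_Mapping.map.rep_eq when_def)

lemma keys_ri [simp]: "keys (ri z) = keys z"
	by (auto simp: in_keys_iff)

lemma ri_simps: "ri (a + b) = ri a + ri b" "ri (a - b) = ri a - ri b" "ri 0 = 0"
	"ri (frag_cmul k a) = rscale (real_of_int k) (ri a)" "ri (frag_of s) = single s 1"
	by (auto intro!: poly_mapping_eqI simp: lookup_add lookup_minus lookup_single when_def)

lemma ri_sum: "ri (sum f A) = (\<Sum>a\<in>A. ri (f a))"
	by (induction A rule: infinite_finite_induct) (auto simp: ri_simps)

lemma ri_frag_extend: "ri (frag_extend g z) = rextend (%s. ri (g s)) (ri z)"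
	by (simp add: frag_extend_def rextend_def ri_sum ri_simps)

lemma rscale_single: "rscale r (single s q) = single s (r * q)"
	by (rule poly_mapping_eqI) (simp add: lookup_single when_def)

lemma rboundary_ri: "rboundary (int p) (ri z) = ri (chain_boundary p z)"
	by (simp add: rboundary_def chain_boundary_def ri_simps ri_frag_extend ri_sum rscale_single)

lemma rlinear_rboundary: "rlinear (rboundary p)"
	by (rule rlinearI) (auto simp: rboundary_def rextend_add rextend_scale)

lemmas rboundary_add = rvp.linear_add[OF rlinear_rboundary]
lemmas rboundary_scale = rvp.linear_scale[OF rlinear_rboundary]
lemmas rboundary_sum = rvp.linear_sum[OF rlinear_rboundary]
lemmas rboundary_0 [simp] = rvp.linear_0[OF rlinear_rboundary]

text \<open>The bridge from integral to real chains. The parts use only simplices of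
  \<open>c\<close>, so they stay in whichever subspace carries \<open>c\<close>.\<close>

lemma rchain_decompose:
	fixes c :: "'s \<Rightarrow>\<^sub>0 real"
	obtains I and z :: "real => 's \<Rightarrow>\<^sub>0 int" where "zindep I" "!!i. keys (z i) \<subseteq> keys c"
		"c = (\<Sum>i\<in>I. rscale i (ri (z i)))"
proof -
	have fin: "finite {s. lookup c s ~= 0}" by simp
	show thesis
	proof (rule zindep_decompose[OF fin])
		fix I and k :: "real => 's => int"
		assume k: "zindep I" "!!i s. lookup c s = 0 ==> k i s = 0"
			"!!s. lookup c s = (\<Sum>i\<in>I. of_int (k i s) * i)"
		have "finite {s. k i s ~= 0}" for i
			by (rule finite_subset[OF _ fin]) (use k(2) in auto)
		then have lk: "lookup (Abs_poly_mapping (k i)) = k i" for i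
			by (simp add: Abs_poly_mapping_inverse)
		show thesis
		proof (rule that[of I "%i. Abs_poly_mapping (k i)"])
			show "keys (Abs_poly_mapping (k i)) \<subseteq> keys c" for i
				using k(2) by (auto simp: in_keys_iff lk)
			show "c = (\<Sum>i\<in>I. rscale i (ri (Abs_poly_mapping (k i))))"
			proof (rule poly_mapping_eqI)
				fix t
				show "lookup c t = lookup (\<Sum>i\<in>I. rscale i (ri (Abs_poly_mapping (k i)))) t"
					unfolding k(3)[of t] by (simp add: lookup_sum lk mult.commute)
			qed
		qed (rule k(1))
	qed
qed

text \<open>Coefficients over an independent set cannot cancel. Applied to the boundaries of the
  parts, it shows that each part inherits every support condition on the boundary of the whole
  chain.\<close>

lemma zindep_keys:
	assumes "zindep I" "i : I"
	shows "keys (z i) \<subseteq> keys (\<Sum>i\<in>I. rscale i (ri (z i)))"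
proof
	fix s assume s: "s : keys (z i)"
	show "s : keys (\<Sum>i\<in>I. rscale i (ri (z i)))"
	proof (rule ccontr)
		assume "~ ?thesis"
		then have "(\<Sum>i\<in>I. of_int (lookup (z i) s) * i) = 0"
			by (simp add: in_keys_iff lookup_sum mult.commute)
		from zindepD[OF assms(1) this assms(2)] s show False by (simp add: in_keys_iff)
	qed
qed

section \<open>Flag complexes\<close>

text \<open>Chains of flags as coefficient functions, graded by the number \<open>k\<close> of
  vertices, hence of dimension \<open>k - 1\<close>. The empty flag is allowed, so the complex is
  augmented; later identities are therefore restricted to nonempty flags.\<close>

definition Fn :: "nat => 'v set set => ('v set => real) set"
	where "Fn k Q = {x. ALL F. x F ~= 0 --> F : Q & card F = k}"

lemma FnD: "x : Fn k Q ==> x F ~= 0 ==> F : Q" "x : Fn k Q ==> x F ~= 0 ==> card F = k"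
	by (auto simp: Fn_def)

lemma FnI: "(!!F. x F ~= 0 ==> F : Q & card F = k) ==> x : Fn k Q"
	by (auto simp: Fn_def)

definition pos :: "('v => nat) => 'v => 'v set => nat"
	where "pos rk v G = card {u\<in>G. rk u < rk v}"

text \<open>The simplicial boundary in coefficient form: \<open>G\<close> collects contributions
  from all flags with one more vertex, signed by the position of that vertex in the order given by
  \<open>rk\<close>.\<close>

definition bd :: "'v set => ('v => nat) => ('v set => real) => 'v set => real"
	where "bd P rk x G = (\<Sum>v\<in>P - G. (-1) ^ pos rk v G * x (insert v G))"

text \<open>The vertices are the members of a finite graded poset and \<open>\<Delta>\<close> is its order complex; the
	order only enters through \<open>rk\<close> and the last assumption, which makes all notions symmetric under
	\<open>rk \<mapsto> m - rk\<close>.\<close>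

locale flag_complex =
	fixes P :: "'v set" and \<Delta> :: "'v set set" and rk :: "'v => nat" and m :: nat
	assumes finP: "finite P" and subP: "F : \<Delta> ==> F \<subseteq> P"
		and down: "F : \<Delta> ==> G \<subseteq> F ==> G : \<Delta>"
		and empty: "{} : \<Delta>" and vert: "v : P ==> {v} : \<Delta>"
		and inj: "F : \<Delta> ==> inj_on rk F" and rkm: "v : P ==> rk v <= m"
		and join: "[|insert s f : \<Delta>; insert s g : \<Delta>; !!v. v : f ==> rk v < rk s; !!v. v : g ==> rk s < rk v|]
			 ==> f Un insert s g : \<Delta>"
begin

abbreviation bnd ("\<partial>") where "\<partial> \<equiv> bd P rk"

lemma fin: "F : \<Delta> ==> finite F"
	using subP finP finite_subset by blast

lemma finD: "finite \<Delta>"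
	by (rule finite_subset[of _ "Pow P"]) (use subP finP in auto)

text \<open>\<open>LF s\<close> and \<open>UF s\<close> are the lower and the upper link of
  \<open>s\<close>; the link of \<open>s\<close> is their join.\<close>

definition LF where "LF s = {f. insert s f : \<Delta> & (ALL v:f. rk v < rk s)}"
definition UF where "UF s = {g. insert s g : \<Delta> & (ALL v:g. rk s < rk v)}"

lemma join': "f : LF s ==> g : UF s ==> f Un insert s g : \<Delta>"
	using join[of s f g] unfolding LF_def UF_def by blast

lemma LF_down: "f : LF s ==> f' \<subseteq> f ==> f' : LF s"
	unfolding LF_def using down[of "insert s f" "insert s f'"] by auto

lemma LF_fin: "f : LF s ==> finite f" and UF_fin: "g : UF s ==> finite g"
	unfolding LF_def UF_def using fin[of "insert s f"] fin[of "insert s g"] by auto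

lemma LF_card: assumes "f : LF s" shows "card f <= rk s"
proof -
	have "inj_on rk f" using assms inj[of "insert s f"] inj_on_subset unfolding LF_def by blast
	then have "card f = card (rk ` f)" by (simp add: card_image)
	also have "\<dots> <= card {..<rk s}" by (rule card_mono) (use assms in \<open>auto simp: LF_def\<close>)
	finally show ?thesis by simp
qed

lemma UF_card: assumes "g : UF s" shows "card g <= m - rk s"
proof -
	have "inj_on rk g" using assms inj[of "insert s g"] inj_on_subset unfolding UF_def by blast
	then have "card g = card (rk ` g)" by (simp add: card_image)
	also have "\<dots> <= card {rk s<..m}"
	proof (rule card_mono)
		show "rk ` g \<subseteq> {rk s<..m}" using assms rkm subP[of "insert s g"] by (auto simp: UF_def)
	qed simp
	finally show ?thesis by simp
qed

lemma LU_disj: "f : LF s ==> g : UF s ==> f \<inter> g = {} & s \<notin> f & s \<notin> g"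
	unfolding LF_def UF_def by force

lemma LU_card: "f : LF s ==> g : UF s ==> card (f Un insert s g) = Suc (card f + card g)"
proof -
	assume a: "f : LF s" "g : UF s"
	have "card (f Un insert s g) = card f + card (insert s g)"
		by (rule card_Un_disjoint) (use a LU_disj[OF a] LF_fin UF_fin in auto)
	then show ?thesis using LU_disj[OF a] UF_fin[OF a(2)] by simp
qed

abbreviation below where "below s F \<equiv> {v\<in>F. rk v < rk s}"
abbreviation above where "above s F \<equiv> {v\<in>F. rk s < rk v}"

lemma split_flag:
	assumes "F : \<Delta>" "s : F"
	shows "below s F : LF s" "above s F : UF s" "below s F Un insert s (above s F) = F"
proof -
	have "insert s (below s F) \<subseteq> F" "insert s (above s F) \<subseteq> F" using assms by auto
	then show "below s F : LF s" "above s F : UF s"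
		unfolding LF_def UF_def using down[OF assms(1)] by auto
	have "v = s \<or> rk v < rk s \<or> rk s < rk v" if "v : F" for v
		using inj_onD[OF inj[OF assms(1)], of v s] that assms(2) by (metis nat_neq_iff)
	then show "below s F Un insert s (above s F) = F" using assms(2) by blast
qed

lemma below_LU: "f : LF s ==> g : UF s ==> below s (f Un insert s g) = f"
	and above_LU: "f : LF s ==> g : UF s ==> above s (f Un insert s g) = g"
	unfolding LF_def UF_def by force+

lemma flag_LF: "f Un insert s g : \<Delta> ==> ALL v:f. rk v < rk s ==> f : LF s"
	unfolding LF_def using down[of "f Un insert s g" "insert s f"] by auto

lemma flag_UF: "f Un insert s g : \<Delta> ==> ALL v:g. rk s < rk v ==> g : UF s"
	unfolding UF_def using down[of "f Un insert s g" "insert s g"] by auto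

text \<open>Leibniz rule for the join. A vertex inserted above \<open>s\<close> is preceded by all
  of \<open>f\<close> and by \<open>s\<close>, which explains the exponent
  \<open>Suc (card f)\<close>; a vertex of the same rank as \<open>s\<close> cannot be inserted into
  a flag through \<open>s\<close>.\<close>

lemma bd_split:
	assumes x: "x : Fn k \<Delta>" and f: "f : LF s" and g: "g : UF s"
	shows "\<partial> x (f Un insert s g) =
		 (\<Sum>v\<in>{v\<in>P - f. rk v < rk s}. (-1) ^ pos rk v f * x (insert v f Un insert s g)) +
		 (-1) ^ Suc (card f) * (\<Sum>v\<in>{v\<in>P - g. rk s < rk v}. (-1) ^ pos rk v g * x (f Un insert s (insert v g)))"
proof -
	let ?G = "f Un insert s g"
	let ?t = "%v. (-1) ^ pos rk v ?G * x (insert v ?G)"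
	let ?A = "{v\<in>P - f. rk v < rk s}" and ?B = "{v\<in>P - g. rk s < rk v}"
	have fl: "!!v. v : f ==> rk v < rk s" and gl: "!!v. v : g ==> rk s < rk v"
		using f g by (auto simp: LF_def UF_def)
	have AB: "?A Un ?B \<subseteq> P - ?G" "?A \<inter> ?B = {}" using fl gl by force+
	have "?t v = 0" if "v : P - ?G - (?A Un ?B)" for v
	proof -
		have "rk v = rk s" "v ~= s" using that by auto
		then have "~ inj_on rk (insert v ?G)" by (auto simp: inj_on_def)
		then have "insert v ?G \<notin> \<Delta>" using inj by blast
		then show ?thesis using FnD(1)[OF x] by fastforce
	qed
	then have "\<partial> x ?G = (\<Sum>v\<in>?A Un ?B. ?t v)"
		unfolding bd_def using AB(1) finP by (intro sum.mono_neutral_right) auto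
	also have "\<dots> = (\<Sum>v\<in>?A. ?t v) + (\<Sum>v\<in>?B. ?t v)"
		by (rule sum.union_disjoint) (use AB(2) finP in auto)
	also have "(\<Sum>v\<in>?A. ?t v) = (\<Sum>v\<in>?A. (-1) ^ pos rk v f * x (insert v f Un insert s g))"
	proof (rule sum.cong[OF refl])
		fix v assume v: "v : ?A"
		have "{u\<in>?G. rk u < rk v} = {u\<in>f. rk u < rk v}" using v gl by force
		moreover have "insert v ?G = insert v f Un insert s g" by auto
		ultimately show "?t v = (-1) ^ pos rk v f * x (insert v f Un insert s g)" by (simp only: pos_def)
	qed
	also have "(\<Sum>v\<in>?B. ?t v) = (\<Sum>v\<in>?B. (-1) ^ Suc (card f) * ((-1) ^ pos rk v g * x (f Un insert s (insert v g))))"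
	proof (rule sum.cong[OF refl])
		fix v assume v: "v : ?B"
		have "{u\<in>?G. rk u < rk v} = insert s f Un {u\<in>g. rk u < rk v}" using v fl by force
		moreover have "card (insert s f Un {u\<in>g. rk u < rk v}) = card (insert s f) + card {u\<in>g. rk u < rk v}"
			by (rule card_Un_disjoint) (use LF_fin[OF f] UF_fin[OF g] LU_disj[OF f g] in auto)
		moreover have "card (insert s f) = Suc (card f)" using LF_fin[OF f] LU_disj[OF f g] by simp
		ultimately have p: "pos rk v ?G = Suc (card f) + pos rk v g" by (simp only: pos_def)
		moreover have "insert v ?G = f Un insert s (insert v g)" by auto
		ultimately show "?t v = (-1) ^ Suc (card f) * ((-1) ^ pos rk v g * x (f Un insert s (insert v g)))"
			by (simp add: power_add)
	qed
	finally show ?thesis by (simp only: sum_distrib_left)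
qed

text \<open>An upper half with \<open>m - rk s\<close> vertices already uses every rank above
  \<open>s\<close>.\<close>

lemma no_above:
	assumes "x : Fn k \<Delta>" "g : UF s" "f : LF s" "card g = m - rk s" "v : P - g" "rk s < rk v"
	shows "x (f Un insert s (insert v g)) = 0"
proof (rule ccontr)
	assume "~ ?thesis"
	then have "f Un insert s (insert v g) : \<Delta>" using FnD[OF assms(1)] by blast
	then have "insert v g : UF s"
		by (rule flag_UF) (use assms in \<open>auto simp: UF_def\<close>)
	from UF_card[OF this] show False using assms UF_fin[OF assms(2)] by simp
qed

lemma no_below:
	assumes "x : Fn k \<Delta>" "g : UF s" "f : LF s" "card f = rk s" "v : P - f" "rk v < rk s"
	shows "x (insert v f Un insert s g) = 0"
proof (rule ccontr)
	assume "~ ?thesis"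
	then have "insert v f Un insert s g : \<Delta>" using FnD[OF assms(1)] by blast
	then have "insert v f : LF s"
		by (rule flag_LF) (use assms in \<open>auto simp: LF_def\<close>)
	from LF_card[OF this] show False using assms LF_fin[OF assms(3)] by simp
qed

lemma bd_add: "\<partial> (%F. x F + y F) G = \<partial> x G + \<partial> y G"
	by (simp add: bd_def distrib_left sum.distrib)

lemma bd_diff: "\<partial> (%F. x F - y F) G = \<partial> x G - \<partial> y G"
	by (simp add: bd_def right_diff_distrib sum_subtractf)

lemma bd_scale: "\<partial> (%F. r * x F) G = r * \<partial> x G"
	by (simp add: bd_def sum_distrib_left mult.left_commute)

lemma bd_Fn: assumes "x : Fn (Suc k) Q" "!!F G. F : Q ==> G \<subseteq> F ==> G : Q" "!!F. F : Q ==> finite F"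
	shows "\<partial> x : Fn k Q"
proof (rule FnI)
	fix G assume "\<partial> x G ~= 0"
	then obtain v where "v : P - G" "(-1) ^ pos rk v G * x (insert v G) ~= 0"
		unfolding bd_def by (rule sum.not_neutral_contains_not_neutral)
	then have v: "v \<notin> G" "x (insert v G) ~= 0" by auto
	then have vG: "insert v G : Q" "card (insert v G) = Suc k" using FnD[OF assms(1)] by auto
	have GQ: "G : Q" using assms(2)[OF vG(1), of G] by blast
	show "G : Q & card G = k" using GQ vG(2) card_insert_disjoint[OF assms(3)[OF GQ] v(1)] by simp
qed

text \<open>The two orders of inserting \<open>v\<close> and \<open>w\<close> carry opposite signs,
  because the one of lower rank shifts the position of the other by one.\<close>

lemma bd_bd:
	assumes x: "x : Fn k \<Delta>"
	shows "\<partial> (\<partial> x) G = 0"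
proof -
	define a where "a v w = (if v : P - G & w : P - G & v ~= w
			then (-1) ^ pos rk v G * ((-1) ^ pos rk w (insert v G) * x (insert w (insert v G))) else 0)" for v w
	have "\<partial> (\<partial> x) G = (\<Sum>v\<in>P-G. \<Sum>w\<in>P - insert v G. a v w)"
		unfolding bd_def[of P rk "\<partial> x"] bd_def[of P rk x] sum_distrib_left
		by (intro sum.cong refl) (auto simp: a_def)
	also have "\<dots> = (\<Sum>v\<in>P-G. \<Sum>w\<in>P-G. a v w)"
		by (intro sum.cong refl sum.mono_neutral_left) (use finP in \<open>auto simp: a_def\<close>)
	finally have eq: "\<partial> (\<partial> x) G = (\<Sum>v\<in>P-G. \<Sum>w\<in>P-G. a v w)" .
	have anti: "a w v = - a v w" for v w
	proof (cases "v : P - G & w : P - G & v ~= w & insert w (insert v G) : \<Delta>")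
		case True
		have fG: "finite G" using True fin[of "insert w (insert v G)"] by auto
		have ne: "rk v ~= rk w" using True inj[of "insert w (insert v G)"] by (auto simp: inj_on_def)
		have *: "pos rk b (insert a G) = Suc (pos rk b G)" "pos rk a (insert b G) = pos rk a G"
			if "rk a < rk b" "a \<notin> G" for a b
		proof -
			have "{u\<in>insert a G. rk u < rk b} = insert a {u\<in>G. rk u < rk b}" using that by auto
			then show "pos rk b (insert a G) = Suc (pos rk b G)" using fG that by (simp add: pos_def)
			have "{u\<in>insert b G. rk u < rk a} = {u\<in>G. rk u < rk a}" using that by auto
			then show "pos rk a (insert b G) = pos rk a G" by (simp add: pos_def)
		qed
		from ne consider "rk v < rk w" | "rk w < rk v" by linarith
		then show ?thesis
			by cases (use True * in \<open>auto simp: a_def insert_commute\<close>)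
	next
		case False
		have "x (insert w (insert v G)) = 0" if "insert w (insert v G) \<notin> \<Delta>"
			using FnD(1)[OF x] that by blast
		then show ?thesis using False by (auto simp: a_def insert_commute)
	qed
	have "(\<Sum>v\<in>P-G. \<Sum>w\<in>P-G. a v w) = (\<Sum>v\<in>P-G. \<Sum>w\<in>P-G. a w v)"
		by (rule sum.swap)
	also have "\<dots> = (\<Sum>v\<in>P-G. \<Sum>w\<in>P-G. - a v w)"
		by (intro sum.cong refl) (rule anti)
	also have "\<dots> = - (\<Sum>v\<in>P-G. \<Sum>w\<in>P-G. a v w)"
		by (simp only: sum_negf)
	finally show ?thesis using eq by simp
qed

text \<open>A chain on the lower link of \<open>s\<close> only involves vertices of smaller rank, so
  its boundary is the lower sum of the Leibniz rule.\<close>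

lemma bd_low:
	assumes y: "ALL f. y f ~= 0 --> f : LF s"
	shows "f : LF s ==> \<partial> y f = (\<Sum>v\<in>{v\<in>P - f. rk v < rk s}. (-1) ^ pos rk v f * y (insert v f))"
		and "f \<notin> LF s ==> \<partial> y f = 0"
proof -
	have "y (insert v f) = 0" if "~ rk v < rk s" for v
		using y that by (auto simp: LF_def)
	then show "\<partial> y f = (\<Sum>v\<in>{v\<in>P - f. rk v < rk s}. (-1) ^ pos rk v f * y (insert v f))"
		unfolding bd_def by (intro sum.mono_neutral_right) (use finP in auto)
	show "\<partial> y f = 0" if "f \<notin> LF s"
	proof -
		have "y (insert v f) = 0" for v
			using y LF_down[of "insert v f" s f] that by blast
		then show ?thesis by (simp add: bd_def)
	qed
qed

text \<open>Closure under smaller elements of the poset: comparability of \<open>v\<close> and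
  \<open>s\<close> is read off from \<open>{v,s}\<close> being a flag.\<close>

definition lower :: "'v set => bool"
	where "lower L \<longleftrightarrow> L \<subseteq> P & (ALL s:L. ALL v. rk v < rk s & {v,s} : \<Delta> --> v : L)"

definition flags :: "'v set => 'v set set"
	where "flags L = {F\<in>\<Delta>. F \<subseteq> L}"

end

text \<open>For every vertex \<open>s\<close>, the relative complex of flags through \<open>s\<close> has the homology of an
	\<open>m\<close>-ball modulo its boundary, generated by the restriction of the cycle \<open>z\<close>.\<close>

locale homology_manifold = flag_complex P \<Delta> rk m
	for P :: "'v set" and \<Delta> :: "'v set set" and rk :: "'v => nat" and m :: nat +
	fixes z :: "'v set => real"
	assumes zFn: "z : Fn (Suc m) \<Delta>" and zc: "G ~= {} ==> \<partial> z G = 0"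
		and znz: "s : P ==> EX F. s : F & z F ~= 0"
		and acyc: "[|s : P; c : Fn k \<Delta>; k ~= Suc m; !!G. s : G ==> \<partial> c G = 0|]
			 ==> EX b:Fn (Suc k) \<Delta>. ALL G. s : G --> c G = \<partial> b G"
		and gen: "[|s : P; c : Fn (Suc m) \<Delta>; !!G. s : G ==> \<partial> c G = 0|]
			 ==> EX r. ALL F. s : F --> c F = r * z F"
begin

text \<open>An arbitrary reference flag through \<open>s\<close> in the support of \<open>z\<close>;
  its halves \<open>f0 s\<close> and \<open>g0 s\<close> are the slices along which \<open>z\<close>
  is restricted.\<close>

definition top where "top s = (SOME F. s : F & z F ~= 0)"

lemma top: assumes "s : P" shows "s : top s" "z (top s) ~= 0" "top s : \<Delta>" "card (top s) = Suc m"
proof -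
	have "s : top s & z (top s) ~= 0" unfolding top_def using someI_ex[OF znz[OF assms]] .
	then show "s : top s" "z (top s) ~= 0" "top s : \<Delta>" "card (top s) = Suc m" using FnD[OF zFn] by auto
qed

abbreviation f0 where "f0 s \<equiv> below s (top s)"
abbreviation g0 where "g0 s \<equiv> above s (top s)"

text \<open>\<open>alpha s\<close> and \<open>beta s\<close> restrict \<open>z\<close> to the flags
  with upper half \<open>g0 s\<close>, respectively lower half \<open>f0 s\<close>, normalised to 1
  on the reference half. They turn out to generate the top homology of the lower and the upper
  link.\<close>

definition alpha where "alpha s f = z (f Un insert s (g0 s)) / z (top s)"
definition beta where "beta s g = z (f0 s Un insert s g) / z (top s)"

lemma f0g0: assumes "s : P"
	shows "f0 s : LF s" "g0 s : UF s" "f0 s Un insert s (g0 s) = top s" "card (f0 s) = rk s" "card (g0 s) = m - rk s"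
		"alpha s (f0 s) = 1" "beta s (g0 s) = 1"
proof -
	note t = top[OF assms]
	show 1: "f0 s : LF s" "g0 s : UF s" "f0 s Un insert s (g0 s) = top s" using split_flag[OF t(3,1)] .
	show "card (f0 s) = rk s" "card (g0 s) = m - rk s"
		using LU_card[OF 1(1,2)] 1(3) t(4) LF_card[OF 1(1)] UF_card[OF 1(2)] rkm[OF assms] by simp_all
	show "alpha s (f0 s) = 1" "beta s (g0 s) = 1" unfolding alpha_def beta_def 1(3) using t(2) by auto
qed

text \<open>A flag in the support of \<open>z\<close> meets every rank, so both of its halves have
  the largest possible size.\<close>

lemma full_card: assumes "f : LF s" "g : UF s" "z (f Un insert s g) ~= 0" "s : P"
	shows "card f = rk s" "card g = m - rk s"
	using LU_card[OF assms(1,2)] FnD(2)[OF zFn assms(3)] LF_card[OF assms(1)] UF_card[OF assms(2)] rkm[OF assms(4)]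
	by auto

lemma alpha_card: "s : P ==> f : LF s ==> alpha s f ~= 0 ==> card f = rk s"
	using full_card(1)[of f s "g0 s"] f0g0(2) by (auto simp: alpha_def)

text \<open>A cycle of the lower link times the upper slice of \<open>z\<close> is a relative cycle
  at \<open>s\<close>. In the Leibniz rule the lower terms give the boundary of \<open>y\<close>;
  the upper terms are a multiple of the boundary of \<open>z\<close> at \<open>f0 s\<close> joined
  with the upper half, where lower terms are absent because \<open>f0 s\<close> is full.\<close>

lemma product_cycle:
	assumes s: "s : P" and y: "ALL f. y f ~= 0 --> f : LF s & card f = j" and cyc: "ALL f. \<partial> y f = 0"
	defines "c \<equiv> %F. if F : \<Delta> & s : F then y (below s F) * beta s (above s F) else 0"
	shows "c : Fn (Suc (j + (m - rk s))) \<Delta>" "s : G ==> \<partial> c G = 0"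
		"f : LF s ==> g : UF s ==> c (f Un insert s g) = y f * beta s g"
proof -
	note t = f0g0[OF s]
	show c: "c (f Un insert s g) = y f * beta s g" if "f : LF s" "g : UF s" for f g
		using that join'[OF that] below_LU[OF that] above_LU[OF that] by (simp add: c_def)
	show cFn: "c : Fn (Suc (j + (m - rk s))) \<Delta>"
	proof (rule FnI)
		fix F assume F: "c F ~= 0"
		then have F': "F : \<Delta>" "s : F" by (auto simp: c_def split: if_splits)
		note sp = split_flag[OF F']
		have "y (below s F) ~= 0" "beta s (above s F) ~= 0" using F F' by (auto simp: c_def)
		then have "card (below s F) = j" "card (above s F) = m - rk s"
			using y full_card(2)[OF t(1) sp(2) _ s] by (auto simp: beta_def)
		then show "F : \<Delta> & card F = Suc (j + (m - rk s))" using LU_card[OF sp(1,2)] sp(3) F' by simp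
	qed
	show "\<partial> c G = 0" if sG: "s : G"
	proof (cases "G : \<Delta>")
		case False
		then have "c (insert v G) = 0" for v using down[of "insert v G" G] by (auto simp: c_def)
		then show ?thesis by (simp add: bd_def)
	next
		case True
		let ?f = "below s G" and ?g = "above s G"
		note sp = split_flag[OF True sG]
		have 1: "c (insert v ?f Un insert s ?g) = y (insert v ?f) * beta s ?g" if "rk v < rk s" for v
		proof (cases "insert v ?f : LF s")
			case True then show ?thesis using c[OF True sp(2)] by simp
		next
			case False
			then have "y (insert v ?f) = 0" using y by blast
			moreover have "insert v ?f Un insert s ?g \<notin> \<Delta>"
				using False flag_LF[of "insert v ?f" s ?g] that by blast
			ultimately show ?thesis by (simp add: c_def)
		qed
		have 2: "c (?f Un insert s (insert v ?g)) = y ?f * beta s (insert v ?g)" if "rk s < rk v" for v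
		proof (cases "insert v ?g : UF s")
			case True then show ?thesis using c[OF sp(1) True] by simp
		next
			case False
			have "f0 s Un insert s (insert v ?g) \<notin> \<Delta>"
				using False flag_UF[of "f0 s" s "insert v ?g"] that by blast
			then have "beta s (insert v ?g) = 0" using FnD(1)[OF zFn] by (auto simp: beta_def)
			moreover have "?f Un insert s (insert v ?g) \<notin> \<Delta>"
				using False flag_UF[of ?f s "insert v ?g"] that by blast
			ultimately show ?thesis by (simp add: c_def)
		qed
		have S1: "(\<Sum>v\<in>{v\<in>P - ?f. rk v < rk s}. (-1) ^ pos rk v ?f * c (insert v ?f Un insert s ?g)) = 0"
		proof -
			have "(\<Sum>v\<in>{v\<in>P - ?f. rk v < rk s}. (-1) ^ pos rk v ?f * c (insert v ?f Un insert s ?g))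
					= (\<Sum>v\<in>{v\<in>P - ?f. rk v < rk s}. (-1) ^ pos rk v ?f * y (insert v ?f)) * beta s ?g"
				unfolding sum_distrib_right by (intro sum.cong refl) (subst 1, auto)
			also have "(\<Sum>v\<in>{v\<in>P - ?f. rk v < rk s}. (-1) ^ pos rk v ?f * y (insert v ?f)) = \<partial> y ?f"
				by (rule bd_low(1)[OF _ sp(1), symmetric]) (use y in blast)
			finally show ?thesis using cyc by simp
		qed
		have S2: "(\<Sum>v\<in>{v\<in>P - ?g. rk s < rk v}. (-1) ^ pos rk v ?g * c (?f Un insert s (insert v ?g))) = 0"
		proof -
			have zero: "\<partial> z (f0 s Un insert s ?g) = 0" by (rule zc) simp
			have "(\<Sum>v\<in>{v\<in>P - f0 s. rk v < rk s}. (-1) ^ pos rk v (f0 s) * z (insert v (f0 s) Un insert s ?g)) = 0"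
				by (rule sum.neutral) (use no_below[OF zFn sp(2) t(1,4)] in auto)
			then have z0: "(\<Sum>v\<in>{v\<in>P - ?g. rk s < rk v}. (-1) ^ pos rk v ?g * z (f0 s Un insert s (insert v ?g))) = 0"
				using zero bd_split[OF zFn t(1) sp(2)] by simp
			have "(\<Sum>v\<in>{v\<in>P - ?g. rk s < rk v}. (-1) ^ pos rk v ?g * c (?f Un insert s (insert v ?g)))
				 = y ?f / z (top s) * (\<Sum>v\<in>{v\<in>P - ?g. rk s < rk v}. (-1) ^ pos rk v ?g * z (f0 s Un insert s (insert v ?g)))"
				unfolding sum_distrib_left by (intro sum.cong refl) (subst 2, auto simp: beta_def)
			then show ?thesis using z0 by simp
		qed
		show ?thesis using bd_split[OF cFn sp(1,2)] S1 S2 sp(3) by simp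
	qed
qed

text \<open>Fixing the full upper half \<open>g0 s\<close> commutes with the boundary, since nothing
  can be inserted above \<open>s\<close>. This is the passage back from relative chains at
  \<open>s\<close> to the lower link.\<close>

lemma bd_slice:
	assumes s: "s : P" and x: "x : Fn k \<Delta>"
	defines "w \<equiv> %f. if f : LF s then x (f Un insert s (g0 s)) else 0"
	shows "f : LF s ==> \<partial> w f = \<partial> x (f Un insert s (g0 s))"
		and "f \<notin> LF s ==> \<partial> w f = 0"
proof -
	note t = f0g0[OF s]
	have w: "ALL f. w f ~= 0 --> f : LF s" by (auto simp: w_def split: if_splits)
	show "f \<notin> LF s ==> \<partial> w f = 0" by (rule bd_low(2)[OF w])
	assume f: "f : LF s"
	have wx: "w (insert v f) = x (insert v f Un insert s (g0 s))" if "rk v < rk s" for v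
	proof (cases "insert v f : LF s")
		case False
		then have "insert v f Un insert s (g0 s) \<notin> \<Delta>"
			using flag_LF[of "insert v f" s "g0 s"] that f unfolding LF_def by blast
		then show ?thesis using False FnD(1)[OF x] by (auto simp: w_def)
	qed (simp add: w_def)
	have "(\<Sum>v\<in>{v\<in>P - g0 s. rk s < rk v}. (-1) ^ pos rk v (g0 s) * x (f Un insert s (insert v (g0 s)))) = 0"
		by (rule sum.neutral) (use no_above[OF x t(2) f t(5)] in auto)
	then have "\<partial> x (f Un insert s (g0 s)) = (\<Sum>v\<in>{v\<in>P - f. rk v < rk s}. (-1) ^ pos rk v f * x (insert v f Un insert s (g0 s)))"
		using bd_split[OF x f t(2)] by simp
	also have "\<dots> = (\<Sum>v\<in>{v\<in>P - f. rk v < rk s}. (-1) ^ pos rk v f * w (insert v f))"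
		by (intro sum.cong refl) (subst wx, auto)
	also have "\<dots> = \<partial> w f" by (rule bd_low(1)[OF w f, symmetric])
	finally show "\<partial> w f = \<partial> x (f Un insert s (g0 s))" by simp
qed

text \<open>\<open>alpha s\<close> is a slice of the cycle \<open>z\<close>, and slicing commutes
  with the boundary.\<close>

lemma bd_alpha:
	assumes s: "s : P"
	shows "\<partial> (%f. if f : LF s then alpha s f else 0) f = 0"
proof -
	have *: "(%f. if f : LF s then alpha s f else 0) =
		 (%f. (1 / z (top s)) * (if f : LF s then z (f Un insert s (g0 s)) else 0))"
		by (auto simp: alpha_def)
	show ?thesis unfolding * bd_scale using bd_slice[OF s zFn] zc by (cases "f : LF s") auto
qed

text \<open>The product of the two slices is a relative cycle of top degree, so \<open>gen\<close>
  makes it a multiple of \<open>z\<close> on the flags through \<open>s\<close>; the factor is read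
  off at \<open>top s\<close>.\<close>

lemma z_product:
	assumes s: "s : P" and f: "f : LF s" and g: "g : UF s"
	shows "z (f Un insert s g) = z (top s) * alpha s f * beta s g"
proof -
	note t = f0g0[OF s]
	define y where "y = (%f. if f : LF s then alpha s f else 0)"
	define c where "c = (%F. if F : \<Delta> & s : F then y (below s F) * beta s (above s F) else 0)"
	have ys: "ALL f. y f ~= 0 --> f : LF s & card f = rk s"
	proof (intro allI impI)
		fix f assume "y f ~= 0"
		then have "f : LF s" "alpha s f ~= 0" by (auto simp: y_def split: if_splits)
		then show "f : LF s & card f = rk s" using alpha_card[OF s] by blast
	qed
	have yc: "ALL f. \<partial> y f = 0" unfolding y_def using bd_alpha[OF s] by blast
	note c = product_cycle[of s y "rk s", OF s ys yc, folded c_def]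
	have "c : Fn (Suc m) \<Delta>" using c(1) rkm[OF s] by simp
	from gen[OF s this c(2)] obtain r where r: "!!F. s : F ==> c F = r * z F" by blast
	have ev: "alpha s f * beta s g = r * z (f Un insert s g)" if "f : LF s" "g : UF s" for f g
	proof -
		have "c (f Un insert s g) = y f * beta s g"
			unfolding c_def by (rule product_cycle(3)[of s y "rk s", OF s ys yc that])
		moreover have "c (f Un insert s g) = r * z (f Un insert s g)" by (rule r) simp
		ultimately show ?thesis using that(1) by (simp add: y_def)
	qed
	have "r * z (top s) = 1" using ev[OF t(1,2)] unfolding t(3,6,7) by simp
	then have "z (f Un insert s g) = (r * z (top s)) * z (f Un insert s g)" by simp
	also have "\<dots> = z (top s) * (r * z (f Un insert s g))" by (simp only: ac_simps)
	also have "\<dots> = z (top s) * alpha s f * beta s g" unfolding ev[OF f g, symmetric] by (simp only: mult.assoc)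
	finally show ?thesis .
qed

text \<open>The lower link of \<open>s\<close> has the homology of a sphere, generated by
  \<open>alpha s\<close>: a cycle is multiplied by the upper slice, local homology at
  \<open>s\<close> is applied, and the result is cut back to the slice at \<open>g0 s\<close>. Here
  \<open>j\<close> counts vertices, and \<open>j = rk s\<close> is the top degree.\<close>

lemma lower_link:
	assumes s: "s : P" and y: "ALL f. y f ~= 0 --> f : LF s & card f = j" and cyc: "ALL f. \<partial> y f = 0"
	shows "j ~= rk s ==> EX w. (ALL f. w f ~= 0 --> f : LF s & card f = Suc j) & (ALL f:LF s. y f = \<partial> w f)"
		and "j = rk s ==> EX r. ALL f:LF s. y f = r * alpha s f"
proof -
	note t = f0g0[OF s]
	define c where "c = (%F. if F : \<Delta> & s : F then y (below s F) * beta s (above s F) else 0)"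
	note c = product_cycle[of s y j, OF s y cyc, folded c_def]
	have yc: "y f = c (f Un insert s (g0 s))" if "f : LF s" for f
	proof -
		have "c (f Un insert s (g0 s)) = y f * beta s (g0 s)"
			unfolding c_def by (rule product_cycle(3)[of s y j, OF s y cyc that t(2)])
		then show ?thesis unfolding t(7) by simp
	qed
	show "EX r. ALL f:LF s. y f = r * alpha s f" if "j = rk s"
	proof -
		have "c : Fn (Suc m) \<Delta>" using c(1) rkm[OF s] that by simp
		from gen[OF s this c(2)] obtain r where r: "!!F. s : F ==> c F = r * z F" by blast
		have "y f = (r * z (top s)) * alpha s f" if "f : LF s" for f
			using yc[OF that] r[of "f Un insert s (g0 s)"] top(2)[OF s] by (simp add: alpha_def)
		then show ?thesis by blast
	qed
	show "EX w. (ALL f. w f ~= 0 --> f : LF s & card f = Suc j) & (ALL f:LF s. y f = \<partial> w f)" if "j ~= rk s"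
	proof -
		have "Suc (j + (m - rk s)) ~= Suc m" using that rkm[OF s] by simp
		from acyc[OF s c(1) this c(2)] obtain b where b: "b : Fn (Suc (Suc (j + (m - rk s)))) \<Delta>"
			"!!G. s : G ==> c G = \<partial> b G" by blast
		define w where "w = (%f. if f : LF s then b (f Un insert s (g0 s)) else 0)"
		have "f : LF s & card f = Suc j" if "w f ~= 0" for f
		proof -
			have f: "f : LF s" "b (f Un insert s (g0 s)) ~= 0" using that by (auto simp: w_def split: if_splits)
			then show ?thesis using FnD(2)[OF b(1) f(2)] LU_card[OF f(1) t(2)] t(5) by simp
		qed
		moreover have "y f = \<partial> w f" if "f : LF s" for f
			using yc[OF that] b(2)[of "f Un insert s (g0 s)"] bd_slice(1)[OF s b(1) that] by (simp add: w_def)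
		ultimately show ?thesis by blast
	qed
qed

text \<open>The cone from \<open>s\<close> over the fundamental cycle \<open>alpha s\<close> of its
  lower link: a homological cell of dimension \<open>rk s\<close>.\<close>

definition E :: "'v => 'v set => real"
	where "E s F = (if s : F & F - {s} : LF s then alpha s (F - {s}) else 0)"

text \<open>The incidence number is read off from \<open>alpha s\<close> at the reference flag of
  \<open>t\<close>, where \<open>alpha t\<close> is normalised to 1; that this one value governs all
  flags through \<open>t\<close> is the content of \<open>alpha_step\<close>.\<close>

definition inc :: "'v => 'v => real"
	where "inc t s = (if t : P & s : P & {t,s} : \<Delta> & Suc (rk t) = rk s then alpha s (insert t (f0 t)) else 0)"

lemma E_Fn: assumes "s : P" shows "E s : Fn (Suc (rk s)) \<Delta>"
proof (rule FnI)
	fix F assume "E s F ~= 0"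
	then have F: "s : F" "F - {s} : LF s" "alpha s (F - {s}) ~= 0" by (auto simp: E_def split: if_splits)
	have "card (F - {s}) = rk s" using alpha_card[OF assms F(2,3)] .
	moreover have "finite F" using LF_fin[OF F(2)] by simp
	then have "card F = Suc (card (F - {s}))" by (rule card.remove[OF _ F(1)])
	ultimately have "card F = Suc (rk s)" by simp
	moreover have "F : \<Delta>" using F(1,2) by (simp add: LF_def insert_absorb)
	ultimately show "F : \<Delta> & card F = Suc (rk s)" by simp
qed

lemma adjacent:
	assumes "t : P" "s : P" "{t,s} : \<Delta>" "Suc (rk t) = rk s"
	shows "f : LF t ==> insert t f : LF s" "g : UF s ==> insert s g : UF t"
proof -
	show "insert t f : LF s" if "f : LF t"
	proof -
		have "f Un insert t {s} : \<Delta>"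
			by (rule join) (use that assms in \<open>auto simp: LF_def\<close>)
		then show ?thesis using that assms(4) by (auto simp: LF_def insert_commute Un_commute)
	qed
	show "insert s g : UF t" if "g : UF s"
	proof -
		have "{t} Un insert s g : \<Delta>"
			by (rule join) (use that assms in \<open>auto simp: UF_def insert_commute\<close>)
		then show ?thesis using that assms(4) by (auto simp: UF_def insert_commute)
	qed
qed

text \<open>Two product formulas for \<open>z\<close>, at \<open>t\<close> and at \<open>s\<close>,
  apply to flags through \<open>t\<close> and \<open>s\<close> with upper half \<open>g0 s\<close>.
  Comparing them for \<open>f\<close> and for \<open>f0 t\<close> makes \<open>alpha s\<close> on
  flags through \<open>t\<close> proportional to \<open>alpha t\<close>.\<close>

lemma alpha_step:
	assumes ts: "t : P" "s : P" "{t,s} : \<Delta>" "Suc (rk t) = rk s" and f: "f : LF t"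
	shows "alpha s (insert t f) = inc t s * alpha t f"
proof -
	note t = f0g0[OF ts(1)] and s = f0g0[OF ts(2)]
	note ad = adjacent[OF ts]
	have key: "z (top s) * alpha s (insert t f) = z (top t) * alpha t f * beta t (insert s (g0 s))" if "f : LF t" for f
	proof -
		have "insert t f Un insert s (g0 s) = f Un insert t (insert s (g0 s))" by auto
		then show ?thesis
			using z_product[OF ts(2) ad(1)[OF that] s(2)] z_product[OF ts(1) that ad(2)[OF s(2)]] s(7) by simp
	qed
	have inc: "inc t s = alpha s (insert t (f0 t))" using ts by (simp add: inc_def)
	have "z (top s) * inc t s = z (top t) * beta t (insert s (g0 s))"
		using key[OF t(1)] t(6) inc by simp
	then have "z (top s) * alpha s (insert t f) = z (top s) * (inc t s * alpha t f)"
		using key[OF f] by simp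
	then show ?thesis using top(2)[OF ts(2)] by simp
qed

text \<open>On flags through \<open>s\<close> the boundary vanishes because \<open>alpha s\<close>
  is a cycle. Elsewhere it is \<open>alpha s\<close> with the sign of \<open>s\<close> in last
  position; a flag of \<open>rk s\<close> elements below \<open>s\<close> has a unique element of
  rank \<open>rk s - 1\<close>, so a single summand on the right survives.\<close>

lemma bd_E:
	assumes s: "s : P" and G: "G ~= {}"
	shows "\<partial> (E s) G = (-1) ^ rk s * (\<Sum>t\<in>P. inc t s * E t G)"
proof (cases "s : G")
	case True
	have "inc t s * E t G = 0" for t
	proof (cases "Suc (rk t) = rk s & G - {t} : LF t")
		case True': True
		then have "s : G - {t}" using True by auto
		then have "rk s < rk t" using True' unfolding LF_def by blast
		then show ?thesis using True' by simp
	qed (auto simp: inc_def E_def)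
	then have R: "(\<Sum>t\<in>P. inc t s * E t G) = 0" by simp
	have "\<partial> (E s) G = 0"
	proof (cases "G - {s} : LF s")
		case False
		then have "E s (insert v G) = 0" if "v \<notin> G" for v
			using LF_down[of "insert v G - {s}" s "G - {s}"] by (auto simp: E_def)
		then show ?thesis by (simp add: bd_def)
	next
		case True': True
		let ?f = "G - {s}"
		have g: "{} : UF s" using vert[OF s] by (simp add: UF_def)
		have eq: "?f Un insert s {} = G" using True by auto
		have Ev: "E s (insert v ?f Un insert s {}) = (if insert v ?f : LF s then alpha s (insert v ?f) else 0)" if "rk v < rk s" for v
		proof -
			have "insert v ?f Un insert s {} - {s} = insert v ?f" using that True by auto
			then show ?thesis by (simp add: E_def)
		qed
		have Ea: "E s (?f Un insert s (insert v {})) = 0" if v: "rk s < rk v" for v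
		proof -
			have "v : ?f Un insert s (insert v {}) - {s}" using v by auto
			then have "rk v < rk s" if "?f Un insert s (insert v {}) - {s} : LF s" using that unfolding LF_def by blast
			then have "?f Un insert s (insert v {}) - {s} \<notin> LF s" using v by linarith
			then show ?thesis unfolding E_def by (simp del: Un_insert_right Un_insert_left)
		qed
		have "\<partial> (E s) G = (\<Sum>v\<in>{v\<in>P - ?f. rk v < rk s}. (-1) ^ pos rk v ?f * E s (insert v ?f Un insert s {}))"
			using bd_split[OF E_Fn[OF s] True' g] Ea unfolding eq by simp
		also have "\<dots> = (\<Sum>v\<in>{v\<in>P - ?f. rk v < rk s}. (-1) ^ pos rk v ?f * (if insert v ?f : LF s then alpha s (insert v ?f) else 0))"
			by (intro sum.cong refl) (subst Ev, auto)
		also have "\<dots> = \<partial> (%f. if f : LF s then alpha s f else 0) ?f"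
			by (rule bd_low(1)[OF _ True', symmetric]) (auto split: if_splits)
		finally show ?thesis using bd_alpha[OF s] by simp
	qed
	then show ?thesis using R by simp
next
	case False
	have "E s (insert v G) = 0" if "v ~= s" for v using that False by (auto simp: E_def)
	then have "\<partial> (E s) G = (\<Sum>v\<in>{s}. (-1) ^ pos rk v G * E s (insert v G))"
		unfolding bd_def by (intro sum.mono_neutral_right) (use finP s False in auto)
	also have "\<dots> = (-1) ^ pos rk s G * (if G : LF s then alpha s G else 0)"
		using False by (simp add: E_def)
	finally have L: "\<partial> (E s) G = (-1) ^ pos rk s G * (if G : LF s then alpha s G else 0)" .
	have R0: "inc t s * E t G = 0" if "~ (t : G & G : LF s & card G = rk s & Suc (rk t) = rk s)" for t
	proof (rule ccontr)
		assume "inc t s * E t G ~= 0"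
		then have h: "t : P" "{t,s} : \<Delta>" "Suc (rk t) = rk s" "t : G" "G - {t} : LF t" "E t G ~= 0"
			by (auto simp: inc_def E_def split: if_splits)
		then have "G : LF s" using adjacent(1)[OF h(1) s h(2,3,5)] by (simp add: insert_absorb)
		moreover have "card G = rk s" using FnD(2)[OF E_Fn[OF h(1)] h(6)] h(3) by simp
		ultimately show False using that h by blast
	qed
	show ?thesis
	proof (cases "G : LF s & card G = rk s")
		case False
		then have "(if G : LF s then alpha s G else 0) = 0" using alpha_card[OF s] by auto
		moreover have "(\<Sum>t\<in>P. inc t s * E t G) = 0" using R0 False by (intro sum.neutral) auto
		ultimately show ?thesis using L by simp
	next
		case True
		have iG: "insert s G : \<Delta>" using True by (auto simp: LF_def)
		then have injG: "inj_on rk G" using inj inj_on_subset by blast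
		have "rk ` G = {..<rk s}"
			by (rule card_subset_eq) (use True card_image[OF injG] in \<open>auto simp: LF_def\<close>)
		moreover have "rk s > 0" using True G LF_fin card_gt_0_iff[of G] by auto
		ultimately have "rk s - 1 : rk ` G" by simp
		then obtain t where t: "t : G" "rk s - 1 = rk t" by (rule imageE)
		have t: "t : G" "Suc (rk t) = rk s" using t \<open>rk s > 0\<close> by simp_all
		have tP: "t : P" using t iG subP by blast
		have ts: "{t,s} : \<Delta>" using down[OF iG] t by auto
		have Gt: "G - {t} : LF t"
		proof -
			have "rk v < rk t" if "v : G - {t}" for v
			proof -
				have "rk v < rk s" using that True by (auto simp: LF_def)
				moreover have "rk v ~= rk t" using that t inj_onD[OF injG] by blast
				ultimately show ?thesis using t(2) by simp
			qed
			moreover have "insert t (G - {t}) : \<Delta>" using down[OF iG] t by (auto simp: insert_absorb)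
			ultimately show ?thesis by (simp add: LF_def)
		qed
		have "(\<Sum>t\<in>P. inc t s * E t G) = (\<Sum>t\<in>{t}. inc t s * E t G)"
		proof (rule sum.mono_neutral_right)
			show "ALL i:P - {t}. inc i s * E i G = 0"
			proof
				fix i assume i: "i : P - {t}"
				have "~ (i : G & Suc (rk i) = rk s)" using inj_onD[OF injG, of i t] t i by auto
				then show "inc i s * E i G = 0" by (intro R0) blast
			qed
		qed (use finP tP in auto)
		also have "\<dots> = alpha s G"
			using alpha_step[OF tP s ts t(2) Gt] t Gt by (simp add: E_def insert_absorb)
		finally have "(\<Sum>t\<in>P. inc t s * E t G) = alpha s G" .
		moreover have "pos rk s G = rk s"
		proof -
			have "{u\<in>G. rk u < rk s} = G" using True by (auto simp: LF_def)
			then show ?thesis using True by (simp add: pos_def)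
		qed
		ultimately show ?thesis using L True by simp
	qed
qed

lemma flags_down: "F : flags L ==> G \<subseteq> F ==> G : flags L"
	unfolding flags_def using down by auto

text \<open>A vertex \<open>s\<close> of greatest rank is removed from \<open>L\<close>. The part of
  \<open>e\<close> through \<open>s\<close> is a cycle of the lower link; it either bounds there,
  and a cone over the filling removes it, or is a multiple of \<open>alpha s\<close>, and a multiple
  of \<open>E s\<close> removes it. The index \<open>k\<close> counts vertices, so \<open>e\<close>
  has dimension \<open>k - 1\<close>.\<close>

theorem cellular:
	assumes "lower L" "e : Fn k (flags L)" "0 < k" "!!s. s : L ==> x s ~= 0 ==> Suc (Suc (rk s)) = k"
		"!!G. G ~= {} ==> \<partial> e G = (\<Sum>s\<in>L. x s * E s G)"
	shows "EX b:Fn (Suc k) (flags L). EX y. (ALL s:L. y s ~= 0 --> Suc (rk s) = k) &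
		 (ALL F. F ~= {} --> e F = \<partial> b F + (\<Sum>s\<in>L. y s * E s F))"
proof -
	have "finite L" using assms(1) finP finite_subset by (auto simp: lower_def)
	then show ?thesis using assms
	proof (induction "card L" arbitrary: L e x)
		case 0
		then have "L = {}" by simp
		then have "e F = 0" if "F ~= {}" for F using FnD(1)[OF 0(4), of F] that by (auto simp: flags_def)
		then show ?case by (intro bexI[of _ "%_. 0"] exI[of _ "%_. 0"]) (auto simp: Fn_def bd_def)
	next
		case (Suc n)
		note fL = Suc.prems(1) and low = Suc.prems(2) and e = Suc.prems(3) and k0 = Suc.prems(4)
			and xr = Suc.prems(5) and be = Suc.prems(6)
		have LP: "L \<subseteq> P" using low by (simp add: lower_def)
		have "L ~= {}" using Suc.hyps(2) by auto
		then have "Max (rk ` L) : rk ` L" using fL by simp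
		then obtain s where s: "Max (rk ` L) = rk s" "s : L" by (rule imageE)
		have s: "s : L" "!!v. v : L ==> rk v <= rk s"
			using s(2) fL by (auto simp flip: s(1))
		have sP: "s : P" using s LP by auto
		let ?L = "L - {s}"
		have low': "lower ?L"
		proof -
			have "v ~= s" if "t : L" "rk v < rk t" for t v using s(2)[OF that(1)] that by auto
			then show ?thesis using low unfolding lower_def by blast
		qed
		have sumL: "(\<Sum>t\<in>L. q t * E t G) = q s * E s G + (\<Sum>t\<in>?L. q t * E t G)" for q G
			using fL s(1) by (simp add: sum.remove)
		have Eo: "E t G = 0" if "t : ?L" "s : G" for t G
		proof (rule ccontr)
			assume "E t G ~= 0"
			then have "G - {t} : LF t" by (auto simp: E_def split: if_splits)
			moreover have "s : G - {t}" using that by auto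
			ultimately have "rk s < rk t" unfolding LF_def by blast
			then show False using s(2)[of t] that(1) by auto
		qed
		have flagLF: "F - {s} : LF s" if "F : flags L" "s : F" for F
		proof -
			have F: "F : \<Delta>" "F \<subseteq> L" using that by (auto simp: flags_def)
			have "rk v < rk s" if "v : F - {s}" for v
				using s(2)[of v] that F inj_onD[OF inj[OF F(1)], of v s] \<open>s : F\<close> by force
			then show ?thesis using F that(2) by (auto simp: LF_def insert_absorb)
		qed
		have LFflag: "insert s f : flags L" if "f : LF s" for f
		proof -
			have "v : L" if "v : f" for v
			proof -
				have "{v,s} : \<Delta>" using \<open>f : LF s\<close> that down[of "insert s f" "{v,s}"] by (auto simp: LF_def)
				then show ?thesis using low s(1) that \<open>f : LF s\<close> unfolding lower_def LF_def by blast
			qed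
			then show ?thesis using that s(1) by (auto simp: flags_def LF_def)
		qed
		\<comment> \<open>Flags of \<open>L\<close> through \<open>s\<close> have at most
		  \<open>Suc (rk s)\<close> vertices, too few for \<open>e\<close>, while a nonzero
		  \<open>x s\<close> would be visible in the boundary at \<open>insert s (f0 s)\<close>.\<close>
		have xs: "x s = 0"
		proof (rule ccontr)
			assume "x s ~= 0"
			then have k: "Suc (Suc (rk s)) = k" using xr s(1) by blast
			have "e F = 0" if "s : F" for F
			proof (rule ccontr)
				assume "e F ~= 0"
				then have F: "F : flags L" "card F = k" using FnD[OF e] by auto
				have "finite F" using F fin by (auto simp: flags_def)
				then have "card F = Suc (card (F - {s}))" by (rule card.remove[OF _ that])
				then show False using LF_card[OF flagLF[OF F(1) that]] F(2) k by simp
			qed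
			then have "\<partial> e (insert s (f0 s)) = 0" by (simp add: bd_def)
			moreover have "\<partial> e (insert s (f0 s)) = x s * E s (insert s (f0 s))"
				using be[of "insert s (f0 s)"] sumL[of x] Eo[of _ "insert s (f0 s)"] by simp
			moreover have "E s (insert s (f0 s)) = 1"
			proof -
				have "insert s (f0 s) - {s} = f0 s" by auto
				then show ?thesis using f0g0[OF sP] by (simp add: E_def)
			qed
			ultimately show False using \<open>x s ~= 0\<close> by simp
		qed
		have be0: "\<partial> e G = 0" if "s : G" for G
			using be[of G] sumL[of x G] Eo[of _ G] that xs by (auto intro!: sum.neutral)
		have be': "\<partial> e G = (\<Sum>t\<in>?L. x t * E t G)" if "G ~= {}" for G
			using be[OF that] sumL[of x G] xs by simp
		\<comment> \<open>The part of \<open>e\<close> through \<open>s\<close>, viewed on the lower link;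
		  by maximality of the rank all other vertices of such a flag lie below \<open>s\<close>.\<close>
		define y where "y = (%f. if f : LF s then e (insert s f) else 0)"
		have eD: "e : Fn k \<Delta>" using e by (auto simp: Fn_def flags_def)
		have U0: "{} : UF s" using vert[OF sP] by (simp add: UF_def)
		have bd0: "\<partial> q f = \<partial> e' (insert s f)" if f: "f : LF s" and q: "q = (%f. if f : LF s then e' (insert s f) else 0)"
			and e': "e' : Fn k' (flags L)" for q f e' k'
		proof -
			have e'D: "e' : Fn k' \<Delta>" using e' by (auto simp: Fn_def flags_def)
			have "e' (f Un insert s (insert v {})) = 0" if "rk s < rk v" for v
				using FnD(1)[OF e', of "f Un insert s (insert v {})"] s(2)[of v] that by (auto simp: flags_def)
			then have "\<partial> e' (f Un insert s {}) = (\<Sum>v\<in>{v\<in>P - f. rk v < rk s}. (-1) ^ pos rk v f * e' (insert v f Un insert s {}))"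
				using bd_split[OF e'D f U0] by simp
			also have "\<dots> = (\<Sum>v\<in>{v\<in>P - f. rk v < rk s}. (-1) ^ pos rk v f * q (insert v f))"
			proof (intro sum.cong refl)
				fix v assume v: "v : {v\<in>P - f. rk v < rk s}"
				have "e' (insert s (insert v f)) = 0" if "insert v f \<notin> LF s"
				proof (rule ccontr)
					assume "e' (insert s (insert v f)) ~= 0"
					then have "insert s (insert v f) : \<Delta>" using FnD(1)[OF e'D] by blast
					then show False using that f v by (auto simp: LF_def)
				qed
				then have "q (insert v f) = e' (insert v f Un insert s {})" by (auto simp: q)
				then show "(-1) ^ pos rk v f * e' (insert v f Un insert s {}) = (-1) ^ pos rk v f * q (insert v f)" by simp
			qed
			also have "\<dots> = \<partial> q f"
			proof (rule bd_low(1)[OF _ f, symmetric])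
				show "ALL f. q f ~= 0 --> f : LF s" unfolding q by simp
			qed
			finally show ?thesis by simp
		qed
		have ylow: "ALL f. y f ~= 0 --> f : LF s" by (auto simp: y_def split: if_splits)
		have ycyc: "ALL f. \<partial> y f = 0"
		proof
			fix f
			show "\<partial> y f = 0"
			proof (cases "f : LF s")
				case True then show ?thesis using bd0[OF True y_def e] be0 by simp
			qed (rule bd_low(2)[OF ylow])
		qed
		have ysupp: "ALL f. y f ~= 0 --> f : LF s & card f = k - 1"
		proof (intro allI impI)
			fix f assume yf: "y f ~= 0"
			have f: "f : LF s" "e (insert s f) ~= 0" using yf by (auto simp: y_def split: if_splits)
			moreover have "s \<notin> f" using f(1) by (auto simp: LF_def)
			ultimately show "f : LF s & card f = k - 1" using FnD(2)[OF e f(2)] LF_fin[OF f(1)] by simp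
		qed
		have ey: "e F = y (F - {s})" if "s : F" "F - {s} : LF s" for F
			using that by (simp add: y_def insert_absorb)
		have e0: "e F = 0" if "s : F" "F - {s} \<notin> LF s" for F
			using that flagLF[of F] FnD(1)[OF e, of F] by blast
		have card': "n = card ?L" using Suc.hyps(2) s(1) fL by simp
		show ?case
		proof (cases "k - 1 = rk s")
			case False
			from lower_link(1)[OF sP ysupp ycyc False] obtain w where
				w': "(ALL f. w f ~= 0 --> f : LF s & card f = Suc (k - 1)) & (ALL f:LF s. y f = \<partial> w f)" by (rule exE)
			have w: "w f ~= 0 ==> f : LF s & card f = Suc (k - 1)" "f : LF s ==> y f = \<partial> w f" for f
				using w' by blast+
			\<comment> \<open>The cone from \<open>s\<close> over the filling \<open>w\<close>; its boundary
			  agrees with \<open>e\<close> on all flags through \<open>s\<close>.\<close>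
			define b0 where "b0 = (%F. if s : F & F - {s} : LF s then w (F - {s}) else 0)"
			have b0: "b0 : Fn (Suc k) (flags L)"
			proof (rule FnI)
				fix F assume "b0 F ~= 0"
				then have F: "s : F" "F - {s} : LF s" "w (F - {s}) ~= 0" by (auto simp: b0_def split: if_splits)
				have "card (F - {s}) = k" using w(1)[OF F(3)] k0 by simp
				moreover have "finite F" using LF_fin[OF F(2)] by simp
				then have "card F = Suc (card (F - {s}))" by (rule card.remove[OF _ F(1)])
				ultimately have "card F = Suc k" by simp
				then show "F : flags L & card F = Suc k" using LFflag[OF F(2)] F(1) by (simp add: insert_absorb)
			qed
			have weq: "w = (%f. if f : LF s then b0 (insert s f) else 0)"
			proof
				fix f
				have "insert s f - {s} = f" if "f : LF s" using that by (auto simp: LF_def)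
				then show "w f = (if f : LF s then b0 (insert s f) else 0)" using w(1)[of f] by (auto simp: b0_def)
			qed
			have b0D: "b0 : Fn (Suc k) \<Delta>" using b0 by (auto simp: Fn_def flags_def)
			define e' where "e' = (%F. e F - \<partial> b0 F)"
			have bb: "\<partial> b0 : Fn k (flags L)"
				by (rule bd_Fn[OF b0 flags_down]) (use fin in \<open>auto simp: flags_def\<close>)
			have e's: "e' F = 0" if "s : F" for F
			proof (cases "F - {s} : LF s")
				case True
				have "\<partial> b0 F = \<partial> w (F - {s})" using bd0[OF True weq b0] that by (simp add: insert_absorb)
				then show ?thesis using w(2)[OF True] ey[OF that True] by (simp add: e'_def)
			next
				case False
				have "\<partial> b0 F = 0"
				proof -
					have "b0 (insert v F) = 0" for v
						using False LF_down[of "insert v F - {s}" s "F - {s}"] by (auto simp: b0_def)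
					then show ?thesis by (simp add: bd_def)
				qed
				then show ?thesis using e0[OF that False] by (simp add: e'_def)
			qed
			have e': "e' : Fn k (flags ?L)"
			proof (rule FnI)
				fix F assume F: "e' F ~= 0"
				then have "e F ~= 0 \<or> \<partial> b0 F ~= 0" by (auto simp: e'_def)
				then have "F : flags L & card F = k" using FnD[OF e] FnD[OF bb] by blast
				then show "F : flags ?L & card F = k" using e's[of F] F by (auto simp: flags_def)
			qed
			have be'': "\<partial> e' G = (\<Sum>t\<in>?L. x t * E t G)" if "G ~= {}" for G
				unfolding e'_def bd_diff bd_bd[OF b0D] using be'[OF that] by simp
			have "EX b:Fn (Suc k) (flags ?L). EX y. (ALL s:?L. y s ~= 0 --> Suc (rk s) = k) &
					(ALL F. F ~= {} --> e' F = \<partial> b F + (\<Sum>s\<in>?L. y s * E s F))"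
				by (rule Suc.hyps(1)[OF card' _ low' e' k0 _ be'']) (use fL xr in auto)
			then obtain b u where b1: "b : Fn (Suc k) (flags ?L)"
				and u: "(ALL s:?L. u s ~= 0 --> Suc (rk s) = k) & (ALL F. F ~= {} --> e' F = \<partial> b F + (\<Sum>s\<in>?L. u s * E s F))"
				by (elim bexE exE)
			have b2: "Suc (rk s) = k" if "s : ?L" "u s ~= 0" for s using conjunct1[OF u] that by blast
			have b3: "e' F = \<partial> b F + (\<Sum>s\<in>?L. u s * E s F)" if "F ~= {}" for F
				using conjunct2[OF u, THEN spec, of F] that by (rule mp)
			note b = b1 b2 b3
			show ?thesis
			proof (intro bexI[of _ "%F. b F + b0 F"] exI[of _ "u(s := 0)"] conjI allI impI ballI)
				fix F :: "'v set" assume "F ~= {}"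
				have "(\<Sum>t\<in>L. (u(s := 0)) t * E t F) = (\<Sum>t\<in>?L. u t * E t F)"
					using sumL[of "u(s := 0)" F] by simp
				then show "e F = \<partial> (%F. b F + b0 F) F + (\<Sum>t\<in>L. (u(s := 0)) t * E t F)"
					using b(3)[OF \<open>F ~= {}\<close>] by (simp add: e'_def bd_add)
			next
				fix t assume "t : L" "(u(s := 0)) t ~= 0"
				then show "Suc (rk t) = k" using b(2)[of t] by (auto split: if_splits)
			next
				show "(%F. b F + b0 F) : Fn (Suc k) (flags L)"
				proof (rule FnI)
					fix F assume "b F + b0 F ~= 0"
					then have "b F ~= 0 \<or> b0 F ~= 0" by auto
					then show "F : flags L & card F = Suc k" using FnD[OF b(1), of F] FnD[OF b0, of F] by (auto simp: flags_def)
				qed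
			qed
		next
			case True
			obtain r where r: "!!f. f : LF s ==> y f = r * alpha s f"
				using lower_link(2)[OF sP ysupp ycyc True] by blast
			define e' where "e' = (%F. e F - r * E s F)"
			have Es: "E s F = alpha s (F - {s})" if "s : F" "F - {s} : LF s" for F using that by (simp add: E_def)
			have e's: "e' F = 0" if "s : F" for F
				by (cases "F - {s} : LF s") (use that ey e0 r Es in \<open>auto simp: e'_def E_def\<close>)
			have e': "e' : Fn k (flags ?L)"
			proof (rule FnI)
				fix F assume F: "e' F ~= 0"
				then have sF: "s \<notin> F" using e's by blast
				then have "e F ~= 0" using F by (auto simp: e'_def E_def)
				then show "F : flags ?L & card F = k" using FnD[OF e, of F] sF by (auto simp: flags_def)
			qed
			\<comment> \<open>Subtracting \<open>r * E s\<close> changes the cellular boundary according to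
			  \<open>bd_E\<close>; the new terms belong to \<open>?L\<close> because \<open>L\<close> is
			  closed downwards.\<close>
			define x' where "x' = (%t. x t - r * (-1) ^ rk s * inc t s)"
			have incL: "inc t s = 0" if "t \<notin> ?L" for t
			proof (rule ccontr)
				assume "inc t s ~= 0"
				then have h: "{t,s} : \<Delta>" "Suc (rk t) = rk s" by (auto simp: inc_def split: if_splits)
				then have "rk t < rk s" by simp
				then have "t : L" "t ~= s" using low s(1) h(1) unfolding lower_def by blast+
				then show False using that by blast
			qed
			have be'': "\<partial> e' G = (\<Sum>t\<in>?L. x' t * E t G)" if "G ~= {}" for G
			proof -
				have "(\<Sum>t\<in>P. inc t s * E t G) = (\<Sum>t\<in>?L. inc t s * E t G)"
					by (rule sum.mono_neutral_right) (use finP LP incL in auto)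
				then have "\<partial> e' G = (\<Sum>t\<in>?L. x t * E t G) - r * ((-1) ^ rk s * (\<Sum>t\<in>?L. inc t s * E t G))"
					unfolding e'_def bd_diff bd_scale be'[OF that] bd_E[OF sP that] by simp
				also have "\<dots> = (\<Sum>t\<in>?L. x' t * E t G)"
					unfolding sum_distrib_left x'_def left_diff_distrib sum_subtractf by (simp add: mult.assoc)
				finally show ?thesis .
			qed
			have xr': "Suc (Suc (rk t)) = k" if "t : ?L" "x' t ~= 0" for t
			proof (cases "x t = 0")
				case True': True
				then have "inc t s ~= 0" using that by (auto simp: x'_def)
				then have "Suc (rk t) = rk s" by (auto simp: inc_def split: if_splits)
				then show ?thesis using True k0 by simp
			qed (use that xr in auto)
			have "EX b:Fn (Suc k) (flags ?L). EX y. (ALL s:?L. y s ~= 0 --> Suc (rk s) = k) &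
					(ALL F. F ~= {} --> e' F = \<partial> b F + (\<Sum>s\<in>?L. y s * E s F))"
				by (rule Suc.hyps(1)[OF card' _ low' e' k0 xr' be'']) (use fL in auto)
			then obtain b u where b1: "b : Fn (Suc k) (flags ?L)"
				and u: "(ALL s:?L. u s ~= 0 --> Suc (rk s) = k) & (ALL F. F ~= {} --> e' F = \<partial> b F + (\<Sum>s\<in>?L. u s * E s F))"
				by (elim bexE exE)
			have b2: "Suc (rk s) = k" if "s : ?L" "u s ~= 0" for s using conjunct1[OF u] that by blast
			have b3: "e' F = \<partial> b F + (\<Sum>s\<in>?L. u s * E s F)" if "F ~= {}" for F
				using conjunct2[OF u, THEN spec, of F] that by (rule mp)
			note b = b1 b2 b3
			show ?thesis
			proof (intro bexI[of _ b] exI[of _ "u(s := r)"] conjI allI impI ballI)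
				fix F :: "'v set" assume "F ~= {}"
				have "(\<Sum>t\<in>L. (u(s := r)) t * E t F) = r * E s F + (\<Sum>t\<in>?L. u t * E t F)"
					using sumL[of "u(s := r)" F] by simp
				then show "e F = \<partial> b F + (\<Sum>t\<in>L. (u(s := r)) t * E t F)"
					using b(3)[OF \<open>F ~= {}\<close>] by (simp add: e'_def)
			next
				fix t assume "t : L" "(u(s := r)) t ~= 0"
				then show "Suc (rk t) = k" using b(2)[of t] True k0 by (auto split: if_splits)
			next
				show "b : Fn (Suc k) (flags L)" using b(1) by (auto simp: Fn_def flags_def)
			qed
		qed
	qed
qed

end

section \<open>Reversing the order\<close>

text \<open>Reversing the order replaces the position of \<open>v\<close> by \<open>card G\<close>
  minus the old position, so the two boundaries differ by a sign depending only on the size of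
  \<open>G\<close>.\<close>

lemma (in flag_complex) bd_rev:
	assumes x: "x : Fn k \<Delta>"
	shows "bd P (%v. m - rk v) x G = (-1) ^ card G * \<partial> x G"
	unfolding bd_def sum_distrib_left
proof (intro sum.cong refl)
	fix v assume v: "v : P - G"
	show "(-1) ^ pos (%v. m - rk v) v G * x (insert v G) = (-1) ^ card G * ((-1) ^ pos rk v G * x (insert v G))"
	proof (cases "x (insert v G) = 0")
		case False
		then have D: "insert v G : \<Delta>" using FnD[OF x] by blast
		have GP: "G \<subseteq> P" and fG: "finite G" using subP[OF D] fin[OF D] by auto
		have "m - rk u < m - rk v \<longleftrightarrow> ~ rk u < rk v" if "u : G" for u
			using rkm[of u] rkm[of v] that GP v inj_onD[OF inj[OF D], of u v] by force
		then have "{u\<in>G. m - rk u < m - rk v} = G - {u\<in>G. rk u < rk v}" by auto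
		then have "pos (%v. m - rk v) v G = card G - pos rk v G"
			unfolding pos_def using fG by (simp add: card_Diff_subset)
		moreover have "pos rk v G <= card G" unfolding pos_def using fG by (intro card_mono) auto
		ultimately have "card G = pos (%v. m - rk v) v G + pos rk v G" by simp
		then show ?thesis by (simp add: power_add mult.assoc flip: power_mult_distrib)
	qed simp
qed

lemma (in flag_complex) flag_complex_rev: "flag_complex P \<Delta> (%v. m - rk v) m"
proof
	fix F assume F: "F : \<Delta>"
	show "inj_on (%v. m - rk v) F"
	proof (rule inj_onI)
		fix u v assume "u : F" "v : F" "m - rk u = m - rk v"
		then show "u = v" using inj_onD[OF inj[OF F], of u v] rkm[of u] rkm[of v] subP[OF F] by force
	qed
next
	fix s f g assume h: "insert s f : \<Delta>" "insert s g : \<Delta>" "!!v. v : f ==> m - rk v < m - rk s"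
		"!!v. v : g ==> m - rk s < m - rk v"
	have "g Un insert s f : \<Delta>"
	proof (rule join)
		fix v assume "v : g" then show "rk v < rk s" using h(4)[of v] by linarith
	next
		fix v assume "v : f" then show "rk s < rk v" using h(3)[of v] by linarith
	qed (use h in auto)
	then show "f Un insert s g : \<Delta>" by (simp add: Un_commute)
qed (use finP subP down empty vert in auto)

text \<open>The assumptions are vanishing statements or can absorb the sign of the reversed
  boundary, so every result on lower links acquires a twin for upper links.\<close>

lemma (in homology_manifold) homology_manifold_rev: "homology_manifold P \<Delta> (%v. m - rk v) m z"
proof -
	interpret r: flag_complex P \<Delta> "%v. m - rk v" m by (rule flag_complex_rev)
	have zero: "bd P (%v. m - rk v) x G = 0 \<longleftrightarrow> \<partial> x G = 0" if "x : Fn k \<Delta>" for x k G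
		using bd_rev[OF that] by simp
	show ?thesis
	proof
		fix s c k assume h: "s : P" "c : Fn k \<Delta>" "k ~= Suc m" "!!G. s : G ==> bd P (%v. m - rk v) c G = 0"
		have "!!G. s : G ==> \<partial> c G = 0" using h(4) zero[OF h(2)] by blast
		from acyc[OF h(1-3) this] obtain b where b: "b : Fn (Suc k) \<Delta>" "!!G. s : G ==> c G = \<partial> b G" by blast
		\<comment> \<open>The factor compensates the reversal sign, because the boundary of
		  \<open>b\<close> lives on flags with \<open>k\<close> vertices.\<close>
		have b': "(%F. (-1) ^ k * b F) : Fn (Suc k) \<Delta>" using b(1) by (auto simp: Fn_def)
		have "c G = bd P (%v. m - rk v) (%F. (-1) ^ k * b F) G" if "s : G" for G
		proof -
			have "bd P (%v. m - rk v) (%F. (-1) ^ k * b F) G = (-1) ^ card G * ((-1) ^ k * c G)"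
				unfolding bd_rev[OF b'] bd_scale using b(2)[OF that] by simp
			also have "\<dots> = c G"
				by (cases "c G = 0") (use FnD(2)[OF h(2), of G] in \<open>auto simp flip: power_add mult.assoc\<close>)
			finally show ?thesis by simp
		qed
		then show "EX b:Fn (Suc k) \<Delta>. ALL G. s : G --> c G = bd P (%v. m - rk v) b G" using b' by blast
	next
		fix s c assume h: "s : P" "c : Fn (Suc m) \<Delta>" "!!G. s : G ==> bd P (%v. m - rk v) c G = 0"
		have "!!G. s : G ==> \<partial> c G = 0" using h(3) zero[OF h(2)] by blast
		then show "EX r. ALL F. s : F --> c F = r * z F" using gen[OF h(1,2)] by blast
	qed (use zFn zc znz zero[OF zFn] in auto)
qed

section \<open>Singular chains on a triangulated space\<close>

lemma continuous_on_Min: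
	fixes g :: "'v => 'b::topological_space => real"
	assumes "finite A" "A ~= {}" "!!v. v : A ==> continuous_on S (g v)"
	shows "continuous_on S (%t. Min ((%v. g v t) ` A))"
	using assms
proof (induction A rule: finite_ne_induct)
	case (insert v A)
	have "(%t. Min ((%v. g v t) ` insert v A)) = (%t. min (g v t) (Min ((%v. g v t) ` A)))"
		using insert by (auto simp: fun_eq_iff)
	then show ?case using insert by (auto intro!: continuous_on_min)
qed auto

lemma split_chain:
	fixes c :: "'s \<Rightarrow>\<^sub>0 int"
	obtains a b where "c = a + b" "keys a \<subseteq> keys c \<inter> A" "keys b \<subseteq> keys c - A"
proof -
	define a where "a = frag_extend (%s. if s : A then frag_of s else 0) c"
	define b where "b = frag_extend (%s. if s : A then 0 else frag_of s) c"
	have "a + b = frag_extend frag_of c"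
		by (auto simp: a_def b_def frag_extend_def simp flip: sum.distrib intro!: sum.cong)
	then have "c = a + b" using frag_expansion by metis
	moreover have "keys a \<subseteq> keys c \<inter> A"
		using keys_frag_extend[of "%s. if s : A then frag_of s else 0" c] by (fastforce simp: a_def split: if_splits)
	moreover have "keys b \<subseteq> keys c - A"
		using keys_frag_extend[of "%s. if s : A then 0 else frag_of s" c] by (fastforce simp: b_def split: if_splits)
	ultimately show thesis by (rule that)
qed

lemma chain_boundary_keys:
	assumes "!!s. s : keys c ==> keys (chain_boundary p (frag_of s)) \<subseteq> A"
	shows "keys (chain_boundary p c) \<subseteq> A"
proof (cases "p = 0")
	case False
	then show ?thesis
		using assms keys_frag_extend[of "%f. \<Sum>k\<le>p. frag_cmul ((-1) ^ k) (frag_of (singular_face p k f))" c]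
		unfolding chain_boundary_of by (fastforce simp: chain_boundary_def)
qed (simp add: chain_boundary_def)

lemma continuous_on_coord: "continuous_on S (%x::'v => real. x v)"
	by (rule continuous_on_subset[OF continuous_on_product_coordinates]) simp

lemma continuous_on_coord_snd: "continuous_on S (%z::real \<times> ('v => real). snd z v)"
	using continuous_on_compose[OF continuous_on_snd[OF continuous_on_id] continuous_on_coord, of S v] by (simp add: o_def)

text \<open>Geometric realisation of a subcomplex \<open>Q\<close> in barycentric coordinates: the
  carrier of a point has to be a simplex of \<open>Q\<close>.\<close>

definition geo :: "'v set => 'v set set => ('v => real) set"
	where "geo P Q = {t. (ALL v. 0 <= t v) & {v. t v ~= 0} : Q & sum t P = 1}"

locale realized_complex = flag_complex P \<Delta> rk m
	for P :: "'v set" and \<Delta> :: "'v set set" and rk :: "'v => nat" and m :: nat +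
	fixes M :: "'a topology" and \<Phi> :: "('v => real) => 'a"
	assumes homeo: "homeomorphic_map (top_of_set (geo P \<Delta>)) M \<Phi>"
begin

definition \<Psi> where "\<Psi> = inv_into (geo P \<Delta>) \<Phi>"

lemma Phi_cont: "continuous_map (top_of_set (geo P \<Delta>)) M \<Phi>"
	using homeo homeomorphic_imp_continuous_map by blast

lemma Phi_image: "\<Phi> ` geo P \<Delta> = topspace M"
	using homeomorphic_imp_surjective_map[OF homeo] by simp

lemma Phi_inj: "inj_on \<Phi> (geo P \<Delta>)"
	using homeomorphic_imp_injective_map[OF homeo] by simp

lemma Psi_Phi: "t : geo P \<Delta> ==> \<Psi> (\<Phi> t) = t"
	unfolding \<Psi>_def by (rule inv_into_f_f[OF Phi_inj])

lemma Phi_Psi: "y : topspace M ==> \<Phi> (\<Psi> y) = y"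
	using f_inv_into_f[of y \<Phi> "geo P \<Delta>"] by (simp add: Phi_image \<Psi>_def)

lemma Psi_in: "y : topspace M ==> \<Psi> y : geo P \<Delta>"
	using inv_into_into[of y \<Phi> "geo P \<Delta>"] by (simp add: Phi_image \<Psi>_def)

lemma Psi_cont: "continuous_map M (top_of_set (geo P \<Delta>)) \<Psi>"
proof -
	obtain g where g: "homeomorphic_maps (top_of_set (geo P \<Delta>)) M \<Phi> g"
		using homeo homeomorphic_map_maps by blast
	have "g y = \<Psi> y" if "y : topspace M" for y
	proof -
		have "g y : geo P \<Delta>" "\<Phi> (g y) = y"
			using g that by (auto simp: homeomorphic_maps_def continuous_map_def)
		then show ?thesis using Psi_Phi by metis
	qed
	moreover have "continuous_map M (top_of_set (geo P \<Delta>)) g" using g by (simp add: homeomorphic_maps_def)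
	ultimately show ?thesis using continuous_map_eq by blast
qed

section \<open>Subspaces carried by subcomplexes\<close>

definition sp where "sp Q = \<Phi> ` geo P Q"

abbreviation X where "X Q \<equiv> subtopology M (sp Q)"

definition subc where "subc Q \<longleftrightarrow> Q \<subseteq> \<Delta> & (ALL F:Q. \<forall>G\<subseteq>F. G : Q)"

lemma subc_Delta: "subc \<Delta>" using down by (auto simp: subc_def)

lemma geo_mono: "Q \<subseteq> Q' ==> geo P Q \<subseteq> geo P Q'" by (auto simp: geo_def)

lemma sp_mono: "Q \<subseteq> Q' ==> sp Q \<subseteq> sp Q'" unfolding sp_def using geo_mono by blast

lemma sp_iff: "Q \<subseteq> \<Delta> ==> t : geo P \<Delta> ==> \<Phi> t : sp Q \<longleftrightarrow> t : geo P Q"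
	unfolding sp_def using Phi_inj geo_mono[of Q \<Delta>] by (auto simp: inj_on_image_mem_iff)

lemma sp_top: "Q \<subseteq> \<Delta> ==> sp Q \<subseteq> topspace M"
	unfolding sp_def Phi_image[symmetric] using geo_mono by blast

lemma sp_Delta: "sp \<Delta> = topspace M" by (simp add: sp_def Phi_image)

lemma X_Delta: "X \<Delta> = M" by (simp add: sp_Delta)

lemma topspace_X: "Q \<subseteq> \<Delta> ==> topspace (X Q) = sp Q"
	using sp_top by auto

lemma sp_Int: "Q \<subseteq> \<Delta> ==> Q' \<subseteq> \<Delta> ==> sp Q \<inter> sp Q' = sp (Q \<inter> Q')"
proof -
	assume *: "Q \<subseteq> \<Delta>" "Q' \<subseteq> \<Delta>"
	have "geo P (Q \<inter> Q') = geo P Q \<inter> geo P Q'" by (auto simp: geo_def)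
	then show ?thesis unfolding sp_def using inj_on_image_Int[OF Phi_inj geo_mono[OF *(1)] geo_mono[OF *(2)]] by simp
qed

lemma chain_Int: "Q \<subseteq> \<Delta> ==> Q' \<subseteq> \<Delta> ==> singular_chain p (X Q) c ==> singular_chain p (X Q') c ==> singular_chain p (X (Q \<inter> Q')) c"
	unfolding singular_chain_subtopology sp_Int[symmetric] by blast

lemma chain_mono: "Q \<subseteq> Q' ==> singular_chain p (X Q) c ==> singular_chain p (X Q') c"
	using singular_chain_mono sp_mono by blast

text \<open>Affine parametrisation of the simplex \<open>F\<close> by the standard simplex, with
  vertices ordered by \<open>rk\<close>.\<close>

definition lift :: "'v set => (nat => real) => 'v => real"
	where "lift F x = (%v. if v : F then x (pos rk v F) else 0)"

definition simp :: "'v set => (nat => real) => 'a"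
	where "simp F = restrict (%x. \<Phi> (lift F x)) (standard_simplex (card F - 1))"

lemma pos_less: "F : \<Delta> ==> u : F ==> rk u < rk v ==> pos rk u F < pos rk v F"
	unfolding pos_def by (rule psubset_card_mono) (use fin in auto)

lemma pos_bij: assumes F: "F : \<Delta>" shows "bij_betw (%v. pos rk v F) F {..<card F}"
proof -
	have "pos rk u F ~= pos rk v F" if "u : F" "v : F" "u ~= v" for u v
		using inj_onD[OF inj[OF F]] that pos_less[OF F that(1), of v] pos_less[OF F that(2), of u] nat_neq_iff[of "rk u" "rk v"]
		by force
	then have i: "inj_on (%v. pos rk v F) F" by (auto simp: inj_on_def)
	have "pos rk v F < card F" if "v : F" for v
		unfolding pos_def by (rule psubset_card_mono) (use fin[OF F] that in auto)
	then have "(%v. pos rk v F) ` F = {..<card F}"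
		by (intro card_subset_eq) (auto simp: card_image[OF i])
	then show ?thesis using i by (simp add: bij_betw_def)
qed

lemma lift_geo:
	assumes Q: "subc Q" and F: "F : Q" "card F = Suc p" and x: "x : standard_simplex p"
	shows "lift F x : geo P Q"
proof -
	have FD: "F : \<Delta>" using Q F by (auto simp: subc_def)
	have "{v. lift F x v ~= 0} \<subseteq> F" by (auto simp: lift_def)
	then have "{v. lift F x v ~= 0} : Q" using Q F by (auto simp: subc_def)
	moreover have "sum (lift F x) P = (\<Sum>v\<in>F. x (pos rk v F))"
		by (rule sum.mono_neutral_cong_right) (use finP subP[OF FD] in \<open>auto simp: lift_def\<close>)
	moreover have "\<dots> = sum x {..<card F}" by (rule sum.reindex_bij_betw[OF pos_bij[OF FD]])
	moreover have "\<dots> = 1" using x F(2) by (simp add: standard_simplex_def lessThan_Suc_atMost)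
	ultimately show ?thesis using x by (auto simp: geo_def lift_def standard_simplex_def)
qed

lemma cont_lift: "continuous_on S (lift F)"
proof (rule continuous_on_coordinatewise_then_product)
	fix v show "continuous_on S (%x. lift F x v)"
		unfolding lift_def by (cases "v : F") (simp_all add: continuous_on_coord)
qed

lemma powertop_eu: "subtopology (powertop_real UNIV) S = top_of_set S"
	by (simp add: euclidean_product_topology)

lemma Phi_cont_sub: "S \<subseteq> geo P \<Delta> ==> \<Phi> ` S \<subseteq> T ==> continuous_map (top_of_set S) (subtopology M T) \<Phi>"
proof -
	assume S: "S \<subseteq> geo P \<Delta>" "\<Phi> ` S \<subseteq> T"
	have "continuous_map (subtopology (top_of_set (geo P \<Delta>)) S) M \<Phi>"
		by (rule continuous_map_from_subtopology[OF Phi_cont])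
	then show ?thesis using S by (auto simp: continuous_map_in_subtopology subtopology_subtopology Int_absorb1)
qed

lemma simp_simplex:
	assumes Q: "subc Q" and F: "F : Q" "card F = Suc p"
	shows "singular_simplex p (X Q) (simp F)"
proof -
	have QD: "Q \<subseteq> \<Delta>" using Q by (auto simp: subc_def)
	have "continuous_map (top_of_set (standard_simplex p)) (top_of_set (geo P Q)) (lift F)"
		using lift_geo[OF Q F] cont_lift by (auto simp: continuous_map_in_subtopology)
	moreover have "continuous_map (top_of_set (geo P Q)) (X Q) \<Phi>"
		by (rule Phi_cont_sub) (use geo_mono[OF QD] in \<open>auto simp: sp_def\<close>)
	ultimately have "continuous_map (top_of_set (standard_simplex p)) (X Q) (\<Phi> \<circ> lift F)"
		by (rule continuous_map_compose)
	then have "continuous_map (top_of_set (standard_simplex p)) (X Q) (simp F)"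
		by (rule continuous_map_eq) (use F in \<open>auto simp: simp_def\<close>)
	then show ?thesis using F unfolding singular_simplex_def powertop_eu by (auto simp: simp_def)
qed

text \<open>Deleting \<open>v\<close> shifts exactly the positions of the vertices above it, which
  is the effect of the face map at \<open>pos rk v F\<close>.\<close>

lemma simp_face:
	assumes F: "F : \<Delta>" "card F = Suc (Suc p)" and v: "v : F"
	shows "singular_face (Suc p) (pos rk v F) (simp F) = simp (F - {v})"
proof -
	have k: "pos rk v F <= Suc p" using bij_betwE[OF pos_bij[OF F(1)]] v F(2) by force
	have c: "card (F - {v}) = Suc p" using F v fin[OF F(1)] by simp
	have leq: "lift F (simplical_face (pos rk v F) x) = lift (F - {v}) x" for x :: "nat => real"
	proof
		fix u
		show "lift F (simplical_face (pos rk v F) x) u = lift (F - {v}) x u"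
		proof (cases "u : F")
			case uF: True
			consider "u = v" | "rk u < rk v" | "rk v < rk u" "u ~= v"
				using inj_onD[OF inj[OF F(1)] _ uF v] by force
			then show ?thesis
			proof cases
				case 1 then show ?thesis using v by (simp add: lift_def simplical_face_def)
			next
				case 2
				have "{w\<in>F - {v}. rk w < rk u} = {w\<in>F. rk w < rk u}" using 2 by auto
				then have "pos rk u (F - {v}) = pos rk u F" by (simp add: pos_def)
				then show ?thesis using 2 uF pos_less[OF F(1) uF 2] by (auto simp: lift_def simplical_face_def)
			next
				case 3
				have "{w\<in>F. rk w < rk u} = insert v {w\<in>F - {v}. rk w < rk u}" using 3 v by auto
				then have "pos rk u F = Suc (pos rk u (F - {v}))" using fin[OF F(1)] by (simp add: pos_def)
				then show ?thesis using 3 uF pos_less[OF F(1) v 3(1)] by (auto simp: lift_def simplical_face_def)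
			qed
		qed (simp add: lift_def)
	qed
	have mem: "simplical_face (pos rk v F) x : standard_simplex (Suc p)" if "x : standard_simplex p" for x :: "nat => real"
		using simplical_face_in_standard_simplex[of "Suc p" "pos rk v F" x] k that by simp
	show ?thesis
	proof (rule ext)
		fix x
		show "singular_face (Suc p) (pos rk v F) (simp F) x = simp (F - {v}) x"
			unfolding singular_face_def simp_def
			by (cases "x : standard_simplex p") (simp_all add: F c leq mem)
	qed
qed

lemma bd_simp:
	assumes F: "F : \<Delta>" "card F = Suc (Suc p)"
	shows "chain_boundary (Suc p) (frag_of (simp F)) = (\<Sum>v\<in>F. frag_cmul ((-1) ^ pos rk v F) (frag_of (simp (F - {v}))))"
proof -
	have "chain_boundary (Suc p) (frag_of (simp F)) = (\<Sum>k\<in>{..<card F}. frag_cmul ((-1) ^ k) (frag_of (singular_face (Suc p) k (simp F))))"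
		by (simp add: chain_boundary_of F(2) lessThan_Suc_atMost del: sum.atMost_Suc)
	also have "\<dots> = (\<Sum>v\<in>F. frag_cmul ((-1) ^ pos rk v F) (frag_of (singular_face (Suc p) (pos rk v F) (simp F))))"
		by (rule sum.reindex_bij_betw[OF pos_bij[OF F(1)], symmetric])
	finally show ?thesis using simp_face[OF F] by simp
qed

lemma bary_simplex: "(%i. if i <= p then 1 / real (Suc p) else 0) : standard_simplex p"
	by (auto simp: standard_simplex_def field_simps)

text \<open>The barycenter is an interior point, so the support of its image recovers the
  flag.\<close>

lemma simp_inj:
	assumes "F : \<Delta>" "G : \<Delta>" "card F = Suc p" "card G = Suc p" "simp F = simp G"
	shows "F = G"
proof -
	let ?x = "%i. if i <= p then 1 / real (Suc p) else 0"
	have "\<Phi> (lift F ?x) = \<Phi> (lift G ?x)"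
		using fun_cong[OF assms(5), of ?x] bary_simplex[of p] assms by (simp add: simp_def del: of_nat_Suc)
	then have e: "lift F ?x = lift G ?x"
		using Phi_inj lift_geo[OF subc_Delta assms(1,3) bary_simplex] lift_geo[OF subc_Delta assms(2,4) bary_simplex]
		by (auto dest: inj_onD)
	have "{v. lift H ?x v ~= 0} = H" if "H : \<Delta>" "card H = Suc p" for H
		using bij_betwE[OF pos_bij[OF that(1)]] that(2) by (auto simp: lift_def)
	then show ?thesis using assms e by metis
qed

definition FS where "FS p Q = simp ` {F\<in>Q. card F = Suc p}"

lemma FS_mono: "Q \<subseteq> Q' ==> FS p Q \<subseteq> FS p Q'" by (auto simp: FS_def)

lemma FS_Int: "Q \<subseteq> \<Delta> ==> Q' \<subseteq> \<Delta> ==> FS p Q \<inter> FS p Q' \<subseteq> FS p (Q \<inter> Q')"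
	unfolding FS_def using simp_inj by blast

lemma FS_chain: "subc Q ==> keys c \<subseteq> FS p Q ==> singular_chain p (X Q) c"
	unfolding singular_chain_def FS_def using simp_simplex by blast

lemma FS_boundary:
	assumes Q: "subc Q" and c: "keys c \<subseteq> FS p Q"
	shows "keys (chain_boundary p c) \<subseteq> FS (p - 1) Q"
proof (cases p)
	case (Suc q)
	show ?thesis
	proof (rule chain_boundary_keys)
		fix s assume "s : keys c"
		then obtain F where F: "F : Q" "card F = Suc (Suc q)" "s = simp F" using c Suc by (auto simp: FS_def)
		have FD: "F : \<Delta>" using F Q by (auto simp: subc_def)
		have "F - {v} : Q" "card (F - {v}) = Suc q" if "v : F" for v
			using that F Q fin[OF FD] by (auto simp: subc_def)
		then have "keys (frag_cmul ((-1) ^ pos rk v F) (frag_of (simp (F - {v})))) \<subseteq> FS q Q" if "v : F" for v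
			using that by (auto simp: FS_def)
		then have "keys (\<Sum>v\<in>F. frag_cmul ((-1) ^ pos rk v F) (frag_of (simp (F - {v})))) \<subseteq> FS q Q"
			using Poly_Mapping.keys_sum[of "%v. frag_cmul ((-1) ^ pos rk v F) (frag_of (simp (F - {v})))" F] by blast
		then show "keys (chain_boundary p (frag_of s)) \<subseteq> FS (p - 1) Q"
			unfolding Suc F(3) bd_simp[OF FD F(2)] by simp
	qed
qed (simp add: chain_boundary_def)

text \<open>A relative formulation: for cycles it gives surjectivity on homology, for singular
  fillings of a flag cycle injectivity. In degree 0 the boundary is zero, so the truncated
  \<open>p - 1\<close> is harmless.\<close>

definition approx where "approx Q \<longleftrightarrow> (ALL p c. singular_chain p (X Q) c -->
	 keys (chain_boundary p c) \<subseteq> FS (p - 1) Q -->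
	 (EX b. singular_chain (Suc p) (X Q) b & keys (c - chain_boundary (Suc p) b) \<subseteq> FS p Q))"

lemma approxD:
	assumes "approx Q" "singular_chain p (X Q) c" "keys (chain_boundary p c) \<subseteq> FS (p - 1) Q"
	obtains b e where "singular_chain (Suc p) (X Q) b" "keys e \<subseteq> FS p Q" "c = chain_boundary (Suc p) b + e"
proof -
	obtain b where "singular_chain (Suc p) (X Q) b" "keys (c - chain_boundary (Suc p) b) \<subseteq> FS p Q"
		using assms unfolding approx_def by blast
	then show thesis by (intro that[of b "c - chain_boundary (Suc p) b"]) auto
qed

section \<open>Radial retractions\<close>

context
	fixes Q f x
	assumes Q: "subc Q" and f: "f : Q" and x: "x : geo P Q" and supp: "{v. x v ~= 0} = f"
begin

text \<open>The largest multiple of \<open>x\<close> that can be subtracted from \<open>t\<close>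
  keeping the coordinates nonnegative. On the realisation it vanishes exactly when the carrier of
  \<open>t\<close> does not contain \<open>f\<close>, and it equals 1 only at
  \<open>x\<close>.\<close>

definition mu where "mu t = Min ((%v. t v / x v) ` f)"

lemma f_ne: "f ~= {}" and f_fin: "finite f" and x_pos: "v : f ==> x v > 0" and x_0: "v \<notin> f ==> x v = 0"
	and f_P: "f \<subseteq> P" and sum_x: "sum x f = 1"
proof -
	have fD: "f : \<Delta>" using f Q by (auto simp: subc_def)
	show "finite f" "f \<subseteq> P" using fin[OF fD] subP[OF fD] .
	have "sum x P = sum x f" by (rule sum.mono_neutral_right) (use finP \<open>f \<subseteq> P\<close> supp in auto)
	then show s: "sum x f = 1" using x by (simp add: geo_def)
	then show "f ~= {}" by auto
	show "v : f ==> x v > 0" using x supp by (auto simp: geo_def order_less_le)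
	show "v \<notin> f ==> x v = 0" using supp by blast
qed

lemma mu_le: "v : f ==> mu t * x v <= t v"
proof -
	assume v: "v : f"
	have "mu t <= t v / x v" unfolding mu_def by (rule Min_le) (use f_fin v in auto)
	then show ?thesis using x_pos[OF v] by (simp add: field_simps)
qed

lemma mu_att: obtains v where "v : f" "mu t * x v = t v"
proof -
	have "mu t : (%v. t v / x v) ` f" unfolding mu_def by (rule Min_in) (use f_fin f_ne in auto)
	then obtain v where "v : f" "mu t = t v / x v" by auto
	then show thesis using that x_pos[of v] by simp
qed

lemma mu_nonneg: "(!!v. 0 <= t v) ==> 0 <= mu t"
proof -
	assume t: "!!v. 0 <= t v"
	obtain v where v: "v : f" "mu t * x v = t v" by (rule mu_att)
	then show ?thesis using t[of v] x_pos[OF v(1)] by (metis mult_neg_pos not_le)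
qed

lemma mu_le_1: assumes t: "t : geo P \<Delta>" shows "mu t <= 1" "mu t = 1 ==> t = x"
proof -
	have "sum t f <= sum t P" by (rule sum_mono2) (use finP f_P t in \<open>auto simp: geo_def\<close>)
	then have tf: "sum t f <= 1" using t by (simp add: geo_def)
	have "mu t = (\<Sum>v\<in>f. mu t * x v)" by (simp add: sum_x flip: sum_distrib_left)
	also have "\<dots> <= sum t f" by (rule sum_mono) (rule mu_le)
	finally show "mu t <= 1" using tf by simp
	assume m1: "mu t = 1"
	have le: "x v <= t v" for v
		using mu_le[of v t] m1 x_0[of v] t by (cases "v : f") (auto simp: geo_def)
	have "(\<Sum>v\<in>P. t v - x v) = 0" using t x by (simp add: geo_def sum_subtractf)
	then have "ALL v:P. t v - x v = 0" by (subst (asm) sum_nonneg_eq_0_iff) (use finP le in auto)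
	moreover have "t v = 0 & x v = 0" if "v \<notin> P" for v
		using that t x_0[of v] f_P subP by (fastforce simp: geo_def)
	ultimately show "t = x" by (auto simp: fun_eq_iff)
qed

lemma mu_0: assumes "t : geo P \<Delta>" shows "mu t = 0 \<longleftrightarrow> ~ f \<subseteq> {v. t v ~= 0}"
proof
	assume "mu t = 0"
	moreover obtain v where "v : f" "mu t * x v = t v" by (rule mu_att)
	ultimately show "~ f \<subseteq> {v. t v ~= 0}" by auto
next
	assume "~ f \<subseteq> {v. t v ~= 0}"
	then obtain v where "v : f" "t v = 0" by auto
	then have "mu t * x v <= 0" using mu_le[of v t] by simp
	then have "mu t <= 0" using x_pos[OF \<open>v : f\<close>] by (simp add: mult_le_0_iff)
	then show "mu t = 0" using mu_nonneg[of t] assms by (auto simp: geo_def)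
qed

text \<open>Radial deformation away from \<open>x\<close>: the fraction \<open>s\<close> of the
  multiple \<open>mu t\<close> of \<open>x\<close> is removed and the coordinates are rescaled to
  sum 1. At \<open>s = 1\<close> some coordinate in \<open>f\<close> becomes zero, and points with
  \<open>mu t = 0\<close> never move.\<close>

definition push where "push s t = (%v. (t v - s * mu t * x v) / (1 - s * mu t))"

definition R where "R = {g\<in>Q. ~ f \<subseteq> g}"

lemma R_subc: "subc R" using Q by (auto simp: R_def subc_def)

lemma cont_mu: "continuous_on S mu"
	unfolding mu_def
	by (rule continuous_on_Min[OF f_fin f_ne])
		 (intro continuous_on_divide continuous_on_coord continuous_on_const, use x_pos in force)

lemma push_geo:
	assumes t: "t : geo P Q" "t ~= x" and s: "0 <= s" "s <= 1"
	shows "push s t : geo P Q" "push s t ~= x" "s * mu t < 1"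
proof -
	have tD: "t : geo P \<Delta>" using t geo_mono[of Q \<Delta>] Q by (auto simp: subc_def)
	have m: "0 <= mu t" "mu t < 1"
		using mu_nonneg[of t] mu_le_1[OF tD] t by (auto simp: geo_def order_less_le)
	show sm: "s * mu t < 1" using m s by (meson le_less_trans mult_left_le_one_le)
	have nn: "0 <= t v - s * mu t * x v" for v
	proof (cases "v : f")
		case True
		have "s * (mu t * x v) <= mu t * x v" using s m x_pos[OF True] by (simp add: mult_left_le_one_le)
		then show ?thesis using mu_le[OF True, of t] by (simp add: mult.assoc)
	qed (use x_0 t in \<open>auto simp: geo_def\<close>)
	have "{v. push s t v ~= 0} \<subseteq> {v. t v ~= 0}"
	proof (rule subsetI, rule ccontr)
		fix v assume v: "v : {v. push s t v ~= 0}" "v \<notin> {v. t v ~= 0}"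
		then have "mu t ~= 0" "x v ~= 0" by (auto simp: push_def)
		then have "f \<subseteq> {v. t v ~= 0}" "v : f" using mu_0[OF tD] x_0 by blast+
		then show False using v by blast
	qed
	then have "{v. push s t v ~= 0} : Q" using t Q by (auto simp: geo_def subc_def)
	moreover have "sum (push s t) P = 1"
		using t x sm by (simp add: push_def geo_def sum_subtractf flip: sum_divide_distrib sum_distrib_left)
	ultimately show "push s t : geo P Q" using nn sm by (auto simp: geo_def push_def)
	show "push s t ~= x"
	proof
		assume e: "push s t = x"
		have "t v = x v" for v using fun_cong[OF e, of v] sm by (simp add: push_def field_simps)
		then show False using t by auto
	qed
qed

lemma push_1: assumes t: "t : geo P Q" "t ~= x" shows "push 1 t : geo P R"
proof -
	obtain v where v: "v : f" "mu t * x v = t v" by (rule mu_att)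
	then have "push 1 t v = 0" by (simp add: push_def)
	then show ?thesis using push_geo(1)[OF t, of 1] v(1) by (auto simp: geo_def R_def)
qed

lemma push_R: assumes t: "t : geo P R" shows "push s t = t"
proof -
	have "t : geo P \<Delta>" using t geo_mono[of R \<Delta>] R_subc by (auto simp: subc_def)
	then have "mu t = 0" using mu_0[of t] t by (auto simp: geo_def R_def)
	then show ?thesis by (simp add: push_def)
qed

lemma x_notin_R: "x \<notin> geo P R" using supp by (auto simp: geo_def R_def)

abbreviation Y where "Y \<equiv> subtopology M (sp Q - {\<Phi> x})"

lemma xD: "x : geo P \<Delta>" using x geo_mono[of Q \<Delta>] Q by (auto simp: subc_def)

lemma spR_sub: "sp R \<subseteq> sp Q - {\<Phi> x}"
proof -
	have "\<Phi> x \<notin> sp R" using sp_iff[of R x] R_subc xD x_notin_R by (auto simp: subc_def)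
	then show ?thesis using sp_mono[of R Q] by (auto simp: R_def)
qed

lemma Y_iff: "y : sp Q - {\<Phi> x} \<longleftrightarrow> y : topspace M & \<Psi> y : geo P Q & \<Psi> y ~= x"
proof -
	have QD: "Q \<subseteq> \<Delta>" using Q by (auto simp: subc_def)
	show ?thesis
		using sp_iff[OF QD, of "\<Psi> y"] Psi_in[of y] Phi_Psi[of y] sp_top[OF QD] Psi_Phi[OF xD] by auto
qed

lemma push_cont: "continuous_on ({0..1} \<times> (geo P Q - {x})) (%(s,t). push s t)"
proof -
	have pr: "continuous_on S (%z. snd z v)" for S :: "(real \<times> ('v => real)) set" and v
		by (rule continuous_on_coord_snd)
	have m: "continuous_on S (%z. mu (snd z))" for S :: "(real \<times> ('v => real)) set"
		by (rule continuous_on_compose2[OF cont_mu[of UNIV] continuous_on_snd[OF continuous_on_id]]) auto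
	have "continuous_on ({0..1} \<times> (geo P Q - {x})) (%z. push (fst z) (snd z) v)" for v
		unfolding push_def
		by (intro continuous_intros pr m) (use push_geo(3) in force)
	then have "continuous_on ({0..1} \<times> (geo P Q - {x})) (%z. push (fst z) (snd z))"
		by (rule continuous_on_coordinatewise_then_product)
	then show ?thesis by (simp add: case_prod_unfold)
qed

text \<open>The homotopy is recorded as preserving \<open>sp R\<close> throughout, so that it acts
  on chains relative to \<open>sp R\<close>.\<close>

lemma push_homotopic: "homotopic_with (%h. h : sp R \<rightarrow> sp R) Y Y id (%y. \<Phi> (push 1 (\<Psi> y)))"
proof -
	let ?G = "geo P Q - {x}"
	have QD: "Q \<subseteq> \<Delta>" using Q by (auto simp: subc_def)
	have GD: "?G \<subseteq> geo P \<Delta>" using geo_mono[OF QD] by auto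
	have tY: "topspace Y = sp Q - {\<Phi> x}" using sp_top[OF QD] by auto
	have psi: "continuous_map Y (top_of_set ?G) \<Psi>"
	proof -
		have "continuous_map Y euclidean \<Psi>"
			using Psi_cont continuous_map_from_subtopology continuous_map_into_fulltopology by blast
		then show ?thesis using Y_iff unfolding continuous_map_in_subtopology tY by auto
	qed
	have 1: "continuous_map (prod_topology (top_of_set {0..1::real}) Y) (top_of_set ({0..1} \<times> ?G)) (%z. (fst z, \<Psi> (snd z)))"
		unfolding prod_topology_subtopology_eu[symmetric]
		by (intro continuous_map_pairedI continuous_map_fst continuous_map_compose[OF continuous_map_snd psi, unfolded o_def])
	have 2: "continuous_map (top_of_set ({0..1} \<times> ?G)) (top_of_set ?G) (%(s,t). push s t)"
		unfolding continuous_map_in_subtopology using push_cont push_geo by auto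
	have 3: "continuous_map (top_of_set ?G) Y \<Phi>"
	proof (rule Phi_cont_sub[OF GD])
		show "\<Phi> ` ?G \<subseteq> sp Q - {\<Phi> x}" using Phi_inj xD GD by (auto simp: sp_def dest: inj_onD)
	qed
	have c: "continuous_map (prod_topology (top_of_set {0..1::real}) Y) Y (%(s,y). \<Phi> (push s (\<Psi> y)))"
		using continuous_map_compose[OF continuous_map_compose[OF 1 2] 3] by (simp add: o_def case_prod_unfold)
	have onR: "\<Phi> (push s (\<Psi> y)) = y" if "y : sp R" for s y
	proof -
		have RD: "R \<subseteq> \<Delta>" using R_subc by (auto simp: subc_def)
		have y: "y : topspace M" using that sp_top[OF RD] by auto
		have "\<Psi> y : geo P R" using sp_iff[OF RD Psi_in[OF y]] Phi_Psi[OF y] that by simp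
		then show ?thesis using push_R Phi_Psi[OF y] by simp
	qed
	have 0: "\<Phi> (push 0 (\<Psi> y)) = y" if "y : topspace Y" for y
		using that Phi_Psi[of y] tY Y_iff by (auto simp: push_def)
	have "homotopic_with (%h. h : sp R \<rightarrow> sp R) Y Y (%y. \<Phi> (push 0 (\<Psi> y))) (%y. \<Phi> (push 1 (\<Psi> y)))"
		unfolding homotopic_with_def
		by (rule exI[of _ "%(s,y). \<Phi> (push s (\<Psi> y))"]) (use c onR in auto)
	then show ?thesis
	proof (rule homotopic_with_eq)
		show "id y = \<Phi> (push 0 (\<Psi> y))" if "y : topspace Y" for y using 0[OF that] by simp
		fix h k :: "'a => 'a" assume e: "!!y. y : topspace Y ==> h y = k y"
		have "h y = k y" if "y : sp R" for y
		proof (rule e)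
			show "y : topspace Y" unfolding tY using that spR_sub by blast
		qed
		then show "(h : sp R \<rightarrow> sp R) = (k : sp R \<rightarrow> sp R)" by (auto simp: Pi_iff)
	qed simp
qed

text \<open>The deformation preserves \<open>sp R\<close> and ends inside it, so relative homotopy
  invariance compares \<open>c\<close> with its image, a chain of \<open>sp R\<close>.\<close>

lemma retract_rel:
	assumes c: "singular_chain p Y c" "singular_chain (p - 1) (X R) (chain_boundary p c)"
	obtains d e where "singular_chain (Suc p) Y d" "singular_chain p (X R) e" "c = chain_boundary (Suc p) d + e"
proof -
	have QD: "Q \<subseteq> \<Delta>" using Q by (auto simp: subc_def)
	have XR: "subtopology Y (sp R) = X R"
		using spR_sub by (simp add: subtopology_subtopology Int_absorb1)
	have rc: "singular_relcycle p Y (sp R) c" using c by (simp add: singular_relcycle XR)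
	let ?r = "%y. \<Phi> (push 1 (\<Psi> y))"
	have "homologous_rel p Y (sp R) (chain_map p id c) (chain_map p ?r c)"
		by (rule homotopic_imp_homologous_rel_chain_maps[OF push_homotopic rc])
	then have "homologous_rel p Y (sp R) c (chain_map p ?r c)"
		using chain_map_ident[OF c(1)] by simp
	then obtain d e where d: "singular_chain (Suc p) Y d" "singular_chain p (X R) e" "chain_boundary (Suc p) d + e = c - chain_map p ?r c"
		unfolding homologous_rel_def singular_relboundary XR by blast
	have "continuous_map Y (X R) ?r"
	proof -
		have "continuous_map Y Y ?r" using homotopic_with_imp_continuous_maps[OF push_homotopic] by blast
		then have "continuous_map Y M ?r" by (simp add: continuous_map_in_subtopology)
		moreover have "?r y : sp R" if "y : topspace Y" for y
			using that push_1[of "\<Psi> y"] Y_iff[of y] by (auto simp: sp_def)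
		ultimately show ?thesis by (auto simp: continuous_map_in_subtopology)
	qed
	then have r: "singular_chain p (X R) (chain_map p ?r c)" by (rule singular_chain_chain_map[OF c(1)])
	show thesis
		by (rule that[OF d(1) singular_chain_add[OF d(2) r]]) (use d(3) in \<open>simp add: algebra_simps\<close>)
qed

end

section \<open>Flag chains compute singular homology\<close>

text \<open>Mayer-Vietoris at chain level for the subcomplexes \<open>Q - {f}\<close> and
  \<open>Pow f\<close>, where \<open>f\<close> is a facet. Puncturing \<open>f\<close> at its
  barycenter provides an open set; excision compares the punctured pairs, and radial retractions
  push everything off the barycenter back into the subcomplexes.\<close>

lemma excision_max:
	assumes Q: "subc Q" and f: "f : Q" "f ~= {}" and max: "!!g. g : Q ==> f \<subseteq> g ==> g = f"
		and c: "singular_chain (Suc p) (X Q) c" "chain_boundary (Suc p) c = a + b"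
			"singular_chain p (X (Q - {f})) a" "singular_chain p (X (Pow f)) b"
	obtains d a' b' where "singular_chain (Suc (Suc p)) (X Q) d" "singular_chain (Suc p) (X (Q - {f})) a'"
		"singular_chain (Suc p) (X (Pow f)) b'" "c = chain_boundary (Suc (Suc p)) d + a' + b'"
proof -
	have QD: "Q \<subseteq> \<Delta>" and fD: "f : \<Delta>" using Q f by (auto simp: subc_def)
	have fP: "f \<subseteq> P" "finite f" using subP[OF fD] fin[OF fD] .
	define x where "x = (%v. if v : f then 1 / real (card f) else 0)"
	have suppx: "{v. x v ~= 0} = f" using fP f by (auto simp: x_def card_eq_0_iff)
	have "sum x P = sum x f" by (rule sum.mono_neutral_right) (use finP fP in \<open>auto simp: x_def\<close>)
	also have "\<dots> = 1" using fP f by (simp add: x_def)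
	finally have xQ: "x : geo P Q" using suppx f by (auto simp: geo_def x_def)
	have Pf: "subc (Pow f)" using down[OF fD] by (auto simp: subc_def)
	have PfQ: "Pow f \<subseteq> Q" using Q f by (auto simp: subc_def)
	have xPf: "x : geo P (Pow f)" using xQ suppx by (auto simp: geo_def)
	have fPf: "f : Pow f" by simp
	let ?Q = "Q - {f}" and ?B = "Pow f - {f}"
	have RQ: "R Q f = ?Q" unfolding R_def[OF Q f(1) xQ suppx] using max by blast
	have RP: "R (Pow f) f = ?B" unfolding R_def[OF Pf fPf xPf suppx] by blast
	have BQ: "?B = ?Q \<inter> Pow f" using PfQ by blast
	let ?y = "\<Phi> x"
	let ?m = "mu f x"
	note muQ = mu_0[OF Q f(1) xQ suppx] mu_le_1[OF Q f(1) xQ suppx] cont_mu[OF Q f(1) xQ suppx]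
	let ?Z = "X Q" and ?T = "sp Q - {?y}" and ?U = "sp Q - sp (Pow f)"
	have tZ: "topspace ?Z = sp Q" by (rule topspace_X[OF QD])
	have psi: "\<Psi> y : geo P Q" "\<Psi> y : geo P \<Delta>" "\<Phi> (\<Psi> y) = y" if "y : sp Q" for y
	proof -
		have y: "y : topspace M" using that sp_top[OF QD] by auto
		show 1: "\<Psi> y : geo P \<Delta>" "\<Phi> (\<Psi> y) = y" using Psi_in[OF y] Phi_Psi[OF y] .
		show "\<Psi> y : geo P Q" using sp_iff[OF QD 1(1)] 1(2) that by simp
	qed
	have cm: "continuous_map ?Z euclideanreal (%y. ?m (\<Psi> y))"
	proof -
		have "continuous_map ?Z euclidean \<Psi>"
			using Psi_cont continuous_map_from_subtopology continuous_map_into_fulltopology by blast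
		moreover have "continuous_map euclidean euclideanreal ?m" using muQ(4)[of UNIV] by simp
		ultimately show ?thesis using continuous_map_compose[of ?Z euclidean \<Psi> euclideanreal ?m] by (simp add: o_def)
	qed
	have spQ': "sp ?Q = {y\<in>topspace ?Z. ?m (\<Psi> y) : {0}}"
	proof -
		have "y : sp ?Q \<longleftrightarrow> ?m (\<Psi> y) = 0" if "y : sp Q" for y
		proof -
			have "y : sp ?Q \<longleftrightarrow> \<Psi> y : geo P ?Q" using sp_iff[of ?Q "\<Psi> y"] QD psi[OF that] by auto
			also have "\<dots> \<longleftrightarrow> {v. \<Psi> y v ~= 0} ~= f" using psi(1)[OF that] by (auto simp: geo_def)
			also have "\<dots> \<longleftrightarrow> ~ f \<subseteq> {v. \<Psi> y v ~= 0}" using psi(1)[OF that] max by (auto simp: geo_def)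
			finally show ?thesis using muQ(1)[OF psi(2)[OF that]] by simp
		qed
		then show ?thesis using sp_mono[of ?Q Q] tZ by auto
	qed
	have T: "?T = {y\<in>topspace ?Z. ?m (\<Psi> y) : {..<1}}"
	proof -
		have "y ~= ?y \<longleftrightarrow> ?m (\<Psi> y) < 1" if "y : sp Q" for y
		proof
			assume "y ~= ?y"
			then have "\<Psi> y ~= x" using psi(3)[OF that] by auto
			then show "?m (\<Psi> y) < 1" using muQ(2,3)[OF psi(2)[OF that]] by force
		next
			assume l: "?m (\<Psi> y) < 1"
			have "?m x = 1"
			proof -
				have "(%v. x v / x v) ` f = {1}" using suppx f by auto
				then show ?thesis unfolding mu_def[OF Q f(1) xQ suppx] by simp
			qed
			moreover have "\<Psi> ?y = x" using Psi_Phi xQ geo_mono[OF QD] by blast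
			ultimately show "y ~= ?y" using l by auto
		qed
		then show ?thesis using tZ by auto
	qed
	have clQ: "closedin ?Z (sp ?Q)" unfolding spQ' by (rule closedin_continuous_map_preimage[OF cm]) simp
	have opT: "openin ?Z ?T" unfolding T by (rule openin_continuous_map_preimage[OF cm]) simp
	have UQ: "?U \<subseteq> sp ?Q"
	proof
		fix y assume y: "y : ?U"
		have "{v. \<Psi> y v ~= 0} ~= f"
		proof
			assume "{v. \<Psi> y v ~= 0} = f"
			then have "\<Psi> y : geo P (Pow f)" using psi(1)[of y] y by (auto simp: geo_def)
			then have "y : sp (Pow f)" using psi(3)[of y] y unfolding sp_def by (metis DiffE imageI)
			then show False using y by blast
		qed
		then have "\<Psi> y : geo P ?Q" using psi(1)[of y] y by (auto simp: geo_def)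
		then show "y : sp ?Q" using psi(3)[of y] y unfolding sp_def by (metis DiffE imageI)
	qed
	have "?Z closure_of ?U \<subseteq> sp ?Q" by (rule closure_of_minimal[OF UQ clQ])
	also have "\<dots> \<subseteq> ?T" unfolding spQ' T by auto
	also have "?T = ?Z interior_of ?T" using opT by (simp add: interior_of_openin)
	finally have cl: "?Z closure_of ?U \<subseteq> ?Z interior_of ?T" .
	have sub: "?T \<subseteq> sp Q" by blast
	have SU: "sp Q - ?U = sp (Pow f)" using sp_mono[OF PfQ] by blast
	have TU: "?T - ?U = sp (Pow f) - {?y}" using sp_mono[OF PfQ] by blast
	have ZP: "subtopology ?Z (sp (Pow f)) = X (Pow f)"
		using sp_mono[OF PfQ] by (simp add: subtopology_subtopology Int_absorb1)
	have ZQ: "subtopology ?Z (sp Q) = ?Z" by (simp add: subtopology_subtopology)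
	let ?S = "sp (Pow f) - {?y}"
	have iso: "hom_induced q (X (Pow f)) ?S ?Z ?T id : iso (relative_homology_group q (X (Pow f)) ?S) (relative_homology_group q ?Z ?T)" for q
		using homology_excision_axiom[OF cl sub, of q] unfolding SU TU ZP ZQ .
	have cid: "continuous_map (X (Pow f)) ?Z id" "id : ?S \<rightarrow> ?T"
		using sp_mono[OF PfQ] by (auto simp: continuous_map_in_subtopology continuous_map_from_subtopology)
	have ind: "hom_induced (int q) (X (Pow f)) ?S ?Z ?T id (homologous_rel_set q (X (Pow f)) ?S u) = homologous_rel_set q ?Z ?T u"
		if "singular_relcycle q (X (Pow f)) ?S u" for q u
	proof -
		have "chain_map q id u = u" using that chain_map_ident by (auto simp: singular_relcycle)
		then show ?thesis using hom_induced_chain_map[OF cid that] by simp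
	qed
	have surj: "EX u. singular_relcycle q (X (Pow f)) ?S u & homologous_rel q ?Z ?T w u"
		if w: "singular_relcycle q ?Z ?T w" for q w
	proof -
		have "homologous_rel_set q ?Z ?T w : carrier (relative_homology_group (int q) ?Z ?T)"
			using w by (auto simp: carrier_relative_homology_group)
		moreover have im: "hom_induced (int q) (X (Pow f)) ?S ?Z ?T id ` carrier (relative_homology_group (int q) (X (Pow f)) ?S)
				= carrier (relative_homology_group (int q) ?Z ?T)"
			using iso[of "int q"] unfolding iso_def bij_betw_def by blast
		ultimately have "homologous_rel_set q ?Z ?T w \<in>
				hom_induced (int q) (X (Pow f)) ?S ?Z ?T id ` carrier (relative_homology_group (int q) (X (Pow f)) ?S)"
			by (simp only: im)
		then obtain C where C: "homologous_rel_set q ?Z ?T w = hom_induced (int q) (X (Pow f)) ?S ?Z ?T id C"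
			"C : carrier (relative_homology_group (int q) (X (Pow f)) ?S)" by (rule imageE)
		obtain u where u: "C = homologous_rel_set q (X (Pow f)) ?S u" "u : singular_relcycle_set q (X (Pow f)) ?S"
			using C(2) unfolding carrier_relative_homology_group by (rule imageE)
		have u: "singular_relcycle q (X (Pow f)) ?S u" "C = homologous_rel_set q (X (Pow f)) ?S u" using u by auto
		have "homologous_rel_set q ?Z ?T w = homologous_rel_set q ?Z ?T u" unfolding C(1) u(2) by (rule ind[OF u(1)])
		then show ?thesis using u(1) homologous_rel_set_eq by blast
	qed
	have injt: "homologous_rel q (X (Pow f)) ?S u 0"
		if u: "singular_relcycle q (X (Pow f)) ?S u" "homologous_rel q ?Z ?T u 0" for q u
	proof -
		let ?h = "hom_induced (int q) (X (Pow f)) ?S ?Z ?T id"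
		have "?h (homologous_rel_set q (X (Pow f)) ?S u) = ?h (homologous_rel_set q (X (Pow f)) ?S 0)"
			using ind[OF u(1)] ind[of q 0] u(2) by (simp add: homologous_rel_set_eq)
		moreover have "inj_on ?h (carrier (relative_homology_group (int q) (X (Pow f)) ?S))"
			using iso[of "int q"] unfolding iso_def bij_betw_def by blast
		moreover have "homologous_rel_set q (X (Pow f)) ?S u : carrier (relative_homology_group (int q) (X (Pow f)) ?S)"
			"homologous_rel_set q (X (Pow f)) ?S 0 : carrier (relative_homology_group (int q) (X (Pow f)) ?S)"
			unfolding carrier_relative_homology_group using u(1) singular_relcycle_0 by blast+
		ultimately have "homologous_rel_set q (X (Pow f)) ?S u = homologous_rel_set q (X (Pow f)) ?S 0"
			by (meson inj_onD)
		then show ?thesis using homologous_rel_set_eq by blast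
	qed
	have YS: "subtopology (X (Pow f)) ?S = subtopology M ?S"
		by (simp add: subtopology_subtopology Int_absorb1)
	have YT: "subtopology ?Z ?T = subtopology M ?T"
		by (simp add: subtopology_subtopology Int_absorb1)
	have QT: "sp ?Q \<subseteq> ?T" using spR_sub[OF Q f(1) xQ suppx] unfolding RQ .
	have BS: "sp ?B \<subseteq> ?S" using spR_sub[OF Pf fPf xPf suppx] unfolding RP .
	have QT': "sp ?Q \<subseteq> sp Q" by (rule sp_mono) auto
	note retQ = retract_rel[OF Q f(1) xQ suppx, unfolded RQ] and retP = retract_rel[OF Pf fPf xPf suppx, unfolded RP]
	\<comment> \<open>first make the boundary of \<open>c\<close> avoid the interior of \<open>f\<close> \<close>
	have db: "singular_chain (p - 1) (X ?B) (chain_boundary p b)"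
	proof -
		have "chain_boundary p (a + b) = 0"
			using chain_boundary_boundary_alt[OF c(1)] c(2) by simp
		then have ba: "chain_boundary p b = - chain_boundary p a" by (simp add: chain_boundary_add eq_neg_iff_add_eq_0 add.commute)
		have "singular_chain (p - 1) (X (Pow f)) (chain_boundary p b)" using singular_chain_boundary[OF c(4)] by simp
		moreover have "singular_chain (p - 1) (X ?Q) (chain_boundary p b)"
			unfolding ba singular_chain_minus using singular_chain_boundary[OF c(3)] by simp
		ultimately have "singular_chain (p - 1) (X (?Q \<inter> Pow f)) (chain_boundary p b)"
			by (intro chain_Int) (use QD PfQ in auto)
		then show ?thesis unfolding BQ .
	qed
	have rb: "singular_relcycle p (X (Pow f)) ?S b"
		unfolding singular_relcycle YS using c(4) singular_chain_mono[OF db BS] by simp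
	\<comment> \<open>The chain \<open>c\<close> itself bounds \<open>b\<close> modulo
	  \<open>a\<close>, which lies off the barycenter.\<close>
	have "homologous_rel p ?Z ?T b 0"
	proof -
		have "singular_chain p (subtopology ?Z ?T) (- a)"
			unfolding YT singular_chain_minus by (rule singular_chain_mono[OF c(3) QT])
		then have "singular_relboundary p ?Z ?T b"
			unfolding singular_relboundary using c(1,2)
			by (intro exI[of _ c] exI[of _ "- a"]) simp
		then show ?thesis by (simp add: homologous_rel_def)
	qed
	then have "homologous_rel p (X (Pow f)) ?S b 0" by (rule injt[OF rb])
	then obtain b2 d where b2: "singular_chain (Suc p) (X (Pow f)) b2" "singular_chain p (subtopology M ?S) d"
		"b = chain_boundary (Suc p) b2 + d"
		unfolding homologous_rel_def singular_relboundary YS by auto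
	have "chain_boundary p d = chain_boundary p b"
		unfolding b2(3) chain_boundary_add using chain_boundary_boundary_alt[OF b2(1)] by simp
	then have "singular_chain (p - 1) (X ?B) (chain_boundary p d)" using db by simp
	from retP[OF b2(2) this] obtain d' d'' where d': "singular_chain (Suc p) (subtopology M ?S) d'"
		"singular_chain p (X ?B) d''" "d = chain_boundary (Suc p) d' + d''" by blast
	have d'P: "singular_chain (Suc p) (X (Pow f)) d'" by (rule singular_chain_mono[OF d'(1)]) blast
	\<comment> \<open>The boundary of \<open>c1\<close> is carried by \<open>?Q\<close>, so
	  \<open>c1\<close> is a relative cycle of the punctured pair and surjectivity of the excision map
	  applies.\<close>
	define c1 where "c1 = c - b2 - d'"
	have c1: "singular_chain (Suc p) ?Z c1"
		unfolding c1_def by (intro singular_chain_diff c(1) chain_mono[OF PfQ b2(1)] chain_mono[OF PfQ d'P])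
	have bc1: "chain_boundary (Suc p) c1 = a + d''"
		unfolding c1_def chain_boundary_diff c(2) b2(3) d'(3) by simp
	have bc1Q: "singular_chain p (X ?Q) (chain_boundary (Suc p) c1)"
		unfolding bc1 by (intro singular_chain_add c(3) chain_mono[OF _ d'(2)]) (auto simp: BQ)
	have "singular_relcycle (Suc p) ?Z ?T c1"
		unfolding singular_relcycle YT using c1 singular_chain_mono[OF bc1Q QT] by simp
	from surj[OF this] obtain u where u: "singular_relcycle (Suc p) (X (Pow f)) ?S u" "homologous_rel (Suc p) ?Z ?T c1 u" by blast
	obtain e w where ew: "singular_chain (Suc (Suc p)) ?Z e" "singular_chain (Suc p) (subtopology M ?T) w"
		"chain_boundary (Suc (Suc p)) e + w = c1 - u"
		using u(2) unfolding homologous_rel_def singular_relboundary YT by blast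
	have uc: "singular_chain (Suc p) (X (Pow f)) u" "singular_chain p (subtopology M ?S) (chain_boundary (Suc p) u)"
		using u(1) unfolding singular_relcycle YS by auto
	have "chain_boundary p (chain_boundary (Suc p) u) = 0" using chain_boundary_boundary_alt[OF uc(1)] .
	then have "singular_chain (p - 1) (X ?B) (chain_boundary p (chain_boundary (Suc p) u))" by simp
	from retP[OF uc(2) this] obtain g h where gh: "singular_chain (Suc p) (subtopology M ?S) g" "singular_chain p (X ?B) h"
		"chain_boundary (Suc p) u = chain_boundary (Suc p) g + h" by blast
	have gP: "singular_chain (Suc p) (X (Pow f)) g" by (rule singular_chain_mono[OF gh(1)]) blast
	have gT: "singular_chain (Suc p) (subtopology M ?T) g" by (rule singular_chain_mono[OF gh(1)]) (use sp_mono[OF PfQ] in blast)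
	\<comment> \<open>Adding \<open>g\<close> to the remainder \<open>w\<close> brings its boundary
	  into \<open>?Q\<close>, so that it can be retracted as well; \<open>g\<close> is returned to the
	  part in \<open>Pow f\<close>.\<close>
	have w': "singular_chain (Suc p) (subtopology M ?T) (w + g)" by (rule singular_chain_add[OF ew(2) gT])
	have "chain_boundary (Suc p) (w + g) = chain_boundary (Suc p) c1 - h"
	proof -
		have "chain_boundary (Suc p) (c1 - u) = chain_boundary (Suc p) w"
			unfolding ew(3)[symmetric] chain_boundary_add using chain_boundary_boundary_alt[OF ew(1)] by simp
		then show ?thesis unfolding chain_boundary_add chain_boundary_diff using gh(3) by (simp add: algebra_simps)
	qed
	moreover have "singular_chain p (X ?Q) (chain_boundary (Suc p) c1 - h)"
		by (intro singular_chain_diff bc1Q chain_mono[OF _ gh(2)]) (auto simp: BQ)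
	ultimately have "singular_chain (Suc p - 1) (X ?Q) (chain_boundary (Suc p) (w + g))" by simp
	from retQ[OF w' this] obtain k l where kl: "singular_chain (Suc (Suc p)) (subtopology M ?T) k" "singular_chain (Suc p) (X ?Q) l"
		"w + g = chain_boundary (Suc (Suc p)) k + l" by blast
	have kQ: "singular_chain (Suc (Suc p)) ?Z k" by (rule singular_chain_mono[OF kl(1)]) blast
	show thesis
	proof (rule that[of "e + k" l "u - g + b2 + d'"])
		show "singular_chain (Suc (Suc p)) (X Q) (e + k)" by (rule singular_chain_add[OF ew(1) kQ])
		show "singular_chain (Suc p) (X (Pow f)) (u - g + b2 + d')"
			by (intro singular_chain_add singular_chain_diff uc(1) gP b2(1) d'P)
		have "c = c1 + b2 + d'" by (simp add: c1_def)
		also have "c1 = chain_boundary (Suc (Suc p)) e + (w + g) + (u - g)" using ew(3) by (simp add: algebra_simps)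
		finally show "c = chain_boundary (Suc (Suc p)) (e + k) + l + (u - g + b2 + d')"
			unfolding kl(3) chain_boundary_add by (simp add: algebra_simps)
	qed (rule kl(2))
qed

lemma frag_linear_eq:
	fixes F G :: "('s \<Rightarrow>\<^sub>0 int) => ('t \<Rightarrow>\<^sub>0 int)"
	assumes "!!a b. F (a - b) = F a - F b" "!!a b. G (a - b) = G a - G b"
		and "!!s. s : A ==> F (frag_of s) = G (frag_of s)" "keys c \<subseteq> A"
	shows "F c = G c"
	using assms(4)
proof (induction c rule: frag_induction)
	case zero
	show ?case using assms(1)[of 0 0] assms(2)[of 0 0] by simp
qed (use assms in auto)

text \<open>The simplicial cone with apex \<open>v\<close> on flag chains of the simplex
  \<open>f\<close>. The flag is recovered from its singular simplex by description; flags through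
  the apex are sent to 0.\<close>

definition cone where "cone f v q = frag_extend (%s. if EX F. F \<subseteq> f & v \<notin> F & card F = Suc q & s = simp F
	 then frag_of (simp (insert v (THE F. F \<subseteq> f & v \<notin> F & card F = Suc q & s = simp F))) else 0)"

lemma cone_simp:
	assumes f: "f : \<Delta>" and F: "F \<subseteq> f" "card F = Suc q"
	shows "cone f v q (frag_of (simp F)) = (if v : F then 0 else frag_of (simp (insert v F)))"
proof -
	have u: "G = F" if "G \<subseteq> f" "card G = Suc q" "simp F = simp G" for G
		using simp_inj[of F G q] down[OF f] F that by auto
	have ex: "(EX G. G \<subseteq> f & v \<notin> G & card G = Suc q & simp F = simp G) \<longleftrightarrow> v \<notin> F"
		using u F by blast
	have "(THE G. G \<subseteq> f & v \<notin> G & card G = Suc q & simp F = simp G) = F" if "v \<notin> F"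
	proof (rule the_equality)
		show "F \<subseteq> f & v \<notin> F & card F = Suc q & simp F = simp F" using F that by blast
		show "G = F" if "G \<subseteq> f & v \<notin> G & card G = Suc q & simp F = simp G" for G
			using that by (intro u) blast+
	qed
	then show ?thesis unfolding cone_def frag_extend_of ex by simp
qed

text \<open>In positive degree, the cone over the boundary of \<open>c\<close> has the same boundary
  as \<open>c\<close>, and the difference is a cycle in a contractible space: the straight-line
  contraction moves it into a point, where cycles of positive degree bound.\<close>

lemma approx_simplex:
	assumes f: "f : \<Delta>" "f ~= {}"
	shows "approx (Pow f)"
	unfolding approx_def
proof (intro allI impI)
	fix p c assume c: "singular_chain p (X (Pow f)) c" "keys (chain_boundary p c) \<subseteq> FS (p - 1) (Pow f)"
	have Pf: "subc (Pow f)" using down[OF f(1)] by (auto simp: subc_def)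
	have PD: "Pow f \<subseteq> \<Delta>" using down[OF f(1)] by auto
	have ff: "finite f" "f \<subseteq> P" using fin[OF f(1)] subP[OF f(1)] .
	\<comment> \<open>With the lowest vertex as apex the added vertex always has position 0, so coning
	  introduces no sign on the base.\<close>
	obtain v0 where v0: "v0 : f" "!!v. v : f ==> v ~= v0 ==> rk v0 < rk v"
	proof -
		have "Min (rk ` f) : rk ` f" using ff(1) f(2) by simp
		then obtain v where v: "Min (rk ` f) = rk v" "v : f" by (rule imageE)
		have v: "v : f" "!!u. u : f ==> rk v <= rk u" using v(2) ff(1) by (auto simp flip: v(1))
		then have "rk v < rk u" if "u : f" "u ~= v" for u
			using inj_onD[OF inj[OF f(1)], of u v] that v(2)[of u] v(1) by force
		then show thesis by (rule that[OF v(1)])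
	qed
	let ?d = "%v. if v = v0 then 1 else (0::real)"
	let ?k = "%y::'a. \<Phi> ?d"
	have dg: "?d : geo P (Pow f)"
		using v0(1) ff finP by (auto simp: geo_def)
	let ?Z = "X (Pow f)"
	have tZ: "topspace ?Z = sp (Pow f)" by (rule topspace_X[OF PD])
	have psi: "\<Psi> y : geo P (Pow f)" "\<Phi> (\<Psi> y) = y" if "y : sp (Pow f)" for y
	proof -
		have y: "y : topspace M" using that sp_top[OF PD] by auto
		show 2: "\<Phi> (\<Psi> y) = y" using Phi_Psi[OF y] .
		show "\<Psi> y : geo P (Pow f)" using sp_iff[OF PD Psi_in[OF y]] 2 that by simp
	qed
	have hom: "homotopic_with (%h. h : {} \<rightarrow> {}) ?Z ?Z id ?k"
	proof -
		let ?H = "%z::real \<times> ('v => real). (%v. (1 - fst z) * snd z v + fst z * ?d v)"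
		have "continuous_map ?Z euclidean \<Psi>"
			using Psi_cont continuous_map_from_subtopology continuous_map_into_fulltopology by blast
		then have ps: "continuous_map ?Z (top_of_set (geo P (Pow f))) \<Psi>"
			using psi(1) tZ by (auto simp: continuous_map_in_subtopology)
		have 1: "continuous_map (prod_topology (top_of_set {0..1::real}) ?Z) (top_of_set ({0..1} \<times> geo P (Pow f))) (%z. (fst z, \<Psi> (snd z)))"
			unfolding prod_topology_subtopology_eu[symmetric]
			by (intro continuous_map_pairedI continuous_map_fst continuous_map_compose[OF continuous_map_snd ps, unfolded o_def])
		have pr: "continuous_on S (%z. snd z v)" for S :: "(real \<times> ('v => real)) set" and v
			by (rule continuous_on_coord_snd)
		have "continuous_on S ?H" for S
			by (rule continuous_on_coordinatewise_then_product) (intro continuous_intros pr)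
		moreover have "?H (s,t) : geo P (Pow f)" if "0 <= s" "s <= 1" "t : geo P (Pow f)" for s t
		proof -
			have "sum (?H (s,t)) P = (1 - s) * sum t P + s * sum ?d P"
				by (simp only: sum.distrib sum_distrib_left fst_conv snd_conv)
			then have "sum (?H (s,t)) P = 1" using that dg by (simp add: geo_def)
			moreover have "{v. ?H (s,t) v ~= 0} \<subseteq> f" using that(3) v0(1) by (auto simp: geo_def)
			moreover have "0 <= ?H (s,t) v" for v using that by (auto simp: geo_def)
			ultimately show ?thesis by (simp add: geo_def)
		qed
		ultimately have 2: "continuous_map (top_of_set ({0..1} \<times> geo P (Pow f))) (top_of_set (geo P (Pow f))) ?H"
			unfolding continuous_map_in_subtopology by force
		have 3: "continuous_map (top_of_set (geo P (Pow f))) ?Z \<Phi>"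
			by (rule Phi_cont_sub[OF geo_mono[OF PD]]) (auto simp: sp_def)
		have "continuous_map (prod_topology (top_of_set {0..1::real}) ?Z) ?Z (%z. \<Phi> (?H (fst z, \<Psi> (snd z))))"
			using continuous_map_compose[OF continuous_map_compose[OF 1 2] 3] by (simp only: o_def)
		then have "homotopic_with (%h. h : {} \<rightarrow> {}) ?Z ?Z (%y. \<Phi> (?H (0, \<Psi> y))) (%y. \<Phi> (?H (1, \<Psi> y)))"
			unfolding homotopic_with_def by (intro exI[of _ "%z. \<Phi> (?H (fst z, \<Psi> (snd z)))"]) auto
		then show ?thesis
			by (rule homotopic_with_eq) (use psi tZ in auto)
	qed
	have toconst: "EX d. singular_chain (Suc q) ?Z d & u = chain_boundary (Suc q) d + chain_map q ?k u"
		if u: "singular_chain q ?Z u" "chain_boundary q u = 0" for q u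
	proof -
		have "singular_relcycle q ?Z {} u" using u by (simp add: singular_cycle)
		from homotopic_imp_homologous_rel_chain_maps[OF hom this]
		have "singular_relboundary q ?Z {} (u - chain_map q ?k u)"
			using chain_map_ident[OF u(1)] by (simp add: homologous_rel_def)
		then obtain d where "singular_chain (Suc q) ?Z d" "chain_boundary (Suc q) d = u - chain_map q ?k u"
			unfolding singular_boundary by blast
		then show ?thesis by (intro exI[of _ d]) simp
	qed
	let ?O = "subtopology M {\<Phi> ?d}"
	have dM: "\<Phi> ?d : topspace M" using dg geo_mono[OF PD] Phi_image by blast
	have tO: "topspace ?O = {\<Phi> ?d}" using dM by auto
	have kO: "continuous_map ?Z ?O ?k" using dM by (auto simp: continuous_map_in_subtopology)
	have OZ: "{\<Phi> ?d} \<subseteq> sp (Pow f)" using dg by (auto simp: sp_def)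
	have s0: "simplex_map 0 ?k s = simp {v0}" for s
	proof
		fix x
		show "simplex_map 0 ?k s x = simp {v0} x"
		proof (cases "x : standard_simplex 0")
			case True
			then have "lift {v0} x = ?d" by (auto simp: standard_simplex_0 lift_def pos_def fun_eq_iff)
			then show ?thesis using True by (simp add: simplex_map_def simp_def)
		qed (simp add: simplex_map_def simp_def)
	qed
	show "EX b. singular_chain (Suc p) ?Z b & keys (c - chain_boundary (Suc p) b) \<subseteq> FS p (Pow f)"
	proof (cases p)
		case 0
		\<comment> \<open>In degree 0 the constant map already sends every singular simplex to the flag
		  simplex \<open>simp {v0}\<close>.\<close>
		obtain d where d: "singular_chain (Suc 0) ?Z d" "c = chain_boundary (Suc 0) d + chain_map 0 ?k c"
			using toconst[of 0 c] c 0 by (auto simp: chain_boundary_def)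
		have "keys (chain_map 0 ?k c) \<subseteq> (\<Union>s\<in>keys c. keys ((frag_of \<circ> simplex_map 0 ?k) s))"
			unfolding chain_map_def by (rule keys_frag_extend)
		also have "\<dots> \<subseteq> {simp {v0}}" by (auto simp: s0)
		finally have "keys (chain_map 0 ?k c) \<subseteq> {simp {v0}}" .
		moreover have "simp {v0} : FS 0 (Pow f)" using v0(1) by (auto simp: FS_def)
		moreover have "c - chain_boundary (Suc 0) d = chain_map 0 ?k c" using d(2) by (simp add: algebra_simps)
		ultimately show ?thesis using d(1) 0 by (intro exI[of _ d]) auto
	next
		case (Suc q)
		let ?e = "chain_boundary p c"
		have ek: "keys ?e \<subseteq> FS q (Pow f)" using c(2) Suc by simp
		define e' where "e' = cone f v0 q ?e"
		have kc: "keys e' \<subseteq> FS p (Pow f)"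
		proof -
			have "keys (cone f v0 q (frag_of s)) \<subseteq> FS p (Pow f)" if sF: "s : FS q (Pow f)" for s
			proof -
				obtain F where F: "F \<subseteq> f" "card F = Suc q" "s = simp F" using sF by (auto simp: FS_def)
				have "finite F" using F(1) ff(1) finite_subset by blast
				then show ?thesis unfolding F(3) cone_simp[OF f(1) F(1,2)] using F v0(1) Suc by (auto simp: FS_def)
			qed
			moreover have "keys (cone f v0 q ?e) \<subseteq> (\<Union>s\<in>keys ?e. keys (cone f v0 q (frag_of s)))"
				unfolding cone_def frag_extend_of by (rule keys_frag_extend)
			ultimately show ?thesis unfolding e'_def using ek by blast
		qed
		have lin: "cone f v0 q (a - b) = cone f v0 q a - cone f v0 q b" for a b q by (simp add: cone_def frag_extend_diff)
		have pos0: "pos rk v0 F = 0" if "F \<subseteq> f" for F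
		proof -
			have "~ rk u < rk v0" if "u : F" for u using v0(2)[of u] that \<open>F \<subseteq> f\<close> by force
			then have "{u\<in>F. rk u < rk v0} = {}" by blast
			then show ?thesis by (simp only: pos_def card.empty)
		qed
		have posS: "pos rk v (insert v0 F) = Suc (pos rk v F)" if "F \<subseteq> f" "v0 \<notin> F" "v : F" for F v
		proof -
			have "{u\<in>insert v0 F. rk u < rk v} = insert v0 {u\<in>F. rk u < rk v}" using v0(2)[of v] that by blast
			moreover have "finite F" using that ff(1) finite_subset by blast
			ultimately show ?thesis using that by (simp add: pos_def)
		qed
		have coneb: "chain_boundary (Suc q) (frag_of (simp (insert v0 F))) =
				frag_of (simp F) - (\<Sum>v\<in>F. frag_cmul ((-1) ^ pos rk v F) (frag_of (simp (insert v0 (F - {v})))))"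
			if F: "F \<subseteq> f" "card F = Suc q" "v0 \<notin> F" for F q
		proof -
			have fF: "finite F" using F(1) ff(1) finite_subset by blast
			have iF: "insert v0 F : \<Delta>" "card (insert v0 F) = Suc (Suc q)" using down[OF f(1)] F v0(1) fF by auto
			have "chain_boundary (Suc q) (frag_of (simp (insert v0 F))) =
				 frag_cmul ((-1) ^ pos rk v0 (insert v0 F)) (frag_of (simp (insert v0 F - {v0}))) +
				 (\<Sum>v\<in>F. frag_cmul ((-1) ^ pos rk v (insert v0 F)) (frag_of (simp (insert v0 F - {v}))))"
				unfolding bd_simp[OF iF] using fF F(3) by (rule sum.insert)
			also have "pos rk v0 (insert v0 F) = 0" by (rule pos0) (use F v0(1) in auto)
			also have "insert v0 F - {v0} = F" using F(3) by auto
			also have "(\<Sum>v\<in>F. frag_cmul ((-1) ^ pos rk v (insert v0 F)) (frag_of (simp (insert v0 F - {v})))) =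
				 - (\<Sum>v\<in>F. frag_cmul ((-1) ^ pos rk v F) (frag_of (simp (insert v0 (F - {v})))))"
				unfolding sum_negf[symmetric]
			proof (rule sum.cong[OF refl])
				fix v assume v: "v : F"
				have "insert v0 F - {v} = insert v0 (F - {v})" using v F(3) by auto
				then show "frag_cmul ((-1) ^ pos rk v (insert v0 F)) (frag_of (simp (insert v0 F - {v}))) =
					 - frag_cmul ((-1) ^ pos rk v F) (frag_of (simp (insert v0 (F - {v}))))"
					unfolding posS[OF F(1,3) v] by simp
			qed
			finally show ?thesis by simp
		qed
		\<comment> \<open>The cone is a contracting homotopy of the flag chains of \<open>f\<close>, with
		  the constant map as correction in degree 0; the correction vanishes on \<open>?e\<close> because
		  \<open>?e\<close> is a boundary.\<close>
		have e'e: "chain_boundary p e' = ?e"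
		proof (cases q)
			case 0
			have "chain_boundary (Suc 0) (cone f v0 0 ?e) = ?e - chain_map 0 ?k ?e"
			proof (rule frag_linear_eq[where F = "%u. chain_boundary (Suc 0) (cone f v0 0 u)" and G = "%u. u - chain_map 0 ?k u" and A = "FS 0 (Pow f)"])
				fix s assume "s : FS 0 (Pow f)"
				then obtain F where F: "F \<subseteq> f" "card F = Suc 0" "s = simp F" by (auto simp: FS_def)
				then obtain v where v: "F = {v}" by (auto simp: card_Suc_eq)
				show "chain_boundary (Suc 0) (cone f v0 0 (frag_of s)) = frag_of s - chain_map 0 ?k (frag_of s)"
				proof (cases "v = v0")
					case True
					then show ?thesis using v F cone_simp[OF f(1) F(1,2), of v0] by (simp add: s0)
				next
					case False
					then have "v0 \<notin> F" using v by simp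
					have "pos rk v F = 0" using v by (simp add: pos_def)
					then show ?thesis
						using coneb[OF F(1,2) \<open>v0 \<notin> F\<close>] cone_simp[OF f(1) F(1,2), of v0] \<open>v0 \<notin> F\<close> v F(3) by (simp add: s0)
				qed
			qed (use ek 0 in \<open>auto simp: lin chain_boundary_diff chain_map_diff\<close>)
			\<comment> \<open>In a one-point space every 1-chain has zero boundary.\<close>
			moreover have "chain_map 0 ?k ?e = 0"
			proof -
				have "chain_map 0 ?k (chain_boundary (Suc 0) c) = chain_boundary (Suc 0) (chain_map (Suc 0) ?k c)"
					using chain_boundary_chain_map[of "Suc 0" ?Z c ?k] c(1) Suc 0 by simp
				moreover have "singular_chain (Suc 0) ?O (chain_map (Suc 0) ?k c)"
					using singular_chain_chain_map[OF _ kO] c(1) Suc 0 by simp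
				ultimately show ?thesis using chain_boundary_of_singleton[OF tO, of "Suc 0"] Suc 0 by simp
			qed
			ultimately show ?thesis using Suc 0 by (simp add: e'_def)
		next
			case (Suc r)
			have "chain_boundary (Suc q) (cone f v0 q ?e) = ?e - cone f v0 r (chain_boundary q ?e)"
			proof (rule frag_linear_eq[where F = "%u. chain_boundary (Suc q) (cone f v0 q u)" and G = "%u. u - cone f v0 r (chain_boundary q u)" and A = "FS q (Pow f)"])
				fix s assume "s : FS q (Pow f)"
				then obtain F where F: "F \<subseteq> f" "card F = Suc q" "s = simp F" by (auto simp: FS_def)
				have FD: "F : \<Delta>" using down[OF f(1) F(1)] .
				have fF: "finite F" using fin[OF FD] .
				have cF: "card (F - {v}) = Suc r" if "v : F" for v using F that fF Suc by simp
				have cb: "cone f v0 r (chain_boundary q (frag_of (simp F))) =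
					(\<Sum>v\<in>F. frag_cmul ((-1) ^ pos rk v F) (cone f v0 r (frag_of (simp (F - {v})))))"
					unfolding Suc bd_simp[OF FD F(2)[unfolded Suc]]
					unfolding cone_def frag_extend_sum[OF fF] o_def frag_extend_cmul ..
				show "chain_boundary (Suc q) (cone f v0 q (frag_of s)) = frag_of s - cone f v0 r (chain_boundary q (frag_of s))"
				proof (cases "v0 : F")
					case False
					have "cone f v0 r (frag_of (simp (F - {v}))) = frag_of (simp (insert v0 (F - {v})))" if "v : F" for v
						using cone_simp[OF f(1) _ cF[OF that], of v0] F(1) False by auto
					then show ?thesis unfolding F(3) cb cone_simp[OF f(1) F(1,2)] using coneb[OF F(1,2) False] False by simp
				next
					case True
					have "cone f v0 r (frag_of (simp (F - {v}))) = (if v = v0 then frag_of (simp F) else 0)" if "v : F" for v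
					proof -
						have "F - {v} \<subseteq> f" using F(1) by blast
						from cone_simp[OF f(1) this cF[OF that], of v0] show ?thesis using True that by (auto simp: insert_absorb)
					qed
					then have "cone f v0 r (chain_boundary q (frag_of (simp F))) =
						 (\<Sum>v\<in>F. if v = v0 then frag_of (simp F) else 0)"
						unfolding cb by (intro sum.cong refl) (use pos0[OF F(1)] in auto)
					also have "\<dots> = frag_of (simp F)" using True fF by simp
					finally show ?thesis unfolding F(3) cone_simp[OF f(1) F(1,2)] using True by simp
				qed
			qed (use ek in \<open>auto simp: lin chain_boundary_diff\<close>)
			moreover have "chain_boundary q ?e = 0" using chain_boundary_boundary[OF c(1)] \<open>p = Suc q\<close> by simp
			ultimately show ?thesis using \<open>p = Suc q\<close> by (simp add: e'_def cone_def)
		qed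
		have ch: "singular_chain p ?Z (c - e')" by (intro singular_chain_diff c(1) FS_chain[OF Pf kc])
		have cy: "chain_boundary p (c - e') = 0" by (simp add: chain_boundary_diff e'e)
		obtain d where d: "singular_chain (Suc p) ?Z d" "c - e' = chain_boundary (Suc p) d + chain_map p ?k (c - e')"
			using toconst[OF ch cy] by blast
		have "singular_chain p ?O (chain_map p ?k (c - e'))" by (rule singular_chain_chain_map[OF ch kO])
		moreover have "chain_boundary p (chain_map p ?k (c - e')) = 0"
			using chain_boundary_chain_map[OF ch, of ?k] cy by simp
		ultimately have "singular_relcycle p ?O {} (chain_map p ?k (c - e'))" by (simp add: singular_cycle)
		then have "singular_relboundary p ?O {} (chain_map p ?k (c - e'))"
			using singular_boundary_eq_cycle_singleton[OF tO] Suc by simp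
		then obtain w where w: "singular_chain (Suc p) ?O w" "chain_boundary (Suc p) w = chain_map p ?k (c - e')"
			unfolding singular_boundary by blast
		have "c - chain_boundary (Suc p) (d + w) = e'"
			unfolding chain_boundary_add w(2) using d(2) by (simp add: algebra_simps)
		then show ?thesis
			using d(1) singular_chain_mono[OF w(1) OZ] kc by (intro exI[of _ "d + w"]) (auto intro: singular_chain_add)
	qed
qed

text \<open>Induction on the number of flags. After splitting along \<open>Q - {f}\<close> and
  \<open>Pow f\<close> for a facet \<open>f\<close>, the mismatch of the boundaries lies in the
  intersection, where the induction hypothesis makes it a flag chain; the two parts can then be
  approximated separately.\<close>

theorem approx_all: "subc Q ==> approx Q"
proof (induction "card Q" arbitrary: Q rule: less_induct)
	case less
	note Q = less.prems
	have QD: "Q \<subseteq> \<Delta>" using Q by (auto simp: subc_def)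
	have fQ: "finite Q" using QD finD finite_subset by blast
	show ?case
	proof (cases "Q \<subseteq> {{}}")
		case True
		have "geo P Q = {}" using True by (auto simp: geo_def)
		then have "topspace (X Q) = {}" by (simp add: sp_def)
		then have "!!p c. singular_chain p (X Q) c ==> c = 0" using singular_chain_empty by blast
		then show ?thesis unfolding approx_def by (metis chain_boundary_0 diff_self keys_zero empty_subsetI singular_chain_0)
	next
		case False
		then have "Q ~= {}" by auto
		then have "Max (card ` Q) : card ` Q" using fQ by simp
		then obtain f where f: "Max (card ` Q) = card f" "f : Q" by (rule imageE)
		have f: "f : Q" "!!g. g : Q ==> card g <= card f" using f(2) fQ by (auto simp flip: f(1))
		have fD: "f : \<Delta>" using f QD by auto
		have f0: "f ~= {}"
		proof
			assume "f = {}"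
			then have "g = {}" if "g : Q" for g using f(2)[OF that] fin[of g] that QD by auto
			then show False using False by blast
		qed
		have max: "g = f" if "g : Q" "f \<subseteq> g" for g
		proof -
			have "finite g" using that(1) QD fin by blast
			then show ?thesis using card_subset_eq[of g f] that f(2)[of g] card_mono[of g f] by force
		qed
		have PfQ: "Pow f \<subseteq> Q" using Q f by (auto simp: subc_def)
		show ?thesis
		proof (cases "Q = Pow f")
			case True then show ?thesis using approx_simplex[OF fD f0] by simp
		next
			case False
			let ?Q = "Q - {f}" and ?B = "Pow f - {f}"
			have BQ: "?B = ?Q \<inter> Pow f" using PfQ by blast
			have sQ: "subc ?Q" using Q max by (auto simp: subc_def)
			have sP: "subc (Pow f)" using down[OF fD] by (auto simp: subc_def)
			have sB: "subc ?B" using down[OF fD] by (auto simp: subc_def)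
			have PQ: "Pow f \<subset> Q" using PfQ False by blast
			have aQ: "approx ?Q" by (rule less.hyps[OF card_Diff1_less[OF fQ f(1)] sQ])
			have aP: "approx (Pow f)" by (rule less.hyps[OF psubset_card_mono[OF fQ PQ] sP])
			have "?B \<subset> Q" using PQ by blast
			then have aB: "approx ?B" by (rule less.hyps[OF psubset_card_mono[OF fQ] sB])
			show ?thesis
				unfolding approx_def
			proof (intro allI impI)
				fix p c assume c: "singular_chain p (X Q) c" "keys (chain_boundary p c) \<subseteq> FS (p - 1) Q"
				have spU: "sp Q = sp ?Q Un sp (Pow f)"
				proof -
					have "geo P Q = geo P ?Q Un geo P (Pow f)" using PfQ by (auto simp: geo_def)
					then show ?thesis by (simp add: sp_def image_Un)
				qed
				show "EX b. singular_chain (Suc p) (X Q) b & keys (c - chain_boundary (Suc p) b) \<subseteq> FS p Q"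
				proof (cases p)
					case 0
					\<comment> \<open>A single point lies in one of the two pieces, so degree 0 is split without
					  excision.\<close>
					obtain a b where ab: "c = a + b" "keys a \<subseteq> keys c \<inter> {s. s ` standard_simplex 0 \<subseteq> sp ?Q}"
						"keys b \<subseteq> keys c - {s. s ` standard_simplex 0 \<subseteq> sp ?Q}"
						by (rule split_chain)
					have cM: "singular_chain 0 M c" "!!s. s : keys c ==> s ` standard_simplex 0 \<subseteq> sp Q"
						using c(1) 0 by (auto simp: singular_chain_subtopology)
					have a: "singular_chain p (X ?Q) a"
					proof -
						have "singular_chain 0 M a" using ab(2) cM(1) unfolding singular_chain_def by blast
						moreover have "ALL s:keys a. s ` standard_simplex 0 \<subseteq> sp ?Q" using ab(2) by blast
						ultimately show ?thesis unfolding 0 singular_chain_subtopology by blast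
					qed
					have b: "singular_chain p (X (Pow f)) b"
					proof -
						have "s ` standard_simplex 0 \<subseteq> sp (Pow f)" if "s : keys b" for s
						proof -
							have "s ` standard_simplex 0 \<subseteq> sp Q" "~ s ` standard_simplex 0 \<subseteq> sp ?Q" using that ab(3) cM(2) by auto
							then show ?thesis unfolding spU by (auto simp: standard_simplex_0)
						qed
						moreover have "singular_chain 0 M b" using ab(3) cM(1) unfolding singular_chain_def by blast
						ultimately show ?thesis unfolding 0 singular_chain_subtopology by blast
					qed
					have z: "keys (chain_boundary p w) \<subseteq> A" for w :: "'a chain" and A using 0 by (simp add: chain_boundary_def)
					obtain b1 e1 where 1: "singular_chain (Suc p) (X ?Q) b1" "keys e1 \<subseteq> FS p ?Q" "a = chain_boundary (Suc p) b1 + e1"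
						by (rule approxD[OF aQ a z])
					obtain b2 e2 where 2: "singular_chain (Suc p) (X (Pow f)) b2" "keys e2 \<subseteq> FS p (Pow f)" "b = chain_boundary (Suc p) b2 + e2"
						by (rule approxD[OF aP b z])
					have "c - chain_boundary (Suc p) (b1 + b2) = e1 + e2"
						unfolding ab(1) 1(3) 2(3) chain_boundary_add by (simp add: algebra_simps)
					moreover have "keys (e1 + e2) \<subseteq> FS p Q"
						using 1(2) 2(2) FS_mono[of ?Q Q p] FS_mono[OF PfQ, of p] Poly_Mapping.keys_add[of e1 e2] by blast
					moreover have "singular_chain (Suc p) (X Q) (b1 + b2)"
						by (intro singular_chain_add chain_mono[OF _ 1(1)] chain_mono[OF PfQ 2(1)]) auto
					ultimately show ?thesis by (intro exI[of _ "b1 + b2"]) simp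
				next
					case (Suc q)
					obtain e1 e2 where e: "chain_boundary p c = e1 + e2" "keys e1 \<subseteq> keys (chain_boundary p c) \<inter> FS q ?Q"
						"keys e2 \<subseteq> keys (chain_boundary p c) - FS q ?Q"
						by (rule split_chain)
					have e1: "keys e1 \<subseteq> FS q ?Q" using e(2) by blast
					have "FS q Q \<subseteq> FS q ?Q Un FS q (Pow f)" by (auto simp: FS_def)
					then have e2: "keys e2 \<subseteq> FS q (Pow f)" using e(3) c(2) Suc by auto
					obtain d a' b' where d: "singular_chain (Suc (Suc q)) (X Q) d" "singular_chain (Suc q) (X ?Q) a'"
						"singular_chain (Suc q) (X (Pow f)) b'" "c = chain_boundary (Suc (Suc q)) d + a' + b'"
						by (rule excision_max[OF Q f(1) f0 max c(1)[unfolded Suc] e(1)[unfolded Suc] FS_chain[OF sQ e1] FS_chain[OF sP e2]])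
					have bc: "chain_boundary p c = chain_boundary p a' + chain_boundary p b'"
						unfolding d(4) Suc chain_boundary_add using chain_boundary_boundary_alt[OF d(1)] by simp
					\<comment> \<open>The mismatch is carried by the intersection: one expression for it lives in
					  \<open>?Q\<close>, the other in \<open>Pow f\<close>.\<close>
					define w where "w = chain_boundary p a' - e1"
					have w2: "w = e2 - chain_boundary p b'" using bc e(1) by (simp add: w_def algebra_simps)
					have "singular_chain q (X ?Q) w"
						unfolding w_def Suc by (intro singular_chain_diff singular_chain_boundary_alt[OF d(2)] FS_chain[OF sQ e1])
					moreover have "singular_chain q (X (Pow f)) w"
						unfolding w2 Suc by (intro singular_chain_diff singular_chain_boundary_alt[OF d(3)] FS_chain[OF sP e2])
					ultimately have wB: "singular_chain q (X ?B) w"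
						unfolding BQ by (intro chain_Int) (use QD PfQ in auto)
					have "chain_boundary q w = - chain_boundary q e1"
						unfolding w_def chain_boundary_diff Suc using chain_boundary_boundary_alt[OF d(2)] by simp
					then have k1: "keys (chain_boundary q w) \<subseteq> FS (q - 1) ?Q" using FS_boundary[OF sQ e1] by simp
					have "chain_boundary q w = chain_boundary q e2"
						unfolding w2 chain_boundary_diff Suc using chain_boundary_boundary_alt[OF d(3)] by simp
					then have k2: "keys (chain_boundary q w) \<subseteq> FS (q - 1) (Pow f)" using FS_boundary[OF sP e2] by simp
					have "FS (q - 1) ?Q \<inter> FS (q - 1) (Pow f) \<subseteq> FS (q - 1) ?B"
						unfolding BQ by (rule FS_Int) (use QD PfQ in auto)
					then have kw: "keys (chain_boundary q w) \<subseteq> FS (q - 1) ?B" using k1 k2 by blast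
					obtain b3 e3 where 3: "singular_chain (Suc q) (X ?B) b3" "keys e3 \<subseteq> FS q ?B" "w = chain_boundary (Suc q) b3 + e3"
						by (rule approxD[OF aB wB kw])
					have b3: "singular_chain (Suc q) (X ?Q) b3" "singular_chain (Suc q) (X (Pow f)) b3"
						by (rule chain_mono[OF _ 3(1)]; auto simp: BQ)+
					have k3: "FS q ?B \<subseteq> FS q ?Q" "FS q ?B \<subseteq> FS q (Pow f)" unfolding BQ by (rule FS_mono; blast)+
					\<comment> \<open>Moving \<open>b3\<close> from one part to the other leaves
					  \<open>a' + b'\<close> unchanged and turns both boundaries into flag chains.\<close>
					have "chain_boundary p (a' - b3) = e1 + e3"
						using 3(3) unfolding chain_boundary_diff w_def Suc by (simp add: algebra_simps)
					then have kk1: "keys (chain_boundary p (a' - b3)) \<subseteq> FS (p - 1) ?Q"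
						using e1 3(2) k3(1) Poly_Mapping.keys_add[of e1 e3] Suc by auto
					have "chain_boundary p (b' + b3) = e2 - e3"
						using 3(3) unfolding chain_boundary_add w2 Suc by (simp add: algebra_simps)
					then have kk2: "keys (chain_boundary p (b' + b3)) \<subseteq> FS (p - 1) (Pow f)"
						using e2 3(2) k3(2) keys_diff[of e2 e3] Suc by auto
					have s1: "singular_chain p (X ?Q) (a' - b3)" unfolding Suc by (rule singular_chain_diff[OF d(2) b3(1)])
					have s2: "singular_chain p (X (Pow f)) (b' + b3)" unfolding Suc by (rule singular_chain_add[OF d(3) b3(2)])
					obtain g1 h1 where 4: "singular_chain (Suc p) (X ?Q) g1" "keys h1 \<subseteq> FS p ?Q" "a' - b3 = chain_boundary (Suc p) g1 + h1"
						by (rule approxD[OF aQ s1 kk1])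
					obtain g2 h2 where 5: "singular_chain (Suc p) (X (Pow f)) g2" "keys h2 \<subseteq> FS p (Pow f)" "b' + b3 = chain_boundary (Suc p) g2 + h2"
						by (rule approxD[OF aP s2 kk2])
					have "a' + b' = chain_boundary (Suc p) g1 + h1 + (chain_boundary (Suc p) g2 + h2)"
						unfolding 4(3)[symmetric] 5(3)[symmetric] by simp
					then have "c - chain_boundary (Suc p) (d + g1 + g2) = h1 + h2"
						unfolding d(4) chain_boundary_add Suc by (simp add: algebra_simps)
					moreover have "keys (h1 + h2) \<subseteq> FS p Q"
						using 4(2) 5(2) FS_mono[of ?Q Q p] FS_mono[OF PfQ, of p] Poly_Mapping.keys_add[of h1 h2] by blast
					moreover have "singular_chain (Suc p) (X Q) (d + g1 + g2)"
						using d(1) Suc by (intro singular_chain_add chain_mono[OF _ 4(1)] chain_mono[OF PfQ 5(1)]) auto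
					ultimately show ?thesis by (intro exI[of _ "d + g1 + g2"]) simp
				qed
			qed
		qed
	qed
qed

end

section \<open>Local homology\<close>

lemma trivial_relative_homology_iff:
	"trivial_group (relative_homology_group (int p) X S) \<longleftrightarrow>
		 (ALL c. singular_relcycle p X S c --> singular_relboundary p X S c)"
proof
	assume t: "trivial_group (relative_homology_group (int p) X S)"
	show "ALL c. singular_relcycle p X S c --> singular_relboundary p X S c"
	proof (intro allI impI)
		fix c assume "singular_relcycle p X S c"
		then have "homologous_rel_set p X S c : carrier (relative_homology_group (int p) X S)"
			by (auto simp: carrier_relative_homology_group)
		then have "homologous_rel_set p X S c = singular_relboundary_set p X S"
			using t by (auto simp: trivial_group_def)
		then show "singular_relboundary p X S c" by (simp only: homologous_rel_set_eq_relboundary)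
	qed
next
	assume h: "ALL c. singular_relcycle p X S c --> singular_relboundary p X S c"
	have "carrier (relative_homology_group (int p) X S) \<subseteq> {\<one>\<^bsub>relative_homology_group (int p) X S\<^esub>}"
	proof
		fix C assume "C : carrier (relative_homology_group (int p) X S)"
		then obtain c where c: "C = homologous_rel_set p X S c" "singular_relcycle p X S c"
			by (auto simp: carrier_relative_homology_group)
		then have "homologous_rel_set p X S c = singular_relboundary_set p X S"
			using h homologous_rel_set_eq_relboundary by blast
		then show "C : {\<one>\<^bsub>relative_homology_group (int p) X S\<^esub>}" by (simp add: c)
	qed
	moreover have "\<one>\<^bsub>relative_homology_group (int p) X S\<^esub> : carrier (relative_homology_group (int p) X S)"
		by (rule monoid.one_closed[OF group.is_monoid[OF group_relative_homology_group]])
	ultimately show "trivial_group (relative_homology_group (int p) X S)"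
		unfolding trivial_group_def by auto
qed

text \<open>Homeomorphic closed sets have complements with isomorphic relative homology, which moves
  \<open>y\<close> to the origin; the dimension shift for complements then reduces the question to
  the one-point space of dimension 0.\<close>

lemma local_homology_Euclidean:
	assumes y: "y : topspace (Euclidean_space m)"
	shows "trivial_group (relative_homology_group p (Euclidean_space m) (topspace (Euclidean_space m) - {y})) \<longleftrightarrow> p ~= int m"
proof -
	let ?o = "%_::nat. 0::real"
	have H: "Hausdorff_space (Euclidean_space k)" for k
		by (simp add: Euclidean_space_def Hausdorff_space_subtopology Hausdorff_space_product_topology)
	have o: "?o : topspace (Euclidean_space k)" for k by (simp add: topspace_Euclidean_space)
	have 1: "relative_homology_group p (Euclidean_space m) (topspace (Euclidean_space m) - {y})
		 \<cong> relative_homology_group p (Euclidean_space m) (topspace (Euclidean_space m) - {?o})"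
	proof (rule isomorphic_relative_homology_groups_Euclidean_complements)
		show "closedin (Euclidean_space m) {y}" "closedin (Euclidean_space m) {?o}"
			using closedin_Hausdorff_singleton[OF H] y o by auto
		have "homeomorphic_map (subtopology (Euclidean_space m) {y}) (subtopology (Euclidean_space m) {?o}) (%_. ?o)"
		proof (rule bijective_open_imp_homeomorphic_map)
			have t: "topspace (subtopology (Euclidean_space m) {?o}) = {?o}" "topspace (subtopology (Euclidean_space m) {y}) = {y}"
				using o y by auto
			show "continuous_map (subtopology (Euclidean_space m) {y}) (subtopology (Euclidean_space m) {?o}) (%_. ?o)"
				using o by (auto simp: continuous_map_in_subtopology)
			show "open_map (subtopology (Euclidean_space m) {y}) (subtopology (Euclidean_space m) {?o}) (%_. ?o)"
				unfolding open_map_def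
			proof (intro allI impI)
				fix U assume "openin (subtopology (Euclidean_space m) {y}) U"
				then have "U \<subseteq> {y}" using openin_subset t(2) by metis
				then have "(%_. ?o) ` U = {} \<or> (%_. ?o) ` U = {?o}" by auto
				then show "openin (subtopology (Euclidean_space m) {?o}) ((%_. ?o) ` U)"
					using openin_topspace[of "subtopology (Euclidean_space m) {?o}"] t(1) by auto
			qed
			show "(%_. ?o) ` topspace (subtopology (Euclidean_space m) {y}) = topspace (subtopology (Euclidean_space m) {?o})"
				unfolding t by simp
			show "inj_on (%_. ?o) (topspace (subtopology (Euclidean_space m) {y}))" unfolding t by simp
		qed
		then show "subtopology (Euclidean_space m) {y} homeomorphic_space subtopology (Euclidean_space m) {?o}"
			unfolding homeomorphic_space by blast
	qed
	have "closedin (Euclidean_space 0) {?o}" using closedin_Hausdorff_singleton[OF H] o by auto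
	from relative_homology_group_Euclidean_complement_step[OF this, of "p - int m" m]
	have 2: "relative_homology_group (p - int m) (Euclidean_space 0) (topspace (Euclidean_space 0) - {?o})
		 \<cong> relative_homology_group p (Euclidean_space m) (topspace (Euclidean_space m) - {?o})" by simp
	have t0: "topspace (Euclidean_space 0) = {?o}" by (auto simp: topspace_Euclidean_space)
	have 3: "trivial_group (homology_group (p - int m) (Euclidean_space 0)) \<longleftrightarrow> p ~= int m"
	proof (cases "p = int m")
		case True
		have "homology_group 0 (Euclidean_space 0) \<cong> integer_group" by (rule homology_coefficients[OF t0])
		then show ?thesis
			using isomorphic_group_triviality[of "homology_group 0 (Euclidean_space 0)" integer_group] True by simp
	next
		case False
		then show ?thesis using homology_dimension_axiom[OF t0, of "p - int m"] by simp
	qed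
	show ?thesis
		using isomorphic_group_triviality[OF 1] isomorphic_group_triviality[OF 2] 3 by (simp add: t0)
qed

text \<open>Excising the complement of a chart around \<open>x\<close> leaves the Euclidean
  case.\<close>

lemma local_homology_manifold:
	assumes M: "closed_manifold d M" and x: "x : topspace M"
	shows "trivial_group (relative_homology_group p M (topspace M - {x})) \<longleftrightarrow> p ~= int d"
proof -
	obtain U where U: "openin M U" "x : U" "subtopology M U homeomorphic_space Euclidean_space d"
		and H: "Hausdorff_space M"
		using M x unfolding closed_manifold_def by blast
	obtain g where g: "homeomorphic_map (subtopology M U) (Euclidean_space d) g"
		using U(3) unfolding homeomorphic_space by blast
	have UM: "U \<subseteq> topspace M" using openin_subset[OF U(1)] .
	have tU: "topspace (subtopology M U) = U" using UM by auto
	let ?T = "topspace M - {x}" and ?U = "topspace M - U"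
	have opT: "openin M ?T" using closedin_Hausdorff_singleton[OF H x] by (simp add: openin_diff)
	have "closedin M ?U" using U(1) by (simp add: closedin_diff)
	then have "M closure_of ?U = ?U" by (simp add: closure_of_closedin)
	also have "?U \<subseteq> ?T" using U(2) by auto
	also have "?T = M interior_of ?T" using opT by (simp add: interior_of_openin)
	finally have cl: "M closure_of ?U \<subseteq> M interior_of ?T" .
	have eq: "topspace M - ?U = U" "?T - ?U = U - {x}" using UM by auto
	have "relative_homology_group p (subtopology M U) (U - {x}) \<cong> relative_homology_group p M ?T"
		using homology_excision_axiom[OF cl, of "topspace M" p] unfolding eq by (auto simp: is_iso_def)
	moreover have "relative_homology_group p (subtopology M U) (U - {x}) \<cong>
		 relative_homology_group p (Euclidean_space d) (topspace (Euclidean_space d) - {g x})"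
	proof -
		have "inj_on g U" "g ` U = topspace (Euclidean_space d)"
			using homeomorphic_imp_injective_map[OF g] homeomorphic_imp_surjective_map[OF g] tU by auto
		then have img: "g ` (U - {x}) = topspace (Euclidean_space d) - {g x}" using U(2) by (auto dest: inj_onD)
		have "hom_induced p (subtopology M U) (U - {x}) (Euclidean_space d) (topspace (Euclidean_space d) - {g x}) g
			\<in> iso (relative_homology_group p (subtopology M U) (U - {x}))
					(relative_homology_group p (Euclidean_space d) (topspace (Euclidean_space d) - {g x}))"
			by (rule homeomorphic_map_relative_homology_iso[OF g]) (use UM tU img in auto)
		then show ?thesis unfolding is_iso_def by blast
	qed
	moreover have "g x : topspace (Euclidean_space d)"
		using homeomorphic_imp_surjective_map[OF g] tU U(2) by blast
	ultimately show ?thesis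
		using isomorphic_group_triviality local_homology_Euclidean[of "g x" d p] by (metis group_relative_homology_group)
qed

section \<open>Local homology in terms of flags\<close>

context realized_complex
begin

text \<open>The flags not containing the carrier of \<open>x\<close>, equivalently those whose
  closed simplex misses \<open>x\<close>. The punctured space retracts onto their union.\<close>

definition avoid where "avoid x = {g\<in>\<Delta>. ~ {v. \<Psi> x v ~= 0} \<subseteq> g}"

lemma avoid_facts:
	assumes x: "x : topspace M"
	shows "{v. \<Psi> x v ~= 0} : \<Delta>" "\<Psi> x : geo P \<Delta>" "\<Phi> (\<Psi> x) = x" "R \<Delta> {v. \<Psi> x v ~= 0} = avoid x" "subc (avoid x)"
		"sp (avoid x) \<subseteq> topspace M - {x}"
proof -
	show 2: "\<Psi> x : geo P \<Delta>" "\<Phi> (\<Psi> x) = x" using Psi_in[OF x] Phi_Psi[OF x] .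
	then show 1: "{v. \<Psi> x v ~= 0} : \<Delta>" by (simp add: geo_def)
	show 3: "R \<Delta> {v. \<Psi> x v ~= 0} = avoid x" unfolding R_def[OF subc_Delta 1 2(1) refl] avoid_def ..
	show "subc (avoid x)" using R_subc[OF subc_Delta 1 2(1) refl] 3 by simp
	show "sp (avoid x) \<subseteq> topspace M - {x}" using spR_sub[OF subc_Delta 1 2(1) refl] unfolding 3 2(2) sp_Delta .
qed

lemma retract_avoid:
	assumes x: "x : topspace M" and c: "singular_chain p (subtopology M (topspace M - {x})) c"
		"singular_chain (p - 1) (X (avoid x)) (chain_boundary p c)"
	obtains d e where "singular_chain (Suc p) (subtopology M (topspace M - {x})) d" "singular_chain p (X (avoid x)) e"
		"c = chain_boundary (Suc p) d + e"
proof -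
	note a = avoid_facts[OF x]
	show thesis
		using retract_rel[OF subc_Delta a(1,2) refl, unfolded a(3,4) sp_Delta, OF c] that by blast
qed

text \<open>The boundary of a relative cycle is pushed into \<open>avoid x\<close> and replaced
  there by a flag chain; with this correction, made off \<open>x\<close>, the global approximation
  applies.\<close>

lemma local_flag_rep:
	assumes x: "x : topspace M" and c: "singular_relcycle p M (topspace M - {x}) c"
	obtains w where "keys w \<subseteq> FS p \<Delta>" "homologous_rel p M (topspace M - {x}) c w"
proof -
	note a = avoid_facts[OF x]
	let ?N = "topspace M - {x}"
	have cM: "singular_chain p M c" and cb: "singular_chain (p - 1) (subtopology M ?N) (chain_boundary p c)"
		using c by (auto simp: singular_relcycle)
	have XaN: "singular_chain q (subtopology M ?N) u" if "singular_chain q (X (avoid x)) u" for q u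
		by (rule singular_chain_mono[OF that a(6)])
	show thesis
	proof (cases p)
		case 0
		obtain b w where "singular_chain (Suc p) (X \<Delta>) b" "keys w \<subseteq> FS p \<Delta>" "c = chain_boundary (Suc p) b + w"
			by (rule approxD[OF approx_all[OF subc_Delta]]) (use cM 0 in \<open>auto simp: X_Delta chain_boundary_def\<close>)
		note bw = this
		have "singular_relboundary p M ?N (c - w)"
			unfolding singular_relboundary using bw by (intro exI[of _ b] exI[of _ 0]) (simp add: X_Delta)
		then show thesis using that[OF bw(2)] by (simp add: homologous_rel_def)
	next
		case (Suc q)
		have "chain_boundary q (chain_boundary p c) = 0" using chain_boundary_boundary[OF cM] Suc by simp
		then have z: "singular_chain (q - 1) (X (avoid x)) (chain_boundary q (chain_boundary p c))" by simp
		have cb': "singular_chain q (subtopology M ?N) (chain_boundary p c)" using cb Suc by simp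
		obtain d e where d: "singular_chain (Suc q) (subtopology M ?N) d" "singular_chain q (X (avoid x)) e"
			"chain_boundary p c = chain_boundary (Suc q) d + e" by (rule retract_avoid[OF x cb' z])
		have "chain_boundary q e = 0"
		proof -
			have "chain_boundary q (chain_boundary (Suc q) d) = 0" by (rule chain_boundary_boundary_alt[OF d(1)])
			then show ?thesis using \<open>chain_boundary q (chain_boundary p c) = 0\<close> unfolding d(3) chain_boundary_add by simp
		qed
		then have "keys (chain_boundary q e) \<subseteq> FS (q - 1) (avoid x)" by simp
		from approxD[OF approx_all[OF a(5)] d(2) this] obtain b1 e1 where b1: "singular_chain (Suc q) (X (avoid x)) b1"
			"keys e1 \<subseteq> FS q (avoid x)" "e = chain_boundary (Suc q) b1 + e1" by blast
		have dM: "singular_chain (Suc q) M d" "singular_chain (Suc q) M b1"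
			using d(1) b1(1) by (auto simp: singular_chain_subtopology)
		have s: "singular_chain p (X \<Delta>) (c - d - b1)"
			unfolding X_Delta using cM dM Suc by (auto intro!: singular_chain_diff)
		have "chain_boundary p (c - d - b1) = e1"
			using d(3) b1(3) Suc by (simp add: chain_boundary_diff)
		then have k: "keys (chain_boundary p (c - d - b1)) \<subseteq> FS (p - 1) \<Delta>"
			using b1(2) FS_mono[of "avoid x" \<Delta> q] Suc by (auto simp: avoid_def)
		obtain b2 w where b2: "singular_chain (Suc p) (X \<Delta>) b2" "keys w \<subseteq> FS p \<Delta>" "c - d - b1 = chain_boundary (Suc p) b2 + w"
			by (rule approxD[OF approx_all[OF subc_Delta] s k])
		have "singular_chain p (subtopology M ?N) (d + b1)" using d(1) XaN[OF b1(1)] Suc by (auto intro: singular_chain_add)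
		moreover have "chain_boundary (Suc p) b2 + (d + b1) = c - w" using b2(3) by (simp add: algebra_simps)
		ultimately have "singular_relboundary p M ?N (c - w)"
			unfolding singular_relboundary using b2(1) unfolding X_Delta by blast
		then show thesis using that[OF b2(2)] by (simp add: homologous_rel_def)
	qed
qed

lemma simp_hits:
	assumes x: "x : topspace M" and G: "G : \<Delta>" "card G = Suc p" "{v. \<Psi> x v ~= 0} \<subseteq> G"
	shows "x : simp G ` standard_simplex p"
proof -
	let ?t = "\<Psi> x"
	have t: "?t : geo P \<Delta>" using Psi_in[OF x] .
	define r where "r = inv_into G (%v. pos rk v G)"
	note bij = pos_bij[OF G(1)]
	have r: "r (pos rk v G) = v" if "v : G" for v
		unfolding r_def by (rule inv_into_f_f[OF bij_betw_imp_inj_on[OF bij] that])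
	define y where "y i = (if i < card G then ?t (r i) else 0)" for i
	have ly: "lift G y = ?t"
	proof
		fix v
		show "lift G y v = ?t v"
		proof (cases "v : G")
			case True
			have "pos rk v G < card G" using bij_betwE[OF bij] True by blast
			then show ?thesis using True r[OF True] by (simp add: lift_def y_def)
		qed (use G(3) in \<open>auto simp: lift_def\<close>)
	qed
	have tG: "sum ?t G = 1"
	proof -
		have "sum ?t P = sum ?t G" by (rule sum.mono_neutral_right) (use finP subP[OF G(1)] G(3) in auto)
		then show ?thesis using t by (simp add: geo_def)
	qed
	have "(\<Sum>i\<le>p. y i) = (\<Sum>i\<in>{..<card G}. ?t (r i))"
		using G(2) by (simp add: y_def lessThan_Suc_atMost)
	also have "\<dots> = (\<Sum>v\<in>G. ?t (r (pos rk v G)))" by (rule sum.reindex_bij_betw[OF bij, symmetric])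
	also have "\<dots> = 1" using r tG by simp
	finally have s: "(\<Sum>i\<le>p. y i) = 1" .
	have le: "?t v <= 1" for v
	proof (cases "v : P")
		case True
		have "?t v <= sum ?t P" by (rule member_le_sum) (use True finP t in \<open>auto simp: geo_def\<close>)
		then show ?thesis using t by (simp add: geo_def)
	next
		case False
		then have "?t v = 0" using G(3) subP[OF G(1)] by blast
		then show ?thesis by simp
	qed
	have "y : standard_simplex p"
		using s le t G(2) by (auto simp: standard_simplex_def y_def geo_def)
	moreover have "simp G y = x" using \<open>y : standard_simplex p\<close> ly G(2) Phi_Psi[OF x] by (simp add: simp_def)
	ultimately show ?thesis by (metis imageI)
qed

lemma FS_avoid:
	assumes x: "x : topspace M" and w: "keys w \<subseteq> FS p \<Delta>" "singular_chain p (subtopology M (topspace M - {x})) w"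
	shows "keys w \<subseteq> FS p (avoid x)"
proof
	fix s assume s: "s : keys w"
	then obtain G where G: "G : \<Delta>" "card G = Suc p" "s = simp G" using w(1) by (auto simp: FS_def)
	have "s ` standard_simplex p \<subseteq> topspace M - {x}" using w(2) s by (auto simp: singular_chain_subtopology)
	then have "~ {v. \<Psi> x v ~= 0} \<subseteq> G" using simp_hits[OF x G(1,2)] G(3) by blast
	then show "s : FS p (avoid x)" using G by (auto simp: FS_def avoid_def)
qed

lemma keys_frag_sum:
	assumes "!!v. v : A ==> f v : S"
	shows "keys (\<Sum>v\<in>A. frag_cmul (k v) (frag_of (f v))) \<subseteq> S"
proof -
	have "keys (frag_cmul (k v) (frag_of (f v))) \<subseteq> S" if "v : A" for v
	proof -
		have "keys (frag_cmul (k v) (frag_of (f v))) \<subseteq> {f v}" by (cases "k v = 0") auto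
		then show ?thesis using assms[OF that] by blast
	qed
	then show ?thesis using Poly_Mapping.keys_sum[of "%v. frag_cmul (k v) (frag_of (f v))" A] by blast
qed

text \<open>Turns a singular null-homology near \<open>x\<close> into one by flag chains, exact up
  to flags avoiding \<open>x\<close>. Coefficients at flags through the carrier of \<open>x\<close>
  can thus be compared combinatorially.\<close>

lemma local_flag_boundary:
	assumes x: "x : topspace M" and w: "keys w \<subseteq> FS p \<Delta>" "singular_relboundary p M (topspace M - {x}) w"
	obtains e where "keys e \<subseteq> FS (Suc p) \<Delta>" "keys (w - chain_boundary (Suc p) e) \<subseteq> FS p (avoid x)"
proof -
	note a = avoid_facts[OF x]
	let ?N = "topspace M - {x}"
	have wc: "singular_chain (p - 1) (subtopology M ?N) (chain_boundary p w)"
		using singular_relboundary_imp_relcycle[OF w(2)] by (simp add: singular_relcycle)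
	have kw: "keys (chain_boundary p w) \<subseteq> FS (p - 1) (avoid x)"
		by (rule FS_avoid[OF x FS_boundary[OF subc_Delta w(1)] wc])
	obtain b u where b: "singular_chain (Suc p) M b" "singular_chain p (subtopology M ?N) u" "chain_boundary (Suc p) b + u = w"
		using w(2) unfolding singular_relboundary by blast
	have bu: "chain_boundary p u = chain_boundary p w"
		unfolding b(3)[symmetric] chain_boundary_add using chain_boundary_boundary_alt[OF b(1)] by simp
	then have "singular_chain (p - 1) (X (avoid x)) (chain_boundary p u)" using FS_chain[OF a(5) kw] by simp
	from retract_avoid[OF x b(2) this] obtain d e where d: "singular_chain (Suc p) (subtopology M ?N) d"
		"singular_chain p (X (avoid x)) e" "u = chain_boundary (Suc p) d + e" by blast
	have "chain_boundary p e = chain_boundary p w"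
		using bu unfolding d(3) chain_boundary_add using chain_boundary_boundary_alt[OF d(1)] by simp
	then have "keys (chain_boundary p e) \<subseteq> FS (p - 1) (avoid x)" using kw by simp
	from approxD[OF approx_all[OF a(5)] d(2) this] obtain b1 e1 where b1: "singular_chain (Suc p) (X (avoid x)) b1"
		"keys e1 \<subseteq> FS p (avoid x)" "e = chain_boundary (Suc p) b1 + e1" by blast
	let ?B = "b + d + b1"
	have "singular_chain (Suc p) M d" "singular_chain (Suc p) M b1" using d(1) b1(1) by (auto simp: singular_chain_subtopology)
	then have B: "singular_chain (Suc p) (X \<Delta>) ?B" unfolding X_Delta by (intro singular_chain_add b(1))
	have Bw: "chain_boundary (Suc p) ?B = w - e1"
		unfolding chain_boundary_add using b(3) d(3) b1(3) by (simp add: algebra_simps)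
	have "keys (w - e1) \<subseteq> FS p \<Delta>"
		using w(1) b1(2) keys_diff[of w e1] FS_mono[of "avoid x" \<Delta> p] by (auto simp: avoid_def)
	then have "keys (chain_boundary (Suc p) ?B) \<subseteq> FS (Suc p - 1) \<Delta>" unfolding Bw by simp
	from approxD[OF approx_all[OF subc_Delta] B this] obtain b2 e' where b2: "singular_chain (Suc (Suc p)) (X \<Delta>) b2"
		"keys e' \<subseteq> FS (Suc p) \<Delta>" "?B = chain_boundary (Suc (Suc p)) b2 + e'" by blast
	have "chain_boundary (Suc p) ?B = chain_boundary (Suc p) e'"
		unfolding b2(3) chain_boundary_add using chain_boundary_boundary_alt[OF b2(1)] by simp
	then have "w - chain_boundary (Suc p) e' = e1" using Bw by (simp add: algebra_simps)
	then show thesis using that[OF b2(2)] b1(2) by simp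
qed

text \<open>An interior point of the simplex \<open>F\<close>: its carrier is exactly
  \<open>F\<close>, so the flags not avoiding it are those containing \<open>F\<close>.\<close>

definition bary where "bary F = \<Phi> (%v. if v : F then 1 / real (card F) else 0)"

lemma bary_facts:
	assumes F: "F : \<Delta>" "F ~= {}"
	shows "(%v. if v : F then 1 / real (card F) else 0) : geo P \<Delta>" "bary F : topspace M" "{v. \<Psi> (bary F) v ~= 0} = F"
		"\<Psi> (bary F) = (%v. if v : F then 1 / real (card F) else 0)"
proof -
	let ?x = "%v. if v : F then 1 / real (card F) else 0"
	have f: "finite F" "F \<subseteq> P" using fin[OF F(1)] subP[OF F(1)] .
	have s: "{v. ?x v ~= 0} = F" using f F by (auto simp: card_eq_0_iff)
	have "sum ?x P = sum ?x F" by (rule sum.mono_neutral_right) (use finP f in auto)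
	also have "\<dots> = 1" using f F by simp
	finally show g: "?x : geo P \<Delta>" using s F by (simp add: geo_def)
	show "bary F : topspace M" unfolding bary_def using g Phi_image by blast
	show p: "\<Psi> (bary F) = ?x" unfolding bary_def by (rule Psi_Phi[OF g])
	show "{v. \<Psi> (bary F) v ~= 0} = F" unfolding p by (rule s)
qed

text \<open>The simplex of a maximal flag is a relative cycle at its barycenter. If local homology
  vanished in its degree, it would be a boundary up to flags avoiding that point, but no larger flag
  has \<open>F\<close> as a face.\<close>

lemma maximal_flag_card:
	assumes M: "closed_manifold d M" and F: "F : \<Delta>" "F ~= {}" and max: "!!G. G : \<Delta> ==> F \<subseteq> G ==> G = F"
	shows "card F = Suc d"
proof (rule ccontr)
	assume ne: "card F ~= Suc d"
	obtain p where p: "card F = Suc p" using F fin[OF F(1)] by (metis card_gt_0_iff gr0_implies_Suc)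
	note b = bary_facts[OF F]
	let ?x = "bary F"
	have kw: "keys (frag_of (simp F)) \<subseteq> FS p \<Delta>" using F p by (auto simp: FS_def)
	have rc: "singular_relcycle p M (topspace M - {?x}) (frag_of (simp F))"
	proof -
		have "keys (chain_boundary p (frag_of (simp F))) \<subseteq> FS (p - 1) (avoid ?x)"
		proof (cases p)
			case (Suc q)
			have "simp (F - {v}) : FS q (avoid ?x)" if "v : F" for v
				using that F p Suc down[OF F(1), of "F - {v}"] fin[OF F(1)] by (auto simp: FS_def avoid_def b(3))
			then have "keys (\<Sum>v\<in>F. frag_cmul ((-1) ^ pos rk v F) (frag_of (simp (F - {v})))) \<subseteq> FS q (avoid ?x)"
				by (rule keys_frag_sum)
			then show ?thesis using bd_simp[of F q] F(1) p Suc by simp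
		qed (simp add: chain_boundary_def)
		then have "singular_chain (p - 1) (X (avoid ?x)) (chain_boundary p (frag_of (simp F)))"
			by (rule FS_chain[OF avoid_facts(5)[OF b(2)]])
		then have "singular_chain (p - 1) (subtopology M (topspace M - {?x})) (chain_boundary p (frag_of (simp F)))"
			by (rule singular_chain_mono[OF _ avoid_facts(6)[OF b(2)]])
		moreover have "singular_chain p M (frag_of (simp F))" using FS_chain[OF subc_Delta kw] by (simp add: X_Delta)
		ultimately show ?thesis by (simp add: singular_relcycle)
	qed
	have "trivial_group (relative_homology_group (int p) M (topspace M - {?x}))"
		using local_homology_manifold[OF M b(2), of "int p"] ne p by simp
	then have rb: "singular_relboundary p M (topspace M - {?x}) (frag_of (simp F))"
		using rc unfolding trivial_relative_homology_iff by blast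
	obtain e where e: "keys e \<subseteq> FS (Suc p) \<Delta>"
		"keys (frag_of (simp F) - chain_boundary (Suc p) e) \<subseteq> FS p (avoid ?x)"
		by (rule local_flag_boundary[OF b(2) kw rb])
	have nF: "simp F \<notin> FS p (avoid ?x)"
	proof
		assume "simp F : FS p (avoid ?x)"
		then obtain G where G: "G : avoid ?x" "card G = Suc p" "simp F = simp G" by (auto simp: FS_def)
		then have "F = G" using simp_inj[of F G p] F(1) p by (auto simp: avoid_def)
		then show False using G(1) b(3) by (auto simp: avoid_def)
	qed
	have "simp F \<notin> keys (chain_boundary (Suc p) e)"
	proof -
		have "keys (chain_boundary (Suc p) e) \<subseteq> - {simp F}"
		proof (rule chain_boundary_keys)
			fix s assume "s : keys e"
			then obtain G where G: "G : \<Delta>" "card G = Suc (Suc p)" "s = simp G" using e(1) by (auto simp: FS_def)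
			have "simp (G - {v}) ~= simp F" if "v : G" for v
			proof
				assume eq: "simp (G - {v}) = simp F"
				have "card (G - {v}) = Suc p" using G that fin[OF G(1)] by simp
				then have "G - {v} = F" using simp_inj[of "G - {v}" F p] down[OF G(1), of "G - {v}"] F(1) p eq by auto
				then have "G = F" using max[OF G(1)] by auto
				then show False using G(2) p by simp
			qed
			then show "keys (chain_boundary (Suc p) (frag_of s)) \<subseteq> - {simp F}"
				unfolding G(3) bd_simp[OF G(1,2)] by (intro keys_frag_sum) simp
		qed
		then show ?thesis by blast
	qed
	then have "lookup (frag_of (simp F) - chain_boundary (Suc p) e) (simp F) = 1"
		by (simp add: lookup_minus in_keys_iff)
	then have "simp F : keys (frag_of (simp F) - chain_boundary (Suc p) e)" by (simp add: in_keys_iff)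
	then show False using e(2) nF by blast
qed

lemma flag_card_le:
	assumes M: "closed_manifold d M" and F: "F : \<Delta>"
	shows "card F <= Suc d"
proof (cases "F = {}")
	case False
	let ?S = "{G\<in>\<Delta>. F \<subseteq> G}"
	have fS: "finite ?S" "?S ~= {}" using finD F by auto
	then have "Max (card ` ?S) : card ` ?S" by simp
	then obtain G where G: "Max (card ` ?S) = card G" "G : ?S" by (rule imageE)
	have mx: "card H <= card G" if "H : ?S" for H unfolding G(1)[symmetric] using fS that by simp
	have "H = G" if "H : \<Delta>" "G \<subseteq> H" for H
		using card_subset_eq[OF fin[OF that(1)] that(2)] mx[of H] G(2) that card_mono[OF fin[OF that(1)] that(2)] by auto
	then have "card G = Suc d" using maximal_flag_card[OF M, of G] G(2) False by auto
	then show ?thesis using mx[of F] F by simp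
qed simp

end

section \<open>The fundamental cycle\<close>

locale oriented_complex = realized_complex P \<Delta> rk m M \<Phi>
	for P :: "'v set" and \<Delta> :: "'v set set" and rk :: "'v => nat" and m :: nat
		and M :: "'a topology" and \<Phi> :: "('v => real) => 'a" +
	fixes ori :: "'a => 'a chain set"
	assumes manifold: "closed_manifold m M" and orient: "manifold_orientation m M ori"
begin

abbreviation N where "N x \<equiv> topspace M - {x}"

lemma FS_top: "FS (Suc m) \<Delta> = {}"
	using flag_card_le[OF manifold] by (force simp: FS_def)

text \<open>No flag has \<open>m + 2\<close> vertices, so the flag filling of a local null-homology
  is zero in top degree.\<close>

lemma top_flags_eq:
	assumes x: "x : topspace M" and w: "keys w \<subseteq> FS m \<Delta>" "singular_relboundary m M (N x) w"
		and F: "F : \<Delta>" "card F = Suc m" "{v. \<Psi> x v ~= 0} \<subseteq> F"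
	shows "lookup w (simp F) = 0"
proof -
	obtain e where e: "keys e \<subseteq> FS (Suc m) \<Delta>" "keys (w - chain_boundary (Suc m) e) \<subseteq> FS m (avoid x)"
		by (rule local_flag_boundary[OF x w])
	have "e = 0" using e(1) FS_top by (simp add: keys_eq_empty)
	then have k: "keys w \<subseteq> FS m (avoid x)" using e(2) by simp
	have "simp F \<notin> FS m (avoid x)"
	proof
		assume "simp F : FS m (avoid x)"
		then obtain G where "G : avoid x" "card G = Suc m" "simp F = simp G" by (auto simp: FS_def)
		then have "G : avoid x" "F = G" using simp_inj[of F G m] F by (auto simp: avoid_def)
		then show False using F(3) by (auto simp: avoid_def)
	qed
	then show ?thesis using k by (auto simp: in_keys_iff)
qed

text \<open>A flag representative of the orientation at \<open>x\<close>; only its coefficients at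
  flags through the carrier of \<open>x\<close> are independent of the choice.\<close>

definition lrep where "lrep x = (SOME w. keys w \<subseteq> FS m \<Delta> & homologous_rel_set m M (N x) w = ori x)"

lemma lrep:
	assumes x: "x : topspace M"
	shows "keys (lrep x) \<subseteq> FS m \<Delta>" "homologous_rel_set m M (N x) (lrep x) = ori x"
		"singular_relcycle m M (N x) (lrep x)"
proof -
	have "ori x : carrier (relative_homology_group (int m) M (N x))"
		using orient x unfolding manifold_orientation_def by blast
	then obtain c where c: "singular_relcycle m M (N x) c" "ori x = homologous_rel_set m M (N x) c"
		by (auto simp: carrier_relative_homology_group)
	obtain w where w: "keys w \<subseteq> FS m \<Delta>" "homologous_rel m M (N x) c w" by (rule local_flag_rep[OF x c(1)])
	have ww: "homologous_rel_set m M (N x) w = ori x" using w(2) c(2) homologous_rel_set_eq by metis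
	then have ex: "EX w. keys w \<subseteq> FS m \<Delta> & homologous_rel_set m M (N x) w = ori x" using w(1) by blast
	show 1: "keys (lrep x) \<subseteq> FS m \<Delta>" "homologous_rel_set m M (N x) (lrep x) = ori x"
		using someI_ex[OF ex] unfolding lrep_def by auto
	then have "homologous_rel m M (N x) c (lrep x)" using c(2) homologous_rel_set_eq by metis
	then show "singular_relcycle m M (N x) (lrep x)" using homologous_rel_singular_relcycle c(1) by blast
qed

lemma Haus: "Hausdorff_space M" using manifold by (simp add: closed_manifold_def)

text \<open>Near \<open>x\<close> the orientation comes from one chain, which differs from
  \<open>lrep x\<close> by a boundary and a chain \<open>a\<close> missing \<open>x\<close>. The
  image of \<open>a\<close> is compact, so it misses nearby points too, and \<open>lrep x\<close>
  represents the orientation there as well.\<close>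

lemma lrep_local:
	assumes x: "x : topspace M"
	obtains V where "openin M V" "x : V"
		"!!y F. y : V ==> F : \<Delta> ==> card F = Suc m ==> {v. \<Psi> y v ~= 0} \<subseteq> F ==>
			 lookup (lrep y) (simp F) = lookup (lrep x) (simp F)"
proof -
	have "EX U c. openin M U & x : U & singular_relcycle m M (topspace M - U) c &
			(ALL y:U. homologous_rel_set m M (N y) c = ori y)"
		by (rule bspec[OF conjunct2[OF orient[unfolded manifold_orientation_def]] x])
	then obtain U c where U: "openin M U" "x : U" "singular_relcycle m M (topspace M - U) c"
		"ALL y:U. homologous_rel_set m M (N y) c = ori y"
		by (elim exE conjE)
	have "homologous_rel_set m M (N x) c = homologous_rel_set m M (N x) (lrep x)" using U(2,4) lrep(2)[OF x] by simp
	then have "homologous_rel m M (N x) c (lrep x)" by (simp only: homologous_rel_set_eq)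
	then obtain b a where b: "singular_chain (Suc m) M b" "singular_chain m (subtopology M (N x)) a"
		"chain_boundary (Suc m) b + a = c - lrep x"
		unfolding homologous_rel_def singular_relboundary by blast
	let ?K = "\<Union>s\<in>keys a. s ` standard_simplex m"
	have "closedin M ?K"
	proof (rule closedin_Union)
		fix T assume "T : (%s. s ` standard_simplex m) ` keys a"
		then obtain s where s: "s : keys a" "T = s ` standard_simplex m" by blast
		have "singular_chain m M a" using b(2) by (simp add: singular_chain_subtopology)
		then have "singular_simplex m M s" using s(1) by (auto simp: singular_chain_def)
		then have "continuous_map (subtopology (powertop_real UNIV) (standard_simplex m)) M s" by (simp add: singular_simplex_def)
		moreover have "compactin (subtopology (powertop_real UNIV) (standard_simplex m)) (standard_simplex m)"
			using compactin_standard_simplex by (simp add: compactin_subtopology)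
		ultimately have "compactin M T" unfolding s(2) by (rule image_compactin[rotated])
		then show "closedin M T" by (rule compactin_imp_closedin[OF Haus])
	qed auto
	then have V: "openin M (U - ?K)" by (rule openin_diff[OF U(1)])
	have xV: "x : U - ?K" using U(2) b(2) by (auto simp: singular_chain_subtopology)
	show thesis
	proof (rule that[OF V xV])
		fix y F assume y: "y : U - ?K" and F: "F : \<Delta>" "card F = Suc m" "{v. \<Psi> y v ~= 0} \<subseteq> F"
		have yM: "y : topspace M" using y openin_subset[OF U(1)] by blast
		have a: "singular_chain m (subtopology M (N y)) a"
		proof -
			have "s ` standard_simplex m \<subseteq> N y" if "s : keys a" for s
			proof -
				have "s ` standard_simplex m \<subseteq> N x" using b(2) that by (auto simp: singular_chain_subtopology)
				then show ?thesis using y that by blast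
			qed
			then show ?thesis using b(2) by (auto simp: singular_chain_subtopology)
		qed
		then have "homologous_rel m M (N y) c (lrep x)"
			unfolding homologous_rel_def singular_relboundary using b(1,3) by blast
		moreover have "homologous_rel m M (N y) c (lrep y)"
		proof -
			have "homologous_rel_set m M (N y) c = homologous_rel_set m M (N y) (lrep y)" using U(4) y lrep(2)[OF yM] by simp
			then show ?thesis by (simp only: homologous_rel_set_eq)
		qed
		ultimately have "homologous_rel m M (N y) (lrep y) (lrep x)" using homologous_rel_sym homologous_rel_trans by blast
		then have rb: "singular_relboundary m M (N y) (lrep y - lrep x)" by (simp add: homologous_rel_def)
		have "keys (lrep y - lrep x) \<subseteq> FS m \<Delta>"
			using lrep(1)[OF x] lrep(1)[OF yM] keys_diff[of "lrep y" "lrep x"] by blast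
		from top_flags_eq[OF yM this rb F]
		show "lookup (lrep y) (simp F) = lookup (lrep x) (simp F)" by (simp add: lookup_minus)
	qed
qed

definition zi where "zi F = (if F : \<Delta> & card F = Suc m then lookup (lrep (bary F)) (simp F) else 0)"

text \<open>The coefficient at \<open>F\<close> is locally constant along the segment from
  \<open>x\<close> to the barycenter of \<open>F\<close>, on which the carrier stays inside
  \<open>F\<close>; the segment is connected.\<close>

lemma lrep_const:
	assumes x: "x : topspace M" and F: "F : \<Delta>" "card F = Suc m" "{v. \<Psi> x v ~= 0} \<subseteq> F"
	shows "lookup (lrep x) (simp F) = zi F"
proof -
	have F0: "F ~= {}" using F(2) by auto
	note b = bary_facts[OF F(1) F0]
	let ?b = "%v. if v : F then 1 / real (card F) else 0"
	define h where "h s = (%v. (1 - s) * \<Psi> x v + s * ?b v)" for s :: real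
	have h: "h s : geo P \<Delta>" "{v. h s v ~= 0} \<subseteq> F" if "s : {0..1}" for s
	proof -
		have "sum (h s) P = (1 - s) * sum (\<Psi> x) P + s * sum ?b P"
			unfolding h_def by (simp only: sum.distrib sum_distrib_left)
		then have "sum (h s) P = 1" using Psi_in[OF x] b(1) by (simp add: geo_def)
		moreover show k: "{v. h s v ~= 0} \<subseteq> F" using F(3) by (auto simp: h_def)
		moreover have "0 <= h s v" for v using that Psi_in[OF x] by (auto simp: h_def geo_def)
		ultimately show "h s : geo P \<Delta>" using down[OF F(1) k] by (simp add: geo_def)
	qed
	have "continuous_on {0..1} h"
	proof (rule continuous_on_coordinatewise_then_product)
		fix v
		have "continuous_on {0..1} (%s::real. (1 - s) * a + s * b)" for a b by (intro continuous_intros)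
		then show "continuous_on {0..1} (%s. h s v)" unfolding h_def .
	qed
	then have "continuous_map (top_of_set {0..1}) (top_of_set (geo P \<Delta>)) h"
		using h(1) by (auto simp: continuous_map_in_subtopology)
	then have c: "continuous_map (top_of_set {0..1}) M (\<Phi> \<circ> h)" by (rule continuous_map_compose[OF _ Phi_cont])
	have hM: "\<Phi> (h s) : topspace M" if "s : {0..1}" for s using h(1)[OF that] Phi_image by blast
	define f where "f s = lookup (lrep (\<Phi> (h s))) (simp F)" for s
	have "f constant_on {0..1}"
	proof (rule locally_constant_imp_constant)
		fix s :: real assume s: "s : {0..1}"
		show "EX T. openin (top_of_set {0..1}) T & s : T & (ALL r:T. f r = f s)"
		proof (rule lrep_local[OF hM[OF s]])
			fix V assume V: "openin M V" "\<Phi> (h s) : V"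
				"!!y F. y : V ==> F : \<Delta> ==> card F = Suc m ==> {v. \<Psi> y v ~= 0} \<subseteq> F ==>
					 lookup (lrep y) (simp F) = lookup (lrep (\<Phi> (h s))) (simp F)"
			let ?T = "{r : topspace (top_of_set {0..1}). (\<Phi> \<circ> h) r : V}"
			have "openin (top_of_set {0..1}) ?T" by (rule openin_continuous_map_preimage[OF c V(1)])
			moreover have "s : ?T" using s V(2) by simp
			moreover have "f r = f s" if "r : ?T" for r
			proof -
				have r: "r : {0..1}" "\<Phi> (h r) : V" using that by auto
				have "{v. \<Psi> (\<Phi> (h r)) v ~= 0} \<subseteq> F" unfolding Psi_Phi[OF h(1)[OF r(1)]] by (rule h(2)[OF r(1)])
				then show ?thesis unfolding f_def by (rule V(3)[OF r(2) F(1,2)])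
			qed
			ultimately show ?thesis by blast
		qed
	qed simp
	then have "f 0 = f 1" unfolding constant_on_def by (metis atLeastAtMost_iff order_refl zero_le_one)
	moreover have "\<Phi> (h 0) = x" using Phi_Psi[OF x] by (simp add: h_def)
	moreover have "\<Phi> (h 1) = bary F" by (simp add: h_def bary_def)
	ultimately show ?thesis unfolding f_def zi_def using F by simp
qed

text \<open>Local representatives agree wherever their coefficients are determined, and so glue to
  one integral chain.\<close>

definition zc where "zc = (\<Sum>F\<in>{F\<in>\<Delta>. card F = Suc m}. frag_cmul (zi F) (frag_of (simp F)))"

lemma flag_sum_lookup:
	assumes "G : \<Delta>" "card G = Suc p"
	shows "lookup (\<Sum>F\<in>{F\<in>\<Delta>. card F = Suc p}. frag_cmul (k F) (frag_of (simp F))) (simp G) = k G"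
proof -
	have "(simp G = simp F) = (F = G)" if "F : \<Delta>" "card F = Suc p" for F
		using simp_inj[of G F p] assms that by auto
	then have "lookup (\<Sum>F\<in>{F\<in>\<Delta>. card F = Suc p}. frag_cmul (k F) (frag_of (simp F))) (simp G)
		 = (\<Sum>F\<in>{F\<in>\<Delta>. card F = Suc p}. if F = G then k F else 0)"
		unfolding lookup_sum lookup_frag_cmul lookup_frag_of by (intro sum.cong refl) auto
	also have "\<dots> = k G" using finD assms by simp
	finally show ?thesis .
qed

lemma flag_sum_keys: "keys (\<Sum>F\<in>{F\<in>\<Delta>. card F = Suc p}. frag_cmul (k F) (frag_of (simp F))) \<subseteq> FS p \<Delta>"
proof -
	have "keys (frag_cmul (k F) (frag_of (simp F))) \<subseteq> FS p \<Delta>" if "F : {F\<in>\<Delta>. card F = Suc p}" for F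
		using that by (auto simp: FS_def)
	then show ?thesis
		using Poly_Mapping.keys_sum[of "%F. frag_cmul (k F) (frag_of (simp F))" "{F\<in>\<Delta>. card F = Suc p}"] by blast
qed

lemma zc_keys: "keys zc \<subseteq> FS m \<Delta>" unfolding zc_def by (rule flag_sum_keys)

lemma zc_lookup: "F : \<Delta> ==> card F = Suc m ==> lookup zc (simp F) = zi F"
	unfolding zc_def by (rule flag_sum_lookup)

lemma zc_lrep:
	assumes x: "x : topspace M"
	shows "keys (zc - lrep x) \<subseteq> FS m (avoid x)"
proof
	fix s assume s: "s : keys (zc - lrep x)"
	then have "s : FS m \<Delta>" using zc_keys lrep(1)[OF x] keys_diff[of zc "lrep x"] by blast
	then obtain F where F: "F : \<Delta>" "card F = Suc m" "s = simp F" by (auto simp: FS_def)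
	have "~ {v. \<Psi> x v ~= 0} \<subseteq> F"
		using s lrep_const[OF x F(1,2)] zc_lookup[OF F(1,2)] F(3) by (auto simp: in_keys_iff lookup_minus)
	then show "s : FS m (avoid x)" using F by (auto simp: FS_def avoid_def)
qed

lemma chain_avoid: "x : topspace M ==> keys w \<subseteq> FS p (avoid x) ==> singular_chain p (subtopology M (N x)) w"
	by (rule singular_chain_mono[OF FS_chain[OF avoid_facts(5)] avoid_facts(6)])

lemma zc_ori: assumes x: "x : topspace M" shows "homologous_rel_set m M (N x) zc = ori x"
proof -
	have "singular_relboundary m M (N x) (zc - lrep x)"
		by (rule singular_chain_imp_relboundary[OF chain_avoid[OF x zc_lrep[OF x]]])
	then have "homologous_rel m M (N x) zc (lrep x)" by (simp add: homologous_rel_def)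
	then have "homologous_rel_set m M (N x) zc = homologous_rel_set m M (N x) (lrep x)" by (simp only: homologous_rel_set_eq)
	then show ?thesis using lrep(2)[OF x] by simp
qed

lemma zc_chain: "singular_chain m M zc"
	using FS_chain[OF subc_Delta zc_keys] by (simp add: X_Delta)

text \<open>A flag in the boundary passes through its own barycenter, yet modulo flags avoiding that
  point \<open>zc\<close> equals a relative cycle, whose boundary misses it.\<close>

lemma zc_cycle: "chain_boundary m zc = 0"
proof (cases m)
	case (Suc q)
	have "keys (chain_boundary m zc) = {}"
	proof (rule ccontr)
		assume "keys (chain_boundary m zc) ~= {}"
		then obtain s where s: "s : keys (chain_boundary m zc)" by blast
		then have "s : FS q \<Delta>" using FS_boundary[OF subc_Delta zc_keys] Suc by auto
		then obtain G where G: "G : \<Delta>" "card G = Suc q" "s = simp G" by (auto simp: FS_def)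
		have G0: "G ~= {}" using G(2) by auto
		note b = bary_facts[OF G(1) G0]
		let ?x = "bary G"
		have "singular_chain (m - 1) (subtopology M (N ?x)) (chain_boundary m (lrep ?x))"
			using lrep(3)[OF b(2)] by (simp add: singular_relcycle)
		moreover have "singular_chain (m - 1) (subtopology M (N ?x)) (chain_boundary m (zc - lrep ?x))"
			using singular_chain_boundary[OF chain_avoid[OF b(2) zc_lrep[OF b(2)]]] by simp
		moreover have "chain_boundary m zc = chain_boundary m (lrep ?x) + chain_boundary m (zc - lrep ?x)"
			by (simp add: chain_boundary_diff)
		ultimately have "singular_chain q (subtopology M (N ?x)) (chain_boundary m zc)"
			using singular_chain_add Suc by fastforce
		then have "s ` standard_simplex q \<subseteq> N ?x" using s by (auto simp: singular_chain_subtopology)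
		moreover have "?x : simp G ` standard_simplex q" by (rule simp_hits[OF b(2) G(1,2)]) (simp add: b(3))
		ultimately show False using G(3) by blast
	qed
	then show ?thesis by (simp add: keys_eq_empty)
qed (simp add: chain_boundary_def)

lemma zc_fundamental: "fundamental_cycle m M ori zc"
	unfolding fundamental_cycle_def using zc_ori zc_chain zc_cycle by (auto simp: singular_cycle)

text \<open>The difference is homologous to a flag chain of top degree, all of whose coefficients
  vanish locally. The comparison is required because the intersection number quantifies over all
  fundamental cycles.\<close>

lemma fundamental_unique:
	assumes z: "fundamental_cycle m M ori z"
	obtains b where "singular_chain (Suc m) M b" "z - zc = chain_boundary (Suc m) b"
proof -
	have zz: "singular_chain m M z" "chain_boundary m z = 0" "!!x. x : topspace M ==> homologous_rel_set m M (N x) z = ori x"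
		using z unfolding fundamental_cycle_def by (auto simp: singular_cycle)
	have s: "singular_chain m (X \<Delta>) (z - zc)" unfolding X_Delta by (rule singular_chain_diff[OF zz(1) zc_chain])
	have cy: "chain_boundary m (z - zc) = 0" using zz(2) zc_cycle by (simp add: chain_boundary_diff)
	obtain b w where b: "singular_chain (Suc m) (X \<Delta>) b" "keys w \<subseteq> FS m \<Delta>" "z - zc = chain_boundary (Suc m) b + w"
		by (rule approxD[OF approx_all[OF subc_Delta] s]) (simp add: cy)
	have bM: "singular_chain (Suc m) M b" using b(1) by (simp add: X_Delta)
	have "keys w = {}"
	proof (rule ccontr)
		assume "keys w ~= {}"
		then obtain s where s: "s : keys w" by blast
		then obtain F where F: "F : \<Delta>" "card F = Suc m" "s = simp F" using b(2) by (auto simp: FS_def)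
		have F0: "F ~= {}" using F(2) by auto
		note bf = bary_facts[OF F(1) F0]
		let ?x = "bary F"
		have "homologous_rel_set m M (N ?x) z = homologous_rel_set m M (N ?x) zc" using zz(3) zc_ori bf(2) by simp
		then have "homologous_rel m M (N ?x) z zc" by (simp only: homologous_rel_set_eq)
		then have "singular_relboundary m M (N ?x) (z - zc)" by (simp only: homologous_rel_def)
		moreover have "singular_relboundary m M (N ?x) (chain_boundary (Suc m) b)"
			unfolding singular_relboundary using bM by (intro exI[of _ b] exI[of _ 0]) simp
		ultimately have "singular_relboundary m M (N ?x) (z - zc - chain_boundary (Suc m) b)" by (rule singular_relboundary_diff)
		then have rb: "singular_relboundary m M (N ?x) w" using b(3) by simp
		have "lookup w (simp F) = 0" by (rule top_flags_eq[OF bf(2) b(2) rb F(1,2)]) (simp add: bf(3))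
		then show False using s F(3) by (simp add: in_keys_iff)
	qed
	then have "w = 0" by (simp add: keys_eq_empty)
	then show thesis using that[OF bM] b(3) by simp
qed

text \<open>If every flag of the fundamental cycle missed \<open>s\<close>, the orientation class at
  \<open>s\<close> would be zero, although it generates a nontrivial group.\<close>

lemma zi_nonzero:
	assumes s: "s : P"
	shows "EX F. s : F & zi F ~= 0"
proof (rule ccontr)
	assume no: "~ ?thesis"
	have sD: "{s} : \<Delta>" "{s} ~= {}" using vert[OF s] by auto
	note b = bary_facts[OF sD]
	let ?x = "bary {s}"
	have "keys zc \<subseteq> FS m (avoid ?x)"
	proof
		fix t assume t: "t : keys zc"
		then obtain F where F: "F : \<Delta>" "card F = Suc m" "t = simp F" using zc_keys by (auto simp: FS_def)
		have "zi F ~= 0" using t zc_lookup[OF F(1,2)] F(3) by (simp add: in_keys_iff)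
		then have "s \<notin> F" using no by blast
		then show "t : FS m (avoid ?x)" using F b(3) by (auto simp: FS_def avoid_def)
	qed
	then have rb: "singular_relboundary m M (N ?x) zc"
		by (rule singular_chain_imp_relboundary[OF chain_avoid[OF b(2)]])
	then have o: "ori ?x = singular_relboundary_set m M (N ?x)"
		using zc_ori[OF b(2)] homologous_rel_set_eq_relboundary by blast
	let ?G = "relative_homology_group (int m) M (N ?x)"
	have "generate ?G {ori ?x} = carrier ?G" using orient b(2) unfolding manifold_orientation_def by blast
	moreover have "generate ?G {\<one>\<^bsub>?G\<^esub>} = {\<one>\<^bsub>?G\<^esub>}" by (rule group.generate_one[OF group_relative_homology_group])
	ultimately have "trivial_group ?G" using o by (auto simp: trivial_group_def)
	then show False using local_homology_manifold[OF manifold b(2), of "int m"] by simp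
qed

lemma local_generator:
	assumes x: "x : topspace M" and c: "singular_relcycle m M (N x) c"
	obtains k where "singular_relboundary m M (N x) (c - frag_cmul k zc)"
proof -
	let ?G = "relative_homology_group (int m) M (N x)"
	let ?h = "homologous_rel_set m M (N x)"
	have gen: "generate ?G {ori x} = carrier ?G" using orient x unfolding manifold_orientation_def by blast
	have zr: "singular_relcycle m M (N x) zc" using zc_chain zc_cycle by (simp add: singular_relcycle)
	\<comment> \<open>The product of the group is elementwise addition of cosets, so multiples of the
	  generator correspond to integral multiples of \<open>zc\<close>.\<close>
	have mul: "?h a \<otimes>\<^bsub>?G\<^esub> ?h b = ?h (a + b)" for a b
	proof -
		have "t : ?h a \<otimes>\<^bsub>?G\<^esub> ?h b \<longleftrightarrow> t : ?h (a + b)" for t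
		proof
			assume "t : ?h a \<otimes>\<^bsub>?G\<^esub> ?h b"
			then obtain r q where "homologous_rel m M (N x) a r" "homologous_rel m M (N x) b q" "t = r + q"
				unfolding mult_relative_homology_group by auto
			then show "t : ?h (a + b)" using homologous_rel_add by auto
		next
			assume "t : ?h (a + b)"
			then have "homologous_rel m M (N x) b (t - a)" by (simp add: homologous_rel_def algebra_simps)
			moreover have "t = a + (t - a)" by simp
			ultimately show "t : ?h a \<otimes>\<^bsub>?G\<^esub> ?h b" unfolding mult_relative_homology_group using homologous_rel_refl by blast
		qed
		then show ?thesis by blast
	qed
	have one: "\<one>\<^bsub>?G\<^esub> = ?h 0" using homologous_rel_set_eq_relboundary[of m M "N x" 0] by simp
	have car: "?h (frag_cmul k zc) : carrier ?G" for k
		using singular_relcycle_cmul[OF zr] by (auto simp: carrier_relative_homology_group)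
	have "EX k. C = ?h (frag_cmul k zc)" if "C : generate ?G {ori x}" for C
		using that
	proof (induction rule: generate.induct)
		case one
		show ?case using \<open>\<one>\<^bsub>?G\<^esub> = ?h 0\<close> by (intro exI[of _ 0]) simp
	next
		case (incl h)
		then show ?case using zc_ori[OF x] by (intro exI[of _ 1]) simp
	next
		case (inv h)
		have h: "h = ?h (frag_cmul 1 zc)" using inv zc_ori[OF x] by simp
		have "?h (frag_cmul (-1) zc) \<otimes>\<^bsub>?G\<^esub> h = \<one>\<^bsub>?G\<^esub>" unfolding h mul one by simp
		then have "inv\<^bsub>?G\<^esub> h = ?h (frag_cmul (-1) zc)"
			by (rule group.inv_equality[OF group_relative_homology_group]) (use car[of 1] car[of "-1"] h in \<open>simp_all only:\<close>)
		then show ?case by blast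
	next
		case (eng h1 h2)
		then obtain k l where "h1 = ?h (frag_cmul k zc)" "h2 = ?h (frag_cmul l zc)" by blast
		then have "h1 \<otimes>\<^bsub>?G\<^esub> h2 = ?h (frag_cmul (k + l) zc)" by (simp only: mul frag_cmul_distrib)
		then show ?case by blast
	qed
	moreover have "?h c : generate ?G {ori x}" unfolding gen using c by (auto simp: carrier_relative_homology_group)
	ultimately obtain k where "?h c = ?h (frag_cmul k zc)" by blast
	then have "homologous_rel m M (N x) c (frag_cmul k zc)" by (simp only: homologous_rel_set_eq)
	then have "singular_relboundary m M (N x) (c - frag_cmul k zc)" by (simp only: homologous_rel_def)
	then show thesis by (rule that)
qed

end

section \<open>Real chains and the cap product\<close>

lemma (in flag_complex) bd_Fn_Delta: "x : Fn (Suc k) \<Delta> ==> \<partial> x : Fn k \<Delta>"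
	by (rule bd_Fn) (use down fin in blast)+

lemma rchain_decomposition:
	"\<exists>I (z :: real => 's \<Rightarrow>\<^sub>0 int). zindep I & (ALL i. keys (z i) \<subseteq> keys c) & c = (\<Sum>i\<in>I. rscale i (ri (z i)))"
	by (rule rchain_decompose[of c]) blast

lemma rchains_nat: "c : rchains (int p) X \<longleftrightarrow> keys c \<subseteq> singular_simplex_set p X"
	by (auto simp: rchains_def)

lemma rchains_ri: "ri z : rchains (int p) X \<longleftrightarrow> singular_chain p X z"
	by (simp add: rchains_nat singular_chain_def)

lemma subspace_rchains: "rv.subspace (rchains p X)"
	unfolding rv.subspace_def rchains_def
	by (auto dest!: subsetD[OF Poly_Mapping.keys_add] subsetD[OF keys_rscale])

lemmas rchains_add = rv.subspace_add[OF subspace_rchains]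
lemmas rchains_scale = rv.subspace_scale[OF subspace_rchains]
lemmas rchains_sum = rv.subspace_sum[OF subspace_rchains]
lemmas rchains_0 = rv.subspace_0[OF subspace_rchains]

lemma rchains_single: "singular_simplex p X s ==> single s r : rchains (int p) X"
	by (auto simp: rchains_nat)

lemma rboundary_rchains:
	assumes "c : rchains (p + 1) X"
	shows "rboundary (p + 1) c : rchains p X"
proof (cases "0 <= p")
	case False
	then show ?thesis by (simp add: rboundary_def rchains_0)
next
	case True
	then obtain q where q: "p = int q" by (metis nonneg_int_cases)
	have Sq: "p + 1 = int (Suc q)" by (simp add: q)
	obtain I z where z: "zindep I" "ALL i. keys (z i) \<subseteq> keys c" "c = (\<Sum>i\<in>I. rscale i (ri (z i)))"
		using rchain_decomposition[of c] by (elim exE conjE)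
	have zc: "singular_chain (Suc q) X (z i)" for i
		using assms z(2)[rule_format, of i] unfolding Sq rchains_nat singular_chain_def by blast
	have "rboundary (p + 1) c = (\<Sum>i\<in>I. rscale i (ri (chain_boundary (Suc q) (z i))))"
		unfolding Sq z(3) rboundary_sum rboundary_scale rboundary_ri ..
	also have "\<dots> : rchains p X"
		unfolding q by (intro rchains_sum rchains_scale) (simp add: rchains_ri singular_chain_boundary_alt zc)
	finally show ?thesis .
qed

lemma rboundary_rboundary:
	assumes "c : rchains (p + 1) X"
	shows "rboundary p (rboundary (p + 1) c) = 0"
proof (cases "0 < p")
	case True
	then obtain q where q: "p = int q" by (metis nonneg_int_cases less_imp_le)
	have Sq: "p + 1 = int (Suc q)" by (simp add: q)
	obtain I z where z: "zindep I" "ALL i. keys (z i) \<subseteq> keys c" "c = (\<Sum>i\<in>I. rscale i (ri (z i)))"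
		using rchain_decomposition[of c] by (elim exE conjE)
	have zc: "singular_chain (Suc q) X (z i)" for i
		using assms z(2)[rule_format, of i] unfolding Sq rchains_nat singular_chain_def by blast
	show ?thesis
		unfolding Sq z(3) rboundary_sum rboundary_scale rboundary_ri
		unfolding q rboundary_ri chain_boundary_boundary_alt[OF zc] by (simp add: ri_simps)
qed (simp add: rboundary_def)

lemma rboundary_single: "0 < p ==> rboundary (int p) (single s r) =
		(\<Sum>k\<le>p. single (singular_face p k s) (r * (-1) ^ k))"
	by (simp add: rboundary_def rv.scale_sum_right rscale_single)

section \<open>Front and back faces and the boundary formula for cap products\<close>

definition sh :: "nat => (nat => real) => nat => real"
	where "sh p x = (%i. if i < p then 0 else x (i - p))"

lemma back_face_sh: "back_face p q s = restrict (s \<circ> sh p) (standard_simplex q)"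
	unfolding back_face_def sh_def by simp

lemma sh_simplex: assumes "x : standard_simplex q" shows "sh p x : standard_simplex (p + q)"
proof -
	have "(\<Sum>i\<le>p+q. sh p x i) = (\<Sum>i\<in>{p..p+q}. sh p x i)"
		by (rule sum.mono_neutral_right) (auto simp: sh_def)
	also have "\<dots> = (\<Sum>i\<in>{0+p..q+p}. sh p x i)" by (simp add: add.commute)
	also have "\<dots> = (\<Sum>i\<in>{0..q}. sh p x (i + p))" by (rule sum.shift_bounds_cl_nat_ivl)
	also have "\<dots> = (\<Sum>i\<le>q. x i)" by (simp add: sh_def atMost_atLeast0)
	finally show ?thesis using assms by (auto simp: standard_simplex_def sh_def)
qed

lemma front_face_simplex:
	assumes "singular_simplex (p + q) X s" shows "singular_simplex p X (front_face p s)"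
proof -
	have "standard_simplex p \<subseteq> standard_simplex (p + q)" by (rule standard_simplex_mono) simp
	moreover have "continuous_map (subtopology (powertop_real UNIV) (standard_simplex (p + q))) X s"
		using assms by (simp add: singular_simplex_def)
	ultimately have "continuous_map (subtopology (powertop_real UNIV) (standard_simplex p)) X s"
		by (rule continuous_map_from_subtopology_mono[rotated])
	then have "continuous_map (subtopology (powertop_real UNIV) (standard_simplex p)) X (front_face p s)"
		by (rule continuous_map_eq) (simp add: front_face_def)
	then show ?thesis by (simp add: singular_simplex_def front_face_def)
qed

lemma back_face_simplex:
	assumes "singular_simplex (p + q) X s" shows "singular_simplex q X (back_face p q s)"
proof -
	have "continuous_on (standard_simplex q) (sh p)"
	proof (rule continuous_on_coordinatewise_then_product)
		fix i
		show "continuous_on (standard_simplex q) (%x. sh p x i)"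
			by (cases "i < p") (simp_all add: sh_def continuous_on_coord)
	qed
	then have "continuous_map (top_of_set (standard_simplex q)) (top_of_set (standard_simplex (p + q))) (sh p)"
		using sh_simplex by (auto simp: continuous_map_in_subtopology)
	moreover have "continuous_map (top_of_set (standard_simplex (p + q))) X s"
		using assms by (simp add: singular_simplex_def euclidean_product_topology)
	ultimately have "continuous_map (top_of_set (standard_simplex q)) X (s \<circ> sh p)" by (rule continuous_map_compose)
	then have "continuous_map (top_of_set (standard_simplex q)) X (back_face p q s)"
		by (rule continuous_map_eq) (simp add: back_face_sh)
	then show ?thesis by (simp add: singular_simplex_def back_face_sh euclidean_product_topology)
qed

lemma cap_rchains: "c : rchains (int (p + q)) X ==> cap p q c \<phi> : rchains (int q) X"
	unfolding rchains_nat cap_def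
	using keys_rextend[of "%s. single (back_face p q s) (\<phi> (front_face p s))" c] back_face_simplex[of p q X]
	by (fastforce split: if_splits)

lemma rlinear_cap: "rlinear (%c. cap p q c \<phi>)"
	unfolding cap_def by (rule rlinear_rextend)

lemma face_front:
	assumes "k <= Suc p"
	shows "front_face p (singular_face (p + Suc r) k s) = singular_face (Suc p) k (front_face (Suc p) s)"
proof (rule ext)
	fix x
	have 1: "x : standard_simplex (p + r)" if "x : standard_simplex p" using that standard_simplex_mono[of p "p + r"] by auto
	have 2: "simplical_face k x : standard_simplex (Suc p)" if "x : standard_simplex p"
		using simplical_face_in_standard_simplex[of "Suc p" k x] assms that by simp
	show "front_face p (singular_face (p + Suc r) k s) x = singular_face (Suc p) k (front_face (Suc p) s) x"
		by (cases "x : standard_simplex p") (simp_all add: front_face_def singular_face_def 1 2)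
qed

lemma face_front_late:
	assumes "p < k"
	shows "front_face p (singular_face (p + Suc r) k s) = front_face p s"
proof (rule ext)
	fix x
	have 1: "x : standard_simplex (p + r)" if "x : standard_simplex p" using that standard_simplex_mono[of p "p + r"] by auto
	have 2: "simplical_face k x = x" if "x : standard_simplex p"
		using that assms by (auto simp: standard_simplex_def simplical_face_def fun_eq_iff)
	show "front_face p (singular_face (p + Suc r) k s) x = front_face p s x"
		by (cases "x : standard_simplex p") (simp_all add: front_face_def singular_face_def 1 2)
qed

lemma face_back_early:
	assumes "k <= p"
	shows "back_face p r (singular_face (p + Suc r) k s) = back_face (Suc p) r s"
proof (rule ext)
	fix x
	have 2: "simplical_face k (sh p x) = sh (Suc p) x"
		using assms by (auto simp: simplical_face_def sh_def fun_eq_iff)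
	show "back_face p r (singular_face (p + Suc r) k s) x = back_face (Suc p) r s x"
		by (cases "x : standard_simplex r") (simp_all add: back_face_sh singular_face_def sh_simplex 2)
qed

lemma face_back:
	assumes "j <= Suc r"
	shows "back_face p r (singular_face (p + Suc r) (p + j) s) = singular_face (Suc r) j (back_face p (Suc r) s)"
proof (rule ext)
	fix x
	have 2: "simplical_face (p + j) (sh p x) = sh p (simplical_face j x)"
	proof
		fix i
		show "simplical_face (p + j) (sh p x) i = sh p (simplical_face j x) i"
		proof (cases "i < p")
			case False
			then obtain l where "i = p + l" using le_Suc_ex not_less by blast
			then show ?thesis by (auto simp: simplical_face_def sh_def)
		qed (auto simp: simplical_face_def sh_def)
	qed
	have 3: "simplical_face j x : standard_simplex (Suc r)" if "x : standard_simplex r"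
		using simplical_face_in_standard_simplex[of "Suc r" j x] assms that by simp
	show "back_face p r (singular_face (p + Suc r) (p + j) s) x = singular_face (Suc r) j (back_face p (Suc r) s) x"
		by (cases "x : standard_simplex r") (simp_all add: back_face_sh singular_face_def sh_simplex 2 3)
qed

text \<open>Faces up to \<open>p\<close> alter the front half, later ones the back half. The cocycle
  condition condenses the first group into the one term missing from the boundary of the back face,
  namely its face opposite the shared vertex.\<close>

lemma cap_boundary_single:
	assumes \<phi>: "rcocycle (int p) X \<phi>" and s: "singular_simplex (p + Suc r) X s"
	shows "cap p r (rboundary (int (p + Suc r)) (single s 1)) \<phi> =
		 rscale ((-1) ^ p) (rboundary (int (Suc r)) (cap p (Suc r) (single s 1) \<phi>))"
proof -
	let ?f = "front_face (Suc p) s" and ?b = "back_face p (Suc r) s" and ?c = "\<phi> (front_face p s)"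
	have fs: "singular_simplex (Suc p) X ?f" using front_face_simplex[of "Suc p" r X s] s by simp
	have "cochain_eval \<phi> (rboundary (int p + 1) (single ?f 1)) = 0"
	proof -
		have "single ?f 1 : rchains (int p + 1) X"
			using rchains_single[OF fs, of 1] by (simp add: add.commute)
		then show ?thesis using \<phi> unfolding rcocycle_def by blast
	qed
	moreover have "rboundary (int p + 1) (single ?f 1) = (\<Sum>k\<le>Suc p. single (singular_face (Suc p) k ?f) ((-1) ^ k))"
		using rboundary_single[of "Suc p" ?f 1] by (simp add: add.commute del: sum.atMost_Suc)
	ultimately have "(\<Sum>k\<le>Suc p. (-1) ^ k * \<phi> (singular_face (Suc p) k ?f)) = 0"
		by (simp add: cochain_eval_sum del: sum.atMost_Suc)
	moreover have "singular_face (Suc p) (Suc p) ?f = front_face p s"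
		using face_front[of "Suc p" p r s] face_front_late[of p "Suc p" r s] by simp
	\<comment> \<open>The last face of the front \<open>(p + 1)\<close>-simplex is the front
	  \<open>p\<close>-face itself; moving it to the other side changes its sign to
	  \<open>(-1) ^ p\<close>.\<close>
	ultimately have coc: "(\<Sum>k\<le>p. (-1) ^ k * \<phi> (singular_face (Suc p) k ?f)) = (-1) ^ p * ?c" by simp
	define t where "t k = single (back_face p r (singular_face (p + Suc r) k s))
			((-1) ^ k * \<phi> (front_face p (singular_face (p + Suc r) k s)))" for k
	have "cap p r (rboundary (int (p + Suc r)) (single s 1)) \<phi> = (\<Sum>k\<le>p + Suc r. t k)"
		using rboundary_single[of "p + Suc r" s 1]
		unfolding cap_def by (simp add: rextend_sum rscale_single t_def del: sum.atMost_Suc)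
	also have "{..p + Suc r} = {..p} Un {p + 1..p + Suc r}" by auto
	also have "(\<Sum>k\<in>{..p} Un {p + 1..p + Suc r}. t k) = (\<Sum>k\<le>p. t k) + (\<Sum>k\<in>{p + 1..p + Suc r}. t k)"
		by (rule sum.union_disjoint) auto
	also have "(\<Sum>k\<le>p. t k) = (\<Sum>k\<le>p. single (back_face (Suc p) r s) ((-1) ^ k * \<phi> (singular_face (Suc p) k ?f)))"
		by (rule sum.cong[OF refl]) (simp add: t_def face_front face_back_early del: add_Suc_right)
	also have "\<dots> = single (back_face (Suc p) r s) ((-1) ^ p * ?c)"
		unfolding coc[symmetric] by (rule poly_mapping_eqI) (simp add: lookup_sum lookup_single when_def)
	also have "back_face (Suc p) r s = singular_face (Suc r) 0 ?b"
		using face_back[of 0 r p s] face_back_early[of p p r s] by simp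
	also have "(\<Sum>k\<in>{p + 1..p + Suc r}. t k) = (\<Sum>j\<in>{1..Suc r}. t (p + j))"
		using sum.shift_bounds_cl_nat_ivl[of t 1 p "Suc r"] by (simp add: add.commute)
	also have "\<dots> = (\<Sum>j\<in>{1..Suc r}. single (singular_face (Suc r) j ?b) ((-1) ^ p * ((-1) ^ j * ?c)))"
		by (rule sum.cong[OF refl]) (simp add: t_def face_front_late face_back power_add mult.assoc del: add_Suc_right)
	also have "single (singular_face (Suc r) 0 ?b) ((-1) ^ p * ?c) +
			(\<Sum>j\<in>{1..Suc r}. single (singular_face (Suc r) j ?b) ((-1) ^ p * ((-1) ^ j * ?c)))
		 = (\<Sum>j\<in>{0..Suc r}. single (singular_face (Suc r) j ?b) ((-1) ^ p * ((-1) ^ j * ?c)))"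
		by (subst (2) sum.atLeast_Suc_atMost) simp_all
	also have "\<dots> = rscale ((-1) ^ p) (rboundary (int (Suc r)) (single ?b ?c))"
		unfolding rboundary_single[OF zero_less_Suc] rv.scale_sum_right rscale_single atMost_atLeast0
		by (intro sum.cong refl) (simp add: mult.commute)
	finally show ?thesis by (simp add: cap_def)
qed

lemma cap_boundary:
	assumes \<phi>: "rcocycle (int p) X \<phi>" and c: "c : rchains (int (p + Suc r)) X"
	shows "cap p r (rboundary (int (p + Suc r)) c) \<phi> = rscale ((-1) ^ p) (rboundary (int (Suc r)) (cap p (Suc r) c \<phi>))"
proof -
	let ?F = "%c. cap p r (rboundary (int (p + Suc r)) c) \<phi>"
	let ?G = "%c. rscale ((-1) ^ p) (rboundary (int (Suc r)) (cap p (Suc r) c \<phi>))"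
	have F: "rlinear ?F"
		by (rule rlinearI) (simp_all add: rboundary_add rboundary_scale rvp.linear_add[OF rlinear_cap] rvp.linear_scale[OF rlinear_cap])
	have G: "rlinear ?G"
		by (rule rlinearI) (simp_all add: rboundary_add rboundary_scale rvp.linear_add[OF rlinear_cap] rvp.linear_scale[OF rlinear_cap]
				rv.scale_right_distrib mult.commute)
	show ?thesis
	proof (rule rlinear_eq_on_singles[OF F G])
		fix s assume "s : keys c"
		then have "singular_simplex (p + Suc r) X s" using c unfolding rchains_nat by blast
		then show "?F (single s 1) = ?G (single s 1)" by (rule cap_boundary_single[OF \<phi>])
	qed
qed

section \<open>Flag chains with real coefficients\<close>

context realized_complex
begin

text \<open>Flag chains realised as real singular chains. The empty flag is left out because
  \<open>simp {}\<close> would be parametrised by the 0-simplex.\<close>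

definition sg :: "('v set => real) => 'a rchain"
	where "sg x = (\<Sum>F\<in>\<Delta> - {{}}. single (simp F) (x F))"

lemma sg_add: "sg (%F. x F + y F) = sg x + sg y"
	by (simp add: sg_def single_add sum.distrib)

lemma sg_scale: "sg (%F. r * x F) = rscale r (sg x)"
	by (simp add: sg_def rv.scale_sum_right rscale_single)

lemma sg_sum: "sg (%F. \<Sum>i\<in>I. x i F) = (\<Sum>i\<in>I. sg (x i))"
proof (induction I rule: infinite_finite_induct)
	case (insert i I)
	then show ?case using sg_add[of "x i" "%F. \<Sum>i\<in>I. x i F"] by simp
qed (simp_all add: sg_def)

lemma sg_cong: "(!!F. F : \<Delta> ==> F ~= {} ==> x F = y F) ==> sg x = sg y"
	unfolding sg_def by (rule sum.cong) auto

lemma lookup_sg: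
	assumes x: "x : Fn (Suc p) \<Delta>" and G: "G : \<Delta>" "card G = Suc p"
	shows "lookup (sg x) (simp G) = x G"
proof -
	have "lookup (sg x) (simp G) = (\<Sum>F\<in>\<Delta> - {{}}. if F = G then x F else 0)"
		unfolding sg_def lookup_sum
	proof (rule sum.cong[OF refl])
		fix F assume F: "F : \<Delta> - {{}}"
		show "lookup (single (simp F) (x F)) (simp G) = (if F = G then x F else 0)"
		proof (cases "x F = 0")
			case False
			then have "card F = Suc p" using FnD(2)[OF x] by blast
			then have "simp F = simp G \<longleftrightarrow> F = G" using simp_inj[of F G p] F G by auto
			then show ?thesis by (auto simp: lookup_single when_def)
		qed auto
	qed
	also have "\<dots> = x G" using G finD by auto
	finally show ?thesis .
qed

lemma keys_sg: assumes x: "x : Fn (Suc p) Q" shows "keys (sg x) \<subseteq> FS p Q"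
proof -
	have "keys (single (simp F) (x F)) \<subseteq> FS p Q" for F
		using FnD[OF x, of F] by (auto simp: FS_def)
	then show ?thesis
		unfolding sg_def using Poly_Mapping.keys_sum[of "%F. single (simp F) (x F)" "\<Delta> - {{}}"] by blast
qed

lemma Fn_mono: "x : Fn k Q ==> Q \<subseteq> Q' ==> x : Fn k Q'" by (auto simp: Fn_def)

lemma sg_of:
	assumes c: "keys c \<subseteq> FS p Q" and Q: "Q \<subseteq> \<Delta>"
	obtains x where "x : Fn (Suc p) Q" "c = sg x"
proof -
	define x where "x F = (if F : Q & card F = Suc p then lookup c (simp F) else 0)" for F
	have x: "x : Fn (Suc p) Q" by (simp add: Fn_def x_def)
	have "c = sg x"
	proof (rule poly_mapping_eqI)
		fix s
		show "lookup c s = lookup (sg x) s"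
		proof (cases "s : FS p Q")
			case True
			then obtain G where G: "G : Q" "card G = Suc p" "s = simp G" by (auto simp: FS_def)
			then show ?thesis using lookup_sg[OF Fn_mono[OF x Q], of G] Q by (auto simp: x_def)
		next
			case False
			then have "s \<notin> keys c" "s \<notin> keys (sg x)" using c keys_sg[OF x] by auto
			then show ?thesis by (simp add: in_keys_iff)
		qed
	qed
	then show thesis using that[OF x] by blast
qed

lemma sg_inj:
	assumes "x : Fn p \<Delta>" "y : Fn p \<Delta>" "sg x = sg y" "F ~= {}"
	shows "x F = y F"
proof (cases "F : \<Delta> & card F = p")
	case True
	then obtain q where q: "p = Suc q" using assms(4) fin[of F] by (metis card_gt_0_iff gr0_implies_Suc)
	then show ?thesis using lookup_sg[of x q F] lookup_sg[of y q F] assms True by simp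
next
	case False
	then show ?thesis using FnD[OF assms(1), of F] FnD[OF assms(2), of F] by metis
qed

text \<open>Pairs of a flag and a vertex deleted from it are reindexed as pairs of a flag and a
  vertex inserted into it.\<close>

lemma rboundary_sg:
	assumes x: "x : Fn (Suc p) \<Delta>"
	shows "rboundary (int p) (sg x) = sg (\<partial> x)"
proof (cases p)
	case 0
	have "\<partial> x : Fn 0 \<Delta>" using bd_Fn_Delta[of x 0] x 0 by simp
	then have "\<partial> x F = 0" if "F : \<Delta> - {{}}" for F
		using FnD(2)[of "\<partial> x" 0 \<Delta> F] that fin[of F] by auto
	then show ?thesis using 0 by (simp add: rboundary_def sg_def)
next
	case (Suc q)
	define S1 where "S1 = {(F,v). F : \<Delta> - {{}} & v : F & x F ~= 0}"
	define S2 where "S2 = {(G,v). G : \<Delta> - {{}} & v : P - G & x (insert v G) ~= 0}"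
	have one: "rboundary (int p) (single (simp F) (x F)) =
			(\<Sum>v\<in>F. single (simp (F - {v})) (x F * (-1) ^ pos rk v F))" for F
	proof (cases "x F = 0")
		case False
		then have F: "F : \<Delta>" "card F = Suc (Suc q)" using FnD[OF x] Suc by auto
		have "single (simp F) (x F) = rscale (x F) (ri (frag_of (simp F)))"
			by (simp add: ri_simps rscale_single)
		then have "rboundary (int p) (single (simp F) (x F)) = rscale (x F) (ri (chain_boundary p (frag_of (simp F))))"
			by (simp only: rboundary_scale rboundary_ri)
		also have "\<dots> = (\<Sum>v\<in>F. single (simp (F - {v})) (x F * (-1) ^ pos rk v F))"
			unfolding Suc bd_simp[OF F] by (simp add: ri_sum ri_simps rv.scale_sum_right rscale_single)
		finally show ?thesis .
	qed simp
	have finS: "finite (\<Delta> - {{}})" using finD by simp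
	have "rboundary (int p) (sg x) = (\<Sum>F\<in>\<Delta> - {{}}. \<Sum>v\<in>F. single (simp (F - {v})) (x F * (-1) ^ pos rk v F))"
		unfolding sg_def rboundary_sum one ..
	also have "\<dots> = (\<Sum>(F,v)\<in>(SIGMA F:\<Delta> - {{}}. F). single (simp (F - {v})) (x F * (-1) ^ pos rk v F))"
		by (rule sum.Sigma) (use finS fin in auto)
	also have "\<dots> = (\<Sum>(F,v)\<in>S1. single (simp (F - {v})) (x F * (-1) ^ pos rk v F))"
		by (rule sum.mono_neutral_right) (use finS fin in \<open>auto simp: S1_def\<close>)
	also have "\<dots> = (\<Sum>(G,v)\<in>S2. single (simp G) ((-1) ^ pos rk v G * x (insert v G)))"
	proof (rule sum.reindex_bij_witness[where i = "%(G,v). (insert v G, v)" and j = "%(F,v). (F - {v}, v)"])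
		fix a assume "a : S1"
		then obtain F v where a: "a = (F,v)" and F: "F : \<Delta>" "v : F" "x F ~= 0" by (auto simp: S1_def)
		have ins: "insert v (F - {v}) = F" using F by auto
		have "card (F - {v}) = Suc q" using F FnD(2)[OF x F(3)] fin[OF F(1)] Suc by simp
		then have "F - {v} ~= {}" by (metis card.empty nat.simps(3))
		then show "(case a of (F,v) => (F - {v}, v)) : S2"
			using F down[OF F(1), of "F - {v}"] subP[OF F(1)] ins by (auto simp: S2_def a)
		show "(case case a of (F,v) => (F - {v}, v) of (G,v) => (insert v G, v)) = a" using ins by (simp add: a)
		have "{u\<in>F. rk u < rk v} = {u\<in>F - {v}. rk u < rk v}" by auto
		then show "(case case a of (F,v) => (F - {v}, v) of (G,v) => single (simp G) ((-1) ^ pos rk v G * x (insert v G))) =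
			 (case a of (F,v) => single (simp (F - {v})) (x F * (-1) ^ pos rk v F))"
			using ins by (simp add: a pos_def mult.commute)
	next
		fix a assume "a : S2"
		then obtain G v where a: "a = (G,v)" and G: "v : P - G" "x (insert v G) ~= 0" by (auto simp: S2_def)
		show "(case case a of (G,v) => (insert v G, v) of (F,v) => (F - {v}, v)) = a" using G by (auto simp: a)
		show "(case a of (G,v) => (insert v G, v)) : S1" using G FnD(1)[OF x G(2)] by (auto simp: S1_def a)
	qed
	also have "\<dots> = (\<Sum>(G,v)\<in>(SIGMA G:\<Delta> - {{}}. P - G). single (simp G) ((-1) ^ pos rk v G * x (insert v G)))"
		by (rule sum.mono_neutral_left) (use finS finP in \<open>auto simp: S2_def\<close>)
	also have "\<dots> = (\<Sum>G\<in>\<Delta> - {{}}. \<Sum>v\<in>P - G. single (simp G) ((-1) ^ pos rk v G * x (insert v G)))"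
		by (rule sum.Sigma[symmetric]) (use finS finP in auto)
	also have "\<dots> = sg (\<partial> x)"
		unfolding sg_def
	proof (rule sum.cong[OF refl])
		fix G
		show "(\<Sum>v\<in>P - G. single (simp G) ((-1) ^ pos rk v G * x (insert v G))) = single (simp G) (\<partial> x G)"
			unfolding bd_def by (rule poly_mapping_eqI) (simp add: lookup_sum lookup_single when_def)
	qed
	finally show ?thesis .
qed

text \<open>The integral parts of \<open>c\<close> inherit the condition on the boundary, since
  parts over an independent set of reals cannot cancel; their integral approximations are recombined
  with the real weights.\<close>

lemma rapprox:
	assumes Q: "subc Q" and c: "c : rchains (int p) (X Q)" "keys (rboundary (int p) c) \<subseteq> FS (p - 1) Q"
	obtains b e where "b : rchains (int (Suc p)) (X Q)" "e : Fn (Suc p) Q" "c = rboundary (int (Suc p)) b + sg e"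
proof -
	have QD: "Q \<subseteq> \<Delta>" using Q by (auto simp: subc_def)
	obtain I z where z: "zindep I" "ALL i. keys (z i) \<subseteq> keys c" "c = (\<Sum>i\<in>I. rscale i (ri (z i)))"
		using rchain_decomposition[of c] by (elim exE conjE)
	have zc: "singular_chain p (X Q) (z i)" for i
		using c(1) z(2)[rule_format, of i] unfolding rchains_nat singular_chain_def by blast
	have bc: "rboundary (int p) c = (\<Sum>i\<in>I. rscale i (ri (chain_boundary p (z i))))"
		unfolding z(3) rboundary_sum rboundary_scale rboundary_ri ..
	have "EX b. i : I --> singular_chain (Suc p) (X Q) b & keys (z i - chain_boundary (Suc p) b) \<subseteq> FS p Q" for i
	proof (cases "i : I")
		case True
		have "keys (chain_boundary p (z i)) \<subseteq> FS (p - 1) Q"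
			using zindep_keys[OF z(1) True, of "%i. chain_boundary p (z i)"] c(2) unfolding bc by blast
		then show ?thesis using approx_all[OF Q] zc[of i] unfolding approx_def by blast
	qed simp
	then obtain b where b: "!!i. i : I ==> singular_chain (Suc p) (X Q) (b i)"
		"!!i. i : I ==> keys (z i - chain_boundary (Suc p) (b i)) \<subseteq> FS p Q" by metis
	let ?b = "\<Sum>i\<in>I. rscale i (ri (b i))" and ?e = "\<Sum>i\<in>I. rscale i (ri (z i - chain_boundary (Suc p) (b i)))"
	have bb: "?b : rchains (int (Suc p)) (X Q)"
		by (intro rchains_sum rchains_scale) (use b(1) in \<open>simp add: rchains_ri del: of_nat_Suc\<close>)
	have ce: "c = rboundary (int (Suc p)) ?b + ?e"
		unfolding rboundary_sum rboundary_scale rboundary_ri ri_simps(2) rv.scale_right_diff_distrib sum_subtractf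
		using z(3) by simp
	have "keys ?e \<subseteq> FS p Q"
	proof -
		have "keys (rscale i (ri (z i - chain_boundary (Suc p) (b i)))) \<subseteq> FS p Q" if "i : I" for i
			using keys_rscale[of i "ri (z i - chain_boundary (Suc p) (b i))"] b(2)[OF that] by simp
		then show ?thesis
			using Poly_Mapping.keys_sum[of "%i. rscale i (ri (z i - chain_boundary (Suc p) (b i)))" I] by blast
	qed
	from sg_of[OF this QD] obtain e where e: "e : Fn (Suc p) Q" "?e = sg e" by blast
	show thesis by (rule that[OF bb e(1) ce[unfolded e(2)]])
qed

lemma sg_rchains: "subc Q ==> x : Fn (Suc p) Q ==> sg x : rchains (int p) (X Q)"
	unfolding rchains_nat using keys_sg[of x p Q] simp_simplex[of Q _ p] by (auto simp: FS_def)

lemma subc_flags: "subc (flags L)"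
	unfolding subc_def flags_def using down by auto

text \<open>A family of cellular chains whose span is quasi-isomorphic to the flag complex of \<open>L\<close> is also
	quasi-isomorphic to the singular complex.\<close>

definition cellular_on :: "'v set => ('v => 'v set => real) => ('v => nat) => bool"
	where "cellular_on L C d \<longleftrightarrow> finite L & (ALL s:L. C s : Fn (Suc (d s)) (flags L)) &
		(ALL k e x. e : Fn k (flags L) --> 0 < k --> (ALL s:L. x s ~= 0 --> Suc (Suc (d s)) = k) -->
			(ALL G. G ~= {} --> \<partial> e G = (\<Sum>s\<in>L. x s * C s G)) -->
			(EX b:Fn (Suc k) (flags L). EX y. (ALL s:L. y s ~= 0 --> Suc (d s) = k) &
				 (ALL F. F ~= {} --> e F = \<partial> b F + (\<Sum>s\<in>L. y s * C s F))))"

definition cchain :: "('v => 'v set => real) => ('v \<Rightarrow>\<^sub>0 real) => 'a rchain"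
	where "cchain C = rextend (%s. sg (C s))"

lemma cchain_sg:
	assumes "finite L" "keys x \<subseteq> L"
	shows "cchain C x = sg (%F. \<Sum>s\<in>L. lookup x s * C s F)"
	unfolding cchain_def rextend_alt[OF assms] sg_sum sg_scale ..

text \<open>Composes the passage from singular to flag chains with that from flag to cellular
  chains; a cellular boundary is in particular a flag chain.\<close>

lemma cellular_approx:
	assumes cel: "cellular_on L C d" and c: "c : rchains (int p) (X (flags L))"
		and x: "keys x \<subseteq> {s\<in>L. Suc (d s) = p}" "rboundary (int p) c = cchain C x"
	obtains b y where "b : rchains (int (Suc p)) (X (flags L))" "keys y \<subseteq> {s\<in>L. d s = p}"
		"c = rboundary (int (Suc p)) b + cchain C y"
proof -
	have fL: "finite L" and C: "!!s. s : L ==> C s : Fn (Suc (d s)) (flags L)" using cel by (auto simp: cellular_on_def)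
	have LD: "flags L \<subseteq> \<Delta>" by (auto simp: flags_def)
	have xL: "keys x \<subseteq> L" using x(1) by auto
	define X' where "X' = (%F. \<Sum>s\<in>L. lookup x s * C s F)"
	have X': "X' : Fn p (flags L)"
	proof (rule FnI)
		fix F assume "X' F ~= 0"
		then obtain s where "s : L" "lookup x s * C s F ~= 0"
			unfolding X'_def by (rule sum.not_neutral_contains_not_neutral)
		then have s: "s : L" "s : keys x" "C s F ~= 0" by (auto simp: in_keys_iff)
		then have "Suc (d s) = p" using x(1) by auto
		then show "F : flags L & card F = p" using FnD[OF C[OF s(1)] s(3)] by simp
	qed
	have cx: "cchain C x = sg X'" unfolding X'_def by (rule cchain_sg[OF fL xL])
	have "keys (rboundary (int p) c) \<subseteq> FS (p - 1) (flags L)"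
	proof (cases p)
		case (Suc q)
		then show ?thesis unfolding x(2) cx using keys_sg[of X' q "flags L"] X' by simp
	qed (simp add: rboundary_def)
	from rapprox[OF subc_flags c this] obtain b e where be: "b : rchains (int (Suc p)) (X (flags L))" "e : Fn (Suc p) (flags L)"
		"c = rboundary (int (Suc p)) b + sg e" by blast
	have eD: "e : Fn (Suc p) \<Delta>" by (rule Fn_mono[OF be(2) LD])
	have "rboundary (int p) (rboundary (int (Suc p)) b) = 0"
		using rboundary_rboundary[of b "int p" "X (flags L)"] be(1) by (simp add: add.commute)
	then have "sg (\<partial> e) = sg X'"
		using x(2) rboundary_sg[OF eD] unfolding be(3) rboundary_add cx by simp
	then have eX: "\<partial> e G = X' G" if "G ~= {}" for G
		using sg_inj[OF _ Fn_mono[OF X' LD] _ that] bd_Fn_Delta[OF eD] by blast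
	have xs: "ALL s:L. lookup x s ~= 0 --> Suc (Suc (d s)) = Suc p"
		using x(1) by (auto simp: in_keys_iff)
	have eG: "ALL G. G ~= {} --> \<partial> e G = (\<Sum>s\<in>L. lookup x s * C s G)"
		using eX unfolding X'_def by blast
	have "EX b:Fn (Suc (Suc p)) (flags L). EX y. (ALL s:L. y s ~= 0 --> Suc (d s) = Suc p) &
				 (ALL F. F ~= {} --> e F = \<partial> b F + (\<Sum>s\<in>L. y s * C s F))"
		by (rule cel[unfolded cellular_on_def, THEN conjunct2, THEN conjunct2, THEN spec, THEN spec, THEN spec,
				THEN mp, THEN mp, THEN mp, THEN mp, OF be(2) zero_less_Suc xs eG])
	then obtain b' y where b': "b' : Fn (Suc (Suc p)) (flags L)"
		and y: "(ALL s:L. y s ~= 0 --> Suc (d s) = Suc p) & (ALL F. F ~= {} --> e F = \<partial> b' F + (\<Sum>s\<in>L. y s * C s F))"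
		by (elim bexE exE)
	define y' where "y' = (\<Sum>s\<in>L. single s (y s))"
	have ly: "lookup y' s = (if s : L then y s else 0)" for s
		using fL by (simp add: y'_def lookup_sum lookup_single when_def)
	have ky: "keys y' \<subseteq> {s\<in>L. d s = p}" 
	proof
		fix s assume "s : keys y'"
		then have "s : L" "y s ~= 0" unfolding in_keys_iff ly by (simp_all split: if_splits)
		then show "s : {s\<in>L. d s = p}" using conjunct1[OF y] by simp
	qed
	have "sg e = sg (%F. \<partial> b' F + (\<Sum>s\<in>L. y s * C s F))"
		by (rule sg_cong) (use conjunct2[OF y] in blast)
	also have "\<dots> = rboundary (int (Suc p)) (sg b') + cchain C y'"
	proof -
		have "keys y' \<subseteq> L" using ky by auto
		then have "cchain C y' = sg (%F. \<Sum>s\<in>L. y s * C s F)"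
			using cchain_sg[OF fL] by (simp add: ly cong: sum.cong)
		then show ?thesis unfolding sg_add using rboundary_sg[OF Fn_mono[OF b' LD]] by simp
	qed
	finally have "c = rboundary (int (Suc p)) (b + sg b') + cchain C y'"
		using be(3) by (simp add: rboundary_add)
	moreover have "b + sg b' : rchains (int (Suc p)) (X (flags L))"
		by (rule rchains_add[OF be(1) sg_rchains[OF subc_flags b']])
	ultimately show thesis using that ky by blast
qed

lemma cchain_rchains:
	assumes cel: "cellular_on L C d" and y: "keys y \<subseteq> {s\<in>L. d s = p}"
	shows "cchain C y : rchains (int p) (X (flags L))"
proof -
	have "sg (C s) : rchains (int p) (X (flags L))" if "s : keys y" for s
		using sg_rchains[OF subc_flags, of "C s" p L] cel y that by (auto simp: cellular_on_def)
	then show ?thesis unfolding cchain_def rextend_def by (intro rchains_sum rchains_scale)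
qed

end

section \<open>Dual cells of a homology manifold\<close>

context homology_manifold
begin

text \<open>The twin of \<open>E\<close> on the upper side. The factor \<open>z (top s)\<close>
  makes \<open>z\<close> on a flag through \<open>s\<close> the product of the coefficients of
  \<open>E s\<close> and \<open>D s\<close> on its two halves, and removes all scaling from the
  incidence numbers.\<close>

definition D :: "'v => 'v set => real"
	where "D s F = (if s : F & F - {s} : UF s then z (top s) * beta s (F - {s}) else 0)"

definition upper :: "'v set => bool"
	where "upper U \<longleftrightarrow> U \<subseteq> P & (ALL s:U. ALL v. rk s < rk v & {v,s} : \<Delta> --> v : U)"

lemma inc_nonzero: "inc t s ~= 0 ==> t : P & s : P & {t,s} : \<Delta> & Suc (rk t) = rk s"
	by (simp add: inc_def split: if_splits)

text \<open>The construction of \<open>E\<close> in the reversed order yields \<open>D\<close> up to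
  the factor \<open>z (top s)\<close>. For nonzero incidence numbers, both sides of the last
  identity are the value of \<open>z\<close> on the flag made of \<open>f0 s\<close>,
  \<open>s\<close>, \<open>t\<close> and \<open>g0 t\<close>.\<close>

lemma rev_facts:
	assumes s: "s : P"
	shows "flag_complex.LF \<Delta> (%v. m - rk v) s = UF s"
		"D s F = z (top s) * homology_manifold.E \<Delta> (%v. m - rk v) z s F"
		"t : P ==> z (top s) * homology_manifold.inc P \<Delta> (%v. m - rk v) z t s = z (top t) * inc s t"
proof -
	interpret r: homology_manifold P \<Delta> "%v. m - rk v" m z by (rule homology_manifold_rev)
	have lt: "m - rk u < m - rk v \<longleftrightarrow> rk v < rk u" if "u : P" "v : P" for u v using rkm[OF that(1)] rkm[OF that(2)] by linarith
	have LF: "r.LF s = UF s" if "s : P" for s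
	proof (rule Set.set_eqI)
		fix f
		have "f \<subseteq> P" if "insert s f : \<Delta>" using subP[OF that] by auto
		then show "f : r.LF s \<longleftrightarrow> f : UF s" unfolding r.LF_def UF_def using lt[OF _ \<open>s : P\<close>] by auto
	qed
	then show "r.LF s = UF s" using s .
	have topP: "top s \<subseteq> P" if "s : P" for s using subP[OF top(3)[OF that]] .
	have g0: "{v\<in>top s. m - rk s < m - rk v} = f0 s" "{v\<in>top s. m - rk v < m - rk s} = g0 s" if "s : P" for s
		using lt[OF that] lt[OF _ that] topP[OF that] by auto
	have al: "r.alpha s f = beta s f" if "s : P" for s f
	proof -
		have "f Un insert s (f0 s) = f0 s Un insert s f" by auto
		then show ?thesis unfolding r.alpha_def beta_def g0[OF that] by simp
	qed
	show "D s F = z (top s) * r.E s F" unfolding D_def r.E_def LF[OF s] al[OF s] by simp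
	show "z (top s) * r.inc t s = z (top t) * inc s t" if t: "t : P"
	proof (cases "{t,s} : \<Delta> & Suc (rk s) = rk t")
		case True
		have 1: "Suc (m - rk t) = m - rk s" "{s,t} : \<Delta>" using True rkm[OF t] by (auto simp: insert_commute)
		have "r.inc t s = beta s (insert t (g0 t))"
			unfolding r.inc_def g0[OF t] al[OF s] using True s t 1 by simp
		moreover have "inc s t = alpha t (insert s (f0 s))" unfolding inc_def using True s t 1 by simp
		moreover have "z (f0 s Un insert s (insert t (g0 t))) = z (top s) * beta s (insert t (g0 t))"
			unfolding beta_def using top(2)[OF s] by simp
		moreover have "z (insert s (f0 s) Un insert t (g0 t)) = z (top t) * alpha t (insert s (f0 s)) * beta t (g0 t)"
			by (rule z_product[OF t adjacent(1)[OF s t 1(2) conjunct2[OF True]] f0g0(2)[OF t]]) (rule f0g0(1)[OF s])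
		moreover have "insert s (f0 s) Un insert t (g0 t) = f0 s Un insert s (insert t (g0 t))" by auto
		ultimately show ?thesis using f0g0(7)[OF t] by simp
	next
		case False
		have "r.inc t s = 0" unfolding r.inc_def using False rkm[OF s] rkm[OF t] by auto
		moreover have "inc s t = 0" unfolding inc_def using False by (auto simp: insert_commute)
		ultimately show ?thesis by simp
	qed
qed

lemma D_Fn: assumes s: "s : P" shows "D s : Fn (Suc (m - rk s)) \<Delta>"
proof -
	interpret r: homology_manifold P \<Delta> "%v. m - rk v" m z by (rule homology_manifold_rev)
	show ?thesis using r.E_Fn[OF s] unfolding Fn_def rev_facts(2)[OF s] by simp
qed

text \<open>The sign from reversing the order and the sign in the reversed \<open>bd_E\<close> both
  have exponent \<open>m - rk s\<close> wherever a term is nonzero, so they cancel.\<close>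

lemma bd_D:
	assumes s: "s : P" and G: "G ~= {}"
	shows "\<partial> (D s) G = (\<Sum>t\<in>P. inc s t * D t G)"
proof -
	interpret r: homology_manifold P \<Delta> "%v. m - rk v" m z by (rule homology_manifold_rev)
	have D: "D s = (%F. z (top s) * r.E s F)" by (rule ext) (rule rev_facts(2)[OF s])
	have "\<partial> (D s) G = z (top s) * \<partial> (r.E s) G" unfolding D by (rule bd_scale)
	also have "\<partial> (r.E s) G = (-1) ^ card G * ((-1) ^ card G * \<partial> (r.E s) G)" by (simp flip: mult.assoc power_mult_distrib)
	also have "\<dots> = (-1) ^ card G * ((-1) ^ (m - rk s) * (\<Sum>t\<in>P. r.inc t s * r.E t G))"
		using bd_rev[OF r.E_Fn[OF s], of G] r.bd_E[OF s G] by simp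
	also have "z (top s) * \<dots> = (\<Sum>t\<in>P. z (top s) * ((-1) ^ card G * ((-1) ^ (m - rk s) * (r.inc t s * r.E t G))))"
		by (simp add: sum_distrib_left)
	also have "\<dots> = (\<Sum>t\<in>P. inc s t * D t G)"
	proof (rule sum.cong[OF refl])
		fix t assume t: "t : P"
		show "z (top s) * ((-1) ^ card G * ((-1) ^ (m - rk s) * (r.inc t s * r.E t G))) = inc s t * D t G"
		proof (cases "r.inc t s * r.E t G = 0")
			case True
			then have "z (top s) * r.inc t s * r.E t G = 0" by (simp add: mult.assoc)
			then have "z (top t) * inc s t * r.E t G = 0" using rev_facts(3)[OF s t] by simp
			then have I: "inc s t * D t G = 0" unfolding rev_facts(2)[OF t] by auto
			show ?thesis unfolding True by (simp only: mult_zero_right I)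
		next
			case False
			then have "card G = Suc (m - rk t)" "Suc (m - rk t) = m - rk s"
				using FnD(2)[OF r.E_Fn[OF t], of G] r.inc_nonzero[of t s] by auto
			then have sgn: "(-1::real) ^ card G * (-1) ^ (m - rk s) = 1" by (simp flip: power_add)
			have "z (top s) * ((-1) ^ card G * ((-1) ^ (m - rk s) * (r.inc t s * r.E t G))) =
					z (top s) * (((-1) ^ card G * (-1) ^ (m - rk s)) * (r.inc t s * r.E t G))" by (simp only: mult.assoc)
			also have "\<dots> = (z (top s) * r.inc t s) * r.E t G" unfolding sgn by (simp only: mult_1 mult.assoc)
			also have "\<dots> = inc s t * D t G" unfolding rev_facts(3)[OF s t] rev_facts(2)[OF t] by simp
			finally show ?thesis .
		qed
	qed
	finally show ?thesis .
qed

lemma D_flags: assumes "upper U" "s : U" shows "D s : Fn (Suc (m - rk s)) (flags U)"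
proof (rule FnI)
	fix F assume F: "D s F ~= 0"
	have s: "s : P" using assms by (auto simp: upper_def)
	have "F : \<Delta>" "card F = Suc (m - rk s)" using FnD[OF D_Fn[OF s] F] .
	moreover have "s : F" "F - {s} : UF s" using F by (auto simp: D_def split: if_splits)
	moreover have "v : U" if "v : F" for v
	proof (cases "v = s")
		case False
		then have "rk s < rk v" using that \<open>F - {s} : UF s\<close> by (auto simp: UF_def)
		moreover have "{v,s} : \<Delta>" using down[OF \<open>F : \<Delta>\<close>] that \<open>s : F\<close> by auto
		ultimately show ?thesis using assms by (auto simp: upper_def)
	qed (use assms in simp)
	ultimately show "F : flags U & card F = Suc (m - rk s)" by (auto simp: flags_def)
qed

lemma E_flags: assumes "lower L" "s : L" shows "E s : Fn (Suc (rk s)) (flags L)"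
proof (rule FnI)
	fix F assume F: "E s F ~= 0"
	have s: "s : P" using assms by (auto simp: lower_def)
	have "F : \<Delta>" "card F = Suc (rk s)" using FnD[OF E_Fn[OF s] F] .
	moreover have "s : F" "F - {s} : LF s" using F by (auto simp: E_def split: if_splits)
	moreover have "v : L" if "v : F" for v
	proof (cases "v = s")
		case False
		then have "rk v < rk s" using that \<open>F - {s} : LF s\<close> by (auto simp: LF_def)
		moreover have "{v,s} : \<Delta>" using down[OF \<open>F : \<Delta>\<close>] that \<open>s : F\<close> by auto
		ultimately show ?thesis using assms by (auto simp: lower_def)
	qed (use assms in simp)
	ultimately show "F : flags L & card F = Suc (rk s)" by (auto simp: flags_def)
qed

text \<open>Transfer of \<open>cellular\<close> along reversal of ranks; \<open>x'\<close> absorbs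
  the sign of the reversed boundary and the scaling of \<open>D\<close>.\<close>

lemma cellular_D:
	assumes U: "upper U" and e: "e : Fn k (flags U)" "0 < k" and x: "!!s. s : U ==> x s ~= 0 ==> Suc (Suc (m - rk s)) = k"
		and bd: "!!G. G ~= {} ==> \<partial> e G = (\<Sum>s\<in>U. x s * D s G)"
	shows "EX b:Fn (Suc k) (flags U). EX y. (ALL s:U. y s ~= 0 --> Suc (m - rk s) = k) &
		 (ALL F. F ~= {} --> e F = \<partial> b F + (\<Sum>s\<in>U. y s * D s F))"
proof -
	interpret r: homology_manifold P \<Delta> "%v. m - rk v" m z by (rule homology_manifold_rev)
	have UP: "U \<subseteq> P" using U by (simp add: upper_def)
	have fD: "flags U \<subseteq> \<Delta>" by (auto simp: flags_def)
	have low: "r.lower U"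
		unfolding r.lower_def
	proof (intro conjI ballI allI impI)
		fix s v assume s: "s : U" and v: "m - rk v < m - rk s & {v, s} : \<Delta>"
		then have "rk s < rk v" by linarith
		then show "v : U" using U s v unfolding upper_def by blast
	qed (rule UP)
	obtain k' where k': "k = Suc k'" using e(2) gr0_implies_Suc by blast
	define x' where "x' s = (-1) ^ k' * x s * z (top s)" for s
	have "EX b:Fn (Suc k) (flags U). EX y. (ALL s:U. y s ~= 0 --> Suc (m - rk s) = k) &
		 (ALL F. F ~= {} --> e F = bd P (%v. m - rk v) b F + (\<Sum>s\<in>U. y s * r.E s F))"
	proof (rule r.cellular[OF low e])
		show "Suc (Suc (m - rk s)) = k" if "s : U" "x' s ~= 0" for s using x[OF that(1)] that(2) by (auto simp: x'_def)
		fix G :: "'v set" assume G: "G ~= {}"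
		have "bd P (%v. m - rk v) e G = (-1) ^ card G * (\<Sum>s\<in>U. x s * D s G)"
			using bd_rev[of e k G] e(1) fD bd[OF G] by (auto simp: Fn_def)
		also have "\<dots> = (\<Sum>s\<in>U. x' s * r.E s G)"
			unfolding sum_distrib_left
		proof (rule sum.cong[OF refl])
			fix s assume s: "s : U"
			have sP: "s : P" using s UP by auto
			show "(-1) ^ card G * (x s * D s G) = x' s * r.E s G"
			proof (cases "x s = 0 \<or> r.E s G = 0")
				case False
				then have "card G = k'" using FnD(2)[OF r.E_Fn[OF sP], of G] x[OF s] k' by auto
				then show ?thesis unfolding rev_facts(2)[OF sP] x'_def by simp
			qed (auto simp: rev_facts(2)[OF sP] x'_def)
		qed
		finally show "bd P (%v. m - rk v) e G = (\<Sum>s\<in>U. x' s * r.E s G)" .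
	qed
	then obtain b y where b: "b : Fn (Suc k) (flags U)" and y: "(ALL s:U. y s ~= 0 --> Suc (m - rk s) = k) &
		 (ALL F. F ~= {} --> e F = bd P (%v. m - rk v) b F + (\<Sum>s\<in>U. y s * r.E s F))" by (elim bexE exE)
	have bD: "b : Fn (Suc k) \<Delta>" using b fD by (auto simp: Fn_def)
	show ?thesis
	proof (intro bexI exI conjI ballI allI impI)
		show "(%F. (-1) ^ k * b F) : Fn (Suc k) (flags U)" using b by (auto simp: Fn_def)
		show "Suc (m - rk s) = k" if "s : U" "y s / z (top s) ~= 0" for s using y that by auto
		fix F :: "'v set" assume F: "F ~= {}"
		have "bd P (%v. m - rk v) b F = \<partial> (%F. (-1) ^ k * b F) F"
		proof (cases "\<partial> b F = 0")
			case False
			then have "card F = k" using FnD(2)[OF bd_Fn_Delta[OF bD]] by blast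
			then show ?thesis unfolding bd_rev[OF bD] bd_scale by simp
		qed (simp add: bd_rev[OF bD] bd_scale)
		moreover have "(\<Sum>s\<in>U. y s * r.E s F) = (\<Sum>s\<in>U. y s / z (top s) * D s F)"
		proof (rule sum.cong[OF refl])
			fix s assume "s : U"
			then have sP: "s : P" using UP by auto
			show "y s * r.E s F = y s / z (top s) * D s F" unfolding rev_facts(2)[OF sP] using top(2)[OF sP] by simp
		qed
		ultimately show "e F = \<partial> (%F. (-1) ^ k * b F) F + (\<Sum>s\<in>U. y s / z (top s) * D s F)"
			using y F by simp
	qed
qed

text \<open>Among all cells, the flag \<open>insert s (f0 s)\<close> is carried by
  \<open>E s\<close> alone: it ends in \<open>s\<close>, and any other cell carrying it would have
  to end in a different member.\<close>

lemma E_indep: assumes s: "s : P"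
	shows "EX F. F ~= {} & E s F ~= 0 & (ALL t:P. t ~= s --> E t F = 0)"
proof (intro exI conjI ballI impI)
	have d: "insert s (f0 s) - {s} = f0 s" by auto
	show "E s (insert s (f0 s)) ~= 0" unfolding E_def d using f0g0(1,6)[OF s] by simp
	show "E t (insert s (f0 s)) = 0" if t: "t : P" "t ~= s" for t
	proof -
		have "~ (t : insert s (f0 s) & insert s (f0 s) - {t} : LF t)"
		proof
			assume h: "t : insert s (f0 s) & insert s (f0 s) - {t} : LF t"
			then have "rk t < rk s" using t(2) by auto
			moreover have "rk s < rk t" using h t(2) unfolding LF_def by auto
			ultimately show False by simp
		qed
		then show ?thesis unfolding E_def by (rule if_not_P)
	qed
qed simp

lemma D_indep: assumes s: "s : P"
	shows "EX F. F ~= {} & D s F ~= 0 & (ALL t:P. t ~= s --> D t F = 0)"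
proof (intro exI conjI ballI impI)
	have d: "insert s (g0 s) - {s} = g0 s" by auto
	show "D s (insert s (g0 s)) ~= 0" unfolding D_def d using f0g0(2,7)[OF s] top(2)[OF s] by simp
	show "D t (insert s (g0 s)) = 0" if t: "t : P" "t ~= s" for t
	proof -
		have "~ (t : insert s (g0 s) & insert s (g0 s) - {t} : UF t)"
		proof
			assume h: "t : insert s (g0 s) & insert s (g0 s) - {t} : UF t"
			then have "rk s < rk t" using t(2) by auto
			moreover have "rk t < rk s" using h t(2) unfolding UF_def by auto
			ultimately show False by simp
		qed
		then show ?thesis unfolding D_def by (rule if_not_P)
	qed
qed simp

end

section \<open>Homology classes\<close>

lemma subspace_rcycles: "rv.subspace (rcycles p X)"
	unfolding rcycles_def by (rule subspace_ker[OF rlinear_rboundary subspace_rchains])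

lemma subspace_rboundaries: "rv.subspace (rboundaries p X)"
	unfolding rboundaries_def by (rule subspace_image[OF rlinear_rboundary subspace_rchains])

lemma rboundaries_rcycles: "rboundaries p X \<subseteq> rcycles p X"
	unfolding rboundaries_def rcycles_def using rboundary_rchains rboundary_rboundary by blast

lemma rclass: "rhomology_class p X c = (%b. b + c) ` rboundaries p X"
	unfolding rhomology_class_def a_r_coset_def' rcycle_space_def by auto

lemma rclass_eq: "rhomology_class p X c = rhomology_class p X c' \<longleftrightarrow> c - c' : rboundaries p X"
proof
	note S = subspace_rboundaries[of p X]
	assume "rhomology_class p X c = rhomology_class p X c'"
	moreover have "0 + c : rhomology_class p X c" unfolding rclass using rv.subspace_0[OF S] by (rule imageI)
	ultimately obtain b where "b : rboundaries p X" "0 + c = b + c'" unfolding rclass by auto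
	then show "c - c' : rboundaries p X" by simp
next
	note S = subspace_rboundaries[of p X]
	assume h: "c - c' : rboundaries p X"
	show "rhomology_class p X c = rhomology_class p X c'"
	proof (intro equalityI subsetI)
		fix a assume "a : rhomology_class p X c"
		then obtain b where b: "b : rboundaries p X" "a = b + c" unfolding rclass by auto
		have "a = (b + (c - c')) + c'" using b(2) by simp
		then show "a : rhomology_class p X c'" unfolding rclass using rv.subspace_add[OF S b(1) h] by blast
	next
		fix a assume "a : rhomology_class p X c'"
		then obtain b where b: "b : rboundaries p X" "a = b + c'" unfolding rclass by auto
		have "a = (b - (c - c')) + c" using b(2) by simp
		then show "a : rhomology_class p X c" unfolding rclass using rv.subspace_diff[OF S b(1) h] by blast
	qed
qed

lemma rhomology_carrier: "carrier (rhomology p X) = rhomology_class p X ` rcycles p X"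
	unfolding rhomology_def quot_space_def A_RCOSETS_def' rhomology_class_def by (auto simp: rcycle_space_def)

lemma rhomology_zero: "\<zero>\<^bsub>rhomology p X\<^esub> = rhomology_class p X 0"
	unfolding rclass by (simp add: rhomology_def quot_space_def)

lemma rhomology_add: "rhomology_class p X a \<oplus>\<^bsub>rhomology p X\<^esub> rhomology_class p X b = rhomology_class p X (a + b)"
proof -
	note S = subspace_rboundaries[of p X]
	have "rhomology_class p X a \<oplus>\<^bsub>rhomology p X\<^esub> rhomology_class p X b = {x + y |x y. x : rhomology_class p X a & y : rhomology_class p X b}"
		by (auto simp: rhomology_def quot_space_def set_add_def' rcycle_space_def)
	also have "\<dots> = rhomology_class p X (a + b)"
	proof (intro equalityI subsetI)
		fix c assume "c : {x + y |x y. x : rhomology_class p X a & y : rhomology_class p X b}"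
		then obtain u v where u: "u : rboundaries p X" "v : rboundaries p X" "c = (u + a) + (v + b)" unfolding rclass by auto
		have "c = (u + v) + (a + b)" using u(3) by (simp add: algebra_simps)
		then show "c : rhomology_class p X (a + b)" unfolding rclass using rv.subspace_add[OF S u(1,2)] by blast
	next
		fix c assume "c : rhomology_class p X (a + b)"
		then obtain u where u: "u : rboundaries p X" "c = u + (a + b)" unfolding rclass by auto
		have "u + a : rhomology_class p X a" "0 + b : rhomology_class p X b"
			unfolding rclass using u(1) rv.subspace_0[OF S] by blast+
		moreover have "c = (u + a) + (0 + b)" using u(2) by (simp add: algebra_simps)
		ultimately show "c : {x + y |x y. x : rhomology_class p X a & y : rhomology_class p X b}" by blast
	qed
	finally show ?thesis .
qed

lemma rhomology_smult: "r \<odot>\<^bsub>rhomology p X\<^esub> rhomology_class p X a = rhomology_class p X (rscale r a)"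
proof -
	note S = subspace_rboundaries[of p X]
	have eq: "rhomology_class p X (rscale r x) = rhomology_class p X (rscale r a)" if "x : rhomology_class p X a" for x
	proof -
		obtain b where b: "b : rboundaries p X" "x = b + a" using \<open>x : rhomology_class p X a\<close> unfolding rclass by auto
		have "rscale r x - rscale r a = rscale r b" using b(2) by (simp add: rv.scale_right_distrib)
		then show ?thesis unfolding rclass_eq using rv.subspace_scale[OF S b(1)] by simp
	qed
	have ne: "rhomology_class p X a ~= {}" unfolding rclass using rv.subspace_0[OF S] by blast
	have "r \<odot>\<^bsub>rhomology p X\<^esub> rhomology_class p X a = (\<Union>x\<in>rhomology_class p X a. rhomology_class p X (rscale r x))"
		by (simp add: rhomology_def quot_space_def rhomology_class_def rcycle_space_def)
	also have "\<dots> = rhomology_class p X (rscale r a)" using eq ne by auto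
	finally show ?thesis .
qed

lemma rchains_subtopology: "rchains p (subtopology M S) \<subseteq> rchains p M"
	by (auto simp: rchains_def singular_simplex_subtopology)

lemma rboundaries_subtopology: "rboundaries p (subtopology M S) \<subseteq> rboundaries p M"
	unfolding rboundaries_def using rchains_subtopology by blast

lemma rchain_map_id: assumes "c : rchains p X" shows "rchain_map p id c = c"
proof -
	have "rchain_map p id c = rextend (%s. single s 1) c"
		unfolding rchain_map_def
	proof (rule rextend_cong)
		fix s assume "s : keys c"
		then have "singular_simplex (nat p) X s" using assms by (auto simp: rchains_def)
		then have "simplex_map (nat p) id s = s" by (rule simplex_map_id_gen) simp
		then show "single (simplex_map (nat p) id s) (1::real) = single s 1" by simp
	qed
	also have "\<dots> = c" unfolding rextend_def by (rule rexpansion)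
	finally show ?thesis .
qed

lemma rhom_induced_id:
	assumes c: "c : rcycles p (subtopology M S)"
	shows "rhom_induced p M id (rhomology_class p (subtopology M S) c) = rhomology_class p M c"
proof -
	note S = subspace_rboundaries[of p "subtopology M S"]
	have "rhomology_class p M (rchain_map p id x) = rhomology_class p M c" if "x : rhomology_class p (subtopology M S) c" for x
	proof -
		obtain b where b: "b : rboundaries p (subtopology M S)" "x = b + c" using \<open>x : rhomology_class p (subtopology M S) c\<close> unfolding rclass by auto
		have "x : rcycles p (subtopology M S)"
			unfolding b(2) using rv.subspace_add[OF subspace_rcycles subsetD[OF rboundaries_rcycles b(1)] c] .
		then have "rchain_map p id x = x" by (intro rchain_map_id) (auto simp: rcycles_def)
		moreover have "x - c : rboundaries p M" using b rboundaries_subtopology by auto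
		ultimately show ?thesis unfolding rclass_eq by simp
	qed
	moreover have "rhomology_class p (subtopology M S) c ~= {}" unfolding rclass using rv.subspace_0[OF S] by blast
	ultimately show ?thesis unfolding rhom_induced_def by auto
qed

lemma V_img_eq:
	assumes "cells_space M L = subtopology M S"
	shows "V_img n M L = rhomology_class (int n) M ` rcycles (int n) (subtopology M S)"
proof -
	have "rhom_induced (int n) M id (rhomology_class (int n) (subtopology M S) c) = rhomology_class (int n) M c"
		if "c : rcycles (int n) (subtopology M S)" for c by (rule rhom_induced_id[OF that])
	then show ?thesis unfolding V_img_def assms rhomology_carrier image_image by (rule image_cong[OF refl])
qed

text \<open>Covers \<open>n = 0\<close>, where the Betti numbers in the polynomial have degree
  \<open>-1\<close>.\<close>

lemma betti_negative: fixes X Y :: "'a topology" shows "betti (-1) X = betti (-1) Y"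
proof -
	have z: "rchains (-1) Z = {0}" for Z :: "'a topology"
		unfolding rchains_def by (auto simp: keys_eq_empty)
	have c: "rcycles (-1) Z = {0}" for Z :: "'a topology" unfolding rcycles_def z by auto
	have b: "rboundaries (-1) Z = {0}" for Z :: "'a topology"
	proof -
		have "rboundaries (-1) Z = (%_. 0) ` rchains 0 Z" unfolding rboundaries_def by (rule image_cong) (auto simp: rboundary_def)
		then show ?thesis using rchains_0[of 0 Z] by auto
	qed
	show ?thesis unfolding betti_def rhomology_def rcycle_space_def c b ..
qed

section \<open>Cellular homology\<close>

text \<open>The common formal properties of the chains \<open>E\<close> and \<open>D\<close>, with
  dimension \<open>d\<close> and incidence matrix \<open>a\<close>, so that cellular homology is
  developed for both at once.\<close>

locale cell_basis = realized_complex P \<Delta> rk m M \<Phi>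
	for P :: "'v set" and \<Delta> :: "'v set set" and rk :: "'v => nat" and m :: nat
		and M :: "'a topology" and \<Phi> :: "('v => real) => 'a" +
	fixes C :: "'v => 'v set => real" and d :: "'v => nat" and a :: "'v => 'v => real"
	assumes CF: "s : P ==> C s : Fn (Suc (d s)) \<Delta>"
		and Cbd: "s : P ==> G ~= {} ==> \<partial> (C s) G = (\<Sum>t\<in>P. a s t * C t G)"
		and Cind: "s : P ==> EX F. F ~= {} & C s F ~= 0 & (ALL t:P. t ~= s --> C t F = 0)"
		and adeg: "a s t ~= 0 ==> d s = Suc (d t)"
begin

definition dC :: "('v \<Rightarrow>\<^sub>0 real) => ('v \<Rightarrow>\<^sub>0 real)"
	where "dC = rextend (%s. \<Sum>t\<in>P. single t (a s t))"

definition cells where "cells p L = {s\<in>L. d s = p}"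

abbreviation cc where "cc \<equiv> cchain C"

lemma rlinear_dC: "rlinear dC" unfolding dC_def by (rule rlinear_rextend)
lemma rlinear_cc: "rlinear cc" unfolding cchain_def by (rule rlinear_rextend)

lemma finite_cells: "L \<subseteq> P ==> finite (cells p L)" using finP finite_subset unfolding cells_def by fastforce

lemma lookup_dC: "lookup (dC x) t = (if t : P then (\<Sum>s\<in>keys x. lookup x s * a s t) else 0)"
	unfolding dC_def lookup_rextend by (simp add: lookup_sum lookup_single when_def finP)

lemma dC_keys: assumes x: "x : csub (cells (Suc p) P)" shows "dC x : csub (cells p P)"
	unfolding csub_def
proof (rule CollectI, rule subsetI)
	fix t assume "t : keys (dC x)"
	then have t: "t : P" "(\<Sum>s\<in>keys x. lookup x s * a s t) ~= 0"
		unfolding in_keys_iff lookup_dC by (auto split: if_splits)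
	from t(2) obtain s where s: "s : keys x" "lookup x s * a s t ~= 0"
		by (rule sum.not_neutral_contains_not_neutral)
	have "d s = Suc p" using x s(1) by (auto simp: csub_def cells_def)
	then show "t : cells p P" using t(1) adeg[of s t] s(2) by (auto simp: cells_def)
qed

lemma dC_keys0: assumes x: "x : csub (cells 0 P)" shows "dC x = 0"
proof (rule poly_mapping_eqI)
	fix t
	have "lookup x s * a s t = 0" if "s : keys x" for s
		using x that adeg[of s t] by (auto simp: csub_def cells_def)
	then show "lookup (dC x) t = lookup 0 t" unfolding lookup_dC by simp
qed

lemma cc_boundary:
	assumes x: "x : csub (cells p P)"
	shows "rboundary (int p) (cc x) = cc (dC x)"
proof -
	have one: "rboundary (int p) (sg (C s)) = cc (\<Sum>t\<in>P. single t (a s t))" if s: "s : keys x" for s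
	proof -
		have sP: "s : P" "d s = p" using x s by (auto simp: csub_def cells_def)
		have "rboundary (int p) (sg (C s)) = sg (\<partial> (C s))" using rboundary_sg[of "C s" p] CF[OF sP(1)] sP(2) by simp
		also have "\<dots> = sg (%G. \<Sum>t\<in>P. a s t * C t G)" by (rule sg_cong) (rule Cbd[OF sP(1)])
		also have "\<dots> = (\<Sum>t\<in>P. rscale (a s t) (sg (C t)))" unfolding sg_sum sg_scale ..
		also have "\<dots> = cc (\<Sum>t\<in>P. single t (a s t))" unfolding cchain_def rextend_sum rextend_single ..
		finally show ?thesis .
	qed
	have "rboundary (int p) (cc x) = (\<Sum>s\<in>keys x. rscale (lookup x s) (rboundary (int p) (sg (C s))))"
		unfolding cchain_def rextend_def rboundary_sum rboundary_scale ..
	also have "\<dots> = (\<Sum>s\<in>keys x. rscale (lookup x s) (cc (\<Sum>t\<in>P. single t (a s t))))"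
		by (rule sum.cong[OF refl]) (simp only: one)
	also have "\<dots> = cc (dC x)"
		unfolding dC_def rextend_def[of _ x] rvp.linear_sum[OF rlinear_cc] rvp.linear_scale[OF rlinear_cc] ..
	finally show ?thesis .
qed

text \<open>Each cell has a flag that no other cell carries, which isolates its coefficient.\<close>

lemma cc_inj0: assumes x: "x : csub (cells p P)" and z: "cc x = 0" shows "x = 0"
proof (rule poly_mapping_eqI)
	fix s
	have xP: "keys x \<subseteq> P" using x by (auto simp: csub_def cells_def)
	let ?f = "%F. \<Sum>s\<in>P. lookup x s * C s F"
	have f: "?f : Fn (Suc p) \<Delta>"
	proof (rule FnI)
		fix F assume "?f F ~= 0"
		then obtain t where t: "t : P" "lookup x t * C t F ~= 0" by (rule sum.not_neutral_contains_not_neutral)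
		then have "t : keys x" by (simp add: in_keys_iff)
		then have "d t = p" using x by (auto simp: csub_def cells_def)
		then show "F : \<Delta> & card F = Suc p" using FnD[OF CF[OF t(1)], of F] t(2) by auto
	qed
	have eq: "sg ?f = sg (%_. 0)" using z cchain_sg[OF finP xP, of C] by (simp add: sg_def)
	have z0: "(%_. 0) : Fn (Suc p) \<Delta>" by (simp add: Fn_def)
	have f0: "?f F = 0" if "F ~= {}" for F by (rule sg_inj[OF f z0 eq that])
	show "lookup x s = lookup 0 s"
	proof (cases "s : P")
		case True
		obtain F where F: "F ~= {}" "C s F ~= 0" "ALL t:P. t ~= s --> C t F = 0" using Cind[OF True] by blast
		have "?f F = (\<Sum>t\<in>P. if t = s then lookup x s * C s F else 0)"
			by (rule sum.cong[OF refl]) (use F(3) in auto)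
		also have "\<dots> = lookup x s * C s F" using True finP by simp
		finally show ?thesis using f0[OF F(1)] F(2) by simp
	next
		case False
		then have "s \<notin> keys x" using xP by blast
		then show ?thesis by (simp add: in_keys_iff)
	qed
qed

lemma cc_inj: assumes "x : csub (cells p P)" "y : csub (cells p P)" "cc x = cc y" shows "x = y"
	using cc_inj0[OF rv.subspace_diff[OF subspace_csub assms(1,2)]] assms(3) by (simp add: rvp.linear_diff[OF rlinear_cc])

lemma csub_mono: "A \<subseteq> B ==> csub A \<subseteq> csub B" by (auto simp: csub_def)

lemma cells_mono: "L \<subseteq> L' ==> cells p L \<subseteq> cells p L'" by (auto simp: cells_def)

lemma cc_cycle_iff: assumes x: "x : csub (cells p P)" shows "rboundary (int p) (cc x) = 0 \<longleftrightarrow> dC x = 0"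
proof (cases p)
	case 0
	then show ?thesis using dC_keys0 x by (simp add: rboundary_def)
next
	case (Suc q)
	then show ?thesis unfolding cc_boundary[OF x] using cc_inj0[OF dC_keys, of x q] x by (auto simp: rvp.linear_0[OF rlinear_cc])
qed

context
	fixes L assumes LP: "L \<subseteq> P" and cel: "cellular_on L C d"
		and clo: "ALL s:L. ALL t:P. a s t ~= 0 --> t : L"
begin

lemma dC_keys_L: assumes x: "x : csub (cells (Suc p) L)" shows "dC x : csub (cells p L)"
	unfolding csub_def
proof (rule CollectI, rule subsetI)
	fix t assume "t : keys (dC x)"
	then have t: "t : P" "(\<Sum>s\<in>keys x. lookup x s * a s t) ~= 0"
		unfolding in_keys_iff lookup_dC by (auto split: if_splits)
	from t(2) obtain s where s: "s : keys x" "lookup x s * a s t ~= 0"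
		by (rule sum.not_neutral_contains_not_neutral)
	have "d s = Suc p" "s : L" using x s(1) by (auto simp: csub_def cells_def)
	then show "t : cells p L" using t(1) adeg[of s t] s(2) clo by (auto simp: cells_def)
qed

lemma cc_rchains: "x : csub (cells p L) ==> cc x : rchains (int p) (X (flags L))"
	using cchain_rchains[OF cel] by (auto simp: csub_def cells_def)

lemma csub_cells_P: "x : csub (cells p L) ==> x : csub (cells p P)"
	using csub_mono[OF cells_mono[OF LP]] by blast

lemma cc_rcycles: "x : csub (cells p L) ==> dC x = 0 ==> cc x : rcycles (int p) (X (flags L))"
	using cc_rchains cc_cycle_iff[OF csub_cells_P] by (auto simp: rcycles_def)

text \<open>A cycle has the cellular boundary 0; this is the case of \<open>cellular_approx\<close>
  giving surjectivity on homology.\<close>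

lemma cycle_rep:
	assumes c: "c : rcycles (int p) (X (flags L))"
	obtains y where "y : csub (cells p L)" "dC y = 0" "c - cc y : rboundaries (int p) (X (flags L))"
proof -
	have cR: "c : rchains (int p) (X (flags L))" "rboundary (int p) c = cc 0"
		using c by (auto simp: rcycles_def rvp.linear_0[OF rlinear_cc])
	obtain b y where b: "b : rchains (int (Suc p)) (X (flags L))" "keys y \<subseteq> {s\<in>L. d s = p}"
		"c = rboundary (int (Suc p)) b + cc y" by (rule cellular_approx[OF cel cR(1) _ cR(2)]) auto
	have y: "y : csub (cells p L)" using b(2) by (simp add: csub_def cells_def)
	have bd: "c - cc y : rboundaries (int p) (X (flags L))"
		unfolding rboundaries_def using b(1,3) by (intro image_eqI[of _ _ b]) (simp_all add: add.commute)
	have "cc y = c - (c - cc y)" by simp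
	also have "\<dots> : rcycles (int p) (X (flags L))"
		by (rule rv.subspace_diff[OF subspace_rcycles c subsetD[OF rboundaries_rcycles bd]])
	finally have "dC y = 0" using cc_cycle_iff[OF csub_cells_P[OF y]] by (simp add: rcycles_def)
	then show thesis by (rule that[OF y _ bd])
qed

text \<open>A singular filling of a cellular cycle has cellular boundary, so
  \<open>cellular_approx\<close> replaces it by a cellular filling; injectivity of \<open>cc\<close>
  turns the equality of realised chains into one of coefficients.\<close>

lemma boundary_iff:
	assumes y: "y : csub (cells p L)"
	shows "cc y : rboundaries (int p) (X (flags L)) \<longleftrightarrow> y : dC ` csub (cells (Suc p) L)"
proof
	assume "cc y : rboundaries (int p) (X (flags L))"
	then obtain c where c: "c : rchains (int (Suc p)) (X (flags L))" "rboundary (int (Suc p)) c = cc y"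
		unfolding rboundaries_def by (auto simp: add.commute)
	have ky: "keys y \<subseteq> {s\<in>L. Suc (d s) = Suc p}" using y by (auto simp: csub_def cells_def)
	obtain b w where b: "b : rchains (int (Suc (Suc p))) (X (flags L))" "keys w \<subseteq> {s\<in>L. d s = Suc p}"
		"c = rboundary (int (Suc (Suc p))) b + cc w" by (rule cellular_approx[OF cel c(1) ky c(2)])
	have w: "w : csub (cells (Suc p) L)" using b(2) by (simp add: csub_def cells_def)
	have "rboundary (int (Suc p)) (rboundary (int (Suc (Suc p))) b) = 0"
		using rboundary_rboundary[of b "int (Suc p)" "X (flags L)"] b(1) by (simp add: add.commute)
	then have "cc y = rboundary (int (Suc p)) (cc w)" using c(2) unfolding b(3) rboundary_add by simp
	also have "\<dots> = cc (dC w)" by (rule cc_boundary[OF csub_cells_P[OF w]])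
	finally have "y = dC w" by (rule cc_inj[OF csub_cells_P[OF y] dC_keys[OF csub_cells_P[OF w]]])
	then show "y : dC ` csub (cells (Suc p) L)" using w by blast
next
	assume "y : dC ` csub (cells (Suc p) L)"
	then obtain w where w: "w : csub (cells (Suc p) L)" "y = dC w" by blast
	have "cc y = rboundary (int p + 1) (cc w)" unfolding w(2) using cc_boundary[OF csub_cells_P[OF w(1)]] by (simp add: add.commute)
	moreover have "cc w : rchains (int p + 1) (X (flags L))" using cc_rchains[OF w(1)] by (simp add: add.commute)
	ultimately show "cc y : rboundaries (int p) (X (flags L))" unfolding rboundaries_def by blast
qed

lemma boundary_cycle: assumes y: "y : csub (cells p L)" "y : dC ` csub (cells (Suc p) L)" shows "dC y = 0"
proof -
	have "cc y : rcycles (int p) (X (flags L))" using boundary_iff[OF y(1)] y(2) rboundaries_rcycles by blast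
	then show ?thesis using cc_cycle_iff[OF csub_cells_P[OF y(1)]] by (simp add: rcycles_def)
qed

abbreviation cls where "cls p x \<equiv> rhomology_class (int p) (X (flags L)) (cc x)"

lemma cls_linear: "cls p (x + y) = cls p x \<oplus>\<^bsub>rhomology (int p) (X (flags L))\<^esub> cls p y"
	"cls p (rscale r x) = r \<odot>\<^bsub>rhomology (int p) (X (flags L))\<^esub> cls p x" "cls p 0 = \<zero>\<^bsub>rhomology (int p) (X (flags L))\<^esub>"
	by (simp_all add: rhomology_add rhomology_smult rhomology_zero rvp.linear_add[OF rlinear_cc] rvp.linear_scale[OF rlinear_cc] rvp.linear_0[OF rlinear_cc])

lemma cls_zero: "x : csub (cells p L) ==> cls p x = \<zero>\<^bsub>rhomology (int p) (X (flags L))\<^esub> \<longleftrightarrow> x : dC ` csub (cells (Suc p) L)"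
	unfolding rhomology_zero rclass_eq using boundary_iff by simp

lemma classes: "rhomology_class (int p) (X (flags L)) ` rcycles (int p) (X (flags L)) = cls p ` {y\<in>csub (cells p L). dC y = 0}"
proof (intro equalityI subsetI)
	fix u assume "u : rhomology_class (int p) (X (flags L)) ` rcycles (int p) (X (flags L))"
	then obtain c where c: "c : rcycles (int p) (X (flags L))" "u = rhomology_class (int p) (X (flags L)) c" by blast
	obtain y where y: "y : csub (cells p L)" "dC y = 0" "c - cc y : rboundaries (int p) (X (flags L))" by (rule cycle_rep[OF c(1)])
	have "u = cls p y" unfolding c(2) rclass_eq by (rule y(3))
	then show "u : cls p ` {y\<in>csub (cells p L). dC y = 0}" using y by blast
next
	fix u assume "u : cls p ` {y\<in>csub (cells p L). dC y = 0}"
	then show "u : rhomology_class (int p) (X (flags L)) ` rcycles (int p) (X (flags L))" using cc_rcycles by blast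
qed

text \<open>Cellular cycles surject onto homology, with the cellular boundaries as kernel.\<close>

lemma betti_cells:
	"betti (int p) (X (flags L)) + rv.dim (dC ` csub (cells (Suc p) L)) = rv.dim {y\<in>csub (cells p L). dC y = 0}"
proof -
	let ?W = "{y\<in>csub (cells p L). dC y = 0}"
	have W: "fin_sub ?W"
		by (rule fin_sub_subset[OF fin_sub_csub[OF finite_cells[OF LP]] subspace_ker[OF rlinear_dC subspace_csub]]) auto
	have car: "carrier (rhomology (int p) (X (flags L))) = cls p ` ?W" unfolding rhomology_carrier by (rule classes)
	have "rdim (rhomology (int p) (X (flags L))) + rv.dim {w\<in>?W. cls p w = \<zero>\<^bsub>rhomology (int p) (X (flags L))\<^esub>} = rv.dim ?W"
		by (rule rdim_of_surj[OF W car cls_linear])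
	moreover have "{w\<in>?W. cls p w = \<zero>\<^bsub>rhomology (int p) (X (flags L))\<^esub>} = dC ` csub (cells (Suc p) L)"
	proof (intro equalityI subsetI)
		fix w assume "w : {w\<in>?W. cls p w = \<zero>\<^bsub>rhomology (int p) (X (flags L))\<^esub>}"
		then show "w : dC ` csub (cells (Suc p) L)" using cls_zero by blast
	next
		fix w assume w: "w : dC ` csub (cells (Suc p) L)"
		then obtain x where x: "x : csub (cells (Suc p) L)" "w = dC x" by blast
		have k: "w : csub (cells p L)" unfolding x(2) by (rule dC_keys_L[OF x(1)])
		show "w : {w\<in>?W. cls p w = \<zero>\<^bsub>rhomology (int p) (X (flags L))\<^esub>}" using cls_zero[OF k] w boundary_cycle[OF k w] k by blast
	qed
	ultimately show ?thesis unfolding betti_def by simp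
qed

lemma V_img_cells:
	assumes "cells_space M K = X (flags L)"
	shows "V_img n M K = (%y. rhomology_class (int n) M (cc y)) ` {y\<in>csub (cells n L). dC y = 0}"
proof (intro equalityI subsetI)
	fix u assume "u : V_img n M K"
	then obtain c where c: "c : rcycles (int n) (X (flags L))" "u = rhomology_class (int n) M c"
		unfolding V_img_eq[OF assms] by blast
	obtain y where y: "y : csub (cells n L)" "dC y = 0" "c - cc y : rboundaries (int n) (X (flags L))" by (rule cycle_rep[OF c(1)])
	have "u = rhomology_class (int n) M (cc y)" unfolding c(2) rclass_eq using y(3) rboundaries_subtopology by blast
	then show "u : (%y. rhomology_class (int n) M (cc y)) ` {y\<in>csub (cells n L). dC y = 0}" using y by blast
next
	fix u assume "u : (%y. rhomology_class (int n) M (cc y)) ` {y\<in>csub (cells n L). dC y = 0}"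
	then show "u : V_img n M K" unfolding V_img_eq[OF assms] using cc_rcycles by blast
qed

end

text \<open>The kernel consists of the classes of cellular boundaries of \<open>M\<close> that are
  supported on \<open>L\<close>. As \<open>L\<close> has no cells of dimension \<open>n + 1\<close>,
  distinct cellular cycles have distinct classes, and the kernel is this space of chains
  itself.\<close>

lemma k_inv_cells:
	assumes LP: "L \<subseteq> P" and cel: "cellular_on L C d" and clo: "ALL s:L. ALL t:P. a s t ~= 0 --> t : L"
		and K: "cells_space M K = X (flags L)" and PC: "cellular_on P C d" and top: "cells (Suc n) L = {}"
	shows "k_inv n M K = rv.dim {w : dC ` csub (cells (Suc n) P). keys w \<subseteq> cells n L}"
proof -
	let ?cls = "%x. rhomology_class (int n) (X (flags L)) (cc x)"
	note classes = classes[OF LP cel clo] and cc_rcycles = cc_rcycles[OF LP cel clo] and csub_cells_P = csub_cells_P[OF LP cel clo]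
		and cls_zero = cls_zero[OF LP cel clo] and cls_linear = cls_linear[OF LP cel clo]
	have XP: "X (flags P) = M"
	proof -
		have "flags P = \<Delta>" unfolding flags_def using subP by auto
		then show ?thesis using X_Delta by simp
	qed
	have cloP: "ALL s:P. ALL t:P. a s t ~= 0 --> t : P" by blast
	let ?H = "rhomology (int n) (X (flags L))"
	let ?V = "?H\<lparr>carrier := {u : carrier ?H. rhom_induced (int n) M id u = \<zero>\<^bsub>rhomology (int n) M\<^esub>}\<rparr>"
	let ?W = "{w : dC ` csub (cells (Suc n) P). keys w \<subseteq> cells n L}"
	have WL: "w : csub (cells n L)" if "w : ?W" for w using that by (simp add: csub_def)
	have eqW: "?W = dC ` csub (cells (Suc n) P) \<inter> csub (cells n L)" by (auto simp: csub_def)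
	have W: "fin_sub ?W"
		by (rule fin_sub_subset[OF fin_sub_csub[OF finite_cells[OF LP]]])
			(auto simp: eqW intro!: rv.subspace_inter subspace_image[OF rlinear_dC] subspace_csub)
	have Wd: "dC w = 0" if "w : ?W" for w
		using boundary_cycle[OF subset_refl PC cloP csub_cells_P[OF WL[OF that]]] that by blast
	have ker: "rhom_induced (int n) M id (?cls y) = \<zero>\<^bsub>rhomology (int n) M\<^esub> \<longleftrightarrow> y : dC ` csub (cells (Suc n) P)"
		if y: "y : csub (cells n L)" "dC y = 0" for y
		using boundary_iff[OF subset_refl PC cloP csub_cells_P[OF y(1)]]
		unfolding rhom_induced_id[OF cc_rcycles[OF y]] rhomology_zero rclass_eq XP by simp
	have car: "carrier ?V = ?cls ` ?W"
	proof (intro equalityI subsetI)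
		fix u assume "u : carrier ?V"
		then have u: "u : carrier ?H" "rhom_induced (int n) M id u = \<zero>\<^bsub>rhomology (int n) M\<^esub>" by auto
		then obtain y where y: "y : csub (cells n L)" "dC y = 0" "u = ?cls y" unfolding rhomology_carrier classes by blast
		have "y : ?W" using ker[OF y(1,2)] u(2) y(1) unfolding y(3) by (simp add: csub_def)
		then show "u : ?cls ` ?W" using y(3) by blast
	next
		fix u assume "u : ?cls ` ?W"
		then obtain w where w: "w : ?W" "u = ?cls w" by blast
		have "u : carrier ?H" unfolding rhomology_carrier classes w(2) using WL[OF w(1)] Wd[OF w(1)] by blast
		moreover have "rhom_induced (int n) M id u = \<zero>\<^bsub>rhomology (int n) M\<^esub>"
			unfolding w(2) using ker[OF WL[OF w(1)] Wd[OF w(1)]] w(1) by blast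
		ultimately show "u : carrier ?V" by simp
	qed
	have "rdim ?V + rv.dim {w\<in>?W. ?cls w = \<zero>\<^bsub>?V\<^esub>} = rv.dim ?W"
		by (rule rdim_of_surj[OF W car]) (use cls_linear in simp_all)
	moreover have "{w\<in>?W. ?cls w = \<zero>\<^bsub>?V\<^esub>} = {0}"
	proof -
		have "csub (cells (Suc n) L) = {0}" unfolding top csub_def by (auto simp: keys_eq_empty)
		then have "dC ` csub (cells (Suc n) L) = {0}" by (simp add: rvp.linear_0[OF rlinear_dC])
		then have "?cls w = \<zero>\<^bsub>?V\<^esub> \<longleftrightarrow> w = 0" if "w : ?W" for w using cls_zero[OF WL[OF that]] by simp
		moreover have "0 : ?W" using rv.subspace_0[OF fin_sub_subspace[OF W]] .
		ultimately show ?thesis by blast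
	qed
	ultimately show ?thesis unfolding k_inv_def K by (simp add: dim_zero_space)
qed

end

section \<open>Poincare duality\<close>

lemma (in flag_complex) bd_sum: "\<partial> (%F. \<Sum>i\<in>I. r i * x i F) G = (\<Sum>i\<in>I. r i * \<partial> (x i) G)"
proof -
	have "\<partial> (%F. \<Sum>i\<in>I. r i * x i F) G = (\<Sum>v\<in>P - G. \<Sum>i\<in>I. r i * ((-1) ^ pos rk v G * x i (insert v G)))"
		unfolding bd_def sum_distrib_left by (intro sum.cong refl) (simp add: mult.left_commute)
	also have "\<dots> = (\<Sum>i\<in>I. r i * \<partial> (x i) G)" unfolding bd_def sum_distrib_left by (rule sum.swap)
	finally show ?thesis .
qed

context oriented_complex
begin

section \<open>Real local homology of the flag complex\<close>

lemma int_flag_chain: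
	fixes k :: "'v set => int"
	assumes k: "(%F. real_of_int (k F)) : Fn (Suc p) \<Delta>"
	shows "ri (\<Sum>F\<in>{F\<in>\<Delta>. card F = Suc p}. frag_cmul (k F) (frag_of (simp F))) = sg (%F. real_of_int (k F))"
proof -
	have "ri (\<Sum>F\<in>{F\<in>\<Delta>. card F = Suc p}. frag_cmul (k F) (frag_of (simp F))) =
			(\<Sum>F\<in>{F\<in>\<Delta>. card F = Suc p}. single (simp F) (real_of_int (k F)))"
		unfolding ri_sum by (intro sum.cong refl) (simp add: ri_simps rscale_single)
	also have "\<dots> = sg (%F. real_of_int (k F))"
		unfolding sg_def
	proof (rule sum.mono_neutral_left)
		show "ALL F:\<Delta> - {{}} - {F\<in>\<Delta>. card F = Suc p}. single (simp F) (real_of_int (k F)) = 0"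
		proof
			fix F assume "F : \<Delta> - {{}} - {F\<in>\<Delta>. card F = Suc p}"
			then have "real_of_int (k F) = 0" using FnD(2)[OF k, of F] by blast
			then show "single (simp F) (real_of_int (k F)) = 0" by simp
		qed
	qed (use finD in auto)
	finally show ?thesis .
qed

abbreviation zr where "zr \<equiv> %F. real_of_int (zi F)"

lemma zr_Fn: "zr : Fn (Suc m) \<Delta>" by (simp add: Fn_def zi_def)

lemma ri_zc: "ri zc = sg zr" unfolding zc_def by (rule int_flag_chain[OF zr_Fn])

lemma avoid_vertex:
	assumes s: "s : P"
	shows "bary {s} : topspace M" "avoid (bary {s}) = {g\<in>\<Delta>. s \<notin> g}" "{v. \<Psi> (bary {s}) v ~= 0} = {s}"
	using bary_facts[OF vert[OF s]] by (auto simp: avoid_def)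

lemma local_int_cycle:
	fixes k :: "'v set => int"
	assumes s: "s : P" and k: "(%F. real_of_int (k F)) : Fn (Suc p) \<Delta>"
		and cy: "ALL G. s : G --> \<partial> (%F. real_of_int (k F)) G = 0"
	obtains w where "keys w \<subseteq> FS p \<Delta>" "ri w = sg (%F. real_of_int (k F))" "singular_relcycle p M (N (bary {s})) w"
proof -
	define w where "w = (\<Sum>F\<in>{F\<in>\<Delta>. card F = Suc p}. frag_cmul (k F) (frag_of (simp F)))"
	have kw: "keys w \<subseteq> FS p \<Delta>" unfolding w_def by (rule flag_sum_keys)
	have rw: "ri w = sg (%F. real_of_int (k F))" unfolding w_def by (rule int_flag_chain[OF k])
	note x = avoid_vertex[OF s]
	have "keys (chain_boundary p w) \<subseteq> FS (p - 1) (avoid (bary {s}))"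
	proof (cases p)
		case (Suc q)
		have b: "\<partial> (%F. real_of_int (k F)) : Fn (Suc q) \<Delta>" using bd_Fn_Delta[OF k] Suc by simp
		then have "\<partial> (%F. real_of_int (k F)) : Fn (Suc q) (avoid (bary {s}))"
			unfolding x(2) Fn_def using cy by auto
		from keys_sg[OF this] have "keys (ri (chain_boundary p w)) \<subseteq> FS q (avoid (bary {s}))"
			unfolding rboundary_ri[symmetric] rw rboundary_sg[OF k] .
		then show ?thesis using Suc by simp
	qed (simp add: chain_boundary_def)
	then have "singular_chain (p - 1) (subtopology M (N (bary {s}))) (chain_boundary p w)" by (rule chain_avoid[OF x(1)])
	moreover have "singular_chain p M w" using FS_chain[OF subc_Delta kw] by (simp add: X_Delta)
	ultimately have "singular_relcycle p M (N (bary {s})) w" by (simp add: singular_relcycle)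
	then show thesis by (rule that[OF kw rw])
qed

lemma simp_notin_avoid:
	assumes "s : P" "G : \<Delta>" "card G = Suc p" "s : G"
	shows "simp G \<notin> FS p (avoid (bary {s}))"
proof
	assume "simp G : FS p (avoid (bary {s}))"
	then obtain F where F: "F : avoid (bary {s})" "card F = Suc p" "simp G = simp F" by (auto simp: FS_def)
	then have "F : \<Delta>" "s \<notin> F" using avoid_vertex(2)[OF assms(1)] by auto
	then show False using simp_inj[OF assms(2) \<open>F : \<Delta>\<close> assms(3) F(2,3)] assms(4) by simp
qed

text \<open>Vanishing local homology provides a flag filling up to flags avoiding the barycenter of
  \<open>{s}\<close>, that is, up to flags without \<open>s\<close>.\<close>

lemma acyc_int:
	fixes k :: "'v set => int"
	assumes s: "s : P" and k: "(%F. real_of_int (k F)) : Fn (Suc p) \<Delta>" and p: "p ~= m"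
		and cy: "ALL G. s : G --> \<partial> (%F. real_of_int (k F)) G = 0"
	shows "EX y:Fn (Suc (Suc p)) \<Delta>. ALL G. s : G --> real_of_int (k G) = \<partial> y G"
proof -
	note x = avoid_vertex[OF s]
	obtain w where w: "keys w \<subseteq> FS p \<Delta>" "ri w = sg (%F. real_of_int (k F))" "singular_relcycle p M (N (bary {s})) w"
		by (rule local_int_cycle[OF s k cy])
	have "trivial_group (relative_homology_group (int p) M (N (bary {s})))"
		using local_homology_manifold[OF manifold x(1), of "int p"] p by simp
	then have rb: "singular_relboundary p M (N (bary {s})) w" using w(3) unfolding trivial_relative_homology_iff by blast
	obtain e where e: "keys e \<subseteq> FS (Suc p) \<Delta>" "keys (w - chain_boundary (Suc p) e) \<subseteq> FS p (avoid (bary {s}))"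
		by (rule local_flag_boundary[OF x(1) w(1) rb])
	have "keys (ri e) \<subseteq> FS (Suc p) \<Delta>" using e(1) by simp
	then obtain y where y: "y : Fn (Suc (Suc p)) \<Delta>" "ri e = sg y" by (rule sg_of) simp
	let ?f = "%F. real_of_int (k F) - \<partial> y F"
	have yb: "\<partial> y : Fn (Suc p) \<Delta>" by (rule bd_Fn_Delta[OF y(1)])
	have f: "?f : Fn (Suc p) \<Delta>"
		by (rule FnI) (use FnD[OF k] FnD[OF yb] in \<open>metis diff_zero diff_0_right diff_self\<close>)
	have "sg ?f = sg (%F. real_of_int (k F)) - sg (\<partial> y)"
		using sg_add[of ?f "\<partial> y"] by simp
	then have sf: "sg ?f = ri (w - chain_boundary (Suc p) e)"
		unfolding ri_simps w(2) rboundary_ri[symmetric] y(2) rboundary_sg[OF y(1)] by simp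
	have "real_of_int (k G) = \<partial> y G" if G: "s : G" for G
	proof (cases "?f G = 0")
		case False
		then have GD: "G : \<Delta>" "card G = Suc p" using FnD[OF f] by blast+
		have "simp G \<notin> keys (ri (w - chain_boundary (Suc p) e))"
			using simp_notin_avoid[OF s GD G] e(2) by auto
		then have "lookup (sg ?f) (simp G) = 0" unfolding sf in_keys_iff by blast
		then have "?f G = 0" using lookup_sg[OF f GD] by simp
		then show ?thesis by simp
	qed simp
	then show ?thesis using y(1) by blast
qed

lemma gen_int:
	fixes k :: "'v set => int"
	assumes s: "s : P" and k: "(%F. real_of_int (k F)) : Fn (Suc m) \<Delta>"
		and cy: "ALL G. s : G --> \<partial> (%F. real_of_int (k F)) G = 0"
	shows "EX r. ALL F. s : F --> real_of_int (k F) = r * zr F"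
proof -
	note x = avoid_vertex[OF s]
	obtain w where w: "keys w \<subseteq> FS m \<Delta>" "ri w = sg (%F. real_of_int (k F))" "singular_relcycle m M (N (bary {s})) w"
		by (rule local_int_cycle[OF s k cy])
	obtain q where q: "singular_relboundary m M (N (bary {s})) (w - frag_cmul q zc)" by (rule local_generator[OF x(1) w(3)])
	have kw: "keys (w - frag_cmul q zc) \<subseteq> FS m \<Delta>"
		using keys_diff[of w "frag_cmul q zc"] keys_cmul[of q zc] w(1) zc_keys by blast
	have "real_of_int (k F) = real_of_int q * zr F" if F: "s : F" for F
	proof (cases "F : \<Delta> & card F = Suc m")
		case True
		have "lookup (w - frag_cmul q zc) (simp F) = 0"
			by (rule top_flags_eq[OF x(1) kw q]) (use True F x(3) in auto)
		moreover have "real_of_int (lookup w (simp F)) = real_of_int (k F)"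
			using lookup_sg[OF k] True w(2)[symmetric] by simp
		ultimately show ?thesis using zc_lookup[of F] True by (simp add: lookup_minus)
	next
		case False
		then have "real_of_int (k F) = 0" "zr F = 0" using FnD[OF k, of F] FnD[OF zr_Fn, of F] by blast+
		then show ?thesis by simp
	qed
	then show ?thesis by blast
qed

text \<open>The boundary coefficients at flags through \<open>s\<close> are integral combinations
  over an independent set of reals, so each integral part is a relative cycle by itself.\<close>

lemma decompose_local_cycle:
	assumes c: "c : Fn (Suc p) \<Delta>" and cy: "ALL G. s : G --> \<partial> c G = 0"
	obtains I and k :: "real => 'v set => int" where "ALL F. c F = (\<Sum>i\<in>I. i * real_of_int (k i F))"
		"ALL i. (%F. real_of_int (k i F)) : Fn (Suc p) \<Delta>" "ALL i:I. ALL G. s : G --> \<partial> (%F. real_of_int (k i F)) G = 0"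
proof -
	have "finite {F. c F ~= 0}" by (rule finite_subset[OF _ finD]) (use FnD[OF c] in blast)
	from zindep_decompose[OF this] obtain I k where I: "zindep I" "!!i F. c F = 0 ==> k i F = (0::int)"
		"!!F. c F = (\<Sum>i\<in>I. of_int (k i F) * i)" by blast
	have kF: "(%F. real_of_int (k i F)) : Fn (Suc p) \<Delta>" for i
		by (rule FnI) (use FnD[OF c] I(2) in \<open>metis of_int_0\<close>)
	have "\<partial> (%F. real_of_int (k i F)) G = 0" if "i : I" "s : G" for i G
	proof -
		define l where "l i = (\<Sum>v\<in>P - G. (-1) ^ pos rk v G * k i (insert v G))" for i
		have l: "\<partial> (%F. real_of_int (k i F)) G = real_of_int (l i)" for i unfolding bd_def l_def by simp
		have cs: "c = (%F. \<Sum>i\<in>I. i * real_of_int (k i F))" using I(3) by (auto simp: mult.commute)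
		have "0 = \<partial> c G" using cy that(2) by simp
		also have "\<dots> = (\<Sum>i\<in>I. i * \<partial> (%F. real_of_int (k i F)) G)" unfolding cs by (rule bd_sum)
		also have "\<dots> = (\<Sum>i\<in>I. of_int (l i) * i)" unfolding l by (simp add: mult.commute)
		finally have "l i = 0" using zindepD[OF I(1) _ that(1), of l] by simp
		then show ?thesis unfolding l by simp
	qed
	then show thesis using that[of k I] I(3) kF by (simp add: mult.commute)
qed

text \<open>Acyclicity and generation over the reals follow from the integral statements, applied to
  each part of a decomposed local cycle.\<close>

lemma zr_manifold: "homology_manifold P \<Delta> rk m zr"
proof
	show "zr : Fn (Suc m) \<Delta>" by (rule zr_Fn)
	show "\<partial> zr G = 0" if "G ~= {}" for G
	proof -
		have eq: "sg (\<partial> zr) = sg (%_. 0)"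
			unfolding rboundary_sg[OF zr_Fn, symmetric] ri_zc[symmetric] rboundary_ri zc_cycle by (simp add: ri_simps sg_def)
		have z0: "(%_. 0) : Fn m \<Delta>" by (simp add: Fn_def)
		show ?thesis by (rule sg_inj[OF bd_Fn_Delta[OF zr_Fn] z0 eq that])
	qed
	show "EX F. s : F & zr F ~= 0" if "s : P" for s using zi_nonzero[OF that] by simp
next
	fix s c k assume h: "s : P" "c : Fn k \<Delta>" "k ~= Suc m" "!!G. s : G ==> \<partial> c G = 0"
	show "EX b:Fn (Suc k) \<Delta>. ALL G. s : G --> c G = \<partial> b G"
	proof (cases k)
		case 0
		have "c G = 0" if "s : G" for G
		proof (rule ccontr)
			assume "c G ~= 0"
			then have "G : \<Delta>" "card G = 0" using FnD[OF h(2)] 0 by auto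
			then show False using fin[of G] that by auto
		qed
		then show ?thesis by (intro bexI[of _ "%_. 0"]) (auto simp: bd_def Fn_def)
	next
		case (Suc p)
		have "c : Fn (Suc p) \<Delta>" "ALL G. s : G --> \<partial> c G = 0" using h Suc by auto
		then obtain I and k' :: "real => 'v set => int" where I: "ALL F. c F = (\<Sum>i\<in>I. i * real_of_int (k' i F))"
			"ALL i. (%F. real_of_int (k' i F)) : Fn (Suc p) \<Delta>" "ALL i:I. ALL G. s : G --> \<partial> (%F. real_of_int (k' i F)) G = 0"
			by (rule decompose_local_cycle)
		have "ALL i:I. EX y. y : Fn (Suc (Suc p)) \<Delta> & (ALL G. s : G --> real_of_int (k' i G) = \<partial> y G)"
		proof
			fix i assume i: "i : I"
			have "p ~= m" using h(3) Suc by simp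
			from acyc_int[OF h(1) I(2)[THEN spec] this bspec[OF I(3) i]]
			show "EX y. y : Fn (Suc (Suc p)) \<Delta> & (ALL G. s : G --> real_of_int (k' i G) = \<partial> y G)" by (simp only: Bex_def)
		qed
		then obtain y where y: "ALL i:I. y i : Fn (Suc (Suc p)) \<Delta> & (ALL G. s : G --> real_of_int (k' i G) = \<partial> (y i) G)"
			by (rule bchoice[THEN exE])
		let ?b = "%F. \<Sum>i\<in>I. i * y i F"
		have "?b : Fn (Suc k) \<Delta>"
		proof (rule FnI)
			fix F assume "?b F ~= 0"
			then obtain i where "i : I" "i * y i F ~= 0" by (rule sum.not_neutral_contains_not_neutral)
			then have "y i : Fn (Suc (Suc p)) \<Delta>" "y i F ~= 0" using y by auto
			then show "F : \<Delta> & card F = Suc k" using FnD Suc by blast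
		qed
		moreover have "c G = \<partial> ?b G" if "s : G" for G
		proof -
			have "c G = (\<Sum>i\<in>I. i * \<partial> (y i) G)" using I(1) y that by simp
			then show ?thesis unfolding bd_sum .
		qed
		ultimately show ?thesis by blast
	qed
next
	fix s c assume h: "s : P" "c : Fn (Suc m) \<Delta>" "!!G. s : G ==> \<partial> c G = 0"
	have "ALL G. s : G --> \<partial> c G = 0" using h by auto
	with h(2) obtain I and k' :: "real => 'v set => int" where I: "ALL F. c F = (\<Sum>i\<in>I. i * real_of_int (k' i F))"
		"ALL i. (%F. real_of_int (k' i F)) : Fn (Suc m) \<Delta>" "ALL i:I. ALL G. s : G --> \<partial> (%F. real_of_int (k' i F)) G = 0"
		by (rule decompose_local_cycle)
	have "ALL i:I. EX r. ALL F. s : F --> real_of_int (k' i F) = r * zr F"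
	proof
		fix i assume i: "i : I"
		show "EX r. ALL F. s : F --> real_of_int (k' i F) = r * zr F" by (rule gen_int[OF h(1) I(2)[THEN spec] bspec[OF I(3) i]])
	qed
	then obtain r where r: "ALL i:I. ALL F. s : F --> real_of_int (k' i F) = r i * zr F" by (rule bchoice[THEN exE])
	have "c F = (\<Sum>i\<in>I. i * r i) * zr F" if "s : F" for F
	proof -
		have "c F = (\<Sum>i\<in>I. i * (r i * zr F))" using I(1) r that by simp
		then show ?thesis by (simp add: sum_distrib_right mult.assoc)
	qed
	then show "EX r. ALL F. s : F --> c F = r * zr F" by blast
qed

end

section \<open>The cellular complexes of the cells and of the dual cells\<close>

sublocale oriented_complex \<subseteq> hm: homology_manifold P \<Delta> rk m "%F. real_of_int (zi F)"
	by (rule zr_manifold)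

sublocale oriented_complex \<subseteq> ce: cell_basis P \<Delta> rk m M \<Phi> hm.E rk "%s t. (-1) ^ rk s * hm.inc t s"
proof
	show "\<partial> (hm.E s) G = (\<Sum>t\<in>P. (-1) ^ rk s * hm.inc t s * hm.E t G)" if "s : P" "G ~= {}" for s G
		unfolding hm.bd_E[OF that] sum_distrib_left by (simp add: mult.assoc)
	show "rk s = Suc (rk t)" if "(-1) ^ rk s * hm.inc t s ~= 0" for s t using hm.inc_nonzero[of t s] that by simp
qed (simp_all add: hm.E_Fn hm.E_indep)

sublocale oriented_complex \<subseteq> cd: cell_basis P \<Delta> rk m M \<Phi> hm.D "%s. m - rk s" "hm.inc"
proof
	show "m - rk s = Suc (m - rk t)" if "hm.inc s t ~= 0" for s t
		using hm.inc_nonzero[OF that] rkm[of t] by auto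
qed (simp_all add: hm.D_Fn hm.D_indep hm.bd_D)

context oriented_complex
begin

lemma cellular_on_E: assumes "lower L" shows "cellular_on L hm.E rk"
	unfolding cellular_on_def
proof (intro conjI ballI allI impI)
	show "finite L" using assms finP finite_subset by (auto simp: lower_def)
	show "hm.E s : Fn (Suc (rk s)) (flags L)" if "s : L" for s by (rule hm.E_flags[OF assms that])
	fix k e x assume "e : Fn k (flags L)" "0 < k" "ALL s:L. x s ~= 0 --> Suc (Suc (rk s)) = k"
		"ALL G. G ~= {} --> \<partial> e G = (\<Sum>s\<in>L. x s * hm.E s G)"
	then show "EX b:Fn (Suc k) (flags L). EX y. (ALL s:L. y s ~= 0 --> Suc (rk s) = k) &
				 (ALL F. F ~= {} --> e F = \<partial> b F + (\<Sum>s\<in>L. y s * hm.E s F))"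
		by (intro hm.cellular[OF assms]) simp_all
qed

lemma cellular_on_D: assumes "hm.upper U" shows "cellular_on U hm.D (%s. m - rk s)"
	unfolding cellular_on_def
proof (intro conjI ballI allI impI)
	show "finite U" using assms finP finite_subset by (auto simp: hm.upper_def)
	show "hm.D s : Fn (Suc (m - rk s)) (flags U)" if "s : U" for s by (rule hm.D_flags[OF assms that])
	fix k e x assume "e : Fn k (flags U)" "0 < k" "ALL s:U. x s ~= 0 --> Suc (Suc (m - rk s)) = k"
		"ALL G. G ~= {} --> \<partial> e G = (\<Sum>s\<in>U. x s * hm.D s G)"
	then show "EX b:Fn (Suc k) (flags U). EX y. (ALL s:U. y s ~= 0 --> Suc (m - rk s) = k) &
				 (ALL F. F ~= {} --> e F = \<partial> b F + (\<Sum>s\<in>U. y s * hm.D s F))"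
		by (intro hm.cellular_D[OF assms]) simp_all
qed

lemma closed_E: "lower L ==> ALL s:L. ALL t:P. (-1) ^ rk s * hm.inc t s ~= 0 --> t : L"
	using hm.inc_nonzero unfolding lower_def by fastforce

lemma closed_D: "hm.upper U ==> ALL s:U. ALL t:P. hm.inc s t ~= 0 --> t : U"
	using hm.inc_nonzero unfolding hm.upper_def by (fastforce simp: insert_commute)

lemma lower_P: "lower P" and upper_P: "hm.upper P"
	unfolding lower_def hm.upper_def using subP by blast+

lemma flags_P: "flags P = \<Delta>" unfolding flags_def using subP by auto

lemma X_P: "X (flags P) = M" unfolding flags_P by (rule X_Delta)

lemma upper_complement: "lower L ==> hm.upper (P - L)"
	unfolding lower_def hm.upper_def
proof (intro conjI ballI allI impI)
	fix s v assume L: "L \<subseteq> P & (ALL s:L. ALL v. rk v < rk s & {v, s} : \<Delta> --> v : L)"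
		and s: "s : P - L" and v: "rk s < rk v & {v, s} : \<Delta>"
	have "v : P" using subP[of "{v,s}"] v by auto
	moreover have "v \<notin> L" using L s v by (metis DiffD2 insert_commute)
	ultimately show "v : P - L" by simp
qed auto

text \<open>The two cellular boundaries use the same matrix with rows and columns exchanged, so they
  are adjoint up to the sign in \<open>bd_E\<close>.\<close>

lemma E_D_adjoint:
	assumes w: "w : csub (ce.cells p P)"
	shows "ip (ce.dC w) y = (-1) ^ p * ip w (cd.dC y)"
proof -
	have wP: "keys w \<subseteq> P" and wp: "!!t. t : keys w ==> rk t = p"
		using w by (auto simp: csub_def ce.cells_def)
	let ?yk = "keys y" and ?wk = "keys w"
	have "ip (ce.dC w) y = ip y (ce.dC w)" by (rule ip_commute)
	also have "\<dots> = (\<Sum>s\<in>?yk. \<Sum>t\<in>?wk. (-1) ^ p * (lookup w t * (lookup y s * hm.inc s t)))"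
		unfolding ip_def
	proof (rule sum.cong[OF refl])
		fix s
		show "lookup y s * lookup (ce.dC w) s =
			(\<Sum>t\<in>?wk. (-1) ^ p * (lookup w t * (lookup y s * hm.inc s t)))"
		proof (cases "s : P")
			case True
			then show ?thesis unfolding ce.lookup_dC by (auto simp: sum_distrib_left wp intro!: sum.cong)
		next
			case False
			then have "hm.inc s t = 0" for t using hm.inc_nonzero[of s t] by blast
			then show ?thesis unfolding ce.lookup_dC using False by simp
		qed
	qed
	also have "\<dots> = (\<Sum>t\<in>?wk. \<Sum>s\<in>?yk. (-1) ^ p * (lookup w t * (lookup y s * hm.inc s t)))"
		by (rule sum.swap)
	also have "\<dots> = (-1) ^ p * ip w (cd.dC y)"
		unfolding ip_def sum_distrib_left
	proof (rule sum.cong[OF refl])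
		fix t assume "t : ?wk"
		then have "t : P" using wP by blast
		then show "(\<Sum>s\<in>?yk. (-1) ^ p * (lookup w t * (lookup y s * hm.inc s t))) =
			 (-1) ^ p * (lookup w t * lookup (cd.dC y) t)"
			unfolding cd.lookup_dC by (simp add: sum_distrib_left)
	qed
	finally show ?thesis .
qed

text \<open>If \<open>s\<close> has position \<open>p\<close> in the flag, the Alexander-Whitney
  faces are again flags: \<open>s\<close> with the members below it, and \<open>s\<close> with the
  members above it.\<close>

lemma front_face_simp:
	assumes F: "F : \<Delta>" "s : F" and c: "card (below s F) = p" "card (above s F) = q"
	shows "front_face p (simp F) = simp (insert s (below s F))" "back_face p q (simp F) = simp (insert s (above s F))"
proof -
	have fF: "finite F" using fin[OF F(1)] .
	note sp = split_flag[OF F]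
	have cF: "card F = Suc (p + q)" using LU_card[OF sp(1,2)] sp(3) c by simp
	have c1: "card (insert s (below s F)) = Suc p" "card (insert s (above s F)) = Suc q" using fF c by auto
	have tri: "v = s \<or> rk v < rk s \<or> rk s < rk v" if "v : F" for v using sp(3) that by blast
	show "front_face p (simp F) = simp (insert s (below s F))"
	proof (rule ext)
		fix x
		show "front_face p (simp F) x = simp (insert s (below s F)) x"
		proof (cases "x : standard_simplex p")
			case True
			have "x : standard_simplex (p + q)" using True standard_simplex_mono[of p "p + q"] by auto
			moreover have "lift F x = lift (insert s (below s F)) x"
			proof (rule ext)
				fix v
				show "lift F x v = lift (insert s (below s F)) x v"
				proof (cases "v : F & rk s < rk v")
					case True': True
					have "insert s (below s F) \<subseteq> {u\<in>F. rk u < rk v}" using F(2) True' by auto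
					then have "Suc p <= pos rk v F" unfolding pos_def c1(1)[symmetric] using fF by (intro card_mono) auto
					\<comment> \<open>Points of the front face have zero coordinates at positions beyond
					  \<open>p\<close>.\<close>
					then have "x (pos rk v F) = 0" using True by (simp add: standard_simplex_def)
					then show ?thesis using True' by (auto simp: lift_def)
				next
					case False
					have "{u\<in>F. rk u < rk v} = {u\<in>insert s (below s F). rk u < rk v}" if "v : F" using tri[OF that] that False F(2) by auto
					then have "pos rk v F = pos rk v (insert s (below s F))" if "v : F" unfolding pos_def using that by simp
					then show ?thesis using tri[of v] False F(2) by (auto simp: lift_def)
				qed
			qed
			ultimately show ?thesis using True cF c1 by (simp add: front_face_def simp_def)
		qed (simp add: front_face_def simp_def c1)
	qed
	show "back_face p q (simp F) = simp (insert s (above s F))"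
	proof (rule ext)
		fix x
		show "back_face p q (simp F) x = simp (insert s (above s F)) x"
		proof (cases "x : standard_simplex q")
			case True
			have "lift F (sh p x) = lift (insert s (above s F)) x"
			proof (rule ext)
				fix v
				show "lift F (sh p x) v = lift (insert s (above s F)) x v"
				proof (cases "v : F & rk v < rk s")
					case True': True
					have "pos rk v F < pos rk s F" by (rule pos_less[OF F(1)]) (use True' in auto)
					also have "pos rk s F = p" unfolding pos_def using c(1) .
					finally show ?thesis using True' by (auto simp: lift_def sh_def)
				next
					case False
					have "pos rk v F = p + pos rk v (insert s (above s F))" if v: "v : F"
					proof -
						have "{u\<in>F. rk u < rk v} = below s F Un {u\<in>insert s (above s F). rk u < rk v}" (is "_ = ?A Un ?B")
							using tri[OF v] tri False v F(2) by auto
						moreover have "?A \<inter> ?B = {}" by auto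
						then have "card (?A Un ?B) = card ?A + card ?B" using fF by (intro card_Un_disjoint) simp_all
						ultimately show ?thesis unfolding pos_def using c(1) by simp
					qed
					then show ?thesis using tri[of v] False F(2) by (auto simp: lift_def sh_def)
				qed
			qed
			then show ?thesis using True cF c1 sh_simplex[OF True, of p] by (simp add: back_face_sh simp_def)
		qed (simp add: back_face_sh simp_def c1)
	qed
qed

section \<open>Cap product with the fundamental flag cycle\<close>

lemma sg_star:
	assumes "finite A" "!!f. f : A ==> insert s f : \<Delta> & s \<notin> f"
	shows "sg (%F. if s : F & F - {s} : A then x (F - {s}) else 0) = (\<Sum>f\<in>A. single (simp (insert s f)) (x f))"
proof -
	have "sg (%F. if s : F & F - {s} : A then x (F - {s}) else 0) =
		 (\<Sum>F\<in>insert s ` A. single (simp F) (if s : F & F - {s} : A then x (F - {s}) else 0))"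
		unfolding sg_def
	proof (rule sum.mono_neutral_right)
		show "finite (\<Delta> - {{}})" "insert s ` A \<subseteq> \<Delta> - {{}}" using finD assms(2) by auto
		show "ALL F:\<Delta> - {{}} - insert s ` A. single (simp F) (if s : F & F - {s} : A then x (F - {s}) else 0) = 0"
		proof
			fix F assume F: "F : \<Delta> - {{}} - insert s ` A"
			have n: "~ (s : F & F - {s} : A)"
			proof
				assume h: "s : F & F - {s} : A"
				then have "F = insert s (F - {s})" by auto
				then show False using F h by blast
			qed
			show "single (simp F) (if s : F & F - {s} : A then x (F - {s}) else 0) = 0" unfolding if_not_P[OF n] by simp
		qed
	qed
	also have "\<dots> = (\<Sum>f\<in>A. single (simp (insert s f)) (x f))"
	proof (subst sum.reindex)
		show "inj_on (insert s) A"
			by (rule inj_onI) (use assms(2) in \<open>metis Diff_insert_absorb\<close>)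
		show "(\<Sum>f\<in>A. ((%F. single (simp F) (if s : F & F - {s} : A then x (F - {s}) else 0)) \<circ> insert s) f) =
			 (\<Sum>f\<in>A. single (simp (insert s f)) (x f))"
			by (rule sum.cong[OF refl]) (use assms(2) in \<open>simp add: Diff_insert_absorb\<close>)
	qed
	finally show ?thesis .
qed

lemma single_sum_right: "single b (\<Sum>f\<in>A. x f) = (\<Sum>f\<in>A. single b (x f :: real))"
	by (rule poly_mapping_eqI) (simp add: lookup_sum lookup_single when_def)

lemma middle_vertex:
	assumes F: "zr F ~= 0" and n: "n <= m"
	shows "EX s. s : F & rk s = n"
proof -
	have FD: "F : \<Delta>" "card F = Suc m" using FnD[OF zr_Fn F] .
	have "rk ` F \<subseteq> {..m}" using rkm subP[OF FD(1)] by auto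
	moreover have "card (rk ` F) = card {..m}" using card_image[OF inj[OF FD(1)]] FD(2) by simp
	ultimately have "rk ` F = {..m}" by (intro card_subset_eq) auto
	then have "n : rk ` F" using n by simp
	then show ?thesis by auto
qed

text \<open>Cellular coordinates of a cochain, its values on the chains \<open>E s\<close>. The
  common index set lets the same coordinates serve as coefficients of the
  \<open>D s\<close>.\<close>

definition hat :: "nat => 'a rcochain => 'v \<Rightarrow>\<^sub>0 real"
	where "hat n \<psi> = (\<Sum>s\<in>ce.cells n P. single s (cochain_eval \<psi> (sg (hm.E s))))"

text \<open>Each maximal flag has exactly one member of rank \<open>n\<close>, and its coefficient in the fundamental
	cycle factors accordingly; this is why capping a cochain with the fundamental cycle yields a
	combination of dual cells.\<close>

lemma cap_fundamental:
	assumes mn: "m = 2 * n"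
	shows "cap n n (sg zr) \<psi> = cd.cc (hat n \<psi>)"
proof -
	let ?z = "%f s g. zr (f Un insert s g)"
	define T where "T = (%(s,f,g). single (simp (insert s g)) (?z f s g * \<psi> (simp (insert s f))))"
	define t where "t F = single (back_face n n (simp F)) (zr F * \<psi> (front_face n (simp F)))" for F
	have LFs: "finite (LF s)" "insert s f : \<Delta> & s \<notin> f" if "f : LF s" for s f
	proof -
		have "LF s \<subseteq> Pow P" using subP by (auto simp: LF_def)
		then show "finite (LF s)" using finP finite_subset by blast
		show "insert s f : \<Delta> & s \<notin> f" using that by (auto simp: LF_def)
	qed
	have finLF: "finite (LF s)" for s using LFs(1)[of _ s] by (cases "LF s = {}") auto
	have "UF s \<subseteq> Pow P" for s using subP by (auto simp: UF_def)
	then have finUF: "finite (UF s)" for s using finP finite_subset by blast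
	have UFs: "insert s f : \<Delta> & s \<notin> f" if "f : UF s" for s f using that by (auto simp: UF_def)
	have sgE: "sg (hm.E s) = (\<Sum>f\<in>LF s. single (simp (insert s f)) (hm.alpha s f))" for s
	proof -
		have "hm.E s = (%F. if s : F & F - {s} : LF s then hm.alpha s (F - {s}) else 0)" by (rule ext) (rule hm.E_def)
		then show ?thesis using sg_star[OF finLF LFs(2), where x = "hm.alpha s"] by simp
	qed
	have sgD: "sg (hm.D s) = (\<Sum>g\<in>UF s. single (simp (insert s g)) (zr (hm.top s) * hm.beta s g))" for s
	proof -
		have "hm.D s = (%F. if s : F & F - {s} : UF s then zr (hm.top s) * hm.beta s (F - {s}) else 0)" by (rule ext) (rule hm.D_def)
		then show ?thesis using sg_star[OF finUF UFs, where x = "%g. zr (hm.top s) * hm.beta s g"] by simp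
	qed
	\<comment> \<open>By \<open>z_product\<close> the coefficients of \<open>E s\<close> and
	  \<open>D s\<close> multiply to that of the fundamental cycle, so this double sum is the part of
	  the cap product coming from flags through \<open>s\<close>.\<close>
	have one: "rscale (cochain_eval \<psi> (sg (hm.E s))) (sg (hm.D s)) = (\<Sum>(f,g)\<in>LF s \<times> UF s. T (s,f,g))" if s: "s : P" for s
	proof -
		have "rscale (cochain_eval \<psi> (sg (hm.E s))) (sg (hm.D s)) = (\<Sum>g\<in>UF s. \<Sum>f\<in>LF s.
				single (simp (insert s g)) (hm.alpha s f * \<psi> (simp (insert s f)) * (zr (hm.top s) * hm.beta s g)))"
			unfolding sgD sgE cochain_eval_sum cochain_eval_single rv.scale_sum_right rscale_single sum_distrib_right single_sum_right ..
		also have "\<dots> = (\<Sum>g\<in>UF s. \<Sum>f\<in>LF s. T (s,f,g))"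
		proof (intro sum.cong refl)
			fix f g assume "g : UF s" "f : LF s"
			then have "?z f s g = zr (hm.top s) * hm.alpha s f * hm.beta s g" by (intro hm.z_product[OF s])
			then show "single (simp (insert s g)) (hm.alpha s f * \<psi> (simp (insert s f)) * (zr (hm.top s) * hm.beta s g)) = T (s,f,g)"
				by (simp add: T_def mult_ac)
		qed
		also have "\<dots> = (\<Sum>f\<in>LF s. \<Sum>g\<in>UF s. T (s,f,g))" by (rule sum.swap)
		also have "\<dots> = (\<Sum>(f,g)\<in>LF s \<times> UF s. T (s,f,g))" by (rule sum.cartesian_product)
		finally show ?thesis .
	qed
	define S where "S = {F\<in>\<Delta>. zr F ~= 0}"
	define R where "R = {(s,f,g). s : P & rk s = n & f : LF s & g : UF s & ?z f s g ~= 0}"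
	have finC: "finite (ce.cells n P)" by (rule ce.finite_cells) simp
	have "cd.cc (hat n \<psi>) = (\<Sum>s\<in>ce.cells n P. rscale (cochain_eval \<psi> (sg (hm.E s))) (sg (hm.D s)))"
		unfolding hat_def cchain_def rextend_sum rextend_single ..
	also have "\<dots> = (\<Sum>s\<in>ce.cells n P. \<Sum>(f,g)\<in>LF s \<times> UF s. T (s,f,g))"
		by (rule sum.cong[OF refl]) (simp add: one ce.cells_def)
	also have "\<dots> = (\<Sum>(s,fg)\<in>(SIGMA s:ce.cells n P. LF s \<times> UF s). case fg of (f,g) => T (s,f,g))"
		by (rule sum.Sigma) (use finC finLF finUF in auto)
	also have "\<dots> = (\<Sum>a\<in>(SIGMA s:ce.cells n P. LF s \<times> UF s). T a)"
		by (rule sum.cong[OF refl]) auto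
	also have "\<dots> = (\<Sum>a\<in>R. T a)"
		by (rule sum.mono_neutral_right) (use finC finLF finUF in \<open>auto simp: R_def ce.cells_def T_def\<close>)
	also have "\<dots> = (\<Sum>F\<in>S. t F)"
	proof (rule sum.reindex_bij_witness[where i = "%F. (SOME s. s : F & rk s = n, below (SOME s. s : F & rk s = n) F, above (SOME s. s : F & rk s = n) F)"
				and j = "%(s,f,g). f Un insert s g"])
		fix a assume "a : R"
		then obtain s f g where a: "a = (s,f,g)" and s: "s : P" "rk s = n" and f: "f : LF s" and g: "g : UF s" and z: "?z f s g ~= 0"
			by (auto simp: R_def)
		let ?F = "f Un insert s g"
		have FD: "?F : \<Delta>" using FnD(1)[OF zr_Fn z] .
		have "(SOME s. s : ?F & rk s = n) = s"
		proof (rule some_equality)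
			show "s : ?F & rk s = n" using s by simp
			fix v assume v: "v : ?F & rk v = n"
			have "v : ?F" "s : ?F" "rk v = rk s" using v s by auto
			then show "v = s" using inj_onD[OF inj[OF FD]] by blast
		qed
		then show "(case case a of (s,f,g) => f Un insert s g of F => (SOME s. s : F & rk s = n, below (SOME s. s : F & rk s = n) F, above (SOME s. s : F & rk s = n) F)) = a"
			using below_LU[OF f g] above_LU[OF f g] by (simp only: a prod.case)
		show "(case a of (s,f,g) => f Un insert s g) : S" unfolding a prod.case S_def mem_Collect_eq using FD z by blast
		have c: "card f = n" "card g = n" using hm.full_card[OF f g z s(1)] s(2) mn by auto
		have sF: "s : ?F" by simp
		have "card (below s ?F) = n" "card (above s ?F) = n" unfolding below_LU[OF f g] above_LU[OF f g] by (rule c)+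
		from front_face_simp[OF FD sF this]
		have "front_face n (simp ?F) = simp (insert s f)" "back_face n n (simp ?F) = simp (insert s g)"
			unfolding below_LU[OF f g] above_LU[OF f g] .
		then show "t (case a of (s,f,g) => f Un insert s g) = T a" unfolding a prod.case t_def T_def by simp
	next
		fix F assume F: "F : S"
		let ?s = "SOME s. s : F & rk s = n"
		have z: "zr F ~= 0" and FD: "F : \<Delta>" using F by (auto simp: S_def)
		have s: "?s : F & rk ?s = n" by (rule someI_ex) (rule middle_vertex[OF z], simp add: mn)
		note sp = split_flag[OF FD conjunct1[OF s]]
		show "(case (?s, below ?s F, above ?s F) of (s,f,g) => f Un insert s g) = F" unfolding prod.case by (rule sp(3))
		have "?s : P" using s subP[OF FD] by blast
		then show "(?s, below ?s F, above ?s F) : R" unfolding R_def mem_Collect_eq prod.case using s sp z by simp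
	qed
	also have "\<dots> = (\<Sum>F\<in>\<Delta> - {{}}. t F)"
	proof (rule sum.mono_neutral_left)
		have "F ~= {}" if "zr F ~= 0" for F using FnD(2)[OF zr_Fn that] by auto
		then show "S \<subseteq> \<Delta> - {{}}" by (auto simp: S_def)
		show "ALL F:\<Delta> - {{}} - S. t F = 0" by (simp add: S_def t_def)
	qed (use finD in simp)
	also have "\<dots> = cap n n (sg zr) \<psi>"
		unfolding sg_def cap_def rextend_sum rextend_single rscale_single t_def ..
	finally show ?thesis ..
qed

section \<open>Poincare duals of cellular cycles and the intersection form\<close>

lemma cells_middle: "m = 2 * n ==> L \<subseteq> P ==> cd.cells n L = ce.cells n L"
	using rkm unfolding cd.cells_def ce.cells_def by force

lemma hat_csub: "hat n \<psi> : csub (ce.cells n P)"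
	unfolding hat_def by (rule rv.subspace_sum[OF subspace_csub]) (auto simp: csub_def)

lemma hat_eval:
	assumes x: "x : csub (ce.cells n P)"
	shows "cochain_eval \<psi> (ce.cc x) = ip x (hat n \<psi>)"
proof -
	have fin: "finite (ce.cells n P)" by (rule ce.finite_cells) simp
	have l: "lookup (hat n \<psi>) s = cochain_eval \<psi> (sg (hm.E s))" if "s : keys x" for s
		using x that fin unfolding hat_def csub_def by (auto simp: lookup_sum lookup_single when_def)
	show ?thesis unfolding cchain_def rextend_def cochain_eval_sum cochain_eval_scale ip_def
		by (rule sum.cong[OF refl]) (simp add: l)
qed

lemma cup_cap: "cochain_eval (cup p q \<phi> \<psi>) c = cochain_eval \<psi> (cap p q c \<phi>)"
	unfolding cap_def rextend_def cochain_eval_sum cochain_eval_scale cochain_eval_single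
	by (simp add: cochain_eval_def cup_def)

lemma cocycle_eval:
	assumes "rcocycle p M \<psi>" "c - c' : rboundaries p M"
	shows "cochain_eval \<psi> c = cochain_eval \<psi> c'"
proof -
	obtain b where "b : rchains (p + 1) M" "c - c' = rboundary (p + 1) b" using assms(2) unfolding rboundaries_def by blast
	then have "cochain_eval \<psi> (c - c') = 0" using assms(1) unfolding rcocycle_def by simp
	then show ?thesis unfolding cochain_eval_diff by simp
qed

lemma ip_zero: "ip 0 y = 0" "ip x 0 = 0" by (simp_all add: ip_def)

lemmas E_M = ce.cycle_rep[OF subset_refl cellular_on_E[OF lower_P] closed_E[OF lower_P], unfolded X_P]
lemmas D_M = cd.cycle_rep[OF subset_refl cellular_on_D[OF upper_P] closed_D[OF upper_P], unfolded X_P]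
lemmas E_M_boundary = ce.boundary_iff[OF subset_refl cellular_on_E[OF lower_P] closed_E[OF lower_P], unfolded X_P]
lemmas D_M_boundary = cd.boundary_iff[OF subset_refl cellular_on_D[OF upper_P] closed_D[OF upper_P], unfolded X_P]
lemmas E_M_cycle = ce.cc_rcycles[OF subset_refl cellular_on_E[OF lower_P] closed_E[OF lower_P], unfolded X_P]

text \<open>The functional \<open>ip x y\<close> on cellular chains kills cellular boundaries,
  because \<open>y\<close> is a cycle and the two boundaries are adjoint. It is extended to all
  singular chains so as to vanish on boundaries, which is the cocycle condition.\<close>

lemma realize:
	assumes y: "y : csub (ce.cells n P)" "cd.dC y = 0"
	obtains \<psi> where "rcocycle (int n) M \<psi>" "hat n \<psi> = y"
proof -
	let ?T = "csub (ce.cells n P)"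
	have "ip x y = 0" if "x : ?T" "ce.cc x = 0" for x using ce.cc_inj0[OF that] by (simp add: ip_zero)
	then obtain h where h: "rfunctional h" "!!x. x : ?T ==> h (ce.cc x) = ip x y"
		using factor_functional[OF ce.rlinear_cc subspace_csub rfunctional_ip_left, of "ce.cells n P" y] by metis
	have z: "h c = 0" if c: "c : ce.cc ` ?T" "c : rboundaries (int n) M" for c
	proof -
		obtain x where x: "x : ?T" "c = ce.cc x" using c(1) by blast
		then obtain w where w: "w : csub (ce.cells (Suc n) P)" "x = ce.dC w" using E_M_boundary[OF x(1)] c(2) by blast
		have "h c = ip (ce.dC w) y" using h(2)[OF x(1)] x(2) w(2) by simp
		also have "\<dots> = 0" unfolding E_D_adjoint[OF w(1)] y(2) by (simp add: ip_zero)
		finally show ?thesis .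
	qed
	obtain f where f: "rfunctional f" "!!x. x : rboundaries (int n) M ==> f x = 0" "!!x. x : ce.cc ` ?T ==> f x = h x"
		by (rule extend_functional[OF subspace_rboundaries subspace_image[OF ce.rlinear_cc subspace_csub] h(1) z]) blast+
	let ?\<psi> = "%s. f (single s 1)"
	have ev: "cochain_eval ?\<psi> c = f c" for c by (rule rfunctional_is_cochain_eval[OF f(1)])
	have coc: "rcocycle (int n) M ?\<psi>"
		unfolding rcocycle_def ev using f(2) unfolding rboundaries_def by blast
	have "hat n ?\<psi> = y"
	proof (rule poly_mapping_eqI)
		fix s
		show "lookup (hat n ?\<psi>) s = lookup y s"
		proof (cases "s : ce.cells n P")
			case True
			then have sT: "single s 1 : ?T" by (simp add: csub_def)
			have "ip (single s 1) (hat n ?\<psi>) = f (ce.cc (single s 1))"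
				using hat_eval[OF sT, of ?\<psi>] ev by simp
			also have "\<dots> = h (ce.cc (single s 1))" by (rule f(3)[OF imageI[OF sT]])
			also have "\<dots> = ip (single s 1) y" by (rule h(2)[OF sT])
			finally show ?thesis by (simp add: ip_def)
		next
			case False
			then have "s \<notin> keys (hat n ?\<psi>)" "s \<notin> keys y" using hat_csub[of n ?\<psi>] y(1) by (auto simp: csub_def)
			then show ?thesis by (simp add: in_keys_iff)
		qed
	qed
	then show thesis by (rule that[OF coc])
qed

text \<open>If the duals are homologous, their coordinates differ by a boundary of the dual complex,
  and by adjointness such a boundary pairs to zero with cellular cycles. This makes the intersection
  number independent of the choice of cocycles.\<close>

lemma dual_injective:
	assumes mn: "m = 2 * n" and \<psi>: "rcocycle (int n) M \<psi>" "rcocycle (int n) M \<psi>'"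
		and b: "cd.cc (hat n \<psi>) - cd.cc (hat n \<psi>') : rboundaries (int n) M" and c: "c : rcycles (int n) M"
	shows "cochain_eval \<psi> c = cochain_eval \<psi>' c"
proof -
	have d: "hat n \<psi> - hat n \<psi>' : csub (cd.cells n P)"
		unfolding cells_middle[OF mn subset_refl] by (rule rv.subspace_diff[OF subspace_csub hat_csub hat_csub])
	obtain w where w: "hat n \<psi> - hat n \<psi>' = cd.dC w"
		using D_M_boundary[OF d] b by (auto simp: rvp.linear_diff[OF cd.rlinear_cc])
	obtain x where x: "x : csub (ce.cells n P)" "ce.dC x = 0" "c - ce.cc x : rboundaries (int n) M" by (rule E_M[OF c])
	have "cochain_eval \<psi> c - cochain_eval \<psi>' c = cochain_eval \<psi> (ce.cc x) - cochain_eval \<psi>' (ce.cc x)"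
		using cocycle_eval[OF \<psi>(1) x(3)] cocycle_eval[OF \<psi>(2) x(3)] by simp
	also have "\<dots> = ip x (cd.dC w)" unfolding hat_eval[OF x(1)] w[symmetric] rvr.linear_diff[OF rfunctional_ip_right] ..
	also have "(-1) ^ n * \<dots> = 0" using E_D_adjoint[OF x(1), of w] x(2) by (simp add: ip_zero)
	finally show ?thesis by simp
qed

text \<open>Capping a cocycle with a boundary gives a boundary, so any fundamental cycle may be
  exchanged for the flag cycle, whose cap product is explicit.\<close>

lemma cap_any_fundamental:
	assumes mn: "m = 2 * n" and z: "fundamental_cycle m M ori z" and \<psi>: "rcocycle (int n) M \<psi>"
	shows "cap n n (ri z) \<psi> - cd.cc (hat n \<psi>) : rboundaries (int n) M"
proof -
	obtain b where b: "singular_chain (Suc m) M b" "z - zc = chain_boundary (Suc m) b" by (rule fundamental_unique[OF z])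
	have bR: "ri b : rchains (int (n + Suc n)) M" unfolding rchains_ri using b(1) mn by (simp add: mult_2)
	have "ri z - sg zr = rboundary (int (n + Suc n)) (ri b)"
		unfolding ri_zc[symmetric] ri_simps(2)[symmetric] b(2) rboundary_ri using mn by (simp add: mult_2)
	then have "cap n n (ri z) \<psi> - cap n n (sg zr) \<psi> = cap n n (rboundary (int (n + Suc n)) (ri b)) \<psi>"
		using rvp.linear_diff[OF rlinear_cap[of n n \<psi>], of "ri z" "sg zr"] by simp
	also have "\<dots> = rscale ((-1) ^ n) (rboundary (int (Suc n)) (cap n (Suc n) (ri b) \<psi>))" by (rule cap_boundary[OF \<psi> bR])
	also have "\<dots> : rboundaries (int n) M"
	proof (rule rv.subspace_scale[OF subspace_rboundaries])
		have "cap n (Suc n) (ri b) \<psi> : rchains (int n + 1) M" using cap_rchains[OF bR] by (simp add: add.commute)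
		then show "rboundary (int (Suc n)) (cap n (Suc n) (ri b) \<psi>) : rboundaries (int n) M"
			unfolding rboundaries_def by (intro image_eqI[of _ _ "cap n (Suc n) (ri b) \<psi>"]) (simp_all add: add.commute)
	qed
	finally show ?thesis unfolding cap_fundamental[OF mn] .
qed

text \<open>The class of \<open>cd.cc y\<close> is dual to a cocycle \<open>\<psi>\<close> with
  coordinates \<open>y\<close>. Evaluating the cup product amounts to evaluating
  \<open>\<psi>\<close> on the class dual to \<open>\<phi>\<close>, that is on
  \<open>ce.cc x\<close>, which gives \<open>ip x y\<close>; \<open>dual_injective\<close> shows
  that other choices give the same value.\<close>

lemma intersection:
	assumes mn: "m = 2 * n" and x: "x : csub (ce.cells n P)" "ce.dC x = 0" and y: "y : csub (ce.cells n P)" "cd.dC y = 0"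
	shows "intersection_number n M ori (rhomology_class (int n) M (ce.cc x)) (rhomology_class (int n) M (cd.cc y)) = ip x y"
	unfolding intersection_number_def
proof (rule the_equality)
	have xc: "ce.cc x : rcycles (int n) M" by (rule E_M_cycle[OF x])
	obtain \<psi> where \<psi>: "rcocycle (int n) M \<psi>" "hat n \<psi> = y" by (rule realize[OF y])
	\<comment> \<open>Dual cocycles are constructed from cycles of dual cells, so the class of
	  \<open>x\<close> is rewritten in that form.\<close>
	obtain x' where x': "x' : csub (cd.cells n P)" "cd.dC x' = 0" "ce.cc x - cd.cc x' : rboundaries (int n) M" by (rule D_M[OF xc])
	have "x' : csub (ce.cells n P)" using x'(1) cells_middle[OF mn subset_refl] by simp
	then obtain \<phi> where \<phi>: "rcocycle (int n) M \<phi>" "hat n \<phi> = x'" by (rule realize[OF _ x'(2)])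
	have fz: "fundamental_cycle (2 * n) M ori zc" using zc_fundamental mn by simp
	have cx: "rhomology_class (int n) M (cap n n (ri zc) \<phi>) = rhomology_class (int n) M (ce.cc x)"
		unfolding ri_zc cap_fundamental[OF mn] \<phi>(2) using x'(3) rclass_eq by metis
	have ev: "cochain_eval (cup n n \<phi> \<psi>) (ri zc) = ip x y"
	proof -
		have "cochain_eval (cup n n \<phi> \<psi>) (ri zc) = cochain_eval \<psi> (cap n n (ri zc) \<phi>)" by (rule cup_cap)
		also have "\<dots> = cochain_eval \<psi> (ce.cc x)" by (rule cocycle_eval[OF \<psi>(1)]) (use cx rclass_eq in metis)
		also have "\<dots> = ip x y" unfolding hat_eval[OF x(1)] \<psi>(2) ..
		finally show ?thesis .
	qed
	have "fundamental_cycle (2 * n) M ori zc & ri zc = Poly_Mapping.map real_of_int zc & rcocycle (int n) M \<phi> & rcocycle (int n) M \<psi> &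
			 rhomology_class (int n) M (cap n n (ri zc) \<phi>) = rhomology_class (int n) M (ce.cc x) &
			 rhomology_class (int n) M (cap n n (ri zc) \<psi>) = rhomology_class (int n) M (cd.cc y) &
			 ip x y = cochain_eval (cup n n \<phi> \<psi>) (ri zc)"
		using fz \<phi>(1) \<psi>(1) cx ev by (simp add: ri_def[symmetric] ri_zc cap_fundamental[OF mn] \<psi>(2))
	then show "\<exists>z \<mu> \<phi> \<psi>. fundamental_cycle (2 * n) M ori z & \<mu> = Poly_Mapping.map real_of_int z &
			 rcocycle (int n) M \<phi> & rcocycle (int n) M \<psi> &
			 rhomology_class (int n) M (cap n n \<mu> \<phi>) = rhomology_class (int n) M (ce.cc x) &
			 rhomology_class (int n) M (cap n n \<mu> \<psi>) = rhomology_class (int n) M (cd.cc y) &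
			 ip x y = cochain_eval (cup n n \<phi> \<psi>) \<mu>" by (intro exI)
	fix r assume "\<exists>z \<mu> \<phi> \<psi>. fundamental_cycle (2 * n) M ori z & \<mu> = Poly_Mapping.map real_of_int z &
			 rcocycle (int n) M \<phi> & rcocycle (int n) M \<psi> &
			 rhomology_class (int n) M (cap n n \<mu> \<phi>) = rhomology_class (int n) M (ce.cc x) &
			 rhomology_class (int n) M (cap n n \<mu> \<psi>) = rhomology_class (int n) M (cd.cc y) &
			 r = cochain_eval (cup n n \<phi> \<psi>) \<mu>"
	then obtain z \<mu> \<phi>' \<psi>' where h: "fundamental_cycle (2 * n) M ori z" "\<mu> = Poly_Mapping.map real_of_int z"
		"rcocycle (int n) M \<phi>'" "rcocycle (int n) M \<psi>'"
		"rhomology_class (int n) M (cap n n \<mu> \<phi>') = rhomology_class (int n) M (ce.cc x)"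
		"rhomology_class (int n) M (cap n n \<mu> \<psi>') = rhomology_class (int n) M (cd.cc y)"
		"r = cochain_eval (cup n n \<phi>' \<psi>') \<mu>" by (elim exE conjE)
	have fz': "fundamental_cycle m M ori z" and \<mu>: "\<mu> = ri z" using h(1,2) mn by (simp_all add: ri_def)
	have 1: "cap n n \<mu> \<psi>' - cd.cc (hat n \<psi>') : rboundaries (int n) M" unfolding \<mu> by (rule cap_any_fundamental[OF mn fz' h(4)])
	have 2: "cap n n \<mu> \<psi>' - cd.cc y : rboundaries (int n) M" using h(6) unfolding rclass_eq .
	have "cd.cc (hat n \<psi>') - cd.cc (hat n \<psi>) = (cap n n \<mu> \<psi>' - cd.cc y) - (cap n n \<mu> \<psi>' - cd.cc (hat n \<psi>'))"
		unfolding \<psi>(2) by simp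
	also have "\<dots> : rboundaries (int n) M" by (rule rv.subspace_diff[OF subspace_rboundaries 2 1])
	finally have "cochain_eval \<psi>' (ce.cc x) = cochain_eval \<psi> (ce.cc x)" by (rule dual_injective[OF mn h(4) \<psi>(1) _ xc])
	moreover have "r = cochain_eval \<psi>' (ce.cc x)"
		unfolding h(7) cup_cap by (rule cocycle_eval[OF h(4)]) (use h(5) rclass_eq in metis)
	ultimately show "r = ip x y" unfolding hat_eval[OF x(1)] \<psi>(2) by simp
qed

section \<open>Orthogonal complements and Betti numbers of complementary subcomplexes\<close>

definition proj :: "'v set => ('v \<Rightarrow>\<^sub>0 real) => ('v \<Rightarrow>\<^sub>0 real)"
	where "proj A x = (\<Sum>t\<in>A. single t (lookup x t))"

lemma lookup_proj: "finite A ==> lookup (proj A x) t = (if t : A then lookup x t else 0)"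
	by (simp add: proj_def lookup_sum lookup_single when_def)

lemma rlinear_proj: "finite A ==> rlinear (proj A)"
	by (rule rlinearI) (auto intro!: poly_mapping_eqI simp: lookup_proj lookup_add)

text \<open>One inclusion holds because the supports are disjoint. For the other, a class orthogonal
  to all dual cycles on \<open>?U\<close> has a cellular representative whose part on
  \<open>?U\<close> is that of a boundary; subtracting this boundary moves the representative into
  \<open>L\<close>.\<close>

lemma V_perp_eq_V_img:
	assumes mn: "m = 2 * n" and L: "lower L" and K: "cells_space M K = X (flags L)" "cells_space M K' = X (flags (P - L))"
	shows "V_perp n M ori K' = V_img n M K"
proof -
	have LP: "L \<subseteq> P" using L by (simp add: lower_def)
	have U: "hm.upper (P - L)" by (rule upper_complement[OF L])
	let ?U = "ce.cells n (P - L)" and ?J = "ce.cells n P"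
	have cU: "cd.cells n (P - L) = ?U" by (rule cells_middle[OF mn]) auto
	have UJ: "?U \<subseteq> ?J" "ce.cells n L \<subseteq> ?J" using LP by (auto simp: ce.cells_def)
	have finU: "finite ?U" by (rule ce.finite_cells) auto
	have VK: "V_img n M K = (%y. rhomology_class (int n) M (ce.cc y)) ` {y\<in>csub (ce.cells n L). ce.dC y = 0}"
		by (rule ce.V_img_cells[OF LP cellular_on_E[OF L] closed_E[OF L] K(1)])
	have VK': "V_img n M K' = (%y. rhomology_class (int n) M (cd.cc y)) ` {y\<in>csub ?U. cd.dC y = 0}"
		using cd.V_img_cells[OF _ cellular_on_D[OF U] closed_D[OF U] K(2), of n] unfolding cU by simp
	show ?thesis
	proof (intro equalityI subsetI)
		fix u assume "u : V_img n M K"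
		then obtain x where x: "x : csub (ce.cells n L)" "ce.dC x = 0" "u = rhomology_class (int n) M (ce.cc x)" unfolding VK by blast
		have xJ: "x : csub ?J" using x(1) UJ by (auto simp: csub_def)
		have "u : carrier (rhomology (int n) M)" unfolding rhomology_carrier x(3) using E_M_cycle[OF xJ x(2)] by blast
		moreover have "intersection_number n M ori u v = 0" if "v : V_img n M K'" for v
		proof -
			obtain y where y: "y : csub ?U" "cd.dC y = 0" "v = rhomology_class (int n) M (cd.cc y)" using \<open>v : V_img n M K'\<close> unfolding VK' by blast
			have yJ: "y : csub ?J" using y(1) UJ by (auto simp: csub_def)
			have "lookup y s = 0" if "s : keys x" for s
			proof -
				have "s \<notin> keys y" using x(1) y(1) that by (auto simp: csub_def ce.cells_def)
				then show ?thesis by (simp add: in_keys_iff)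
			qed
			then have "ip x y = 0" unfolding ip_def by simp
			then show ?thesis unfolding x(3) y(3) intersection[OF mn xJ x(2) yJ y(2)] .
		qed
		ultimately show "u : V_perp n M ori K'" unfolding V_perp_def by blast
	next
		fix u assume "u : V_perp n M ori K'"
		then have uc: "u : carrier (rhomology (int n) M)" and perp: "!!v. v : V_img n M K' ==> intersection_number n M ori u v = 0"
			unfolding V_perp_def by auto
		obtain c where c: "c : rcycles (int n) M" "u = rhomology_class (int n) M c" using uc unfolding rhomology_carrier by blast
		obtain x where x: "x : csub ?J" "ce.dC x = 0" "c - ce.cc x : rboundaries (int n) M" by (rule E_M[OF c(1)])
		have ux: "u = rhomology_class (int n) M (ce.cc x)" unfolding c(2) rclass_eq by (rule x(3))
		have ortho: "ip x y = 0" if y: "y : csub ?U" "cd.dC y = 0" for y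
		proof -
			have yJ: "y : csub ?J" using y(1) UJ by (auto simp: csub_def)
			have "rhomology_class (int n) M (cd.cc y) : V_img n M K'" unfolding VK' using y by blast
			from perp[OF this] show ?thesis unfolding ux intersection[OF mn x(1,2) yJ y(2)] .
		qed
		let ?S = "(%w. proj ?U (ce.dC w)) ` csub (ce.cells (Suc n) P)"
		have lin: "rlinear (%w. proj ?U (ce.dC w))"
			by (rule rlinearI) (simp_all add: rvp.linear_add[OF ce.rlinear_dC] rvp.linear_scale[OF ce.rlinear_dC]
					rvp.linear_add[OF rlinear_proj[OF finU]] rvp.linear_scale[OF rlinear_proj[OF finU]])
		have S: "rv.subspace ?S" by (rule subspace_image[OF lin subspace_csub])
		\<comment> \<open>Otherwise a functional separates \<open>proj ?U x\<close> from the projected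
		  boundaries, and its coordinates form a dual cycle on \<open>?U\<close> that is not orthogonal to
		  \<open>x\<close>.\<close>
		have "proj ?U x : ?S"
		proof (rule ccontr)
			let ?x = "proj ?U x"
			assume nS: "?x \<notin> ?S"
			have T: "rv.subspace (range (%r. rscale r ?x))"
			proof -
				have "range (%r. rscale r ?x) = rv.span {?x}" by (simp add: rv.span_singleton)
				then show ?thesis by simp
			qed
			have zero: "ip w ?x = 0" if "w : range (%r. rscale r ?x)" "w : ?S" for w
			proof -
				obtain r where r: "w = rscale r ?x" using \<open>w : range (%r. rscale r ?x)\<close> by blast
				have "r = 0"
				proof (rule ccontr)
					assume "r ~= 0"
					then have "?x = rscale (1 / r) w" unfolding r by simp
					then show False using nS rv.subspace_scale[OF S \<open>w : ?S\<close>] by metis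
				qed
				then show ?thesis unfolding r by (simp add: ip_zero)
			qed
			obtain f where f: "rfunctional f" "!!w. w : ?S ==> f w = 0" "!!w. w : range (%r. rscale r ?x) ==> f w = ip w ?x"
				by (rule extend_functional[OF S T rfunctional_ip_left zero]) blast+
			define y where "y = (\<Sum>t\<in>?U. single t (f (single t 1)))"
			have ly: "lookup y t = (if t : ?U then f (single t 1) else 0)" for t
				using finU by (simp add: y_def lookup_sum lookup_single when_def)
			have yU: "y : csub ?U" by (auto simp: csub_def in_keys_iff ly split: if_splits)
			have ipy: "ip w y = f (proj ?U w)" for w
			proof -
				have "f (proj ?U w) = (\<Sum>t\<in>?U. f (rscale (lookup w t) (single t 1)))"
					unfolding proj_def rvr.linear_sum[OF f(1)] by (simp add: rscale_single)
				also have "\<dots> = (\<Sum>t\<in>?U. lookup w t * lookup y t)"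
					unfolding rvr.linear_scale[OF f(1)] by (intro sum.cong refl) (simp add: ly)
				also have "\<dots> = ip y w" using ip_alt[OF finU, of y w] yU by (simp add: csub_def mult.commute)
				finally show ?thesis using ip_commute by metis
			qed
			have yJ: "y : csub (cd.cells n P)" using yU UJ cells_middle[OF mn subset_refl] by (auto simp: csub_def)
			\<comment> \<open>Adjointness turns vanishing on the boundaries of \<open>(n + 1)\<close>-cells
			  into the cycle condition; since \<open>y\<close> lives in rank \<open>n\<close>, other ranks do
			  not occur in \<open>cd.dC y\<close>.\<close>
			have "cd.dC y = 0"
			proof (rule poly_mapping_eqI)
				fix t
				show "lookup (cd.dC y) t = lookup 0 t"
				proof (cases "t : ce.cells (Suc n) P")
					case True
					have w: "single t 1 : csub (ce.cells (Suc n) P)" using True by (simp add: csub_def)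
					have "ip (ce.dC (single t 1)) y = 0" unfolding ipy using f(2) w by blast
					then have "ip (single t 1) (cd.dC y) = 0" using E_D_adjoint[OF w, of y] by simp
					then show ?thesis by (simp add: ip_def)
				next
					case False
					have "lookup y s * hm.inc s t = 0" if "s : keys y" for s
					proof -
						have "rk s = n" using yU that by (auto simp: csub_def ce.cells_def)
						then show ?thesis using hm.inc_nonzero[of s t] False by (auto simp: ce.cells_def)
					qed
					then show ?thesis unfolding cd.lookup_dC by simp
				qed
			qed
			then have "ip x y = 0" by (rule ortho[OF yU])
			then have "f ?x = 0" unfolding ipy .
			moreover have "f ?x = ip ?x ?x" by (rule f(3)) (auto intro: range_eqI[of _ _ 1])
			ultimately have "?x = 0" by (simp add: ip_self)
			then show False using nS rv.subspace_0[OF S] by simp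
		qed
		then obtain w where w: "w : csub (ce.cells (Suc n) P)" "proj ?U x = proj ?U (ce.dC w)" by blast
		have dw: "ce.dC w : csub ?J" by (rule ce.dC_keys[OF w(1)])
		have bw: "ce.cc (ce.dC w) : rboundaries (int n) M" using E_M_boundary[OF dw] w(1) by blast
		have d0: "ce.dC (ce.dC w) = 0"
			using ce.boundary_cycle[OF subset_refl cellular_on_E[OF lower_P] closed_E[OF lower_P] dw] w(1) by blast
		define x' where "x' = x - ce.dC w"
		have x'J: "x' : csub ?J" unfolding x'_def by (rule rv.subspace_diff[OF subspace_csub x(1) dw])
		have "lookup x' t = 0" if "t : ?U" for t
			using arg_cong[OF w(2), of "%p. lookup p t"] that finU by (simp add: lookup_proj x'_def lookup_minus)
		then have "keys x' \<inter> ?U = {}" by (auto simp: in_keys_iff)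
		then have x'L: "x' : csub (ce.cells n L)" using x'J by (auto simp: csub_def ce.cells_def)
		have "ce.dC x' = 0" unfolding x'_def rvp.linear_diff[OF ce.rlinear_dC] x(2) d0 by simp
		moreover have "u = rhomology_class (int n) M (ce.cc x')"
			unfolding ux rclass_eq x'_def rvp.linear_diff[OF ce.rlinear_cc] using bw by simp
		ultimately show "u : V_img n M K" unfolding VK using x'L by blast
	qed
qed

text \<open>Both spaces have the same cells below dimension \<open>n\<close>, so the Betti numbers
  differ by the rank of the boundary on all \<open>n\<close>-cells minus its rank on those of
  \<open>L\<close>. By \<open>rank_complement_transpose\<close> this is the dimension of the dual
  boundaries supported off \<open>L\<close>, which \<open>k_inv_cells\<close> identifies with the
  kernel on the dual side.\<close>

lemma betti_k_inv:
	assumes mn: "m = 2 * n" and L: "lower L" "ALL s:P. rk s < n --> s : L" "ALL s:L. rk s <= n"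
		and K': "cells_space M K' = X (flags (P - L))"
	shows "betti (int n - 1) (X (flags L)) = betti (int n - 1) M + k_inv n M K'"
proof -
	have LP: "L \<subseteq> P" using L by (simp add: lower_def)
	have U: "hm.upper (P - L)" by (rule upper_complement[OF L(1)])
	have cU: "cd.cells n (P - L) = ce.cells n (P - L)" by (rule cells_middle[OF mn]) auto
	have "cd.cells (Suc n) (P - L) = {}"
	proof -
		have "rk s < n" if "m - rk s = Suc n" for s using that mn by linarith
		then show ?thesis using L(2) unfolding cd.cells_def by blast
	qed
	from cd.k_inv_cells[OF Diff_subset cellular_on_D[OF U] closed_D[OF U] K' cellular_on_D[OF upper_P] this]
	have k: "k_inv n M K' = rv.dim {w : cd.dC ` csub (cd.cells (Suc n) P). keys w \<subseteq> ce.cells n (P - L)}"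
		unfolding cU .
	show ?thesis
	proof (cases n)
		case 0
		\<comment> \<open>For \<open>n = 0\<close> the dual complex has no cells of positive dimension, so
		  the space of boundaries is zero.\<close>
		have "cd.cells (Suc n) P = {}" unfolding cd.cells_def using mn 0 by auto
		then have c0: "csub (cd.cells (Suc n) P) = {0}" by (auto simp: csub_def keys_eq_empty)
		have i0: "cd.dC ` {0} = {0}" by (simp add: rvp.linear_0[OF cd.rlinear_dC])
		have "{w : cd.dC ` csub (cd.cells (Suc n) P). keys w \<subseteq> ce.cells n (P - L)} = {0}"
			unfolding c0 i0 by auto
		then have "k_inv n M K' = 0" unfolding k by (simp add: dim_zero_space)
		moreover have "int n - 1 = -1" using 0 by simp
		ultimately show ?thesis using betti_negative[of "X (flags L)" M] by simp
	next
		case (Suc q)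
		let ?I = "ce.cells q P" and ?J = "ce.cells n P" and ?L = "ce.cells n L"
		let ?col = "%t. \<Sum>s\<in>?I. single s (hm.inc s t)"
		let ?row = "%s. \<Sum>t\<in>?J. single t (hm.inc s t)"
		have fI: "finite ?I" "finite ?J" by (auto intro: ce.finite_cells)
		have LJ: "?L \<subseteq> ?J" using LP by (auto simp: ce.cells_def)
		\<comment> \<open>The sign \<open>(-1) ^ n\<close> in the boundary does not affect the image of a
		  subspace.\<close>
		have col: "ce.dC ` csub A = rextend ?col ` csub A" if A: "A \<subseteq> ?J" for A
		proof -
			have eq: "ce.dC x = rextend ?col (rscale ((-1) ^ n) x)" if x: "x : csub A" for x
			proof (rule poly_mapping_eqI)
				fix s
				have rk: "rk t = n" if "t : keys x" for t using x that A by (auto simp: csub_def ce.cells_def)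
				have "lookup (ce.dC x) s = (\<Sum>t\<in>keys x. (-1) ^ n * (lookup x t * (if s : ?I then hm.inc s t else 0)))"
				proof (cases "s : P")
					case True
					have "hm.inc s t = (if s : ?I then hm.inc s t else 0)" if "t : keys x" for t
						using hm.inc_nonzero[of s t] rk[OF that] Suc by (auto simp: ce.cells_def)
					then show ?thesis unfolding ce.lookup_dC using True rk by (auto intro!: sum.cong)
				next
					case False
					then have "s \<notin> ?I" by (auto simp: ce.cells_def)
					then show ?thesis unfolding ce.lookup_dC using False by simp
				qed
				also have "\<dots> = lookup (rextend ?col (rscale ((-1) ^ n) x)) s"
					unfolding rextend_scale lookup_rscale lookup_rextend sum_distrib_left
					by (intro sum.cong refl) (simp add: lookup_sum lookup_single when_def fI)
				finally show "lookup (ce.dC x) s = lookup (rextend ?col (rscale ((-1) ^ n) x)) s" .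
			qed
			have sc: "rscale ((-1) ^ n) x : csub A" if "x : csub A" for x by (rule rv.subspace_scale[OF subspace_csub that])
			have eq': "rextend ?col x = ce.dC (rscale ((-1) ^ n) x)" if "x : csub A" for x
				unfolding eq[OF sc[OF that]] by (simp flip: power_mult_distrib)
			show ?thesis
			proof (intro equalityI subsetI)
				fix w assume "w : ce.dC ` csub A"
				then obtain x where x: "w = ce.dC x" "x : csub A" by (rule imageE)
				show "w : rextend ?col ` csub A" unfolding x(1) eq[OF x(2)] by (rule imageI[OF sc[OF x(2)]])
			next
				fix w assume "w : rextend ?col ` csub A"
				then obtain x where x: "w = rextend ?col x" "x : csub A" by (rule imageE)
				show "w : ce.dC ` csub A" unfolding x(1) eq'[OF x(2)] by (rule imageI[OF sc[OF x(2)]])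
			qed
		qed
		\<comment> \<open>Dimension \<open>Suc n\<close> in the dual complex means rank
		  \<open>2 * n - Suc n\<close>, which is \<open>q\<close>.\<close>
		have cellsI: "cd.cells (Suc n) P = ?I"
			unfolding cd.cells_def ce.cells_def using mn Suc rkm by force
		have row: "cd.dC x = rextend ?row x" if x: "x : csub ?I" for x
			unfolding cd.dC_def
		proof (rule rextend_cong)
			fix s assume "s : keys x"
			then have s: "rk s = q" using x by (auto simp: csub_def ce.cells_def)
			show "(\<Sum>t\<in>P. single t (hm.inc s t)) = ?row s"
			proof (rule sum.mono_neutral_right)
				show "ALL t:P - ?J. single t (hm.inc s t) = 0"
				proof
					fix t assume "t : P - ?J"
					then have "t : P" "rk t ~= Suc (rk s)" using s Suc by (auto simp: ce.cells_def)
					then have "hm.inc s t = 0" using hm.inc_nonzero[of s t] by metis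
					then show "single t (hm.inc s t) = 0" by simp
				qed
			qed (auto simp: finP ce.cells_def)
		qed
		have "cd.dC ` csub (cd.cells (Suc n) P) = rextend ?row ` csub ?I" unfolding cellsI using row by (rule image_cong[OF refl])
		moreover have "ce.cells n (P - L) = ?J - ?L" by (auto simp: ce.cells_def)
		ultimately have kk: "k_inv n M K' = rv.dim {w : rextend ?row ` csub ?I. keys w \<subseteq> ?J - ?L}" unfolding k by simp
		have r: "rv.dim (ce.dC ` csub ?J) = rv.dim (ce.dC ` csub ?L) + k_inv n M K'"
			unfolding kk col[OF subset_refl] col[OF LJ] by (rule rank_complement_transpose[OF fI LJ])
		have "betti (int q) (X (flags L)) + rv.dim (ce.dC ` csub ?L) = rv.dim {y\<in>csub (ce.cells q L). ce.dC y = 0}"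
			using ce.betti_cells[OF LP cellular_on_E[OF L(1)] closed_E[OF L(1)], of q] Suc by simp
		moreover have "betti (int q) M + rv.dim (ce.dC ` csub ?J) = rv.dim {y\<in>csub ?I. ce.dC y = 0}"
			using ce.betti_cells[OF subset_refl cellular_on_E[OF lower_P] closed_E[OF lower_P], of q] Suc unfolding X_P by simp
		moreover have "ce.cells q L = ?I" using L(2) LP Suc by (auto simp: ce.cells_def)
		ultimately have "betti (int q) (X (flags L)) = betti (int q) M + k_inv n M K'" using r by simp
		then show ?thesis using Suc by simp
	qed
qed

lemma oriented_complex_rev: "oriented_complex P \<Delta> (%v. m - rk v) m M \<Phi> ori"
	by (intro oriented_complex.intro realized_complex.intro flag_complex_rev realized_complex_axioms.intro
			oriented_complex_axioms.intro homeo manifold orient)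

text \<open>Two of the identities are the other two for the reversed order, in which
  \<open>P - L\<close> is the lower set; the spaces, their homology and the pairing do not refer to
  the ranks.\<close>

theorem duality:
	assumes mn: "m = 2 * n" and L: "lower L" "ALL s:P. rk s < n --> s : L" "ALL s:L. rk s <= n"
		and K: "cells_space M K = X (flags L)" "cells_space M K' = X (flags (P - L))"
	shows "V_perp n M ori K' = V_img n M K" "V_perp n M ori K = V_img n M K'"
		"betti (int n - 1) (cells_space M K) = betti (int n - 1) M + k_inv n M K'"
		"betti (int n - 1) (cells_space M K') = betti (int n - 1) M + k_inv n M K"
proof -
	show "V_perp n M ori K' = V_img n M K" by (rule V_perp_eq_V_img[OF mn L(1) K])
	show "betti (int n - 1) (cells_space M K) = betti (int n - 1) M + k_inv n M K'"
		unfolding K(1) by (rule betti_k_inv[OF mn L K(2)])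
	interpret r: oriented_complex P \<Delta> "%v. m - rk v" m M \<Phi> ori by (rule oriented_complex_rev)
	have LP: "L \<subseteq> P" using L by (simp add: lower_def)
	have dd: "P - (P - L) = L" using LP by auto
	have K2: "cells_space M K = X (flags (P - (P - L)))" unfolding dd by (rule K(1))
	have low: "r.lower (P - L)"
		unfolding r.lower_def
	proof (intro conjI ballI allI impI)
		fix s v assume s: "s : P - L" and v: "m - rk v < m - rk s & {v, s} : \<Delta>"
		then have "rk s < rk v" by linarith
		then show "v : P - L" using upper_complement[OF L(1)] s v unfolding hm.upper_def by blast
	qed auto
	have sp: "ALL s:P. m - rk s < n --> s : P - L" "ALL s:P - L. m - rk s <= n"
		using L(2,3) mn by force+
	show "V_perp n M ori K = V_img n M K'" by (rule r.V_perp_eq_V_img[OF mn low K(2) K2])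
	show "betti (int n - 1) (cells_space M K') = betti (int n - 1) M + k_inv n M K"
		unfolding K(2) by (rule r.betti_k_inv[OF mn low sp K2])
qed

end

section \<open>The barycentric subdivision of a simplicial complex\<close>

locale simplicial =
	fixes K :: "'e::euclidean_space set set"
	assumes K: "simplicial_complex K"
begin

definition vt :: "'e set => 'e set" where "vt \<sigma> = {v. v extreme_point_of \<sigma>}"

definition P :: "'e set set" where "P = K - {{}}"

definition \<Delta> :: "'e set set set" where "\<Delta> = {F. F \<subseteq> P & (\<forall>\<sigma>\<in>F. \<forall>\<tau>\<in>F. \<sigma> \<subseteq> \<tau> \<or> \<tau> \<subseteq> \<sigma>)}"

definition rk :: "'e set => nat" where "rk \<sigma> = card (vt \<sigma>) - 1"

text \<open>The coordinate at the vertex \<open>v\<close> of the point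
  \<open>\<Phi>\<^sub>0 t\<close> in the original simplex: the weight of each
  \<open>\<sigma>\<close> is shared equally among its vertices.\<close>

definition u :: "('e set => real) => 'e => real"
	where "u t v = (\<Sum>\<sigma>\<in>P. if v : vt \<sigma> then t \<sigma> / real (card (vt \<sigma>)) else 0)"

definition \<Phi>\<^sub>0 :: "('e set => real) => 'e" where "\<Phi>\<^sub>0 t = (\<Sum>\<sigma>\<in>P. t \<sigma> *\<^sub>R barycenter \<sigma>)"

lemma finP: "finite P" using K by (auto simp: simplicial_complex_def P_def)

lemma vt_hull: "~ affine_dependent C ==> vt (convex hull C) = C"
	unfolding vt_def by (auto simp: extreme_point_of_convex_hull_affine_independent)

lemma simplex_vt:
	assumes "\<sigma> : K"
	shows "~ affine_dependent (vt \<sigma>)" "finite (vt \<sigma>)" "\<sigma> = convex hull vt \<sigma>"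
proof -
	obtain n where "n simplex \<sigma>" using K assms unfolding simplicial_complex_def by blast
	then obtain C where C: "~ affine_dependent C" "\<sigma> = convex hull C" unfolding simplex_def by blast
	have "vt \<sigma> = C" unfolding C(2) by (rule vt_hull[OF C(1)])
	then show "~ affine_dependent (vt \<sigma>)" "finite (vt \<sigma>)" "\<sigma> = convex hull vt \<sigma>" using C aff_independent_finite by auto
qed

lemma face_in: assumes "\<sigma> : K" "C \<subseteq> vt \<sigma>" shows "convex hull C : K" "vt (convex hull C) = C"
proof -
	have "convex hull C face_of convex hull (vt \<sigma>)"
		using face_of_convex_hull_affine_independent[OF simplex_vt(1)[OF assms(1)]] assms(2) by blast
	then have "convex hull C face_of \<sigma>" using simplex_vt(3)[OF assms(1)] by simp
	then show "convex hull C : K" using K assms(1) unfolding simplicial_complex_def by blast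
	show "vt (convex hull C) = C" by (rule vt_hull) (use affine_independent_subset[OF simplex_vt(1)[OF assms(1)] assms(2)] in auto)
qed

lemma vt_nonempty: "\<sigma> : P ==> vt \<sigma> ~= {} & 0 < card (vt \<sigma>)"
	using simplex_vt[of \<sigma>] unfolding P_def by (metis DiffD1 DiffD2 card_gt_0_iff convex_hull_empty singletonI)

lemma vt_mono:
	assumes "\<tau> : K" "\<sigma> : K"
	shows "\<tau> \<subseteq> \<sigma> \<longleftrightarrow> vt \<tau> \<subseteq> vt \<sigma>"
proof
	assume "\<tau> \<subseteq> \<sigma>"
	then have "\<sigma> \<inter> \<tau> = \<tau>" by auto
	moreover have "(\<sigma> \<inter> \<tau>) face_of \<sigma>" using K assms unfolding simplicial_complex_def by blast
	ultimately have "\<tau> face_of convex hull (vt \<sigma>)" using simplex_vt(3)[OF assms(2)] by simp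
	then obtain c where c: "c \<subseteq> vt \<sigma>" "\<tau> = convex hull c"
		using face_of_convex_hull_affine_independent[OF simplex_vt(1)[OF assms(2)]] by blast
	then show "vt \<tau> \<subseteq> vt \<sigma>" using face_in(2)[OF assms(2) c(1)] by simp
next
	assume "vt \<tau> \<subseteq> vt \<sigma>"
	then show "\<tau> \<subseteq> \<sigma>" using hull_mono[of "vt \<tau>" "vt \<sigma>" convex] simplex_vt(3)[OF assms(1)] simplex_vt(3)[OF assms(2)] by simp
qed

lemma vt_inj: "\<tau> : K ==> \<sigma> : K ==> vt \<tau> = vt \<sigma> ==> \<tau> = \<sigma>"
	using vt_mono by blast

lemma PK: "\<sigma> : P ==> \<sigma> : K" by (simp add: P_def)

lemma subset_rk: assumes "\<tau> : P" "\<sigma> : P" "\<tau> \<subseteq> \<sigma>" shows "rk \<tau> < rk \<sigma> \<or> \<tau> = \<sigma>"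
proof (cases "vt \<tau> = vt \<sigma>")
	case False
	then have "vt \<tau> \<subset> vt \<sigma>" using vt_mono[OF PK PK] assms by blast
	then have "card (vt \<tau>) < card (vt \<sigma>)" by (rule psubset_card_mono[OF simplex_vt(2)[OF PK[OF assms(2)]]])
	then show ?thesis using vt_nonempty[OF assms(1)] unfolding rk_def by linarith
qed (use vt_inj assms PK in blast)

lemma simplex_rk: assumes "\<sigma> : P" shows "int k simplex \<sigma> \<longleftrightarrow> rk \<sigma> = k"
proof
	assume "int k simplex \<sigma>"
	then obtain C where C: "~ affine_dependent C" "int (card C) = int k + 1" "\<sigma> = convex hull C" unfolding simplex_def by blast
	then have "vt \<sigma> = C" using vt_hull by blast
	then show "rk \<sigma> = k" using C(2) by (simp add: rk_def)
next
	assume "rk \<sigma> = k"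
	then have "card (vt \<sigma>) = Suc k" using conjunct2[OF vt_nonempty[OF assms]] unfolding rk_def by arith
	then have "int (card (vt \<sigma>)) = int k + 1" by simp
	then show "int k simplex \<sigma>" unfolding simplex_def using simplex_vt[OF PK[OF assms]] by blast
qed

lemma barycenter_vt: "barycenter \<sigma> = (\<Sum>v\<in>vt \<sigma>. v) /\<^sub>R real (card (vt \<sigma>))"
	by (simp add: barycenter_def vt_def)

lemma barycenter_in: assumes "\<sigma> : P" shows "barycenter \<sigma> : \<sigma>"
proof -
	have "(\<Sum>v\<in>vt \<sigma>. inverse (real (card (vt \<sigma>))) *\<^sub>R v) : convex hull (vt \<sigma>)"
		by (rule convex_sum) (use simplex_vt(2)[OF PK[OF assms]] vt_nonempty[OF assms] in \<open>auto simp: hull_inc\<close>)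
	then show ?thesis using simplex_vt(3)[OF PK[OF assms]] by (simp add: barycenter_vt scaleR_sum_right)
qed

lemma coord_unique_simplex:
	assumes C: "~ affine_dependent C" "finite C" and a: "!!v. a v ~= 0 ==> v : C" and b: "!!v. b v ~= 0 ==> v : C"
		and s: "sum a C = (1::real)" "sum b C = 1" "(\<Sum>v\<in>C. a v *\<^sub>R v) = (\<Sum>v\<in>C. b v *\<^sub>R v)"
	shows "a = b"
proof (rule ext)
	fix v
	have "sum (%v. a v - b v) C = 0" using s by (simp add: sum_subtractf)
	moreover have "(\<Sum>v\<in>C. (a v - b v) *\<^sub>R v) = 0" using s(3) by (simp add: scaleR_diff_left sum_subtractf)
	ultimately have "ALL v:C. a v - b v = 0" using C(1) unfolding affine_dependent_explicit_finite[OF C(2)] by blast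
	moreover have "a v = 0" "b v = 0" if "v \<notin> C" using a[of v] b[of v] that by blast+
	ultimately show "a v = b v" by (cases "v : C") simp_all
qed

text \<open>The point lies in both simplices, hence in their common face. Its coordinates in that
  face are also coordinates in either simplex, where they are unique.\<close>

lemma coord_unique:
	assumes \<sigma>: "\<sigma> : K" "\<sigma>' : K" and a: "!!v. a v ~= 0 ==> v : vt \<sigma>" "!!v. 0 <= a v" "sum a (vt \<sigma>) = (1::real)"
		and b: "!!v. b v ~= 0 ==> v : vt \<sigma>'" "!!v. 0 <= b v" "sum b (vt \<sigma>') = 1"
		and eq: "(\<Sum>v\<in>vt \<sigma>. a v *\<^sub>R v) = (\<Sum>v\<in>vt \<sigma>'. b v *\<^sub>R v)"
	shows "a = b"
proof -
	let ?x = "\<Sum>v\<in>vt \<sigma>. a v *\<^sub>R v"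
	have "?x : convex hull (vt \<sigma>)"
		by (rule convex_sum[OF simplex_vt(2)[OF \<sigma>(1)] convex_convex_hull a(3) a(2)]) (rule hull_inc)
	then have x1: "?x : \<sigma>" unfolding simplex_vt(3)[OF \<sigma>(1), symmetric] .
	have "?x : convex hull (vt \<sigma>')" unfolding eq
		by (rule convex_sum[OF simplex_vt(2)[OF \<sigma>(2)] convex_convex_hull b(3) b(2)]) (rule hull_inc)
	then have x2: "?x : \<sigma>'" unfolding simplex_vt(3)[OF \<sigma>(2), symmetric] .
	have "(\<sigma> \<inter> \<sigma>') face_of \<sigma>" using K \<sigma> unfolding simplicial_complex_def by blast
	then have \<rho>: "\<sigma> \<inter> \<sigma>' : K" using K \<sigma> unfolding simplicial_complex_def by blast
	let ?C = "vt (\<sigma> \<inter> \<sigma>')"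
	have C: "?C \<subseteq> vt \<sigma>" "?C \<subseteq> vt \<sigma>'" using vt_mono[OF \<rho>] \<sigma> by auto
	have "?x : convex hull ?C" using x1 x2 simplex_vt(3)[OF \<rho>] by auto
	then obtain w where w: "ALL v:?C. 0 <= w v" "sum w ?C = 1" "(\<Sum>v\<in>?C. w v *\<^sub>R v) = ?x"
		unfolding convex_hull_finite[OF simplex_vt(2)[OF \<rho>]] by blast
	define w' where "w' v = (if v : ?C then w v else 0)" for v
	have ws: "sum w' A = 1" "(\<Sum>v\<in>A. w' v *\<^sub>R v) = ?x" if "?C \<subseteq> A" "finite A" for A
	proof -
		have "sum w' A = sum w' ?C" "(\<Sum>v\<in>A. w' v *\<^sub>R v) = (\<Sum>v\<in>?C. w' v *\<^sub>R v)"
			by (rule sum.mono_neutral_right; use that in \<open>auto simp: w'_def\<close>)+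
		then show "sum w' A = 1" "(\<Sum>v\<in>A. w' v *\<^sub>R v) = ?x" using w by (simp_all add: w'_def)
	qed
	have sw: "v : ?C" if "w' v ~= 0" for v using that by (metis w'_def)
	have "a = w'"
	proof (rule coord_unique_simplex[OF simplex_vt(1,2)[OF \<sigma>(1)]])
		show "v : vt \<sigma>" if "a v ~= 0" for v by (rule a(1)[OF that])
		show "v : vt \<sigma>" if "w' v ~= 0" for v using sw[OF that] C(1) by blast
		show "sum a (vt \<sigma>) = 1" by (rule a(3))
		show "sum w' (vt \<sigma>) = 1" by (rule ws(1)[OF C(1) simplex_vt(2)[OF \<sigma>(1)]])
		show "?x = (\<Sum>v\<in>vt \<sigma>. w' v *\<^sub>R v)" by (rule ws(2)[OF C(1) simplex_vt(2)[OF \<sigma>(1)], symmetric])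
	qed
	moreover have "b = w'"
	proof (rule coord_unique_simplex[OF simplex_vt(1,2)[OF \<sigma>(2)]])
		show "v : vt \<sigma>'" if "b v ~= 0" for v by (rule b(1)[OF that])
		show "v : vt \<sigma>'" if "w' v ~= 0" for v using sw[OF that] C(2) by blast
		show "sum b (vt \<sigma>') = 1" by (rule b(3))
		show "sum w' (vt \<sigma>') = 1" by (rule ws(1)[OF C(2) simplex_vt(2)[OF \<sigma>(2)]])
		show "(\<Sum>v\<in>vt \<sigma>'. b v *\<^sub>R v) = (\<Sum>v\<in>vt \<sigma>'. w' v *\<^sub>R v)"
			unfolding ws(2)[OF C(2) simplex_vt(2)[OF \<sigma>(2)]] by (rule eq[symmetric])
	qed
	ultimately show ?thesis by simp
qed

lemma Delta_P: "F : \<Delta> ==> F \<subseteq> P" by (simp add: \<Delta>_def)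

lemma finF: "F : \<Delta> ==> finite F" using Delta_P finP finite_subset by blast

lemma chain_max:
	assumes F: "F \<subseteq> P" "F ~= {}" "\<forall>\<sigma>\<in>F. \<forall>\<tau>\<in>F. \<sigma> \<subseteq> \<tau> \<or> \<tau> \<subseteq> \<sigma>"
	obtains \<mu> where "\<mu> : F" "!!\<tau>. \<tau> : F ==> \<tau> \<subseteq> \<mu>"
proof -
	have fF: "finite F" using F(1) finP finite_subset by blast
	have "Max (rk ` F) : rk ` F" using fF F(2) by simp
	then obtain \<mu> where \<mu>: "Max (rk ` F) = rk \<mu>" "\<mu> : F" by (rule imageE)
	have "\<tau> \<subseteq> \<mu>" if "\<tau> : F" for \<tau>
	proof -
		have "rk \<tau> <= rk \<mu>" unfolding \<mu>(1)[symmetric] using fF that by simp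
		then show ?thesis using subset_rk[of \<mu> \<tau>] F(1,3) that \<mu>(2) by fastforce
	qed
	then show thesis by (rule that[OF \<mu>(2)])
qed

lemma chain_min:
	assumes F: "F \<subseteq> P" "F ~= {}" "\<forall>\<sigma>\<in>F. \<forall>\<tau>\<in>F. \<sigma> \<subseteq> \<tau> \<or> \<tau> \<subseteq> \<sigma>"
	obtains \<mu> where "\<mu> : F" "!!\<tau>. \<tau> : F ==> \<mu> \<subseteq> \<tau>"
proof -
	have fF: "finite F" using F(1) finP finite_subset by blast
	have "Min (rk ` F) : rk ` F" using fF F(2) by simp
	then obtain \<mu> where \<mu>: "Min (rk ` F) = rk \<mu>" "\<mu> : F" by (rule imageE)
	have "\<mu> \<subseteq> \<tau>" if "\<tau> : F" for \<tau>
	proof -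
		have "rk \<mu> <= rk \<tau>" unfolding \<mu>(1)[symmetric] using fF that by simp
		then show ?thesis using subset_rk[of \<tau> \<mu>] F(1,3) that \<mu>(2) by fastforce
	qed
	then show thesis by (rule that[OF \<mu>(2)])
qed

section \<open>The subdivision map as a homeomorphism\<close>

lemma geo_facts:
	assumes t: "t : geo P \<Delta>"
	shows "{\<sigma>. t \<sigma> ~= 0} \<subseteq> P" "{\<sigma>. t \<sigma> ~= 0} ~= {}" "\<forall>\<sigma>\<in>{\<sigma>. t \<sigma> ~= 0}. \<forall>\<tau>\<in>{\<sigma>. t \<sigma> ~= 0}. \<sigma> \<subseteq> \<tau> \<or> \<tau> \<subseteq> \<sigma>"
		"0 <= t \<sigma>" "sum t P = 1"
proof -
	show "{\<sigma>. t \<sigma> ~= 0} \<subseteq> P" "\<forall>\<sigma>\<in>{\<sigma>. t \<sigma> ~= 0}. \<forall>\<tau>\<in>{\<sigma>. t \<sigma> ~= 0}. \<sigma> \<subseteq> \<tau> \<or> \<tau> \<subseteq> \<sigma>" "0 <= t \<sigma>" "sum t P = 1"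
		using t unfolding geo_def \<Delta>_def by auto
	show "{\<sigma>. t \<sigma> ~= 0} ~= {}"
	proof
		assume "{\<sigma>. t \<sigma> ~= 0} = {}"
		then have "sum t P = 0" by simp
		then show False using t by (simp add: geo_def)
	qed
qed

lemma u_sum: assumes "finite S" "!!\<sigma>. \<sigma> : P ==> t \<sigma> ~= 0 ==> vt \<sigma> \<subseteq> S"
	shows "sum (u t) S = sum t P" "(\<Sum>v\<in>S. u t v *\<^sub>R v) = \<Phi>\<^sub>0 t"
proof -
	have one: "(\<Sum>v\<in>S. if v : vt \<sigma> then t \<sigma> / real (card (vt \<sigma>)) else 0) = t \<sigma>" 
		"(\<Sum>v\<in>S. (if v : vt \<sigma> then t \<sigma> / real (card (vt \<sigma>)) else 0) *\<^sub>R v) = t \<sigma> *\<^sub>R barycenter \<sigma>" if \<sigma>: "\<sigma> : P" for \<sigma>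
	proof -
		have "(\<Sum>v\<in>S. if v : vt \<sigma> then t \<sigma> / real (card (vt \<sigma>)) else 0) = t \<sigma> &
			(\<Sum>v\<in>S. (if v : vt \<sigma> then t \<sigma> / real (card (vt \<sigma>)) else 0) *\<^sub>R v) = t \<sigma> *\<^sub>R barycenter \<sigma>"
		proof (cases "t \<sigma> = 0")
			case True
			then show ?thesis by (simp add: if_distrib[of "%x. x *\<^sub>R _"] cong: if_cong)
		next
			case False
			have sub: "vt \<sigma> \<subseteq> S" by (rule assms(2)[OF \<sigma> False])
			have "(\<Sum>v\<in>S. if v : vt \<sigma> then t \<sigma> / real (card (vt \<sigma>)) else 0) = (\<Sum>v\<in>vt \<sigma>. t \<sigma> / real (card (vt \<sigma>)))"
				by (rule sum.mono_neutral_cong_right) (use sub assms(1) in auto)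
			moreover have "\<dots> = t \<sigma>" using vt_nonempty[OF \<sigma>] by simp
			moreover have "(\<Sum>v\<in>S. (if v : vt \<sigma> then t \<sigma> / real (card (vt \<sigma>)) else 0) *\<^sub>R v) = (\<Sum>v\<in>vt \<sigma>. (t \<sigma> / real (card (vt \<sigma>))) *\<^sub>R v)"
				by (rule sum.mono_neutral_cong_right) (use sub assms(1) in auto)
			moreover have "\<dots> = t \<sigma> *\<^sub>R barycenter \<sigma>"
				unfolding barycenter_vt by (simp add: scaleR_sum_right[symmetric] divide_inverse)
			ultimately show ?thesis by simp
		qed
		then show "(\<Sum>v\<in>S. if v : vt \<sigma> then t \<sigma> / real (card (vt \<sigma>)) else 0) = t \<sigma>" 
			"(\<Sum>v\<in>S. (if v : vt \<sigma> then t \<sigma> / real (card (vt \<sigma>)) else 0) *\<^sub>R v) = t \<sigma> *\<^sub>R barycenter \<sigma>" by auto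
	qed
	have "sum (u t) S = (\<Sum>\<sigma>\<in>P. \<Sum>v\<in>S. if v : vt \<sigma> then t \<sigma> / real (card (vt \<sigma>)) else 0)"
		unfolding u_def by (rule sum.swap)
	also have "\<dots> = sum t P" by (rule sum.cong[OF refl]) (rule one(1))
	finally show "sum (u t) S = sum t P" .
	have "(\<Sum>v\<in>S. u t v *\<^sub>R v) = (\<Sum>v\<in>S. \<Sum>\<sigma>\<in>P. (if v : vt \<sigma> then t \<sigma> / real (card (vt \<sigma>)) else 0) *\<^sub>R v)"
		unfolding u_def scaleR_sum_left ..
	also have "\<dots> = (\<Sum>\<sigma>\<in>P. \<Sum>v\<in>S. (if v : vt \<sigma> then t \<sigma> / real (card (vt \<sigma>)) else 0) *\<^sub>R v)" by (rule sum.swap)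
	also have "\<dots> = \<Phi>\<^sub>0 t" unfolding \<Phi>\<^sub>0_def by (rule sum.cong[OF refl]) (rule one(2))
	finally show "(\<Sum>v\<in>S. u t v *\<^sub>R v) = \<Phi>\<^sub>0 t" .
qed

lemma u_nonneg: "(!!\<sigma>. 0 <= t \<sigma>) ==> 0 <= u t v" unfolding u_def by (rule sum_nonneg) simp

lemma u_supp: assumes "u t v ~= 0" obtains \<sigma> where "\<sigma> : P" "t \<sigma> ~= 0" "v : vt \<sigma>"
proof -
	obtain \<sigma> where "\<sigma> : P" "(if v : vt \<sigma> then t \<sigma> / real (card (vt \<sigma>)) else 0) ~= 0"
		using assms unfolding u_def by (rule sum.not_neutral_contains_not_neutral)
	then show thesis using that by (auto split: if_splits)
qed

text \<open>The point determines the coordinates \<open>u t\<close>. If \<open>t\<close> and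
  \<open>t'\<close> differ, take a simplex of largest dimension where they do: one of its vertices
  lies in no other simplex of at most that size in the support of the function with the smaller
  value there, and the vertex coordinates differ at it.\<close>

lemma Phi0_inj:
	assumes t: "t : geo P \<Delta>" and t': "t' : geo P \<Delta>" and eq: "\<Phi>\<^sub>0 t = \<Phi>\<^sub>0 t'"
	shows "t = t'"
proof -
	note g = geo_facts[OF t] and g' = geo_facts[OF t']
	have prep: "\<exists>\<mu>\<in>K. (ALL v. u s v ~= 0 --> v : vt \<mu>) & sum (u s) (vt \<mu>) = 1 & (\<Sum>v\<in>vt \<mu>. u s v *\<^sub>R v) = \<Phi>\<^sub>0 s" if s: "s : geo P \<Delta>" for s
	proof -
		note gs = geo_facts[OF s]
		obtain \<mu> where \<mu>: "\<mu> : {\<sigma>. s \<sigma> ~= 0}" "!!\<tau>. \<tau> : {\<sigma>. s \<sigma> ~= 0} ==> \<tau> \<subseteq> \<mu>" by (rule chain_max[OF gs(1-3)]) blast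
		have \<mu>K: "\<mu> : K" using \<mu>(1) gs(1) PK by blast
		have sub: "vt \<sigma> \<subseteq> vt \<mu>" if "\<sigma> : P" "s \<sigma> ~= 0" for \<sigma> using vt_mono[OF PK[OF that(1)] \<mu>K] \<mu>(2) that(2) by blast
		have "v : vt \<mu>" if "u s v ~= 0" for v by (rule u_supp[OF that]) (use sub in blast)
		then show ?thesis using u_sum[where t = s, OF simplex_vt(2)[OF \<mu>K] sub] gs(5) \<mu>K by (intro bexI[of _ \<mu>] conjI allI impI) simp_all
	qed
	have uu: "u t = u t'"
	proof -
		obtain \<mu> where \<mu>: "\<mu> : K" "ALL v. u t v ~= 0 --> v : vt \<mu>" "sum (u t) (vt \<mu>) = 1" "(\<Sum>v\<in>vt \<mu>. u t v *\<^sub>R v) = \<Phi>\<^sub>0 t" using prep[OF t] by blast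
		obtain \<mu>' where \<mu>': "\<mu>' : K" "ALL v. u t' v ~= 0 --> v : vt \<mu>'" "sum (u t') (vt \<mu>') = 1" "(\<Sum>v\<in>vt \<mu>'. u t' v *\<^sub>R v) = \<Phi>\<^sub>0 t'" using prep[OF t'] by blast
		show ?thesis
			by (rule coord_unique[OF \<mu>(1) \<mu>'(1)]) (use \<mu> \<mu>' eq u_nonneg[OF g(4)] u_nonneg[OF g'(4)] in simp_all)
	qed
	have main: False if s: "s : geo P \<Delta>" "s' : geo P \<Delta>" "u s = u s'" and \<sigma>: "\<sigma> : P" "s' \<sigma> < s \<sigma>"
		and mx: "!!\<rho>. \<rho> : P ==> card (vt \<sigma>) < card (vt \<rho>) ==> s \<rho> = s' \<rho>" for s s' \<sigma>
	proof -
		note gs = geo_facts[OF s(1)] and gs' = geo_facts[OF s(2)]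
		let ?R = "{\<rho>. s' \<rho> ~= 0 & card (vt \<rho>) <= card (vt \<sigma>) & \<rho> ~= \<sigma>}"
		\<comment> \<open>The members of \<open>?R\<close> are nested. The largest of them has at most as
		  many vertices as \<open>\<sigma>\<close> and is different from it, so it omits a vertex of
		  \<open>\<sigma>\<close>, and with it all the others do.\<close>
		have "EX w:vt \<sigma>. \<forall>\<rho>\<in>?R. w \<notin> vt \<rho>"
		proof (cases "?R = {}")
			case True
			then show ?thesis using vt_nonempty[OF \<sigma>(1)] by blast
		next
			case False
			have RP: "?R \<subseteq> P" using gs'(1) by blast
			have RC: "\<forall>\<sigma>\<in>?R. \<forall>\<tau>\<in>?R. \<sigma> \<subseteq> \<tau> \<or> \<tau> \<subseteq> \<sigma>" using gs'(3) by blast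
			obtain \<mu> where \<mu>: "\<mu> : ?R" "!!\<tau>. \<tau> : ?R ==> \<tau> \<subseteq> \<mu>" by (rule chain_max[OF RP False RC]) blast
			have \<mu>K: "\<mu> : K" using \<mu>(1) gs'(1) PK by blast
			have "~ vt \<sigma> \<subseteq> vt \<mu>"
			proof
				assume h: "vt \<sigma> \<subseteq> vt \<mu>"
				have "vt \<sigma> = vt \<mu>" by (rule card_seteq[OF simplex_vt(2)[OF \<mu>K] h]) (use \<mu>(1) in blast)
				then show False using vt_inj[OF PK[OF \<sigma>(1)] \<mu>K] \<mu>(1) by blast
			qed
			then obtain w where w: "w : vt \<sigma>" "w \<notin> vt \<mu>" by blast
			have "w \<notin> vt \<rho>" if "\<rho> : ?R" for \<rho>
			proof -
				have "\<rho> : K" using that gs'(1) PK by blast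
				then show ?thesis using vt_mono[OF _ \<mu>K] \<mu>(2)[OF that] w(2) by blast
			qed
			then show ?thesis using w(1) by blast
		qed
		then obtain w where w: "w : vt \<sigma>" "\<forall>\<rho>\<in>?R. w \<notin> vt \<rho>" by blast
		have cpos: "0 < real (card (vt \<sigma>))" using vt_nonempty[OF \<sigma>(1)] by simp
		have le: "(if w : vt \<rho> then s' \<rho> / real (card (vt \<rho>)) else 0) <= (if w : vt \<rho> then s \<rho> / real (card (vt \<rho>)) else 0)" if \<rho>: "\<rho> : P" for \<rho>
		proof (cases "\<rho> = \<sigma>")
			case True
			then show ?thesis using \<sigma>(2) by (simp add: divide_right_mono)
		next
			case False
			show ?thesis
			proof (cases "card (vt \<rho>) <= card (vt \<sigma>)")
				case True
				then have "s' \<rho> = 0 \<or> w \<notin> vt \<rho>" using w(2) False by blast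
				then show ?thesis using gs(4)[of \<rho>] by auto
			next
				case F: False
				then show ?thesis using mx[OF \<rho>] by simp
			qed
		qed
		have "u s' w < u s w"
			unfolding u_def
		proof (rule sum_strict_mono_ex1[OF finP])
			show "\<forall>\<rho>\<in>P. (if w : vt \<rho> then s' \<rho> / real (card (vt \<rho>)) else 0) <= (if w : vt \<rho> then s \<rho> / real (card (vt \<rho>)) else 0)" using le by blast
			show "\<exists>\<rho>\<in>P. (if w : vt \<rho> then s' \<rho> / real (card (vt \<rho>)) else 0) < (if w : vt \<rho> then s \<rho> / real (card (vt \<rho>)) else 0)"
				using \<sigma> w(1) cpos by (intro bexI[of _ \<sigma>]) (simp_all add: divide_strict_right_mono)
		qed
		then show False using s(3) by simp
	qed
	show "t = t'"
	proof (rule ccontr)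
		assume "t ~= t'"
		let ?D = "{\<sigma>\<in>P. t \<sigma> ~= t' \<sigma>}"
		obtain \<rho> where "t \<rho> ~= t' \<rho>" using \<open>t ~= t'\<close> by blast
		then have "\<rho> : ?D" using g(1) g'(1) by force
		then have D: "finite ?D" "?D ~= {}" using finP by auto
		then have "Max ((%\<sigma>. card (vt \<sigma>)) ` ?D) : (%\<sigma>. card (vt \<sigma>)) ` ?D" by simp
		then obtain \<sigma> where \<sigma>: "Max ((%\<sigma>. card (vt \<sigma>)) ` ?D) = card (vt \<sigma>)" "\<sigma> : ?D" by (rule imageE)
		have mx: "t \<rho> = t' \<rho>" if "\<rho> : P" "card (vt \<sigma>) < card (vt \<rho>)" for \<rho>
		proof (rule ccontr)
			assume "t \<rho> ~= t' \<rho>"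
			then have "card (vt \<rho>) <= card (vt \<sigma>)" unfolding \<sigma>(1)[symmetric] using D(1) that(1) by (intro Max_ge) auto
			then show False using that(2) by simp
		qed
		consider "t' \<sigma> < t \<sigma>" | "t \<sigma> < t' \<sigma>" using \<sigma>(2) by force
		then show False
		proof cases
			case 1
			show False by (rule main[OF t t' uu _ 1]) (use \<sigma>(2) mx in auto)
		next
			case 2
			show False by (rule main[OF t' t uu[symmetric] _ 2]) (use \<sigma>(2) mx in auto)
		qed
	qed
qed

text \<open>Greedy peeling: the smallest coordinate \<open>c\<close> is removed from all vertices of
  \<open>S\<close> at once, which is the weight \<open>c * card S\<close> on the simplex spanned by
  \<open>S\<close>; the rest is supported on fewer vertices, so the simplices found are
  nested.\<close>

lemma subdivide:
	assumes "finite S" "S \<subseteq> vt \<sigma>" "\<sigma> : K" "!!v. 0 < a v \<longleftrightarrow> v : S" "!!v. 0 <= (a v::real)"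
	shows "EX t. (\<forall>\<rho>. 0 <= t \<rho>) & {\<rho>. t \<rho> ~= 0} : \<Delta> & (\<forall>\<rho>. t \<rho> ~= 0 --> vt \<rho> \<subseteq> S) & u t = a"
	using assms
proof (induction "card S" arbitrary: S a rule: less_induct)
	case less
	show ?case
	proof (cases "S = {}")
		case True
		then have "a = (%_. 0)" using less.prems(4,5) by (auto simp: fun_eq_iff order_le_less)
		then show ?thesis by (intro exI[of _ "%_. 0"]) (auto simp: \<Delta>_def u_def)
	next
		case False
		define \<rho> where "\<rho> = convex hull S"
		have \<rho>: "\<rho> : K" "vt \<rho> = S" using face_in[OF less.prems(3,2)] by (simp_all add: \<rho>_def)
		have "\<rho> ~= {}" using \<rho>(2) False simplex_vt(3)[OF \<rho>(1)] by auto
		then have \<rho>P: "\<rho> : P" using \<rho>(1) by (simp add: P_def)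
		define c where "c = Min (a ` S)"
		have "c : a ` S" unfolding c_def using less.prems(1) False by simp
		then obtain v0 where v0: "c = a v0" "v0 : S" by (rule imageE)
		have cle: "c <= a v" if "v : S" for v unfolding c_def using less.prems(1) that by simp
		have c0: "0 < c" using v0 less.prems(4) by simp
		define a' where "a' v = (if v : S then a v - c else 0)" for v
		define S' where "S' = {v\<in>S. a v ~= c}"
		have S': "S' \<subset> S" using v0 by (auto simp: S'_def)
		have "EX t. (\<forall>\<rho>. 0 <= t \<rho>) & {\<rho>. t \<rho> ~= 0} : \<Delta> & (\<forall>\<rho>. t \<rho> ~= 0 --> vt \<rho> \<subseteq> S') & u t = a'"
		proof (rule less.hyps)
			show "card S' < card S" by (rule psubset_card_mono[OF less.prems(1) S'])
			show "finite S'" "S' \<subseteq> vt \<sigma>" using S' less.prems(1,2) finite_subset by blast+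
			show "0 < a' v \<longleftrightarrow> v : S'" for v using cle[of v] by (auto simp: a'_def S'_def)
			show "0 <= a' v" for v using cle[of v] by (auto simp: a'_def)
		qed (rule less.prems(3))
		then obtain t where t: "\<forall>\<rho>. 0 <= t \<rho>" "{\<rho>. t \<rho> ~= 0} : \<Delta>" "\<forall>\<rho>. t \<rho> ~= 0 --> vt \<rho> \<subseteq> S'" "u t = a'" by blast
		have t\<rho>: "t \<rho> = 0" using t(3) \<rho>(2) S' by blast
		define t' where "t' = t(\<rho> := c * real (card S))"
		have cS: "0 < real (card S)" using less.prems(1) False by (simp add: card_gt_0_iff)
		have sub: "\<tau> \<subseteq> \<rho>" if "t' \<tau> ~= 0" for \<tau>
		proof (cases "\<tau> = \<rho>")
			case False
			then have "t \<tau> ~= 0" using that by (simp add: t'_def)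
			then have "\<tau> : K" "vt \<tau> \<subseteq> vt \<rho>" using t(2,3) \<rho>(2) S' PK unfolding \<Delta>_def by blast+
			then show ?thesis using vt_mono[OF _ \<rho>(1)] by blast
		qed simp
		have "{\<tau>. t' \<tau> ~= 0} : \<Delta>"
			unfolding \<Delta>_def
		proof (intro CollectI conjI ballI)
			show "{\<tau>. t' \<tau> ~= 0} \<subseteq> P" using t(2) \<rho>P unfolding \<Delta>_def t'_def by (auto split: if_splits)
			fix \<sigma>' \<tau> assume h: "\<sigma>' : {\<tau>. t' \<tau> ~= 0}" "\<tau> : {\<tau>. t' \<tau> ~= 0}"
			show "\<sigma>' \<subseteq> \<tau> \<or> \<tau> \<subseteq> \<sigma>'"
			proof (cases "\<sigma>' = \<rho> \<or> \<tau> = \<rho>")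
				case True
				then show ?thesis using sub h by blast
			next
				case False
				then have "t \<sigma>' ~= 0" "t \<tau> ~= 0" using h by (auto simp: t'_def)
				then show ?thesis using t(2) unfolding \<Delta>_def by blast
			qed
		qed
		moreover have "\<forall>\<tau>. 0 <= t' \<tau>" using t(1) c0 by (simp add: t'_def)
		moreover have "\<forall>\<tau>. t' \<tau> ~= 0 --> vt \<tau> \<subseteq> S" using t(3) \<rho>(2) S' by (auto simp: t'_def split: if_splits)
		moreover have "u t' = a"
		proof (rule ext)
			fix v
			have "u t' v = (\<Sum>\<tau>\<in>P. (if v : vt \<tau> then t \<tau> / real (card (vt \<tau>)) else 0) + (if \<tau> = \<rho> then (if v : S then c else 0) else 0))"
				unfolding u_def by (rule sum.cong[OF refl]) (use t\<rho> \<rho>(2) cS in \<open>auto simp: t'_def\<close>)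
			also have "\<dots> = u t v + (if v : S then c else 0)" unfolding sum.distrib u_def using finP \<rho>P by simp
			also have "\<dots> = a v" using less.prems(4)[of v] less.prems(5)[of v] unfolding t(4) by (auto simp: a'_def)
			finally show "u t' v = a v" .
		qed
		ultimately show ?thesis by blast
	qed
qed

lemma simplex_subdivision:
	assumes \<sigma>: "\<sigma> : K" and x: "x : \<sigma>"
	obtains t where "t : geo P \<Delta>" "\<Phi>\<^sub>0 t = x" "!!\<rho>. t \<rho> ~= 0 ==> \<rho> \<subseteq> \<sigma>"
proof -
	note s = simplex_vt[OF \<sigma>]
	obtain w where w: "ALL v:vt \<sigma>. 0 <= w v" "sum w (vt \<sigma>) = 1" "(\<Sum>v\<in>vt \<sigma>. w v *\<^sub>R v) = x"
		using x s(3) unfolding convex_hull_finite[OF s(2)] by blast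
	define a where "a v = (if v : vt \<sigma> then w v else 0)" for v
	define S where "S = {v\<in>vt \<sigma>. 0 < w v}"
	have "EX t. (\<forall>\<rho>. 0 <= t \<rho>) & {\<rho>. t \<rho> ~= 0} : \<Delta> & (\<forall>\<rho>. t \<rho> ~= 0 --> vt \<rho> \<subseteq> S) & u t = a"
		by (rule subdivide[OF _ _ \<sigma>]) (use s(2) w(1) in \<open>auto simp: S_def a_def\<close>)
	then obtain t where t: "\<forall>\<rho>. 0 <= t \<rho>" "{\<rho>. t \<rho> ~= 0} : \<Delta>" "\<forall>\<rho>. t \<rho> ~= 0 --> vt \<rho> \<subseteq> S" "u t = a" by blast
	have sub: "vt \<rho> \<subseteq> vt \<sigma>" if "\<rho> : P" "t \<rho> ~= 0" for \<rho> using t(3) that(2) by (auto simp: S_def)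
	have "sum t P = 1" "\<Phi>\<^sub>0 t = x"
		using u_sum[where t = t, OF s(2) sub] w(2,3) unfolding t(4) by (simp_all add: a_def)
	moreover have "\<rho> \<subseteq> \<sigma>" if "t \<rho> ~= 0" for \<rho>
	proof -
		have "\<rho> : P" using t(2) that unfolding \<Delta>_def by blast
		then show ?thesis using vt_mono[OF PK \<sigma>] sub that by blast
	qed
	ultimately show thesis using that[of t] t(1,2) by (simp add: geo_def)
qed

lemma Phi0_in_hull:
	assumes t: "t : geo P \<Delta>" "{\<rho>. t \<rho> ~= 0} \<subseteq> F" and S: "convex S" "!!\<rho>. \<rho> : F ==> barycenter \<rho> : S"
	shows "\<Phi>\<^sub>0 t : S"
proof -
	let ?F = "{\<rho>. t \<rho> ~= 0}"
	note g = geo_facts[OF t(1)]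
	have fF: "finite ?F" using g(1) finP finite_subset by blast
	have "\<Phi>\<^sub>0 t = (\<Sum>\<rho>\<in>?F. t \<rho> *\<^sub>R barycenter \<rho>)"
		unfolding \<Phi>\<^sub>0_def by (rule sum.mono_neutral_right) (use finP g(1) in auto)
	also have "\<dots> : S"
	proof (rule convex_sum[OF fF S(1)])
		have "sum t P = sum t ?F" by (rule sum.mono_neutral_right) (use finP g(1) in auto)
		then show "sum t ?F = 1" using g(5) by simp
	qed (use g(4) S(2) t(2) in auto)
	finally show ?thesis .
qed

text \<open>A point of the realisation lies in the largest member of its flag; conversely, the
  subdivision of a simplex only uses its faces.\<close>

lemma Phi0_lower:
	assumes L: "L \<subseteq> P" "!!\<sigma> \<tau>. \<sigma> : L ==> \<tau> : P ==> \<tau> \<subseteq> \<sigma> ==> \<tau> : L"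
	shows "\<Phi>\<^sub>0 ` geo P {F\<in>\<Delta>. F \<subseteq> L} = \<Union>L"
proof (intro equalityI subsetI)
	fix x assume "x : \<Phi>\<^sub>0 ` geo P {F\<in>\<Delta>. F \<subseteq> L}"
	then obtain t where t: "t : geo P {F\<in>\<Delta>. F \<subseteq> L}" "x = \<Phi>\<^sub>0 t" by blast
	have tD: "t : geo P \<Delta>" "{\<sigma>. t \<sigma> ~= 0} \<subseteq> L" using t(1) by (auto simp: geo_def)
	note g = geo_facts[OF tD(1)]
	obtain \<mu> where \<mu>: "\<mu> : {\<sigma>. t \<sigma> ~= 0}" "!!\<tau>. \<tau> : {\<sigma>. t \<sigma> ~= 0} ==> \<tau> \<subseteq> \<mu>" by (rule chain_max[OF g(1-3)]) blast
	have \<mu>L: "\<mu> : L" using \<mu>(1) tD(2) by blast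
	have "convex \<mu>" using simplex_vt(3)[of \<mu>] \<mu>L L(1) PK by (metis convex_convex_hull subsetD)
	have "x : \<mu>" unfolding t(2)
	proof (rule Phi0_in_hull[OF tD(1) subset_refl \<open>convex \<mu>\<close>])
		fix \<rho> assume "\<rho> : {\<rho>. t \<rho> ~= 0}"
		then show "barycenter \<rho> : \<mu>" using barycenter_in[of \<rho>] \<mu>(2)[of \<rho>] g(1) by blast
	qed
	then show "x : \<Union>L" using \<mu>L by blast
next
	fix x assume "x : \<Union>L"
	then obtain \<sigma> where \<sigma>: "\<sigma> : L" "x : \<sigma>" by blast
	have \<sigma>K: "\<sigma> : K" using \<sigma>(1) L(1) PK by blast
	obtain t where t: "t : geo P \<Delta>" "\<Phi>\<^sub>0 t = x" "!!\<rho>. t \<rho> ~= 0 ==> \<rho> \<subseteq> \<sigma>" by (rule simplex_subdivision[OF \<sigma>K \<sigma>(2)]) blast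
	have "{\<rho>. t \<rho> ~= 0} \<subseteq> L" using L(2)[OF \<sigma>(1)] t(3) geo_facts(1)[OF t(1)] by blast
	then have "t : geo P {F\<in>\<Delta>. F \<subseteq> L}" using t(1) by (simp add: geo_def)
	then show "x : \<Phi>\<^sub>0 ` geo P {F\<in>\<Delta>. F \<subseteq> L}" using t(2) by blast
qed

text \<open>A finite union of closed subsets of a cube. Compactness is what turns the continuous
  bijection \<open>\<Phi>\<^sub>0\<close> into a homeomorphism.\<close>

lemma compact_geo: "compact (geo P \<Delta>)"
proof -
	define C where "C F = {t::'e set => real. (\<forall>\<sigma>. 0 <= t \<sigma>) & (\<forall>\<sigma>\<in>- F. t \<sigma> = 0) & sum t P = 1}" for F
	have "geo P \<Delta> = (\<Union>F\<in>\<Delta>. C F)"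
	proof (intro equalityI subsetI)
		fix t assume t: "t : geo P \<Delta>"
		then show "t : (\<Union>F\<in>\<Delta>. C F)" unfolding geo_def C_def by (intro UN_I[of "{\<sigma>. t \<sigma> ~= 0}"]) auto
	next
		fix t assume "t : (\<Union>F\<in>\<Delta>. C F)"
		then obtain F where F: "F : \<Delta>" "t : C F" by blast
		then have "{\<sigma>. t \<sigma> ~= 0} \<subseteq> F" by (auto simp: C_def)
		then have "{\<sigma>. t \<sigma> ~= 0} : \<Delta>" using F(1) unfolding \<Delta>_def by blast
		then show "t : geo P \<Delta>" using F(2) by (auto simp: geo_def C_def)
	qed
	moreover have "compact (C F)" if F: "F : \<Delta>" for F
	proof -
		have "compactin (product_topology (%_::'e set. euclideanreal) UNIV) (PiE UNIV (%_. {0..1::real}))"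
			unfolding compactin_PiE by simp
		then have cb: "compact (PiE UNIV (%_::'e set. {0..1::real}))"
			by (simp add: euclidean_product_topology)
		have cl: "closed (C F)"
		proof -
			have "C F = (\<Inter>\<sigma>. {t. 0 <= t \<sigma>}) \<inter> (\<Inter>\<sigma>\<in>- F. {t. t \<sigma> = 0}) \<inter> {t. sum t P = 1}" by (auto simp: C_def)
			moreover have "closed {t::'e set => real. 0 <= t \<sigma>}" "closed {t::'e set => real. t \<sigma> = 0}" for \<sigma>
				by (rule closed_Collect_le closed_Collect_eq; simp add: continuous_on_coord)+
			moreover have "closed {t::'e set => real. sum t P = 1}"
				by (rule closed_Collect_eq) (auto intro!: continuous_on_sum continuous_on_coord)
			ultimately show ?thesis by (auto intro!: closed_Int closed_INT)
		qed
		have "C F \<subseteq> PiE UNIV (%_. {0..1})"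
		proof
			fix t :: "'e set => real" assume "t : C F"
			then have t: "\<forall>\<sigma>. 0 <= t \<sigma>" "\<forall>\<sigma>\<in>- F. t \<sigma> = 0" "sum t P = 1" by (auto simp: C_def)
			have "t \<sigma> <= 1" for \<sigma>
			proof (cases "\<sigma> : P")
				case True
				have "t \<sigma> <= sum t P" by (rule member_le_sum) (use True finP t in auto)
				then show ?thesis using t(3) by simp
			next
				case False
				then have "\<sigma> : - F" using Delta_P[OF F] by blast
				then have "t \<sigma> = 0" using t(2) by blast
				then show ?thesis by simp
			qed
			then show "t : PiE UNIV (%_. {0..1})" using t(1) by (auto simp: PiE_def extensional_def)
		qed
		then show ?thesis using compact_Int_closed[OF cb cl] by (simp add: Int_absorb1)
	qed
	moreover have "finite \<Delta>" by (rule finite_subset[of _ "Pow P"]) (use finP in \<open>auto simp: \<Delta>_def\<close>)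
	ultimately show ?thesis by (simp add: compact_UN)
qed

lemma Union_P: "\<Union>P = \<Union>K" by (auto simp: P_def)

lemma Phi0_homeo: "homeomorphic_map (top_of_set (geo P \<Delta>)) (top_of_set (\<Union>K)) \<Phi>\<^sub>0"
proof (rule continuous_imp_homeomorphic_map)
	have img: "\<Phi>\<^sub>0 ` geo P \<Delta> = \<Union>K"
	proof -
		have "{F\<in>\<Delta>. F \<subseteq> P} = \<Delta>" by (auto simp: \<Delta>_def)
		then show ?thesis using Phi0_lower[of P] Union_P by simp
	qed
	have "continuous_on (geo P \<Delta>) \<Phi>\<^sub>0"
		unfolding \<Phi>\<^sub>0_def by (intro continuous_on_sum continuous_on_scaleR continuous_on_coord continuous_on_const)
	then show "continuous_map (top_of_set (geo P \<Delta>)) (top_of_set (\<Union>K)) \<Phi>\<^sub>0" using img by (auto simp: continuous_map_in_subtopology)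
	show "compact_space (top_of_set (geo P \<Delta>))" using compact_geo by (simp add: compact_space_subtopology)
	show "Hausdorff_space (top_of_set (\<Union>K))" by (simp add: Hausdorff_space_subtopology)
	show "\<Phi>\<^sub>0 ` topspace (top_of_set (geo P \<Delta>)) = topspace (top_of_set (\<Union>K))" using img by simp
	show "inj_on \<Phi>\<^sub>0 (topspace (top_of_set (geo P \<Delta>)))" using Phi0_inj by (auto intro: inj_onI)
qed

section \<open>Dual cells as unions of flags\<close>

lemma vertex_geo:
	assumes "\<sigma> : P"
	shows "(%\<rho>. if \<rho> = \<sigma> then 1 else 0) : geo P \<Delta>" "\<Phi>\<^sub>0 (%\<rho>. if \<rho> = \<sigma> then 1 else 0) = barycenter \<sigma>"
proof -
	have "{\<rho>. (if \<rho> = \<sigma> then 1 else 0::real) ~= 0} = {\<sigma>}" by auto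
	then show "(%\<rho>. if \<rho> = \<sigma> then 1 else 0) : geo P \<Delta>" using assms finP by (simp add: geo_def \<Delta>_def)
	have "\<Phi>\<^sub>0 (%\<rho>. if \<rho> = \<sigma> then 1 else 0) = (\<Sum>\<rho>\<in>P. if \<rho> = \<sigma> then barycenter \<rho> else 0)"
		unfolding \<Phi>\<^sub>0_def by (rule sum.cong[OF refl]) auto
	then show "\<Phi>\<^sub>0 (%\<rho>. if \<rho> = \<sigma> then 1 else 0) = barycenter \<sigma>" using assms finP by simp
qed

lemma barycenter_Phi0:
	assumes "\<sigma> : P" "t : geo P \<Delta>" "\<Phi>\<^sub>0 t = barycenter \<sigma>"
	shows "t = (%\<rho>. if \<rho> = \<sigma> then 1 else 0)"
	using Phi0_inj[OF assms(2) vertex_geo(1)[OF assms(1)]] vertex_geo(2)[OF assms(1)] assms(3) by simp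

lemma barycenter_inj: assumes "\<sigma> : P" "\<tau> : P" "barycenter \<sigma> = barycenter \<tau>" shows "\<sigma> = \<tau>"
proof -
	have "(%\<rho>. if \<rho> = \<tau> then 1 else 0) = (%\<rho>. if \<rho> = \<sigma> then 1 else 0::real)"
		by (rule barycenter_Phi0[OF assms(1) vertex_geo(1)[OF assms(2)]]) (simp add: vertex_geo(2)[OF assms(2)] assms(3))
	from fun_cong[OF this, of \<sigma>] show ?thesis by (simp split: if_splits)
qed

lemma hull_barycenters:
	assumes C: "C : \<Delta>"
	shows "convex hull (barycenter ` C) = \<Phi>\<^sub>0 ` geo P {F\<in>\<Delta>. F \<subseteq> C}"
proof (intro equalityI subsetI)
	fix x assume "x : \<Phi>\<^sub>0 ` geo P {F\<in>\<Delta>. F \<subseteq> C}"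
	then obtain t where t: "t : geo P \<Delta>" "{\<rho>. t \<rho> ~= 0} \<subseteq> C" "x = \<Phi>\<^sub>0 t" by (auto simp: geo_def)
	show "x : convex hull (barycenter ` C)" unfolding t(3)
		by (rule Phi0_in_hull[OF t(1,2) convex_convex_hull]) (simp add: hull_inc)
next
	have fC: "finite C" by (rule finF[OF C])
	have inj: "inj_on barycenter C" using barycenter_inj Delta_P[OF C] by (auto intro!: inj_onI)
	fix x assume "x : convex hull (barycenter ` C)"
	then obtain w where w: "ALL y:barycenter ` C. 0 <= w y" "sum w (barycenter ` C) = 1" "(\<Sum>y\<in>barycenter ` C. w y *\<^sub>R y) = x"
		unfolding convex_hull_finite[OF finite_imageI[OF fC]] by blast
	define t where "t \<rho> = (if \<rho> : C then w (barycenter \<rho>) else 0)" for \<rho>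
	have sub: "{\<rho>. t \<rho> ~= 0} \<subseteq> C" by (auto simp: t_def)
	then have "{\<rho>. t \<rho> ~= 0} : \<Delta>" using C unfolding \<Delta>_def by blast
	moreover have "sum t P = 1"
	proof -
		have "sum t P = sum t C" by (rule sum.mono_neutral_right) (use finP Delta_P[OF C] in \<open>auto simp: t_def\<close>)
		also have "\<dots> = sum w (barycenter ` C)" unfolding sum.reindex[OF inj] by (simp add: t_def)
		finally show ?thesis using w(2) by simp
	qed
	moreover have "\<Phi>\<^sub>0 t = x"
	proof -
		have "\<Phi>\<^sub>0 t = (\<Sum>\<rho>\<in>C. t \<rho> *\<^sub>R barycenter \<rho>)"
			unfolding \<Phi>\<^sub>0_def by (rule sum.mono_neutral_right) (use finP Delta_P[OF C] in \<open>auto simp: t_def\<close>)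
		also have "\<dots> = (\<Sum>y\<in>barycenter ` C. w y *\<^sub>R y)" unfolding sum.reindex[OF inj] by (simp add: t_def)
		finally show ?thesis using w(3) by simp
	qed
	moreover have "\<forall>\<rho>. 0 <= t \<rho>" using w(1) by (simp add: t_def)
	ultimately show "x : \<Phi>\<^sub>0 ` geo P {F\<in>\<Delta>. F \<subseteq> C}" using sub by (intro image_eqI[of _ _ t]) (auto simp: geo_def)
qed

text \<open>Transversality becomes a condition on flags: a simplex meeting \<open>\<sigma>\<close>
  only in its barycenter cannot involve a proper face of \<open>\<sigma>\<close>, whose barycenter
  lies in \<open>\<sigma>\<close> as well. Conversely, uniqueness of flag coordinates gives
  extremality and the one-point intersection.\<close>

lemma dual_cell_eq:
	assumes \<sigma>: "\<sigma> : P"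
	shows "dual_cell K \<sigma> = \<Union>{convex hull (barycenter ` C) |C. C : \<Delta> & \<sigma> : C & (\<forall>\<rho>\<in>C. \<sigma> \<subseteq> \<rho>)}"
proof -
	have eq: "\<tau> : barycentric_subdivision K & barycenter \<sigma> extreme_point_of \<tau> & \<tau> \<inter> \<sigma> = {barycenter \<sigma>} \<longleftrightarrow>
		 (EX C. \<tau> = convex hull (barycenter ` C) & C : \<Delta> & \<sigma> : C & (\<forall>\<rho>\<in>C. \<sigma> \<subseteq> \<rho>))" for \<tau>
	proof
		assume h: "\<tau> : barycentric_subdivision K & barycenter \<sigma> extreme_point_of \<tau> & \<tau> \<inter> \<sigma> = {barycenter \<sigma>}"
		then obtain C where C: "\<tau> = convex hull (barycenter ` C)" "C : \<Delta>"
			unfolding barycentric_subdivision_def \<Delta>_def P_def by blast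
		have "barycenter \<sigma> : barycenter ` C" using h extreme_point_of_convex_hull unfolding C(1) by blast
		then obtain \<rho> where \<rho>: "\<rho> : C" "barycenter \<sigma> = barycenter \<rho>" by blast
		have \<sigma>C: "\<sigma> : C" using barycenter_inj[OF \<sigma> _ \<rho>(2)] \<rho>(1) Delta_P[OF C(2)] by blast
		have "\<sigma> \<subseteq> \<rho>" if "\<rho> : C" for \<rho>
		proof (rule ccontr)
			assume n: "~ \<sigma> \<subseteq> \<rho>"
			then have sub: "\<rho> \<subseteq> \<sigma>" using C(2) \<sigma>C that unfolding \<Delta>_def by blast
			have \<rho>P: "\<rho> : P" using that Delta_P[OF C(2)] by blast
			have "barycenter \<rho> : \<tau>" unfolding C(1) using that by (simp add: hull_inc)
			moreover have "barycenter \<rho> : \<sigma>" using barycenter_in[OF \<rho>P] sub by blast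
			ultimately have "barycenter \<rho> = barycenter \<sigma>" using h by blast
			then show False using barycenter_inj[OF \<rho>P \<sigma>] n by blast
		qed
		then show "EX C. \<tau> = convex hull (barycenter ` C) & C : \<Delta> & \<sigma> : C & (\<forall>\<rho>\<in>C. \<sigma> \<subseteq> \<rho>)" using C \<sigma>C by blast
	next
		assume "EX C. \<tau> = convex hull (barycenter ` C) & C : \<Delta> & \<sigma> : C & (\<forall>\<rho>\<in>C. \<sigma> \<subseteq> \<rho>)"
		then obtain C where C: "\<tau> = convex hull (barycenter ` C)" "C : \<Delta>" "\<sigma> : C" "\<forall>\<rho>\<in>C. \<sigma> \<subseteq> \<rho>" by blast
		have bs: "\<tau> : barycentric_subdivision K" unfolding barycentric_subdivision_def C(1) using C(2,3) unfolding \<Delta>_def P_def by blast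
		have b\<tau>: "barycenter \<sigma> : \<tau>" unfolding C(1) using C(3) by (simp add: hull_inc)
		have rep: "EX t. t : geo P \<Delta> & {\<rho>. t \<rho> ~= 0} \<subseteq> C & x = \<Phi>\<^sub>0 t" if "x : \<tau>" for x
			using that unfolding C(1) hull_barycenters[OF C(2)] by (auto simp: geo_def)
		\<comment> \<open>The barycenter has a unit vector as flag coordinates. Nonnegative coordinates of
		  the endpoints with this weighted average must both equal it, so the segment is
		  degenerate.\<close>
		have ext: "barycenter \<sigma> \<notin> open_segment a b" if ab: "a : \<tau>" "b : \<tau>" for a b
		proof
			assume o: "barycenter \<sigma> : open_segment a b"
			then obtain r where r: "a ~= b" "0 < r" "r < 1" "barycenter \<sigma> = (1 - r) *\<^sub>R a + r *\<^sub>R b"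
				unfolding in_segment by blast
			obtain s where s: "s : geo P \<Delta>" "{\<rho>. s \<rho> ~= 0} \<subseteq> C" "a = \<Phi>\<^sub>0 s" using rep[OF ab(1)] by blast
			obtain t where t: "t : geo P \<Delta>" "{\<rho>. t \<rho> ~= 0} \<subseteq> C" "b = \<Phi>\<^sub>0 t" using rep[OF ab(2)] by blast
			let ?q = "%\<rho>. (1 - r) * s \<rho> + r * t \<rho>"
			have nn: "0 <= ?q \<rho>" for \<rho> using geo_facts(4)[OF s(1)] geo_facts(4)[OF t(1)] r by simp
			have qC: "{\<rho>. ?q \<rho> ~= 0} \<subseteq> C"
			proof
				fix \<rho> assume "\<rho> : {\<rho>. ?q \<rho> ~= 0}"
				then have "s \<rho> ~= 0 \<or> t \<rho> ~= 0" by auto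
				then show "\<rho> : C" using s(2) t(2) by blast
			qed
			then have "{\<rho>. ?q \<rho> ~= 0} : \<Delta>" using C(2) unfolding \<Delta>_def by blast
			moreover have "sum ?q P = 1"
				using geo_facts(5)[OF s(1)] geo_facts(5)[OF t(1)] by (simp add: sum.distrib flip: sum_distrib_left)
			ultimately have q: "?q : geo P \<Delta>" using nn by (simp add: geo_def)
			have "\<Phi>\<^sub>0 ?q = barycenter \<sigma>"
				unfolding r(4) s(3) t(3) \<Phi>\<^sub>0_def by (simp add: scaleR_add_left sum.distrib scaleR_sum_right)
			then have qe: "?q = (%\<rho>. if \<rho> = \<sigma> then 1 else 0)" by (rule barycenter_Phi0[OF \<sigma> q])
			have z: "s \<rho> = 0 & t \<rho> = 0" if "\<rho> ~= \<sigma>" for \<rho>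
			proof -
				have "(1 - r) * s \<rho> + r * t \<rho> = 0" using fun_cong[OF qe, of \<rho>] that by simp
				moreover have "0 <= (1 - r) * s \<rho>" "0 <= r * t \<rho>" using geo_facts(4)[OF s(1), of \<rho>] geo_facts(4)[OF t(1), of \<rho>] r by simp_all
				ultimately have "(1 - r) * s \<rho> = 0" "r * t \<rho> = 0" by linarith+
				then show ?thesis using r by simp
			qed
			have one: "q \<sigma> = 1" if "q : geo P \<Delta>" "\<forall>\<rho>. \<rho> ~= \<sigma> --> q \<rho> = 0" for q
			proof -
				have "sum q P = (\<Sum>\<rho>\<in>P. if \<rho> = \<sigma> then q \<sigma> else 0)" by (rule sum.cong[OF refl]) (use that(2) in auto)
				then show ?thesis using geo_facts(5)[OF that(1)] \<sigma> finP by simp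
			qed
			have "s = t"
			proof (rule ext)
				fix \<rho> show "s \<rho> = t \<rho>" using z one[OF s(1)] one[OF t(1)] by (cases "\<rho> = \<sigma>") auto
			qed
			then show False using r(1) s(3) t(3) by simp
		qed
		have "x = barycenter \<sigma>" if x: "x : \<tau>" "x : \<sigma>" for x
		proof -
			obtain s where s: "s : geo P \<Delta>" "{\<rho>. s \<rho> ~= 0} \<subseteq> C" "x = \<Phi>\<^sub>0 s" using rep[OF x(1)] by blast
			obtain t where t: "t : geo P \<Delta>" "\<Phi>\<^sub>0 t = x" "!!\<rho>. t \<rho> ~= 0 ==> \<rho> \<subseteq> \<sigma>" by (rule simplex_subdivision[OF PK[OF \<sigma>] x(2)]) blast
			have st: "s = t" using Phi0_inj[OF s(1) t(1)] s(3) t(2) by simp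
			have "{\<rho>. s \<rho> ~= 0} \<subseteq> {\<sigma>}" using s(2) t(3) C(4) unfolding st by blast
			then have "\<Phi>\<^sub>0 s : {barycenter \<sigma>}" by (rule Phi0_in_hull[OF s(1)]) auto
			then show ?thesis using s(3) by simp
		qed
		then have "\<tau> \<inter> \<sigma> = {barycenter \<sigma>}" using b\<tau> barycenter_in[OF \<sigma>] by blast
		then show "\<tau> : barycentric_subdivision K & barycenter \<sigma> extreme_point_of \<tau> & \<tau> \<inter> \<sigma> = {barycenter \<sigma>}"
			using bs ext b\<tau> unfolding extreme_point_of_def by blast
	qed
	show ?thesis unfolding dual_cell_def by (rule arg_cong[of _ _ Union], rule Collect_cong, rule eq)
qed

lemma dual_cell_mem:
	assumes \<sigma>: "\<sigma> : P"
	shows "x : dual_cell K \<sigma> \<longleftrightarrow> (EX C t. C : \<Delta> & \<sigma> : C & (\<forall>\<rho>\<in>C. \<sigma> \<subseteq> \<rho>) & t : geo P \<Delta> & {\<rho>. t \<rho> ~= 0} \<subseteq> C & x = \<Phi>\<^sub>0 t)"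
proof -
	have "x : convex hull (barycenter ` C) \<longleftrightarrow> (EX t. t : geo P \<Delta> & {\<rho>. t \<rho> ~= 0} \<subseteq> C & x = \<Phi>\<^sub>0 t)" if "C : \<Delta>" for C
		unfolding hull_barycenters[OF that] by (auto simp: geo_def)
	then show ?thesis unfolding dual_cell_eq[OF \<sigma>] by blast
qed

text \<open>A point belongs to the dual cell of the smallest member of its flag.\<close>

lemma dual_upper:
	assumes U: "U \<subseteq> P" "!!\<sigma> \<tau>. \<sigma> : U ==> \<tau> : P ==> \<sigma> \<subseteq> \<tau> ==> \<tau> : U"
	shows "\<Phi>\<^sub>0 ` geo P {F\<in>\<Delta>. F \<subseteq> U} = (\<Union>\<sigma>\<in>U. dual_cell K \<sigma>)"
proof (intro equalityI subsetI)
	fix x assume "x : \<Phi>\<^sub>0 ` geo P {F\<in>\<Delta>. F \<subseteq> U}"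
	then obtain t where t: "t : geo P \<Delta>" "{\<sigma>. t \<sigma> ~= 0} \<subseteq> U" "x = \<Phi>\<^sub>0 t" by (auto simp: geo_def)
	note g = geo_facts[OF t(1)]
	obtain \<mu> where \<mu>: "\<mu> : {\<sigma>. t \<sigma> ~= 0}" "!!\<tau>. \<tau> : {\<sigma>. t \<sigma> ~= 0} ==> \<mu> \<subseteq> \<tau>" by (rule chain_min[OF g(1-3)]) blast
	have "{\<sigma>. t \<sigma> ~= 0} : \<Delta>" using t(1) by (simp add: geo_def)
	then have "x : dual_cell K \<mu>" using dual_cell_mem[of \<mu> x] \<mu> g(1) t(1,3) by blast
	then show "x : (\<Union>\<sigma>\<in>U. dual_cell K \<sigma>)" using \<mu>(1) t(2) by blast
next
	fix x assume "x : (\<Union>\<sigma>\<in>U. dual_cell K \<sigma>)"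
	then obtain \<sigma> where \<sigma>: "\<sigma> : U" "x : dual_cell K \<sigma>" by blast
	have "\<sigma> : P" using \<sigma>(1) U(1) by blast
	then obtain C t where C: "C : \<Delta>" "\<forall>\<rho>\<in>C. \<sigma> \<subseteq> \<rho>" and t: "t : geo P \<Delta>" "{\<rho>. t \<rho> ~= 0} \<subseteq> C" "x = \<Phi>\<^sub>0 t"
		using dual_cell_mem \<sigma>(2) by metis
	have "{\<rho>. t \<rho> ~= 0} \<subseteq> U" using U(2)[OF \<sigma>(1)] C t(2) Delta_P[OF C(1)] by blast
	then show "x : \<Phi>\<^sub>0 ` geo P {F\<in>\<Delta>. F \<subseteq> U}" using t(1,3) by (intro image_eqI[of _ _ t]) (auto simp: geo_def)
qed

lemma dual_cell_sub: assumes "\<sigma> : P" shows "dual_cell K \<sigma> \<subseteq> \<Union>K"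
proof
	fix x assume "x : dual_cell K \<sigma>"
	then obtain t where t: "t : geo P \<Delta>" "x = \<Phi>\<^sub>0 t" using dual_cell_mem[OF assms] by metis
	then show "x : \<Union>K" using homeomorphic_imp_surjective_map[OF Phi0_homeo] by auto
qed

text \<open>The barycenter of \<open>\<sigma>\<close> lies in its dual cell and has unique flag
  coordinates. Since faces are defined by inclusion of cells, this controls the face relation of the
  dual complex.\<close>

lemma dual_cell_mono:
	assumes \<sigma>: "\<sigma> : P" "\<tau> : P" and s: "dual_cell K \<sigma> \<subseteq> dual_cell K \<tau>"
	shows "\<tau> \<subseteq> \<sigma>"
proof -
	let ?d = "%\<rho>. if \<rho> = \<sigma> then 1 else 0::real"
	have "{\<rho>. ?d \<rho> ~= 0} = {\<sigma>}" by auto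
	moreover have "{\<sigma>} : \<Delta>" using \<sigma>(1) by (simp add: \<Delta>_def)
	ultimately have "barycenter \<sigma> : dual_cell K \<sigma>"
		unfolding dual_cell_mem[OF \<sigma>(1)] by (intro exI[of _ "{\<sigma>}"] exI[of _ ?d]) (simp add: vertex_geo[OF \<sigma>(1)])
	then have "barycenter \<sigma> : dual_cell K \<tau>" using s by blast
	then obtain C t where C: "\<forall>\<rho>\<in>C. \<tau> \<subseteq> \<rho>" and t: "t : geo P \<Delta>" "{\<rho>. t \<rho> ~= 0} \<subseteq> C" "barycenter \<sigma> = \<Phi>\<^sub>0 t"
		unfolding dual_cell_mem[OF \<sigma>(2)] by blast
	have "t = ?d" by (rule barycenter_Phi0[OF \<sigma>(1) t(1)]) (simp add: t(3))
	then have "t \<sigma> ~= 0" by simp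
	then show ?thesis using C t(2) by blast
qed

lemma flag_complex_subdivision:
	assumes "!!\<sigma>. \<sigma> : P ==> rk \<sigma> <= m"
	shows "flag_complex P \<Delta> rk m"
proof
	show "finite P" by (rule finP)
	show "inj_on rk F" if "F : \<Delta>" for F
	proof (rule inj_onI)
		fix \<sigma> \<tau> assume h: "\<sigma> : F" "\<tau> : F" "rk \<sigma> = rk \<tau>"
		then have "\<sigma> : P" "\<tau> : P" "\<sigma> \<subseteq> \<tau> \<or> \<tau> \<subseteq> \<sigma>" using that unfolding \<Delta>_def by auto
		then show "\<sigma> = \<tau>" using subset_rk[of \<sigma> \<tau>] subset_rk[of \<tau> \<sigma>] h(3) by auto
	qed
	show "f Un insert s g : \<Delta>" if h: "insert s f : \<Delta>" "insert s g : \<Delta>" "!!v. v : f ==> rk v < rk s" "!!v. v : g ==> rk s < rk v" for s f g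
	proof -
		have P: "f \<subseteq> P" "g \<subseteq> P" "s : P" using h(1,2) unfolding \<Delta>_def by auto
		have f: "v \<subseteq> s" if "v : f" for v
		proof -
			have "v \<subseteq> s \<or> s \<subseteq> v" using h(1) that unfolding \<Delta>_def by blast
			then show ?thesis using subset_rk[of s v] P that h(3)[OF that] by fastforce
		qed
		have g: "s \<subseteq> v" if "v : g" for v
		proof -
			have "v \<subseteq> s \<or> s \<subseteq> v" using h(2) that unfolding \<Delta>_def by blast
			then show ?thesis using subset_rk[of v s] P that h(4)[OF that] by fastforce
		qed
		have ff: "a \<subseteq> b \<or> b \<subseteq> a" if "a : f" "b : f" for a b using h(1) that unfolding \<Delta>_def by blast
		have gg: "a \<subseteq> b \<or> b \<subseteq> a" if "a : g" "b : g" for a b using h(2) that unfolding \<Delta>_def by blast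
		show ?thesis unfolding \<Delta>_def
		proof (intro CollectI conjI ballI)
			show "f Un insert s g \<subseteq> P" using P by auto
			fix a b assume "a : f Un insert s g" "b : f Un insert s g"
			then consider "a : f" "b : f" | "a : f" "b : insert s g" | "a : insert s g" "b : f" | "a : insert s g" "b : insert s g" by blast
			then show "a \<subseteq> b \<or> b \<subseteq> a"
			proof cases
				case 1 then show ?thesis by (rule ff)
			next
				case 2
				have "s \<subseteq> b" using 2(2) g by auto
				then show ?thesis using f[OF 2(1)] by blast
			next
				case 3
				have "s \<subseteq> a" using 3(1) g by auto
				then show ?thesis using f[OF 3(2)] by blast
			next
				case 4 then show ?thesis using g[of a] g[of b] gg[of a b] by blast
			qed
		qed
	qed
	show "G : \<Delta>" if "F : \<Delta>" "G \<subseteq> F" for F G using that unfolding \<Delta>_def by blast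
qed (use assms in \<open>auto simp: \<Delta>_def\<close>)

text \<open>Adding vertices one at a time gives nested faces. Together with the bound on the size of
  flags this limits the dimension of the simplices of \<open>K\<close>.\<close>

lemma full_flag:
	assumes "finite C" "C \<subseteq> vt \<sigma>" "\<sigma> : K"
	shows "EX F:\<Delta>. card F = card C & (\<forall>\<rho>\<in>F. vt \<rho> \<subseteq> C)"
	using assms
proof (induction C rule: finite_induct)
	case empty
	then show ?case by (intro bexI[of _ "{}"]) (auto simp: \<Delta>_def)
next
	case (insert v C)
	then obtain F where F: "F : \<Delta>" "card F = card C" "\<forall>\<rho>\<in>F. vt \<rho> \<subseteq> C" by blast
	let ?\<rho> = "convex hull (insert v C)"
	note \<rho> = face_in[OF insert.prems(2,1)]
	have "?\<rho> ~= {}" by simp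
	then have \<rho>P: "?\<rho> : P" using \<rho>(1) by (simp add: P_def)
	have sub: "\<tau> \<subseteq> ?\<rho>" if "\<tau> : F" for \<tau>
	proof -
		have "\<tau> : K" using that Delta_P[OF F(1)] PK by blast
		then show ?thesis using vt_mono[OF _ \<rho>(1)] \<rho>(2) F(3) that by blast
	qed
	have "?\<rho> \<notin> F" using F(3) \<rho>(2) insert.hyps(2) by blast
	then have "card (insert ?\<rho> F) = card (insert v C)" using finF[OF F(1)] insert.hyps F(2) by simp
	moreover have "insert ?\<rho> F : \<Delta>" using F(1) \<rho>P sub unfolding \<Delta>_def by blast
	moreover have "\<forall>\<tau>\<in>insert ?\<rho> F. vt \<tau> \<subseteq> insert v C" using F(3) \<rho>(2) by blast
	ultimately show ?case by blast
qed

end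

section \<open>Spanning subcomplexes\<close>

definition span_of :: "nat => ('v => 'a set) => ('v => nat) => 'v set => 'v set => 'a cells"
	where "span_of n c r P S k = (if k < n then c ` {\<sigma>\<in>P. r \<sigma> = k} else if k = n then c ` S else {})"

text \<open>An inclusion between distinct cells strictly raises the dimension, so closure under
  faces constrains only cells below dimension \<open>n\<close>, which are all present; the
  \<open>n\<close>-cells can be chosen freely.\<close>

lemma spanning_bij:
	assumes K: "!!k. K k = c ` {\<sigma>\<in>P. r \<sigma> = k}" and sub: "!!\<sigma> \<tau>. \<sigma> : P ==> \<tau> : P ==> c \<sigma> \<subseteq> c \<tau> ==> r \<sigma> < r \<tau> \<or> \<sigma> = \<tau>"
	shows "bij_betw (span_of n c r P) (Pow {\<sigma>\<in>P. r \<sigma> = n}) {L. spanning_subcomplex n L K}"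
proof -
	have inj: "inj_on c P" using sub by (intro inj_onI) (metis less_asym subset_refl)
	have le: "j <= k" if "f : K j" "e : K k" "f \<subseteq> e" for f e j k
		using that sub unfolding K by fastforce
	have eq: "f = e" if "f : K k" "e : K k" "f \<subseteq> e" for f e k
		using that sub unfolding K by fastforce
	show ?thesis
		unfolding bij_betw_def
	proof (intro conjI)
		show "inj_on (span_of n c r P) (Pow {\<sigma>\<in>P. r \<sigma> = n})"
		proof (rule inj_onI)
		fix S T assume h: "S : Pow {\<sigma>\<in>P. r \<sigma> = n}" "T : Pow {\<sigma>\<in>P. r \<sigma> = n}" "span_of n c r P S = span_of n c r P T"
		have "c ` S = c ` T" using fun_cong[OF h(3), of n] by (simp add: span_of_def)
		moreover have SP: "S \<subseteq> P" and TP: "T \<subseteq> P" using h(1,2) by auto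
		ultimately show "S = T" using inj_on_image_eq_iff[OF inj SP TP] by simp
		qed
		show "span_of n c r P ` Pow {\<sigma>\<in>P. r \<sigma> = n} = {L. spanning_subcomplex n L K}"
		proof (intro equalityI subsetI)
		fix L assume "L : span_of n c r P ` Pow {\<sigma>\<in>P. r \<sigma> = n}"
		then obtain S where S: "S \<subseteq> {\<sigma>\<in>P. r \<sigma> = n}" "L = span_of n c r P S" by blast
		have LK: "L k \<subseteq> K k" for k using S unfolding span_of_def K by auto
		have Lk: "L k = K k" if "k < n" for k using S(2) that unfolding span_of_def K by simp
		have L0: "L k = {}" if "n < k" for k using S(2) that unfolding span_of_def by simp
		have "f : L j" if e: "e : L k" and f: "f : K j" "f \<subseteq> e" for k j e f
		proof -
			have kn: "k <= n" using L0[of k] e by (cases "n < k") auto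
			have jk: "j <= k" by (rule le[OF f(1) subsetD[OF LK e] f(2)])
			show ?thesis
			proof (cases "j < n")
				case True
				then show ?thesis using Lk f(1) by simp
			next
				case False
				then have "j = k" using jk kn by simp
				then show ?thesis using eq[OF _ subsetD[OF LK e] f(2)] f(1) e by simp
			qed
		qed
		then show "L : {L. spanning_subcomplex n L K}"
			unfolding spanning_subcomplex_def subcomplex_def using LK Lk L0 by blast
	next
		fix L assume "L : {L. spanning_subcomplex n L K}"
		then have L: "L n \<subseteq> K n" "!!k. k < n ==> L k = K k" "!!k. n < k ==> L k = {}"
			unfolding spanning_subcomplex_def subcomplex_def by auto
		obtain S where S: "S \<subseteq> {\<sigma>\<in>P. r \<sigma> = n}" "L n = c ` S" using L(1) unfolding K by (meson subset_imageE)
		have "L = span_of n c r P S"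
		proof (rule ext)
			fix k
			consider "k < n" | "k = n" | "n < k" by linarith
			then show "L k = span_of n c r P S k" by cases (use L S K in \<open>auto simp: span_of_def\<close>)
		qed
		then show "L : span_of n c r P ` Pow {\<sigma>\<in>P. r \<sigma> = n}" using S(1) by blast
		qed
	qed
qed

lemma span_union: "(\<Union>k. \<Union>(span_of n c r P S k)) = (\<Union>\<sigma>\<in>{\<sigma>\<in>P. r \<sigma> < n} Un S. c \<sigma>)"
proof (intro equalityI subsetI)
	fix x assume "x : (\<Union>k. \<Union>(span_of n c r P S k))"
	then obtain k e where "x : e" "e : span_of n c r P S k" by blast
	then show "x : (\<Union>\<sigma>\<in>{\<sigma>\<in>P. r \<sigma> < n} Un S. c \<sigma>)" by (auto simp: span_of_def split: if_splits)
next
	fix x assume "x : (\<Union>\<sigma>\<in>{\<sigma>\<in>P. r \<sigma> < n} Un S. c \<sigma>)"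
	then obtain \<sigma> where \<sigma>: "\<sigma> : {\<sigma>\<in>P. r \<sigma> < n} Un S" "x : c \<sigma>" by blast
	show "x : (\<Union>k. \<Union>(span_of n c r P S k))"
	proof (cases "\<sigma> : S")
		case True
		then have "c \<sigma> : span_of n c r P S n" by (simp add: span_of_def)
		then show ?thesis using \<sigma>(2) by blast
	next
		case False
		then have "c \<sigma> : span_of n c r P S (r \<sigma>)" using \<sigma>(1) by (auto simp: span_of_def)
		then show ?thesis using \<sigma>(2) by blast
	qed
qed

theorem theorem3:
  fixes n :: nat
    and M :: "'a topology"
    and ori :: "'a \<Rightarrow> 'a chain set"
    and K :: "'e::euclidean_space set set"
    and h :: "'e \<Rightarrow> 'a"
    and X Y A B :: "'r::comm_ring_1"
  assumes "closed_manifold (2 * n) M"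
    and "manifold_orientation (2 * n) M ori"
    and "triangulates K h M"
  shows "P_poly n M ori (simplicial_cells K h) X Y A B =
         P_poly n M ori (dual_cells (2 * n) K h) Y X B A"
proof -
	have sc: "simplicial_complex K" and hh: "homeomorphic_map (top_of_set (\<Union>K)) M h"
		using assms(3) by (auto simp: triangulates_def)
	interpret simplicial K by (rule simplicial.intro[OF sc])
	define \<Phi> where "\<Phi> = h \<circ> \<Phi>\<^sub>0"
	have homeo: "homeomorphic_map (top_of_set (geo P \<Delta>)) M \<Phi>"
		unfolding \<Phi>_def by (rule homeomorphic_map_compose[OF Phi0_homeo hh])
	have inj_h: "inj_on h (\<Union>K)" and img_h: "h ` \<Union>K = topspace M"
		using homeomorphic_imp_injective_map[OF hh] homeomorphic_imp_surjective_map[OF hh] by auto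
	\<comment> \<open>The bound is extracted from the manifold structure: with the sum of all ranks as
	  a crude bound the flag complex is already available, and its local homology limits the size of
	  flags, hence of simplices.\<close>
	have rk: "rk \<sigma> <= 2 * n" if \<sigma>: "\<sigma> : P" for \<sigma>
	proof -
		have "rk \<rho> <= (\<Sum>\<sigma>\<in>P. rk \<sigma>)" if "\<rho> : P" for \<rho> by (rule member_le_sum) (use that finP in auto)
		then have "flag_complex P \<Delta> rk (\<Sum>\<sigma>\<in>P. rk \<sigma>)" by (rule flag_complex_subdivision)
		then interpret f: realized_complex P \<Delta> rk "\<Sum>\<sigma>\<in>P. rk \<sigma>" M \<Phi>
			by (rule realized_complex.intro) (rule realized_complex_axioms.intro[OF homeo])
		obtain F where "F : \<Delta>" "card F = card (vt \<sigma>)"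
			using full_flag[OF simplex_vt(2)[OF PK[OF \<sigma>]] subset_refl PK[OF \<sigma>]] by blast
		then have "card (vt \<sigma>) <= Suc (2 * n)" using f.flag_card_le[OF assms(1)] by metis
		then show ?thesis by (simp add: rk_def)
	qed
	interpret o: oriented_complex P \<Delta> rk "2 * n" M \<Phi> ori
		by (intro oriented_complex.intro realized_complex.intro flag_complex_subdivision realized_complex_axioms.intro
				oriented_complex_axioms.intro homeo assms(1,2) rk)
	let ?c = "%\<sigma>. h ` \<sigma>" and ?d = "%\<sigma>. h ` dual_cell K \<sigma>" and ?r = "%\<sigma>. 2 * n - rk \<sigma>"
	let ?N = "{\<sigma>\<in>P. rk \<sigma> = n}"
	have N2: "{\<sigma>\<in>P. ?r \<sigma> = n} = ?N" using rk by force
	have Kc: "simplicial_cells K h k = ?c ` {\<sigma>\<in>P. rk \<sigma> = k}" for k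
	proof -
		have "\<sigma> : K & int k simplex \<sigma> \<longleftrightarrow> \<sigma> : P & rk \<sigma> = k" for \<sigma>
			using simplex_rk[of \<sigma> k] by (cases "\<sigma> = {}") (auto simp: P_def)
		then show ?thesis unfolding simplicial_cells_def by blast
	qed
	have Kd: "dual_cells (2 * n) K h k = ?d ` {\<sigma>\<in>P. ?r \<sigma> = k}" for k
	proof -
		have "\<sigma> : K & \<sigma> ~= {} & (int (2 * n) - int k) simplex \<sigma> \<longleftrightarrow> \<sigma> : P & ?r \<sigma> = k" for \<sigma>
		proof (cases "\<sigma> : P")
			case True
			show ?thesis
			proof (cases "k <= 2 * n")
				case k: True
				then have "int (2 * n) - int k = int (2 * n - k)" by simp
				then show ?thesis using simplex_rk[OF True, of "2 * n - k"] rk[OF True] k True by (auto simp: P_def)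
			next
				case False
				have "~ (int (2 * n) - int k) simplex \<sigma>"
				proof
					assume s: "(int (2 * n) - int k) simplex \<sigma>"
					then have "int (2 * n) - int k = -1" using simplex_dim_ge[OF s] False by simp
					then show False using s True by (simp add: P_def)
				qed
				then show ?thesis using False by auto
			qed
		qed (auto simp: P_def)
		then show ?thesis unfolding dual_cells_def by blast
	qed
	have subK: "\<sigma> \<subseteq> \<Union>K" if "\<sigma> : P" for \<sigma> using PK[OF that] by blast
	have hsub: "C \<subseteq> D" if "h ` C \<subseteq> h ` D" "C \<subseteq> \<Union>K" "D \<subseteq> \<Union>K" for C D
		using inj_on_image_subset_iff[OF inj_h that(2,3)] that(1) by blast
	have bc: "bij_betw (span_of n ?c rk P) (Pow ?N) {L. spanning_subcomplex n L (simplicial_cells K h)}"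
		by (rule spanning_bij[OF Kc]) (use subset_rk hsub subK in metis)
	have "bij_betw (span_of n ?d ?r P) (Pow {\<sigma>\<in>P. ?r \<sigma> = n}) {L. spanning_subcomplex n L (dual_cells (2 * n) K h)}"
	proof (rule spanning_bij[OF Kd])
		fix \<sigma> \<tau> assume P: "\<sigma> : P" "\<tau> : P" and s: "?d \<sigma> \<subseteq> ?d \<tau>"
		have "dual_cell K \<sigma> \<subseteq> dual_cell K \<tau>" by (rule hsub[OF s dual_cell_sub[OF P(1)] dual_cell_sub[OF P(2)]])
		then have "\<tau> \<subseteq> \<sigma>" by (rule dual_cell_mono[OF P])
		then show "?r \<sigma> < ?r \<tau> \<or> \<sigma> = \<tau>" using subset_rk[OF P(2,1)] rk[OF P(1)] by auto
	qed
	then have bd: "bij_betw (span_of n ?d ?r P) (Pow ?N) {L. spanning_subcomplex n L (dual_cells (2 * n) K h)}"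
		unfolding N2 .
	have low: "h ` \<Union>L = o.sp (o.flags L)" if "L \<subseteq> P" "!!\<sigma> \<tau>. \<sigma> : L ==> \<tau> : P ==> \<tau> \<subseteq> \<sigma> ==> \<tau> : L" for L
	proof -
		have eq: "\<Phi>\<^sub>0 ` geo P {F\<in>\<Delta>. F \<subseteq> L} = \<Union>L" by (rule Phi0_lower[OF that(1)]) (rule that(2))
		show ?thesis unfolding o.sp_def o.flags_def unfolding \<Phi>_def image_comp[symmetric] eq ..
	qed
	have upp: "h ` (\<Union>\<sigma>\<in>U. dual_cell K \<sigma>) = o.sp (o.flags U)" if "U \<subseteq> P" "!!\<sigma> \<tau>. \<sigma> : U ==> \<tau> : P ==> \<sigma> \<subseteq> \<tau> ==> \<tau> : U" for U
	proof -
		have eq: "\<Phi>\<^sub>0 ` geo P {F\<in>\<Delta>. F \<subseteq> U} = (\<Union>\<sigma>\<in>U. dual_cell K \<sigma>)" by (rule dual_upper[OF that(1)]) (rule that(2))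
		show ?thesis unfolding o.sp_def o.flags_def unfolding \<Phi>_def image_comp[symmetric] eq ..
	qed
	have Mc: "cells_space M (simplicial_cells K h) = M"
	proof -
		have "(\<Union>k. \<Union>(simplicial_cells K h k)) = h ` \<Union>P" unfolding Kc by blast
		then show ?thesis unfolding cells_space_def using img_h Union_P by simp
	qed
	have Md: "cells_space M (dual_cells (2 * n) K h) = M"
	proof -
		have "(\<Union>k. \<Union>(dual_cells (2 * n) K h k)) = h ` (\<Union>\<sigma>\<in>P. dual_cell K \<sigma>)" unfolding Kd by blast
		also have "\<dots> = o.sp (o.flags P)" by (rule upp) auto
		also have "\<dots> = topspace M" unfolding o.flags_P by (rule o.sp_Delta)
		finally show ?thesis unfolding cells_space_def by simp
	qed
	define f where "f L = X ^ (betti (int n - 1) (cells_space M L) - betti (int n - 1) M) *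
			 Y ^ k_inv n M L * A ^ s_inv n M ori L * B ^ s_perp_inv n M ori L" for L
	define g where "g L = Y ^ (betti (int n - 1) (cells_space M L) - betti (int n - 1) M) *
			 X ^ k_inv n M L * B ^ s_inv n M ori L * A ^ s_perp_inv n M ori L" for L
	have key: "f (span_of n ?c rk P S) = g (span_of n ?d ?r P (?N - S))" if S: "S \<subseteq> ?N" for S
	proof -
		define L where "L = {\<sigma>\<in>P. rk \<sigma> < n} Un S"
		let ?K = "span_of n ?c rk P S" and ?K' = "span_of n ?d ?r P (?N - S)"
		have LP: "L \<subseteq> P" using S by (auto simp: L_def)
		have Lrk: "ALL s:P. rk s < n --> s : L" "ALL s:L. rk s <= n" using S by (auto simp: L_def)
		have Ldown: "\<tau> : L" if "\<sigma> : L" "\<tau> : P" "\<tau> \<subseteq> \<sigma>" for \<sigma> \<tau>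
		proof -
			have "rk \<tau> < rk \<sigma> \<or> \<tau> = \<sigma>" using subset_rk[OF that(2) _ that(3)] that(1) LP by blast
			moreover have "rk \<sigma> <= n" using Lrk(2) that(1) by blast
			ultimately show ?thesis using Lrk(1) that(1,2) by (metis less_le_trans)
		qed
		have lower: "o.lower L"
			unfolding o.lower_def
		proof (intro conjI ballI allI impI)
			fix s v assume s: "s : L" and v: "rk v < rk s & {v, s} : \<Delta>"
			then have "v : P" "v \<subseteq> s \<or> s \<subseteq> v" unfolding \<Delta>_def by auto
			moreover have "~ s \<subseteq> v" using subset_rk[of s v] \<open>v : P\<close> s LP v by auto
			ultimately show "v : L" using Ldown[OF s] by blast
		qed (rule LP)
		have "P - L = {\<sigma>\<in>P. ?r \<sigma> < n} Un (?N - S)"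
		proof (intro equalityI subsetI)
			fix \<sigma> assume \<sigma>: "\<sigma> : P - L"
			then have "n <= rk \<sigma>" "\<sigma> \<notin> S" using Lrk(1) by (auto simp: L_def)
			moreover have "?r \<sigma> < n" if "rk \<sigma> ~= n" using that \<open>n <= rk \<sigma>\<close> rk[of \<sigma>] \<sigma> by fastforce
			ultimately show "\<sigma> : {\<sigma>\<in>P. ?r \<sigma> < n} Un (?N - S)" using \<sigma> by blast
		next
			fix \<sigma> assume "\<sigma> : {\<sigma>\<in>P. ?r \<sigma> < n} Un (?N - S)"
			then show "\<sigma> : P - L" using S by (auto simp: L_def)
		qed
		then have u2: "(\<Union>k. \<Union>(?K' k)) = h ` (\<Union>\<sigma>\<in>P - L. dual_cell K \<sigma>)" unfolding span_union by blast
		have u1: "(\<Union>k. \<Union>(?K k)) = h ` \<Union>L" unfolding span_union L_def by blast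
		have hL: "h ` \<Union>L = o.sp (o.flags L)" by (rule low[OF LP]) (rule Ldown)
		have K1: "cells_space M ?K = o.X (o.flags L)" unfolding cells_space_def u1 hL ..
		have "h ` (\<Union>\<sigma>\<in>P - L. dual_cell K \<sigma>) = o.sp (o.flags (P - L))" by (rule upp) (use Ldown in blast)+
		then have K2: "cells_space M ?K' = o.X (o.flags (P - L))" unfolding cells_space_def u2 by simp
		note dual = o.duality[OF refl lower Lrk K1 K2]
		\<comment> \<open>The identities for orthogonal complements interchange \<open>s_inv\<close> with
		  \<open>s_perp_inv\<close>; those for Betti numbers turn each Betti exponent into the
		  \<open>k_inv\<close> of the partner.\<close>
		show ?thesis
			unfolding f_def g_def s_inv_def s_perp_inv_def dual
			by (simp add: Int_commute mult_ac)
	qed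
	have "P_poly n M ori (simplicial_cells K h) X Y A B = (\<Sum>L | spanning_subcomplex n L (simplicial_cells K h). f L)"
		unfolding P_poly_def f_def Mc ..
	also have "\<dots> = (\<Sum>S\<in>Pow ?N. f (span_of n ?c rk P S))" by (rule sum.reindex_bij_betw[OF bc, symmetric])
	also have "\<dots> = (\<Sum>S\<in>Pow ?N. g (span_of n ?d ?r P S))"
		by (rule sum.reindex_bij_witness[where i = "%S. ?N - S" and j = "%S. ?N - S"]) (auto simp: key double_diff)
	also have "\<dots> = (\<Sum>L | spanning_subcomplex n L (dual_cells (2 * n) K h). g L)" by (rule sum.reindex_bij_betw[OF bd])
	also have "\<dots> = P_poly n M ori (dual_cells (2 * n) K h) Y X B A" unfolding P_poly_def g_def Md ..
	finally show ?thesis .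
qed

end
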